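(* Let $\delta=\delta(\epsilon)>0$ be any choice with $\delta(\epsilon)\to0$ and $\epsilon\,\delta(\epsilon)^{-5/(4\beta)}\to0$ as $\epsilon\to0$ (the conclusions hold for every such choice). For each $\epsilon$ let $\overline U^\epsilon_\delta(0)\in L^2(\Omega;H\cap V)$ be a random variable, such that the family $(\overline U^\epsilon_\delta(0))_\epsilon$ satisfies a large deviation principle with speed $\epsilon^{-1}$ in the weak topology of $H$, with a good rate function $\mathcal I_0$ vanishing at a unique $u_0^\star$. For a divergence-free white noise $W$, let $(\overline U^\epsilon_\delta(t),0\le t<\tau^\epsilon)$ be the maximal strong solution of the Landau-Lifshitz-Navier-Stokes equation with this initial datum, viewed as a random element of $\mathbb X_{\mathrm{st,loc}}$. Let $r_\epsilon>0$ satisfy $r_\epsilon\to\infty$ as $\epsilon\to0$. (i) If $\inf_\epsilon\epsilon r_\epsilon>0$, then for every $\overline u\in\mathbb X_{\mathrm{st,loc}}$ and every $\overline v\preceq\overline u$, $$\inf_{\overline{\mathcal U}\ni\overline v}\liminf_{\epsilon\to0}r_\epsilon^{-1}\log\mathbb P\big(\overline U^\epsilon_\delta\in\overline{\mathcal U}\big)\ \ge\ \inf_{\overline{\mathcal U}\ni\overline u}\liminf_{\epsilon\to0}r_\epsilon^{-1}\log\mathbb P\big(\overline U^\epsilon_\delta\in\overline{\mathcal U}\big),$$ where the infima run over open sets $\overline{\mathcal U}\subset\mathbb X_{\mathrm{st,loc}}$ containing $\overline v$, respectively $\overline u$. For the trivial path $\star$, $$\inf_{\overline{\mathcal U}\ni\star}\liminf_{\epsilon\to0}r_\epsilon^{-1}\log\mathbb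 P\big(\overline U^\epsilon_\delta\in\overline{\mathcal U}\big)=0 .$$ (ii) Let $\overline u^\star$ be the maximal strong solution of the Navier-Stokes equation starting from $u_0^\star$ (which presupposes $u_0^\star\in H\cap V$). If $\epsilon r_\epsilon\to0$, then for every $\overline v\in\mathbb X_{\mathrm{st,loc}}$ which is not an initial segment of $\overline u^\star$ (i.e. $\overline v\not\preceq\overline u^\star$), $$\inf_{\overline{\mathcal U}\ni\overline v}\limsup_{\epsilon\to0}r_\epsilon^{-1}\log\mathbb P\big(\overline U^\epsilon_\delta\in\overline{\mathcal U}\big)=-\infty ,$$ the infimum being over open sets $\overline{\mathcal U}\ni\overline v$.
   Context: Spaces. Fix $T>0$, $\mathbb T^3=\mathbb R^3/\mathbb Z^3$. $\mathcal X_{d.f.}=\{f\in C^\infty(\mathbb T^3;\mathbb R^3):\nabla\cdot f=0\}$, $H$ is its closure in $L^2(\mathbb T^3;\mathbb R^3)$, $\langle\cdot,\cdot\rangle$ the $L^2$ inner product (of vector or matrix fields), $\mathbf P$ the Leray projection onto $H$. Conventions: $(\nabla u)_{ij}=\partial_iu_j$, $(\nabla\cdot g)_j=\sum_i\partial_ig_{ij}$. $\|u\|_V=\|\nabla u\|_{L^2}$; $H\cap V=\{u\in H:\|u\|_V<\infty\}$. Noise. $A=-\mathbf P\Delta$; $\{e_\zeta\}_{\zeta\in\mathcal B}$ is an orthonormal basis of $H$ of real plane waves which are eigenvectors of $A$, $e_\zeta$ having frequency $2\pi k$, $k\in\mathbb Z^3$, and eigenvalue $\lambda_\zeta=4\pi^2|k|^2$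 (two for each $k\ne0$, three for $k=0$). $H^\gamma(\mathbb T^3)$ denotes the divergence-free Sobolev space with norm $\|\varphi\|_{H^\gamma}^2=\sum_\zeta(1+\lambda_\zeta)^\gamma\langle e_\zeta,\varphi\rangle^2$ (so $H^1=H\cap V$). $\beta>5/4$ is fixed, $Q_\delta=(I+\delta A^{2\beta})^{-1}$. A divergence-free white noise is $W=(W^1,W^2,W^3)$, $W^i(t)=\sum_\zeta\beta^{\zeta,i}(t)e_\zeta$ with independent standard Brownian motions $\beta^{\zeta,i}$; $W_\delta=\sqrt{Q_\delta}W$; $\int\langle G,dW_\delta\rangle=\sum_{\zeta,i}\int\langle G_{i\cdot},\sqrt{Q_\delta}e_\zeta\rangle d\beta^{\zeta,i}$. Strong solutions. The equation is $\partial_tu=\Delta u-(u\cdot\nabla)u-\nabla p-\sqrt\epsilon\,\nabla\cdot\xi_\delta$, $\mathrm{div}\,u=0$, $\xi_\delta=dW_\delta/dt$. For $U_0\in L^2(\Omega;H\cap V)$ independent of $W$, a pair $(\overline U,\tau)$ is a strong solution with initial datum $U_0$ if: (a) $\tau\in(0,T]$ is a stopping time; (b) a.s. $\overline U\in C([0,\tau);H^1(\mathbb T^3))\cap L^2_{\mathrm{loc}}([0,\tau);H^2(\mathbb T^3))$ and $\mathrm{div}\,\overline U=0$; (c) for some $C=C(T)$, $\mathbb E\sup_{t<\tau}\|\overline U(t)\|_{L^2}^2+\mathbb E\int_0^\tau\|\overline U\|_V^2ds\le C(1+\mathbb E\|U_0\|_{L^2}^2)$; (d) a.s., for every $\varphi\in\mathcal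 X_{d.f.}$ and all $t<\tau$, $\langle\overline U(t),\varphi\rangle+\int_0^t\langle A\overline U,\varphi\rangle ds=\langle U_0,\varphi\rangle-\int_0^t\langle(\overline U\cdot\nabla)\overline U,\varphi\rangle ds+\sqrt\epsilon\int_0^t\langle\nabla\varphi,dW_\delta\rangle$. It is maximal if every other strong solution with the same datum and noise is an initial segment of it. A (local) strong solution of Navier-Stokes $\partial_t\overline u=-A\overline u-\mathbf P(\overline u\cdot\nabla)\overline u$ is a divergence-free solution $\overline u\in C([0,\tau),H^1)\cap L^2_{\mathrm{loc}}([0,\tau),H^2)$, and maximality is defined in the same way. The space $\mathbb X_{\mathrm{st,loc}}$. For $0<\tau\le T$ let $\mathbb X_{\mathrm{st},\tau}=C([0,\tau),H^1(\mathbb T^3))\cap L^2_{\mathrm{loc}}([0,\tau),H^2(\mathbb T^3))$, and $\mathbb X_{\mathrm{st,loc}}=\{\star\}\sqcup\bigsqcup_{\tau\in(0,T]}\mathbb X_{\mathrm{st},\tau}$, where $\star$ is a trivial path with $\tau(\star)=0$; $\tau(\overline u)$ denotes the time of existence of $\overline u$ (part of its data). Write $\overline v\preceq\overline u$ ("initial segment") if $\tau(\overline v)\le\tau(\overline u)$ and $\overline v(t)=\overline u(t)$ for $0\le t<\tau(\overline v)$. For $M>0$ let $\tau_M(\overline u)=\inf\{t:\|\overline u(t)\|_{H^1}\ge M\text{ or }\|\overline u\|_{L^2([0,t];H^2)}\ge M\}\wedge T$ (infimum over $t$ in the domain of $\overline u$, $\inf\emptyset=\infty$), and $\tau_M(\star)=0$.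 Define spaces of functions on $[0,1)$ by $\mathbb X_{\mathrm{st},1}=C([0,1),H^1)\cap L^2_{\mathrm{loc}}([0,1),H^2)$ with the locally convex topology $\mathfrak t_{\mathrm{st},1}$ of the seminorms $\sup_{s\le t}\|\overline u(s)\|_{H^1}$ and $(\int_0^t\|\overline u\|_{H^2}^2ds)^{1/2}$, $t<1$. For $\tau'<\tau(\overline u)$ let $\overline u^{\tau'}(s)=\overline u(s\tau')$, $0\le s<1$. A base of neighbourhoods of $\overline u\ne\star$ is given by the sets $$\{\overline v:\tau(\overline v)>\tau',\ \overline v^{\tau'}\in\overline{\mathcal V},\ \min(\tau_M(\overline v),\tau(\overline v))<\tau(\overline u)+\kappa\},$$ with $\tau'\in(0,\tau(\overline u))$, $\overline{\mathcal V}$ a $\mathfrak t_{\mathrm{st},1}$-neighbourhood of $\overline u^{\tau'}$, $\kappa>0$, $M>0$; neighbourhoods of $\star$ are given by the sets $\{\overline v:\min(\tau(\overline v),\tau_M(\overline v))<\kappa\}$, $\kappa>0$, $M>0$. *)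

theory Defs
  imports "HOL-Probability.Probability"
begin

section \<open>Square-integrable vector fields on the torus\<close>

text \<open>As a measure space the torus is a half-open unit cell. Periodicity enters only through the
  smooth test fields, which are periodic functions on the whole of \<open>real ^ 3\<close>. The quotient type
  \<open>vfield\<close> is \<open>L\<^sup>2(\<T>\<^sup>3; \<real>\<^sup>3)\<close>.\<close>

definition torus :: "(real ^ 3) measure" where
  "torus = restrict_space lborel {x. \<forall>i. 0 \<le> x $ i \<and> x $ i < 1}"

definition sq_integrable :: "(real ^ 3 \<Rightarrow> real ^ 3) \<Rightarrow> bool" where
  "sq_integrable f \<longleftrightarrow> f \<in> borel_measurable torus \<and> integrable torus (\<lambda>x. (norm (f x))\<^sup>2)"

lemma sq_integrable_0 [simp]: "sq_integrable (\<lambda>_. 0)"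
  by (simp add: sq_integrable_def)

lemma sq_integrable_scale:
  assumes "sq_integrable f" shows "sq_integrable (\<lambda>x. c *\<^sub>R f x)"
  using assms unfolding sq_integrable_def by (auto simp: power_mult_distrib)

lemma sq_integrable_add:
  assumes "sq_integrable f" "sq_integrable g" shows "sq_integrable (\<lambda>x. f x + g x)"
proof -
  have m [measurable]: "f \<in> borel_measurable torus" "g \<in> borel_measurable torus"
    using assms by (auto simp: sq_integrable_def)
  have "integrable torus (\<lambda>x. 2 * (norm (f x))\<^sup>2 + 2 * (norm (g x))\<^sup>2)"
    using assms by (auto simp: sq_integrable_def)
  moreover have "(norm (f x + g x))\<^sup>2 \<le> 2 * (norm (f x))\<^sup>2 + 2 * (norm (g x))\<^sup>2" for x
  proof -
    have "(norm (f x + g x))\<^sup>2 \<le> (norm (f x) + norm (g x))\<^sup>2"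
      by (intro power_mono norm_triangle_ineq) auto
    also have "\<dots> \<le> 2 * (norm (f x))\<^sup>2 + 2 * (norm (g x))\<^sup>2"
      using sum_squares_bound[of "norm (f x)" "norm (g x)"] by (simp add: power2_sum)
    finally show ?thesis .
  qed
  ultimately have "integrable torus (\<lambda>x. (norm (f x + g x))\<^sup>2)"
    by - (rule Bochner_Integration.integrable_bound[where f="\<lambda>x. 2 * (norm (f x))\<^sup>2 + 2 * (norm (g x))\<^sup>2"],
       auto)
  then show ?thesis by (simp add: sq_integrable_def)
qed

lemma sq_integrable_inner:
  assumes "sq_integrable f" "sq_integrable g" shows "integrable torus (\<lambda>x. f x \<bullet> g x)"
proof -
  have m [measurable]: "f \<in> borel_measurable torus" "g \<in> borel_measurable torus"
    using assms by (auto simp: sq_integrable_def)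
  have "integrable torus (\<lambda>x. (norm (f x))\<^sup>2 + (norm (g x))\<^sup>2)"
    using assms by (auto simp: sq_integrable_def)
  moreover have "\<bar>f x \<bullet> g x\<bar> \<le> (norm (f x))\<^sup>2 + (norm (g x))\<^sup>2" for x
  proof -
    have "\<bar>f x \<bullet> g x\<bar> \<le> norm (f x) * norm (g x)" by (rule Cauchy_Schwarz_ineq2)
    also have "\<dots> \<le> 2 * norm (f x) * norm (g x)" by simp
    also have "\<dots> \<le> (norm (f x))\<^sup>2 + (norm (g x))\<^sup>2"
      by (rule sum_squares_bound)
    finally show ?thesis .
  qed
  ultimately show ?thesis
    by - (rule Bochner_Integration.integrable_bound[where f="\<lambda>x. (norm (f x))\<^sup>2 + (norm (g x))\<^sup>2"],
       auto)
qed

definition ae_eq :: "(real ^ 3 \<Rightarrow> real ^ 3) \<Rightarrow> (real ^ 3 \<Rightarrow> real ^ 3) \<Rightarrow> bool" where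
  "ae_eq f g \<longleftrightarrow> sq_integrable f \<and> sq_integrable g \<and> (AE x in torus. f x = g x)"

quotient_type vfield = "real ^ 3 \<Rightarrow> real ^ 3" / partial: ae_eq
proof (rule part_equivpI)
  show "\<exists>f. ae_eq f f" by (rule exI[of _ "\<lambda>_. 0"]) (simp add: ae_eq_def)
  show "symp ae_eq" by (rule sympI) (auto simp: ae_eq_def)
  show "transp ae_eq" by (rule transpI) (auto simp: ae_eq_def)
qed

instantiation vfield :: real_inner
begin

lift_definition zero_vfield :: vfield is "\<lambda>_. 0" by (simp add: ae_eq_def)

lift_definition plus_vfield :: "vfield \<Rightarrow> vfield \<Rightarrow> vfield" is "\<lambda>f g x. f x + g x"
  by (auto simp: ae_eq_def sq_integrable_add)

lift_definition scaleR_vfield :: "real \<Rightarrow> vfield \<Rightarrow> vfield" is "\<lambda>c f x. c *\<^sub>R f x"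
  by (auto simp: ae_eq_def sq_integrable_scale)

lift_definition inner_vfield :: "vfield \<Rightarrow> vfield \<Rightarrow> real"
  is "\<lambda>f g. (\<integral>x. f x \<bullet> g x \<partial>torus)"
  by (rule integral_cong_AE) (auto simp: ae_eq_def sq_integrable_def)

definition uminus_vfield :: "vfield \<Rightarrow> vfield" where "uminus_vfield u = (-1) *\<^sub>R u"
definition minus_vfield :: "vfield \<Rightarrow> vfield \<Rightarrow> vfield" where "minus_vfield u v = u + - v"
definition norm_vfield :: "vfield \<Rightarrow> real" where "norm_vfield u = sqrt (u \<bullet> u)"
definition dist_vfield :: "vfield \<Rightarrow> vfield \<Rightarrow> real" where "dist_vfield u v = norm (u - v)"
definition sgn_vfield :: "vfield \<Rightarrow> vfield" where "sgn_vfield u = inverse (norm u) *\<^sub>R u"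
definition uniformity_vfield :: "(vfield \<times> vfield) filter" where
  "uniformity_vfield = (INF r\<in>{0<..}. principal {(u, v). dist u v < r})"
definition open_vfield :: "vfield set \<Rightarrow> bool" where
  "open_vfield S \<longleftrightarrow> (\<forall>u\<in>S. \<forall>\<^sub>F (u', v) in uniformity. u' = u \<longrightarrow> v \<in> S)"

instance
proof
  fix u v w :: vfield and a b :: real
  show "u + v + w = u + (v + w)" by transfer (auto simp: ae_eq_def sq_integrable_add add.assoc)
  show "u + v = v + u" by transfer (auto simp: ae_eq_def sq_integrable_add add.commute)
  show "0 + u = u" by transfer (auto simp: ae_eq_def)
  show "- u + u = 0" unfolding uminus_vfield_def by transfer (auto simp: ae_eq_def)
  show "u - v = u + - v" by (rule minus_vfield_def)
  show "a *\<^sub>R (u + v) = a *\<^sub>R u + a *\<^sub>R v"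
    by transfer (auto simp: ae_eq_def sq_integrable_add sq_integrable_scale scaleR_add_right)
  show "(a + b) *\<^sub>R u = a *\<^sub>R u + b *\<^sub>R u"
    by transfer (auto simp: ae_eq_def sq_integrable_add sq_integrable_scale scaleR_add_left)
  show "a *\<^sub>R b *\<^sub>R u = (a * b) *\<^sub>R u"
    by transfer (auto simp: ae_eq_def sq_integrable_scale)
  show "1 *\<^sub>R u = u" by transfer (auto simp: ae_eq_def)
  show "dist u v = norm (u - v)" by (rule dist_vfield_def)
  show "sgn u = inverse (norm u) *\<^sub>R u" by (rule sgn_vfield_def)
  show "(uniformity :: (vfield \<times> vfield) filter) = (INF r\<in>{0<..}. principal {(u, v). dist u v < r})"
    by (rule uniformity_vfield_def)
  show "open S \<longleftrightarrow> (\<forall>u\<in>S. \<forall>\<^sub>F (u', v) in uniformity. u' = u \<longrightarrow> v \<in> S)" for S :: "vfield set"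
    by (rule open_vfield_def)
  show "u \<bullet> v = v \<bullet> u" by transfer (simp add: inner_commute)
  show "(u + v) \<bullet> w = u \<bullet> w + v \<bullet> w"
    by transfer (auto simp: ae_eq_def inner_add_left sq_integrable_inner
        intro!: Bochner_Integration.integral_add)
  show "(a *\<^sub>R u) \<bullet> v = a * (u \<bullet> v)" by transfer auto
  show "0 \<le> u \<bullet> u" by transfer auto
  show "u \<bullet> u = 0 \<longleftrightarrow> u = 0"
  proof transfer
    fix f assume "ae_eq f f"
    then have "sq_integrable f" by (simp add: ae_eq_def)
    then show "(\<integral>x. f x \<bullet> f x \<partial>torus) = 0 \<longleftrightarrow> ae_eq f (\<lambda>_. 0)"
      by (subst integral_nonneg_eq_0_iff_AE) (auto simp: ae_eq_def sq_integrable_inner)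
  qed
  show "norm u = sqrt (u \<bullet> u)" by (rule norm_vfield_def)
qed

end

lift_definition field_of :: "(real ^ 3 \<Rightarrow> real ^ 3) \<Rightarrow> vfield"
  is "\<lambda>f. if sq_integrable f then f else (\<lambda>_. 0)"
  by (auto simp: ae_eq_def)


section \<open>Divergence-free fields, weak derivatives, the Stokes operator\<close>

definition pderiv_at :: "3 \<Rightarrow> (real ^ 3 \<Rightarrow> real ^ 3) \<Rightarrow> real ^ 3 \<Rightarrow> real ^ 3" where
  "pderiv_at i f x = frechet_derivative f (at x) (axis i 1)"

definition smooth_periodic :: "(real ^ 3 \<Rightarrow> real ^ 3) \<Rightarrow> bool" where
  "smooth_periodic f \<longleftrightarrow>
     (\<forall>js :: 3 list. \<forall>x. foldr pderiv_at js f differentiable (at x)) \<and>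
     (\<forall>x. \<forall>i. f (x + axis i 1) = f x)"

definition smooth_df :: "(real ^ 3 \<Rightarrow> real ^ 3) set" where
  "smooth_df = {f. smooth_periodic f \<and> (\<forall>x. (\<Sum>i\<in>UNIV. pderiv_at i f x $ i) = 0)}"

definition df_space :: "vfield set" where
  "df_space = closure (field_of ` smooth_df)"

definition leray :: "vfield \<Rightarrow> vfield" where
  "leray u = (THE p. p \<in> df_space \<and> (\<forall>h\<in>df_space. (u - p) \<bullet> h = 0))"

definition has_weak_deriv :: "3 \<Rightarrow> vfield \<Rightarrow> vfield \<Rightarrow> bool" where
  "has_weak_deriv i u g \<longleftrightarrow>
     (\<forall>\<phi>. smooth_periodic \<phi> \<longrightarrow> u \<bullet> field_of (pderiv_at i \<phi>) = - (g \<bullet> field_of \<phi>))"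

definition weak_deriv :: "3 \<Rightarrow> vfield \<Rightarrow> vfield" where
  "weak_deriv i u = (if \<exists>g. has_weak_deriv i u g then THE g. has_weak_deriv i u g else 0)"

text \<open>The seminorm \<open>\<parallel>\<nabla>u\<parallel>\<close> in \<open>L\<^sup>2\<close>; row \<open>i\<close> of the matrix field \<open>\<nabla>u\<close> is \<open>\<partial>\<^sub>i u\<close>. It is meaningful
  where all three weak derivatives exist in \<open>L\<^sup>2\<close>, i.e. where \<open>\<parallel>u\<parallel>\<close> in \<open>V\<close> is finite.\<close>

definition V_norm :: "vfield \<Rightarrow> real" where
  "V_norm u = sqrt (\<Sum>i\<in>UNIV. (norm (weak_deriv i u))\<^sup>2)"

definition HV :: "vfield set" where
  "HV = {u \<in> df_space. \<forall>i. \<exists>g. has_weak_deriv i u g}"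

definition laplace :: "vfield \<Rightarrow> vfield" where
  "laplace u = (\<Sum>i\<in>UNIV. weak_deriv i (weak_deriv i u))"

definition stokes :: "vfield \<Rightarrow> vfield" where
  "stokes u = - leray (laplace u)"

text \<open>The pairing \<open>\<langle>(u \<cdot> \<nabla>)u, \<phi>\<rangle>\<close>. For \<open>u\<close> in \<open>H\<^sup>1\<close> the field \<open>(u \<cdot> \<nabla>)u\<close> need not be in \<open>L\<^sup>2\<close>, so it
  is paired with the bounded function \<open>\<phi>\<close> through representatives.\<close>

definition advection :: "vfield \<Rightarrow> (real ^ 3 \<Rightarrow> real ^ 3) \<Rightarrow> real" where
  "advection u \<phi> =
     (\<integral>x. (\<Sum>i\<in>UNIV. rep_vfield u x $ i *\<^sub>R rep_vfield (weak_deriv i u) x) \<bullet> \<phi> x \<partial>torus)"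


section \<open>The plane-wave basis and Sobolev norms\<close>

definition wave_vec :: "int ^ 3 \<Rightarrow> real ^ 3" where
  "wave_vec k = (\<chi> j. 2 * pi * real_of_int (k $ j))"

definition eigval :: "('z \<Rightarrow> int ^ 3) \<Rightarrow> 'z \<Rightarrow> real" where
  "eigval k \<zeta> = (norm (wave_vec (k \<zeta>)))\<^sup>2"

text \<open>A real plane wave of frequency \<open>2\<pi>k\<close> is the real part of some \<open>c exp (2\<pi>i k \<cdot> x)\<close> with
  a complex amplitude \<open>c = a - ib\<close>.\<close>

definition plane_wave_basis :: "('z \<Rightarrow> vfield) \<Rightarrow> ('z \<Rightarrow> int ^ 3) \<Rightarrow> bool" where
  "plane_wave_basis e k \<longleftrightarrow>
     (\<forall>\<zeta>. e \<zeta> \<in> df_space) \<and>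
     (\<forall>\<zeta> \<zeta>'. e \<zeta> \<bullet> e \<zeta>' = (if \<zeta> = \<zeta>' then 1 else 0)) \<and>
     closure (span (range e)) = df_space \<and>
     (\<forall>\<zeta>. \<exists>a b. e \<zeta> = field_of (\<lambda>x. cos (wave_vec (k \<zeta>) \<bullet> x) *\<^sub>R a + sin (wave_vec (k \<zeta>) \<bullet> x) *\<^sub>R b)) \<and>
     (\<forall>\<zeta>. stokes (e \<zeta>) = eigval k \<zeta> *\<^sub>R e \<zeta>) \<and>
     (\<forall>m. card {\<zeta>. k \<zeta> = m} = (if m = 0 then 3 else 2))"

definition sobolev :: "('z \<Rightarrow> vfield) \<Rightarrow> ('z \<Rightarrow> int ^ 3) \<Rightarrow> real \<Rightarrow> vfield set" where
  "sobolev e k \<gamma> = {u \<in> df_space. (\<lambda>\<zeta>. (1 + eigval k \<zeta>) powr \<gamma> * (e \<zeta> \<bullet> u)\<^sup>2) summable_on UNIV}"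

definition sobolev_norm :: "('z \<Rightarrow> vfield) \<Rightarrow> ('z \<Rightarrow> int ^ 3) \<Rightarrow> real \<Rightarrow> vfield \<Rightarrow> real" where
  "sobolev_norm e k \<gamma> u = sqrt (\<Sum>\<^sub>\<infinity>\<zeta>. (1 + eigval k \<zeta>) powr \<gamma> * (e \<zeta> \<bullet> u)\<^sup>2)"


section \<open>The path spaces\<close>

definition L2H2_norm :: "('z \<Rightarrow> vfield) \<Rightarrow> ('z \<Rightarrow> int ^ 3) \<Rightarrow> real \<Rightarrow> (real \<Rightarrow> vfield) \<Rightarrow> real" where
  "L2H2_norm e k t u = sqrt (LINT s:{0..t}|lebesgue. (sobolev_norm e k 2 (u s))\<^sup>2)"

text \<open>\<open>C([0,\<tau>), H\<^sup>1) \<inter> L\<^sup>2\<^sub>l\<^sub>o\<^sub>c([0,\<tau>), H\<^sup>2)\<close>; paths are made extensional so that equality of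
  functions is equality on \<open>[0,\<tau>)\<close>. Elements of \<open>sobolev\<close> are divergence-free.\<close>

definition Xst :: "('z \<Rightarrow> vfield) \<Rightarrow> ('z \<Rightarrow> int ^ 3) \<Rightarrow> real \<Rightarrow> (real \<Rightarrow> vfield) set" where
  "Xst e k \<tau> = {u \<in> extensional {0..<\<tau>}.
     (\<forall>s\<in>{0..<\<tau>}. u s \<in> sobolev e k 1 \<and>
        ((\<lambda>r. sobolev_norm e k 1 (u r - u s)) \<longlongrightarrow> 0) (at s within {0..<\<tau>})) \<and>
     (AE s in lebesgue. s \<in> {0..<\<tau>} \<longrightarrow> u s \<in> sobolev e k 2) \<and>
     (\<forall>t\<in>{0..<\<tau>}. set_integrable lebesgue {0..t} (\<lambda>s. (sobolev_norm e k 2 (u s))\<^sup>2))}"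

definition Xst1_topology :: "('z \<Rightarrow> vfield) \<Rightarrow> ('z \<Rightarrow> int ^ 3) \<Rightarrow> (real \<Rightarrow> vfield) topology" where
  "Xst1_topology e k = topology_generated_by
     ({{w \<in> Xst e k 1. (SUP s\<in>{0..t}. sobolev_norm e k 1 (w s - u s)) < r} | u t r.
         u \<in> Xst e k 1 \<and> 0 \<le> t \<and> t < 1 \<and> 0 < r} \<union>
      {{w \<in> Xst e k 1. L2H2_norm e k t (\<lambda>s. w s - u s) < r} | u t r.
         u \<in> Xst e k 1 \<and> 0 \<le> t \<and> t < 1 \<and> 0 < r})"

datatype path = Star | Path real "real \<Rightarrow> vfield"

fun lifetime :: "path \<Rightarrow> real" where
  "lifetime Star = 0"
| "lifetime (Path \<tau> u) = \<tau>"

fun path_at :: "path \<Rightarrow> real \<Rightarrow> vfield" where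
  "path_at Star t = undefined"
| "path_at (Path \<tau> u) t = u t"

definition path_of :: "real \<Rightarrow> (real \<Rightarrow> vfield) \<Rightarrow> path" where
  "path_of \<tau> u = Path \<tau> (restrict u {0..<\<tau>})"

definition Xst_loc :: "('z \<Rightarrow> vfield) \<Rightarrow> ('z \<Rightarrow> int ^ 3) \<Rightarrow> real \<Rightarrow> path set" where
  "Xst_loc e k T = {Star} \<union> {Path \<tau> u | \<tau> u. 0 < \<tau> \<and> \<tau> \<le> T \<and> u \<in> Xst e k \<tau>}"

definition initial_segment :: "path \<Rightarrow> path \<Rightarrow> bool" (infix \<open>\<preceq>\<^sub>s\<close> 50) where
  "v \<preceq>\<^sub>s u \<longleftrightarrow> lifetime v \<le> lifetime u \<and> (\<forall>t. 0 \<le> t \<and> t < lifetime v \<longrightarrow> path_at v t = path_at u t)"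

fun exit_time :: "('z \<Rightarrow> vfield) \<Rightarrow> ('z \<Rightarrow> int ^ 3) \<Rightarrow> real \<Rightarrow> real \<Rightarrow> path \<Rightarrow> ereal" where
  "exit_time e k T M Star = 0"
| "exit_time e k T M (Path \<tau> u) =
     min (INF t\<in>{t \<in> {0..<\<tau>}. sobolev_norm e k 1 (u t) \<ge> M \<or> L2H2_norm e k t u \<ge> M}. ereal t) (ereal T)"

definition rescale :: "real \<Rightarrow> path \<Rightarrow> real \<Rightarrow> vfield" where
  "rescale \<tau>' u = restrict (\<lambda>s. path_at u (s * \<tau>')) {0..<1}"

definition nbhd_of :: "'a topology \<Rightarrow> 'a \<Rightarrow> 'a set \<Rightarrow> bool" where
  "nbhd_of X x N \<longleftrightarrow> N \<subseteq> topspace X \<and> (\<exists>G. openin X G \<and> x \<in> G \<and> G \<subseteq> N)"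

definition Xst_base :: "('z \<Rightarrow> vfield) \<Rightarrow> ('z \<Rightarrow> int ^ 3) \<Rightarrow> real \<Rightarrow> path \<Rightarrow> path set set" where
  "Xst_base e k T u =
     (if u = Star
      then {{v \<in> Xst_loc e k T. min (ereal (lifetime v)) (exit_time e k T M v) < ereal \<kappa>} | \<kappa> M.
              0 < \<kappa> \<and> 0 < M}
      else {{v \<in> Xst_loc e k T. \<tau>' < lifetime v \<and> rescale \<tau>' v \<in> \<V> \<and>
               min (exit_time e k T M v) (ereal (lifetime v)) < ereal (lifetime u + \<kappa>)} | \<tau>' \<V> \<kappa> M.
              0 < \<tau>' \<and> \<tau>' < lifetime u \<and> nbhd_of (Xst1_topology e k) (rescale \<tau>' u) \<V> \<and>
              0 < \<kappa> \<and> 0 < M})"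

text \<open>The basic neighbourhoods need not be open themselves (a path may touch the level \<open>M\<close>), so
  they are used as a neighbourhood base and not as a subbase.\<close>

definition Xst_open :: "('z \<Rightarrow> vfield) \<Rightarrow> ('z \<Rightarrow> int ^ 3) \<Rightarrow> real \<Rightarrow> path set \<Rightarrow> bool" where
  "Xst_open e k T \<U> \<longleftrightarrow> \<U> \<subseteq> Xst_loc e k T \<and> (\<forall>u\<in>\<U>. \<exists>N\<in>Xst_base e k T u. N \<subseteq> \<U>)"


section \<open>Brownian motions and the regularised white noise\<close>

definition standard_brownian :: "'w measure \<Rightarrow> (real \<Rightarrow> 'w \<Rightarrow> real) \<Rightarrow> bool" where
  "standard_brownian M b \<longleftrightarrow>
     (\<forall>t\<ge>0. b t \<in> borel_measurable M) \<and>
     (AE \<omega> in M. b 0 \<omega> = 0) \<and>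
     (\<forall>s t. 0 \<le> s \<and> s < t \<longrightarrow>
        distributed M lborel (\<lambda>\<omega>. b t \<omega> - b s \<omega>) (normal_density 0 (sqrt (t - s)))) \<and>
     (\<forall>n (t :: nat \<Rightarrow> real). 0 \<le> t 0 \<and> mono t \<longrightarrow>
        prob_space.indep_vars M (\<lambda>_. borel) (\<lambda>j \<omega>. b (t (Suc j)) \<omega> - b (t j) \<omega>) {..<n}) \<and>
     (AE \<omega> in M. continuous_on {0..} (\<lambda>t. b t \<omega>))"

definition white_noise :: "'w measure \<Rightarrow> ('z \<Rightarrow> 3 \<Rightarrow> real \<Rightarrow> 'w \<Rightarrow> real) \<Rightarrow> bool" where
  "white_noise M B \<longleftrightarrow>
     (\<forall>\<zeta> i. standard_brownian M (B \<zeta> i)) \<and>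
     prob_space.indep_vars M (\<lambda>_. PiM {0..} (\<lambda>_. borel))
       (\<lambda>(\<zeta>, i) \<omega>. \<lambda>t\<in>{0..}. B \<zeta> i t \<omega>) UNIV"

definition indep_of_noise ::
  "'w measure \<Rightarrow> ('z \<Rightarrow> 3 \<Rightarrow> real \<Rightarrow> 'w \<Rightarrow> real) \<Rightarrow> ('w \<Rightarrow> vfield) \<Rightarrow> bool" where
  "indep_of_noise M B U0 \<longleftrightarrow>
     prob_space.indep_set M
       (sets (vimage_algebra (space M) U0 borel))
       (sets (vimage_algebra (space M)
          (\<lambda>\<omega>. \<lambda>(\<zeta>, i, t)\<in>UNIV \<times> UNIV \<times> {0..}. B \<zeta> i t \<omega>)
          (PiM (UNIV \<times> UNIV \<times> {0..}) (\<lambda>_. borel :: real measure))))"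

text \<open>\<open>Q\<^sub>\<delta> = (I + \<delta> A\<^bsup>2\<beta>\<^esup>)\<^bsup>-1\<^esup>\<close> is diagonal in the basis; this is the eigenvalue of its square root.\<close>

definition sqrtQ :: "('z \<Rightarrow> int ^ 3) \<Rightarrow> real \<Rightarrow> real \<Rightarrow> 'z \<Rightarrow> real" where
  "sqrtQ k \<beta> \<delta> \<zeta> = sqrt (inverse (1 + \<delta> * eigval k \<zeta> powr (2 * \<beta>)))"

text \<open>The integral of \<open>\<langle>\<nabla>\<phi>, dW\<^sub>\<delta>\<rangle>\<close> over \<open>[0,t]\<close>. The integrand is deterministic and constant in
  time, so each one-dimensional integral is a multiple of the value of the Brownian motion at time
  \<open>t\<close>. As \<open>\<phi>\<close> is smooth the coefficients decay rapidly, so that almost surely the series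
  converges absolutely for all \<open>\<phi>\<close> and \<open>t\<close> simultaneously.\<close>

definition noise_term ::
  "('z \<Rightarrow> vfield) \<Rightarrow> ('z \<Rightarrow> int ^ 3) \<Rightarrow> real \<Rightarrow> real \<Rightarrow> ('z \<Rightarrow> 3 \<Rightarrow> real \<Rightarrow> 'w \<Rightarrow> real) \<Rightarrow>
   (real ^ 3 \<Rightarrow> real ^ 3) \<Rightarrow> real \<Rightarrow> 'w \<Rightarrow> real" where
  "noise_term e k \<beta> \<delta> B \<phi> t \<omega> =
     (\<Sum>\<^sub>\<infinity>(\<zeta>, i). (field_of (pderiv_at i \<phi>) \<bullet> (sqrtQ k \<beta> \<delta> \<zeta> *\<^sub>R e \<zeta>)) * B \<zeta> i t \<omega>)"

text \<open>Including the null sets makes this filtration right-continuous, since the initial datum is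
  independent of the noise. Only times \<open>t \<ge> 0\<close> matter, as the stopping times below are positive.\<close>

definition noise_filtration ::
  "'w measure \<Rightarrow> ('z \<Rightarrow> 3 \<Rightarrow> real \<Rightarrow> 'w \<Rightarrow> real) \<Rightarrow> ('w \<Rightarrow> vfield) \<Rightarrow> real \<Rightarrow> 'w measure" where
  "noise_filtration M B U0 t = sigma (space M)
     (null_sets M \<union>
      {U0 -` A \<inter> space M | A. A \<in> sets borel} \<union>
      {B \<zeta> i s -` A \<inter> space M | \<zeta> i s A. 0 \<le> s \<and> s \<le> t \<and> A \<in> sets borel})"


section \<open>Strong solutions\<close>

text \<open>Square integrability is with respect to the norm of \<open>H \<inter> V\<close>, which is the \<open>H\<^sup>1\<close> norm.\<close>

definition L2_datum :: "('z \<Rightarrow> vfield) \<Rightarrow> ('z \<Rightarrow> int ^ 3) \<Rightarrow> 'w measure \<Rightarrow> ('w \<Rightarrow> vfield) \<Rightarrow> bool" where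
  "L2_datum e k M U0 \<longleftrightarrow> U0 \<in> borel_measurable M \<and> (AE \<omega> in M. U0 \<omega> \<in> HV) \<and>
     (\<integral>\<^sup>+\<omega>. ennreal ((sobolev_norm e k 1 (U0 \<omega>))\<^sup>2) \<partial>M) < \<infinity>"

text \<open>The constant \<open>C\<close> of the energy bound may depend on the solution, not only on \<open>T\<close>. Solutions are
  tested only against divergence-free fields, so neither the pressure nor the projection appears.
  A pair \<open>(U, \<tau>)\<close> is regarded as the random path \<open>path_of (\<tau> \<omega>) (U \<omega>)\<close>; the second conjunct
  says that this is a random element for the Borel sets of the path space.\<close>

definition strong_solution ::
  "('z \<Rightarrow> vfield) \<Rightarrow> ('z \<Rightarrow> int ^ 3) \<Rightarrow> real \<Rightarrow> real \<Rightarrow> 'w measure \<Rightarrow>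
   ('z \<Rightarrow> 3 \<Rightarrow> real \<Rightarrow> 'w \<Rightarrow> real) \<Rightarrow> real \<Rightarrow> real \<Rightarrow> ('w \<Rightarrow> vfield) \<Rightarrow>
   ('w \<Rightarrow> real \<Rightarrow> vfield) \<Rightarrow> ('w \<Rightarrow> real) \<Rightarrow> bool" where
  "strong_solution e k \<beta> T M B \<epsilon> \<delta> U0 U \<tau> \<longleftrightarrow>
     (stopping_time (noise_filtration M B U0) \<tau> \<and> (\<forall>\<omega>\<in>space M. 0 < \<tau> \<omega> \<and> \<tau> \<omega> \<le> T)) \<and>
     (\<forall>\<U>. Xst_open e k T \<U> \<longrightarrow> {\<omega> \<in> space M. path_of (\<tau> \<omega>) (U \<omega>) \<in> \<U>} \<in> sets M) \<and>
     (AE \<omega> in M. path_of (\<tau> \<omega>) (U \<omega>) \<in> Xst_loc e k T) \<and>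
     (\<exists>C\<ge>0.
        (\<integral>\<^sup>+\<omega>. (SUP t\<in>{0..<\<tau> \<omega>}. ennreal ((norm (U \<omega> t))\<^sup>2)) \<partial>M) +
        (\<integral>\<^sup>+\<omega>. (\<integral>\<^sup>+s\<in>{0..<\<tau> \<omega>}. ennreal ((V_norm (U \<omega> s))\<^sup>2) \<partial>lebesgue) \<partial>M)
        \<le> ennreal C * (1 + (\<integral>\<^sup>+\<omega>. ennreal ((norm (U0 \<omega>))\<^sup>2) \<partial>M))) \<and>
     (AE \<omega> in M. \<forall>\<phi>\<in>smooth_df. \<forall>t\<in>{0..<\<tau> \<omega>}.
        U \<omega> t \<bullet> field_of \<phi> + (LINT s:{0..t}|lebesgue. stokes (U \<omega> s) \<bullet> field_of \<phi>) =
        U0 \<omega> \<bullet> field_of \<phi> - (LINT s:{0..t}|lebesgue. advection (U \<omega> s) \<phi>) +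
        sqrt \<epsilon> * noise_term e k \<beta> \<delta> B \<phi> t \<omega>)"

definition maximal_strong_solution ::
  "('z \<Rightarrow> vfield) \<Rightarrow> ('z \<Rightarrow> int ^ 3) \<Rightarrow> real \<Rightarrow> real \<Rightarrow> 'w measure \<Rightarrow>
   ('z \<Rightarrow> 3 \<Rightarrow> real \<Rightarrow> 'w \<Rightarrow> real) \<Rightarrow> real \<Rightarrow> real \<Rightarrow> ('w \<Rightarrow> vfield) \<Rightarrow>
   ('w \<Rightarrow> real \<Rightarrow> vfield) \<Rightarrow> ('w \<Rightarrow> real) \<Rightarrow> bool" where
  "maximal_strong_solution e k \<beta> T M B \<epsilon> \<delta> U0 U \<tau> \<longleftrightarrow>
     strong_solution e k \<beta> T M B \<epsilon> \<delta> U0 U \<tau> \<and>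
     (\<forall>V \<sigma>. strong_solution e k \<beta> T M B \<epsilon> \<delta> U0 V \<sigma> \<longrightarrow>
        (AE \<omega> in M. path_of (\<sigma> \<omega>) (V \<omega>) \<preceq>\<^sub>s path_of (\<tau> \<omega>) (U \<omega>)))"

definition NS_strong_solution ::
  "('z \<Rightarrow> vfield) \<Rightarrow> ('z \<Rightarrow> int ^ 3) \<Rightarrow> real \<Rightarrow> vfield \<Rightarrow> path \<Rightarrow> bool" where
  "NS_strong_solution e k T u0 u \<longleftrightarrow> u \<in> Xst_loc e k T \<and> u \<noteq> Star \<and>
     (\<forall>\<phi>\<in>smooth_df. \<forall>t\<in>{0..<lifetime u}.
        path_at u t \<bullet> field_of \<phi> + (LINT s:{0..t}|lebesgue. stokes (path_at u s) \<bullet> field_of \<phi>) =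
        u0 \<bullet> field_of \<phi> - (LINT s:{0..t}|lebesgue. advection (path_at u s) \<phi>))"

definition NS_maximal_solution ::
  "('z \<Rightarrow> vfield) \<Rightarrow> ('z \<Rightarrow> int ^ 3) \<Rightarrow> real \<Rightarrow> vfield \<Rightarrow> path \<Rightarrow> bool" where
  "NS_maximal_solution e k T u0 u \<longleftrightarrow> NS_strong_solution e k T u0 u \<and>
     (\<forall>v. NS_strong_solution e k T u0 v \<longrightarrow> v \<preceq>\<^sub>s u)"


section \<open>Large deviations\<close>

definition log_prob :: "real \<Rightarrow> ereal" where
  "log_prob p = (if p = 0 then -\<infinity> else ereal (ln p))"

definition weak_topology :: "vfield topology" where
  "weak_topology = topology_generated_by
     {{h \<in> df_space. h \<bullet> g \<in> G} | g G. g \<in> df_space \<and> open G}"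

definition good_rate_function :: "'x topology \<Rightarrow> ('x \<Rightarrow> ereal) \<Rightarrow> bool" where
  "good_rate_function X I \<longleftrightarrow>
     (\<forall>x\<in>topspace X. 0 \<le> I x) \<and>
     (\<forall>a :: real. closedin X {x \<in> topspace X. I x \<le> ereal a} \<and>
                  compactin X {x \<in> topspace X. I x \<le> ereal a})"

text \<open>\<open>r\<^sub>\<epsilon>\<^bsup>-1\<^esup> log P(Y\<^sub>\<epsilon> \<in> S)\<close>, with \<open>log 0 = -\<infinity>\<close>.\<close>

definition scaled_log_prob ::
  "'w measure \<Rightarrow> (real \<Rightarrow> real) \<Rightarrow> (real \<Rightarrow> 'w \<Rightarrow> 'x) \<Rightarrow> 'x set \<Rightarrow> real \<Rightarrow> ereal" where
  "scaled_log_prob M r Y S \<epsilon> =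
     ereal (inverse (r \<epsilon>)) * log_prob (measure M {\<omega> \<in> space M. Y \<epsilon> \<omega> \<in> S})"

definition LDP ::
  "'w measure \<Rightarrow> 'x topology \<Rightarrow> (real \<Rightarrow> real) \<Rightarrow> (real \<Rightarrow> 'w \<Rightarrow> 'x) \<Rightarrow> ('x \<Rightarrow> ereal) \<Rightarrow> bool" where
  "LDP M X r Y I \<longleftrightarrow>
     (\<forall>G. openin X G \<longrightarrow> - (INF x\<in>G. I x) \<le> Liminf (at_right 0) (scaled_log_prob M r Y G)) \<and>
     (\<forall>F. closedin X F \<longrightarrow> Limsup (at_right 0) (scaled_log_prob M r Y F) \<le> - (INF x\<in>F. I x))"

end

theory Submission
  imports Defs
begin

text \<open>The equation, tested against a wave of frequency \<open>c\<close> in the first coordinate direction, says that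
  as long as the solution stays below \<open>K\<close> in \<open>H\<^sup>1\<close>, the noise in that mode moves by only
  \<open>O(K / c + K\<^sup>2 / c\<^sup>2)\<close> within a time \<open>1 / c\<^sup>2\<close>. It moves by more with probability at least
  \<open>exp (- o(1) / \<epsilon>)\<close> as \<open>c \<rightarrow> \<infinity>\<close>, independently of the past. So at every time the solution
  leaves the ball of radius \<open>K\<close> almost immediately at negligible cost, and paths that have left the
  ball are unconstrained by the neighbourhoods: this gives (i). Independence needs that being close to
  a given path up to time \<open>s\<close> is an event of the filtration at time \<open>s\<close>, which follows from a
  stability estimate for the equation. For (ii), a path that is not an initial segment of the maximal
  solution violates the equation in some mode at some time; the violation persists in a neighbourhood
  and forces a macroscopic deviation of the datum or of finitely many Brownian motions, of probability
  at most \<open>exp (- c / \<epsilon>)\<close>.\<close>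

text \<open>The test field is \<open>fw z\<close>, the quarter-period translate of
  \<open>e z\<close>: its gradient is a multiple of \<open>e z\<close>, so for a frequency along the
  first axis the tested noise is a multiple of the single Brownian motion \<open>B z 1\<close>. Over
  a time 1/c^2 its increment has standard deviation of order sqrt \<epsilon>, whereas a solution
  below K tolerates only O(1/c). The frequency is fixed before \<epsilon> \<rightarrow> 0, so
  \<open>sqrtQ\<close> tends to 1 in that mode. The obstacle is adaptedness: a strong solution is
  only required to be a random path whose lifetime is a stopping time. That closeness to a given
  path belongs to the past has to be derived from datum and noise. Hence a stability estimate that
  compares the noise in finitely many modes, uniformly in time; the H^1 bound controls the other
  modes, and the L^2 H^2 bound feeds Gronwall through the embedding of H^2 into bounded fields.
  Stability holds in L^2 only; the stronger norms are recovered by lower semicontinuity along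
  Fourier partial sums, which is why closeness is defined by non-strict inequalities.\<close>

abbreviation cell :: "(real ^ 3) set" where
  "cell \<equiv> {x. \<forall>i. 0 \<le> x $ i \<and> x $ i < 1}"

section \<open>The torus as a probability space\<close>

lemma cell_borel [measurable]: "cell \<in> sets borel"
proof -
  have "cell = (\<Inter>i. {x :: real ^ 3. 0 \<le> x $ i} \<inter> {x. x $ i < 1})" by auto
  also have "\<dots> \<in> sets borel" by measurable
  finally show ?thesis .
qed

lemma space_torus [simp]: "space torus = cell"
  by (simp add: torus_def space_restrict_space)

lemma borel_measurable_torusI [intro]: "f \<in> borel_measurable borel \<Longrightarrow> f \<in> borel_measurable torus"
  unfolding torus_def by (rule measurable_restrict_space1) simp

lemma Basis_vec3: "(Basis :: (real ^ 3) set) = (\<lambda>i. axis i 1) ` UNIV"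
  by (auto simp: Basis_vec_def)

lemma prod_Basis_vec3: "(\<Prod>b\<in>Basis. (1 :: real ^ 3) \<bullet> b) = 1"
  by (rule prod.neutral) (auto simp: Basis_vec3 inner_axis)

text \<open>The half-open cell lies between the open and the closed unit box, both of volume
  one.\<close>

lemma measure_torus: "emeasure torus (space torus) = 1"
proof -
  have e: "emeasure torus (space torus) = emeasure lborel cell"
    unfolding torus_def by (subst emeasure_restrict_space) (auto simp: space_restrict_space)
  have 1: "emeasure lborel cell \<le> emeasure lborel (cbox 0 (1 :: real ^ 3))"
    by (rule emeasure_mono) (auto simp: mem_box_cart less_imp_le)
  have 2: "emeasure lborel (box 0 (1 :: real ^ 3)) \<le> emeasure lborel cell"
    by (rule emeasure_mono) (auto simp: mem_box_cart less_imp_le)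
  have "emeasure lborel (cbox 0 (1 :: real ^ 3)) = 1" "emeasure lborel (box 0 (1 :: real ^ 3)) = 1"
    by (simp_all add: emeasure_lborel_cbox_eq emeasure_lborel_box_eq prod_Basis_vec3, simp_all add: Basis_vec3 inner_axis)
  then show ?thesis using 1 2 e by simp
qed

interpretation torus: prob_space torus
  by (rule prob_spaceI) (rule measure_torus)

lemma integrable_torus_bounded:
  fixes f :: "real ^ 3 \<Rightarrow> 'a :: {banach, second_countable_topology}"
  assumes "f \<in> borel_measurable torus" "\<And>x. x \<in> cell \<Longrightarrow> norm (f x) \<le> K"
  shows "integrable torus f"
  using assms by (intro torus.integrable_const_bound[of _ K]) (auto intro!: AE_I2)

lemma sq_integrable_bounded:
  assumes "f \<in> borel_measurable torus" "\<And>x. x \<in> cell \<Longrightarrow> norm (f x) \<le> K"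
  shows "sq_integrable f"
proof -
  have "integrable torus (\<lambda>x. (norm (f x))\<^sup>2)"
  proof (rule integrable_torus_bounded[where K="K\<^sup>2"])
    show "(\<lambda>x. (norm (f x))\<^sup>2) \<in> borel_measurable torus" using assms(1) by measurable
    show "norm ((norm (f x))\<^sup>2) \<le> K\<^sup>2" if "x \<in> cell" for x
      using assms(2)[OF that] by (simp add: power_mono)
  qed
  then show ?thesis using assms by (simp add: sq_integrable_def)
qed

section \<open>Representatives of square-integrable fields\<close>

lemma ae_eq_rep: "ae_eq (rep_vfield u) (rep_vfield u)"
  by (rule Quotient3_rep_reflp[OF Quotient3_vfield])

lemma sq_integrable_rep [simp]: "sq_integrable (rep_vfield u)"
  using ae_eq_rep by (simp add: ae_eq_def)

lemma rep_measurable [measurable]: "rep_vfield u \<in> borel_measurable torus"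
  using sq_integrable_rep by (simp add: sq_integrable_def)

lemma abs_rep_vfield [simp]: "abs_vfield (rep_vfield u) = u"
  by (rule Quotient3_abs_rep[OF Quotient3_vfield])

lemma field_of_eq_abs: "sq_integrable f \<Longrightarrow> field_of f = abs_vfield f"
  unfolding field_of_def by simp

lemma field_of_rep [simp]: "field_of (rep_vfield u) = u"
  by (simp add: field_of_eq_abs)

lemma field_of_eq_iff:
  assumes "sq_integrable f" "sq_integrable g"
  shows "field_of f = field_of g \<longleftrightarrow> (AE x in torus. f x = g x)"
  using assms Quotient3_rel[OF Quotient3_vfield, of f g]
  by (auto simp: field_of_eq_abs ae_eq_def)

lemma rep_field_of:
  assumes "sq_integrable f" shows "AE x in torus. rep_vfield (field_of f) x = f x"
  using field_of_eq_iff[of "rep_vfield (field_of f)" f] assms by simp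

lemma inner_field_of:
  assumes "sq_integrable f" "sq_integrable g"
  shows "field_of f \<bullet> field_of g = (\<integral>x. f x \<bullet> g x \<partial>torus)"
  using assms by (simp add: field_of_eq_abs inner_vfield.abs_eq ae_eq_def)

lemma inner_field_of_right:
  assumes "sq_integrable g"
  shows "u \<bullet> field_of g = (\<integral>x. rep_vfield u x \<bullet> g x \<partial>torus)"
  using inner_field_of[of "rep_vfield u" g] assms by simp

lemma field_of_add:
  assumes "sq_integrable f" "sq_integrable g"
  shows "field_of (\<lambda>x. f x + g x) = field_of f + field_of g"
  using assms by (simp add: field_of_eq_abs sq_integrable_add plus_vfield.abs_eq ae_eq_def)

lemma field_of_scaleR:
  assumes "sq_integrable f"
  shows "field_of (\<lambda>x. c *\<^sub>R f x) = c *\<^sub>R field_of f"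
  using assms by (simp add: field_of_eq_abs sq_integrable_scale scaleR_vfield.abs_eq ae_eq_def)

lemma rep_add: "AE x in torus. rep_vfield (u + v) x = rep_vfield u x + rep_vfield v x"
  using field_of_add[of "rep_vfield u" "rep_vfield v"] rep_field_of[of "\<lambda>x. rep_vfield u x + rep_vfield v x"]
  by (simp add: sq_integrable_add)

lemma rep_scaleR: "AE x in torus. rep_vfield (c *\<^sub>R u) x = c *\<^sub>R rep_vfield u x"
  using field_of_scaleR[of "rep_vfield u" c] rep_field_of[of "\<lambda>x. c *\<^sub>R rep_vfield u x"]
  by (simp add: sq_integrable_scale)

lemma rep_diff: "AE x in torus. rep_vfield (u - v) x = rep_vfield u x - rep_vfield v x"
  using rep_add[of u "(-1) *\<^sub>R v"] rep_scaleR[of "-1" v] by eventually_elim simp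

lemma norm_field_of:
  assumes "sq_integrable f"
  shows "(norm (field_of f))\<^sup>2 = (\<integral>x. (norm (f x))\<^sup>2 \<partial>torus)"
  using inner_field_of[OF assms assms] by (simp add: power2_norm_eq_inner)

section \<open>Completeness of \<open>L\<^sup>2\<close>\<close>

text \<open>Riesz-Fischer: on a probability space the L^1 norm is at most the L^2 norm, so the
  increments are absolutely summable almost everywhere; the pointwise limit is then an L^2 limit by
  Fatou.\<close>

lemma vfield_summable_limit:
  fixes X :: "nat \<Rightarrow> vfield"
  assumes fast: "\<And>n. norm (X (Suc n) - X n) \<le> (1/2) ^ n"
  shows "\<exists>l. X \<longlonglongrightarrow> l"
proof -
  define f where "f n = rep_vfield (X n)" for n
  define d where "d n = rep_vfield (X (Suc n) - X n)" for n
  have fm [measurable]: "f n \<in> borel_measurable torus" for n by (simp add: f_def)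
  have dm [measurable]: "d n \<in> borel_measurable torus" for n by (simp add: d_def)
  have dsq: "integrable torus (\<lambda>x. (norm (d n x))\<^sup>2)" for n
    using sq_integrable_rep unfolding sq_integrable_def d_def by auto
  have dint: "(\<integral>x. (norm (d n x))\<^sup>2 \<partial>torus) = (norm (X (Suc n) - X n))\<^sup>2" for n
    using norm_field_of[of "d n"] by (simp add: d_def)
  have d1: "integrable torus (\<lambda>x. norm (d n x))" for n
  proof (rule Bochner_Integration.integrable_bound)
    show "integrable torus (\<lambda>x. 1 + (norm (d n x))\<^sup>2)" using dsq by simp
    show "AE x in torus. norm (norm (d n x)) \<le> norm (1 + (norm (d n x))\<^sup>2)"
    proof (rule AE_I2)
      fix x :: "real ^ 3"
      have "0 \<le> (norm (d n x) - 1)\<^sup>2" by simp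
      then have "2 * norm (d n x) \<le> 1 + (norm (d n x))\<^sup>2" by (simp add: power2_diff)
      moreover have "0 \<le> norm (d n x)" by simp
      ultimately show "norm (norm (d n x)) \<le> norm (1 + (norm (d n x))\<^sup>2)" unfolding real_norm_def by linarith
    qed
  qed simp
  have dL1: "(\<integral>x. norm (d n x) \<partial>torus) \<le> (1/2) ^ n" for n
  proof (rule power2_le_imp_le)
    \<comment> \<open>Non-negativity of the variance is Cauchy-Schwarz against the constant
      1.\<close>
    have "(\<integral>x. norm (d n x) \<partial>torus)\<^sup>2 \<le> (\<integral>x. (norm (d n x))\<^sup>2 \<partial>torus)"
      using torus.variance_positive[of "\<lambda>x. norm (d n x)"] torus.variance_eq[OF d1 dsq] by simp
    also have "\<dots> \<le> ((1/2) ^ n)\<^sup>2" unfolding dint by (intro power_mono fast) simp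
    finally show "(\<integral>x. norm (d n x) \<partial>torus)\<^sup>2 \<le> ((1/2) ^ n)\<^sup>2" .
  qed simp
  have "AE x in torus. summable (\<lambda>n. norm (d n x))"
  proof -
    have "(\<integral>\<^sup>+x. (\<Sum>n. ennreal (norm (d n x))) \<partial>torus) = (\<Sum>n. \<integral>\<^sup>+x. ennreal (norm (d n x)) \<partial>torus)"
      by (rule nn_integral_suminf) simp
    also have "\<dots> = (\<Sum>n. ennreal (\<integral>x. norm (d n x) \<partial>torus))"
      by (intro suminf_cong nn_integral_eq_integral d1) simp
    also have "\<dots> \<le> (\<Sum>n. ennreal ((1/2) ^ n))"
      by (intro suminf_le ennreal_leI dL1) auto
    also have "\<dots> = ennreal (\<Sum>n. (1/2) ^ n)"
      by (intro suminf_ennreal_eq) (auto intro!: summable_sums summable_geometric)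
    also have "\<dots> < \<infinity>" by simp
    finally have "AE x in torus. (\<Sum>n. ennreal (norm (d n x))) \<noteq> \<infinity>"
      by (intro nn_integral_PInf_AE) auto
    then show ?thesis
      by eventually_elim (auto intro: summable_suminf_not_top)
  qed
  moreover have "AE x in torus. \<forall>n. d n x = f (Suc n) x - f n x"
    unfolding AE_all_countable d_def f_def by (intro allI rep_diff)
  ultimately have conv: "AE x in torus. convergent (\<lambda>n. f n x)"
  proof eventually_elim
    case (elim x)
    have "summable (\<lambda>n. norm (f (Suc n) x - f n x))" using elim by simp
    then have "summable (\<lambda>n. f (Suc n) x - f n x)" by (rule summable_norm_cancel)
    then have "convergent (\<lambda>m. f m x - f 0 x)"
      unfolding summable_iff_convergent sum_lessThan_telescope[of "\<lambda>n. f n x"] .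
    then show ?case by (simp only: convergent_diff_const_right_iff)
  qed
  define l where "l x = lim (\<lambda>n. f n x)" for x
  have lm [measurable]: "l \<in> borel_measurable torus" unfolding l_def by (rule borel_measurable_lim_metric) simp
  have lim: "AE x in torus. (\<lambda>n. f n x) \<longlonglongrightarrow> l x"
    using conv by eventually_elim (auto simp: l_def convergent_LIMSEQ_iff)
  have gap: "norm (X m - X n) \<le> 2 * (1/2) ^ n" if "n \<le> m" for m n
    using that
  proof (induction m rule: dec_induct)
    case base show ?case by simp
  next
    case (step m)
    \<comment> \<open>The term subtracted on the right makes the induction close; it is dropped
      afterwards.\<close>
    have *: "norm (X m - X n) \<le> 2 * (1/2) ^ n - 2 * (1/2) ^ m" if "n \<le> m" for m
      using that
    proof (induction m rule: dec_induct)
      case (step m)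
      have "norm (X (Suc m) - X n) \<le> norm (X (Suc m) - X m) + norm (X m - X n)"
        by (metis diff_add_cancel add_diff_eq norm_triangle_ineq)
      with step fast[of m] show ?case by simp
    qed simp
    have "n \<le> Suc m" using step by simp
    from *[OF this] show ?case by (smt (verit) zero_less_power half_gt_zero zero_less_one)
  qed
  have nn: "(\<integral>\<^sup>+x. ennreal ((norm (l x - f n x))\<^sup>2) \<partial>torus) \<le> ennreal ((2 * (1/2) ^ n)\<^sup>2)" for n
  proof -
    have "(\<integral>\<^sup>+x. ennreal ((norm (l x - f n x))\<^sup>2) \<partial>torus)
        = (\<integral>\<^sup>+x. liminf (\<lambda>m. ennreal ((norm (f m x - f n x))\<^sup>2)) \<partial>torus)"
    proof (rule nn_integral_cong_AE)
      show "AE x in torus. ennreal ((norm (l x - f n x))\<^sup>2) = liminf (\<lambda>m. ennreal ((norm (f m x - f n x))\<^sup>2))"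
        using lim
      proof eventually_elim
        case (elim x)
        have "(\<lambda>m. ennreal ((norm (f m x - f n x))\<^sup>2)) \<longlonglongrightarrow> ennreal ((norm (l x - f n x))\<^sup>2)"
          by (intro tendsto_intros elim)
        then show ?case by (rule lim_imp_Liminf[OF sequentially_bot, symmetric])
      qed
    qed
    also have "\<dots> \<le> liminf (\<lambda>m. \<integral>\<^sup>+x. ennreal ((norm (f m x - f n x))\<^sup>2) \<partial>torus)"
      by (rule nn_integral_liminf) measurable
    also have "\<dots> \<le> limsup (\<lambda>m. \<integral>\<^sup>+x. ennreal ((norm (f m x - f n x))\<^sup>2) \<partial>torus)"
      by (rule Liminf_le_Limsup) simp
    also have "\<dots> \<le> ennreal ((2 * (1/2) ^ n)\<^sup>2)"
    proof (rule Limsup_bounded)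
      show "\<forall>\<^sub>F m in sequentially. (\<integral>\<^sup>+x. ennreal ((norm (f m x - f n x))\<^sup>2) \<partial>torus) \<le> ennreal ((2 * (1/2) ^ n)\<^sup>2)"
        using eventually_ge_at_top[of n]
      proof eventually_elim
        case (elim m)
        have "(\<integral>\<^sup>+x. ennreal ((norm (f m x - f n x))\<^sup>2) \<partial>torus) = (\<integral>\<^sup>+x. ennreal ((norm (rep_vfield (X m - X n) x))\<^sup>2) \<partial>torus)"
          using rep_diff[of "X m" "X n"] by (intro nn_integral_cong_AE) (auto simp: f_def)
        also have "\<dots> = ennreal ((norm (X m - X n))\<^sup>2)"
          using sq_integrable_rep[of "X m - X n"] norm_field_of[of "rep_vfield (X m - X n)"]
          by (subst nn_integral_eq_integral) (auto simp: sq_integrable_def)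
        also have "\<dots> \<le> ennreal ((2 * (1/2) ^ n)\<^sup>2)"
          by (intro ennreal_leI power_mono gap elim) simp
        finally show ?case .
      qed
    qed
    finally show ?thesis .
  qed
  have intd: "integrable torus (\<lambda>x. (norm (l x - f n x))\<^sup>2)" for n
  proof (rule integrableI_bounded)
    have "(\<integral>\<^sup>+x. ennreal (norm ((norm (l x - f n x))\<^sup>2)) \<partial>torus) \<le> ennreal ((2 * (1/2) ^ n)\<^sup>2)"
      using nn[of n] by simp
    then show "(\<integral>\<^sup>+x. ennreal (norm ((norm (l x - f n x))\<^sup>2)) \<partial>torus) < \<infinity>"
      using order_le_less_trans by fastforce
  qed measurable
  then have sqd: "sq_integrable (\<lambda>x. l x - f n x)" for n by (simp add: sq_integrable_def)
  have lsq: "sq_integrable l"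
    using sq_integrable_add[OF sqd[of 0] sq_integrable_rep[of "X 0"]] by (simp add: f_def)
  have eq: "field_of l - X n = field_of (\<lambda>x. l x - f n x)" for n
    using field_of_add[OF sqd[of n] sq_integrable_rep[of "X n"]] by (simp add: f_def)
  have le: "norm (X n - field_of l) \<le> 2 * (1/2) ^ n" for n
  proof (rule power2_le_imp_le)
    have "ennreal ((norm (field_of l - X n))\<^sup>2) = (\<integral>\<^sup>+x. ennreal ((norm (l x - f n x))\<^sup>2) \<partial>torus)"
      unfolding eq norm_field_of[OF sqd] by (subst nn_integral_eq_integral) (auto simp: intd)
    also have "\<dots> \<le> ennreal ((2 * (1/2) ^ n)\<^sup>2)" by (rule nn)
    finally show "(norm (X n - field_of l))\<^sup>2 \<le> (2 * (1/2) ^ n)\<^sup>2"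
      by (subst norm_minus_commute) (simp add: ennreal_le_iff)
  qed simp
  have "(\<lambda>n. X n - field_of l) \<longlonglongrightarrow> 0"
  proof (rule Lim_null_comparison)
    show "\<forall>\<^sub>F n in sequentially. norm (X n - field_of l) \<le> 2 * (1/2) ^ n" using le by simp
    show "(\<lambda>n. 2 * (1/2) ^ n :: real) \<longlonglongrightarrow> 0"
      by (intro tendsto_mult_right_zero LIMSEQ_power_zero) simp
  qed
  then show ?thesis using LIM_zero_cancel by blast
qed

text \<open>A subsequence with geometrically small gaps converges, hence so does the Cauchy
  sequence. Completeness is what gives differentiated Fourier series a sum.\<close>

instance vfield :: banach
proof
  fix X :: "nat \<Rightarrow> vfield" assume X: "Cauchy X"
  have "\<exists>N. \<forall>n. (\<forall>m\<ge>N n. norm (X m - X (N n)) < (1/2) ^ n) \<and> N n < N (Suc n)"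
  proof (rule dependent_nat_choice)
    show "\<exists>N. \<forall>m\<ge>N. norm (X m - X N) < (1/2) ^ 0"
    proof -
      obtain N where "\<And>m n. m \<ge> N \<Longrightarrow> n \<ge> N \<Longrightarrow> norm (X m - X n) < 1"
        using CauchyD[OF X, of 1] by auto
      then show ?thesis by auto
    qed
    fix x n
    obtain N where N: "\<And>m n'. m \<ge> N \<Longrightarrow> n' \<ge> N \<Longrightarrow> norm (X m - X n') < (1/2) ^ Suc n"
      using CauchyD[OF X, of "(1/2) ^ Suc n"] by auto
    show "\<exists>y. (\<forall>m\<ge>y. norm (X m - X y) < (1/2) ^ Suc n) \<and> x < y"
      by (rule exI[of _ "max N (Suc x)"]) (auto intro!: N simp del: power_Suc)
  qed
  then obtain N where N: "\<And>n m. m \<ge> N n \<Longrightarrow> norm (X m - X (N n)) < (1/2) ^ n" "\<And>n. N n < N (Suc n)"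
    by blast
  have sm: "strict_mono N" using N(2) by (simp add: strict_mono_Suc_iff)
  obtain l where "(\<lambda>n. X (N n)) \<longlonglongrightarrow> l"
    using vfield_summable_limit[of "\<lambda>n. X (N n)"] less_imp_le[OF N(1)[OF less_imp_le[OF N(2)]]] by blast
  then have "X \<longlonglongrightarrow> l" using Cauchy_converges_subseq[OF X sm, of l]
    by (simp add: o_def)
  then show "convergent X" by (auto simp: convergent_def)
qed

section \<open>Integration by parts on the torus\<close>

lemma lborel_integral_shift:
  fixes f :: "'a :: euclidean_space \<Rightarrow> real"
  assumes [measurable]: "f \<in> borel_measurable borel"
  shows "(\<integral>x. f (c + x) \<partial>lborel) = (\<integral>x. f x \<partial>lborel)"
proof -
  have "(\<integral>x. f x \<partial>lborel) = (\<integral>x. f x \<partial>(distr lborel borel ((+) c)))" by (simp add: lborel_distr_plus)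
  also have "\<dots> = (\<integral>x. f (c + x) \<partial>lborel)" by (rule integral_distr) measurable
  finally show ?thesis by simp
qed

lemma integral_torus:
  "(\<integral>x. f x \<partial>torus) = (\<integral>x. indicator cell x * f x \<partial>lborel)" for f :: "real ^ 3 \<Rightarrow> real"
  unfolding torus_def by (subst integral_restrict_space) auto

text \<open>Translating the cell by h in direction i moves the slab of points with coordinate below
  h to the opposite face, shifted by one period, where the periodic integrand takes the same
  values.\<close>

lemma integral_torus_shift:
  fixes \<psi> :: "real ^ 3 \<Rightarrow> real"
  assumes cont: "continuous_on UNIV \<psi>" and per: "\<And>x. \<psi> (x + axis i 1) = \<psi> x"
    and h: "0 \<le> h" "h \<le> 1"
  shows "(\<integral>x. \<psi> (x + h *\<^sub>R axis i 1) \<partial>torus) = (\<integral>x. \<psi> x \<partial>torus)"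
proof -
  define a :: "real ^ 3" where "a = axis i 1"
  define A where "A = {x \<in> cell. h \<le> x $ i}"
  define B where "B = {x \<in> cell. x $ i < h}"
  define S where "S = {y. y - h *\<^sub>R a \<in> cell}"
  have [measurable]: "\<psi> \<in> borel_measurable borel" using cont by (rule borel_measurable_continuous_onI)
  have [measurable]: "A \<in> sets borel" "B \<in> sets borel" unfolding A_def B_def by measurable
  have Sm [measurable]: "S \<in> sets borel"
  proof -
    have "(\<lambda>y. y - h *\<^sub>R a) -` cell \<inter> space borel \<in> sets borel" by measurable
    then show ?thesis by (simp add: S_def vimage_def)
  qed
  have ai: "(y - c *\<^sub>R a) $ j = y $ j - (if j = i then c else 0)" for y c j
    by (simp add: a_def axis_def)
  have ind: "indicator S y = (indicator A y + indicator B (y - a) :: real)" for y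
  proof -
    have cell_iff: "y - t *\<^sub>R a \<in> cell \<longleftrightarrow> (\<forall>j. j \<noteq> i \<longrightarrow> 0 \<le> y $ j \<and> y $ j < 1) \<and> t \<le> y $ i \<and> y $ i < 1 + t"
      for t
    proof -
      have split: "(\<forall>j. Q j) \<longleftrightarrow> (\<forall>j. j \<noteq> i \<longrightarrow> Q j) \<and> Q i" for Q :: "3 \<Rightarrow> bool" by metis
      have ai': "(y - t *\<^sub>R a) $ i = y $ i - t" "j \<noteq> i \<Longrightarrow> (y - t *\<^sub>R a) $ j = y $ j" for j
        unfolding ai by auto
      have "y - t *\<^sub>R a \<in> cell \<longleftrightarrow> (\<forall>j. j \<noteq> i \<longrightarrow> 0 \<le> (y - t *\<^sub>R a) $ j \<and> (y - t *\<^sub>R a) $ j < 1)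
          \<and> 0 \<le> (y - t *\<^sub>R a) $ i \<and> (y - t *\<^sub>R a) $ i < 1"
        unfolding mem_Collect_eq by (rule split)
      also have "\<dots> \<longleftrightarrow> (\<forall>j. j \<noteq> i \<longrightarrow> 0 \<le> y $ j \<and> y $ j < 1) \<and> t \<le> y $ i \<and> y $ i < 1 + t"
        using ai' by (simp del: vector_minus_component vector_scaleR_component add: diff_less_eq cong: conj_cong imp_cong)
      finally show ?thesis .
    qed
    have "y \<in> S \<longleftrightarrow> (\<forall>j. j \<noteq> i \<longrightarrow> 0 \<le> y $ j \<and> y $ j < 1) \<and> h \<le> y $ i \<and> y $ i < 1 + h"
      using cell_iff[of h] by (simp add: S_def del: mem_Collect_eq) (simp add: S_def)
    moreover have "y \<in> A \<longleftrightarrow> (\<forall>j. j \<noteq> i \<longrightarrow> 0 \<le> y $ j \<and> y $ j < 1) \<and> h \<le> y $ i \<and> y $ i < 1"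
      using cell_iff[of 0] h by (auto simp: A_def)
    moreover have "y - a \<in> B \<longleftrightarrow> (\<forall>j. j \<noteq> i \<longrightarrow> 0 \<le> y $ j \<and> y $ j < 1) \<and> 1 \<le> y $ i \<and> y $ i < 1 + h"
      using cell_iff[of 1] h ai[of y 1 i] by (auto simp: B_def)
    ultimately have "y \<in> S \<longleftrightarrow> y \<in> A \<or> y - a \<in> B" "\<not> (y \<in> A \<and> y - a \<in> B)"
      using h by force+
    then show ?thesis by (auto simp: indicator_def)
  qed
  have int: "integrable lborel (\<lambda>x. indicator C x * \<psi> x)" if "C \<in> sets borel" "C \<subseteq> cell" for C
  proof -
    have "integrable lborel (\<lambda>x. indicator (cbox 0 1) x *\<^sub>R \<psi> x)"
      by (rule borel_integrable_compact) (auto intro: continuous_on_subset[OF cont])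
    from integrable_mult_indicator[OF _ this, of C] that(1)
    have "integrable lborel (\<lambda>x. indicator C x *\<^sub>R (indicator (cbox 0 1) x *\<^sub>R \<psi> x))" by simp
    moreover have "indicator C x *\<^sub>R (indicator (cbox 0 1) x *\<^sub>R \<psi> x) = indicator C x * \<psi> x" for x
      using that(2) by (auto simp: indicator_def mem_box_cart less_imp_le subset_eq)
    ultimately show ?thesis by (simp only:)
  qed
  have per': "\<psi> (a + x) = \<psi> x" for x using per[of x] by (simp add: a_def add.commute)
  have shiftB: "(\<lambda>x. indicator B (a + x - a) * \<psi> (a + x)) = (\<lambda>x. indicator B x * \<psi> x)"
    by (simp add: per')
  have intB: "integrable lborel (\<lambda>y. indicator B (y - a) * \<psi> y)"
  proof -
    have "integrable lborel (\<lambda>x. indicator B x * \<psi> x)" by (rule int) (auto simp: B_def)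
    then have "integrable (distr lborel borel ((+) (- a))) (\<lambda>x. indicator B x * \<psi> x)"
      by (simp add: lborel_distr_plus)
    then have "integrable lborel (\<lambda>x. indicator B (- a + x) * \<psi> (- a + x))"
      by (subst (asm) integrable_distr_eq) (auto simp: measurable_completion)
    moreover have "\<psi> (- a + x) = \<psi> x" for x using per'[of "- a + x"] by simp
    ultimately show ?thesis by (simp add: algebra_simps)
  qed
  have "(\<integral>x. \<psi> (x + h *\<^sub>R a) \<partial>torus) = (\<integral>x. indicator S (h *\<^sub>R a + x) * \<psi> (h *\<^sub>R a + x) \<partial>lborel)"
    unfolding integral_torus by (intro Bochner_Integration.integral_cong) (auto simp: S_def indicator_def algebra_simps)
  also have "\<dots> = (\<integral>y. indicator S y * \<psi> y \<partial>lborel)"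
    by (rule lborel_integral_shift[where f="\<lambda>y. indicator S y * \<psi> y"]) measurable
  also have "\<dots> = (\<integral>y. indicator A y * \<psi> y + indicator B (y - a) * \<psi> y \<partial>lborel)"
    by (simp add: ind distrib_right)
  also have "\<dots> = (\<integral>y. indicator A y * \<psi> y \<partial>lborel) + (\<integral>y. indicator B (y - a) * \<psi> y \<partial>lborel)"
    by (rule Bochner_Integration.integral_add[OF int intB]) (auto simp: A_def)
  also have "(\<integral>y. indicator B (y - a) * \<psi> y \<partial>lborel) = (\<integral>y. indicator B y * \<psi> y \<partial>lborel)"
    using lborel_integral_shift[where f="\<lambda>y. indicator B (y - a) * \<psi> y" and c=a] unfolding shiftB by simp
  also have "(\<integral>y. indicator A y * \<psi> y \<partial>lborel) + (\<integral>y. indicator B y * \<psi> y \<partial>lborel)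
      = (\<integral>y. indicator A y * \<psi> y + indicator B y * \<psi> y \<partial>lborel)"
    by (rule Bochner_Integration.integral_add[symmetric, OF int int]) (auto simp: A_def B_def)
  also have "\<dots> = (\<integral>x. \<psi> x \<partial>torus)"
    unfolding integral_torus by (intro Bochner_Integration.integral_cong) (auto simp: A_def B_def indicator_def)
  finally show ?thesis by (simp add: a_def)
qed

text \<open>By \<open>integral_torus_shift\<close> every difference quotient has integral zero. The
  mean value theorem bounds the quotients by the supremum of the derivative, so dominated
  convergence applies.\<close>

lemma integral_torus_partial_derivative:
  fixes \<psi> :: "real ^ 3 \<Rightarrow> real"
  assumes der: "\<And>x. (\<psi> has_derivative D x) (at x)"
    and cont: "continuous_on UNIV (\<lambda>x. D x (axis i 1))"
    and per: "\<And>x. \<psi> (x + axis i 1) = \<psi> x"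
  shows "(\<integral>x. D x (axis i 1) \<partial>torus) = 0"
proof -
  define a :: "real ^ 3" where "a = axis i 1"
  define d where "d x = D x a" for x
  have cont\<psi>: "continuous_on UNIV \<psi>"
    using der has_derivative_continuous by (blast intro: continuous_at_imp_continuous_on)
  have [measurable]: "\<psi> \<in> borel_measurable borel" using cont\<psi> by (rule borel_measurable_continuous_onI)
  have [measurable]: "d \<in> borel_measurable borel"
    using cont unfolding d_def a_def by (rule borel_measurable_continuous_onI)
  have line: "((\<lambda>t. \<psi> (x + t *\<^sub>R a)) has_real_derivative d (x + t *\<^sub>R a)) (at t)" for x t
  proof -
    have "((\<lambda>t. x + t *\<^sub>R a) has_derivative (\<lambda>t. t *\<^sub>R a)) (at t)"
      by (auto intro!: derivative_eq_intros)
    from has_derivative_compose[OF this der]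
    have "((\<lambda>t. \<psi> (x + t *\<^sub>R a)) has_derivative (\<lambda>s. D (x + t *\<^sub>R a) (s *\<^sub>R a))) (at t)" .
    moreover have "D y (s *\<^sub>R a) = d y * s" for y s
      using linear_cmul[OF has_derivative_linear[OF der[of y]], of s a] by (simp add: d_def)
    ultimately show ?thesis by (simp add: has_field_derivative_def)
  qed
  \<comment> \<open>The box of side two contains every segment of length at most one that starts in
    the cell and runs in direction i.\<close>
  have "compact (d ` cbox 0 (2 *\<^sub>R 1))"
    by (intro compact_continuous_image continuous_on_subset[OF cont[folded a_def, folded d_def]]) auto
  then have "bounded (d ` cbox 0 (2 *\<^sub>R 1))" by (rule compact_imp_bounded)
  then obtain K where K: "\<And>x. x \<in> cbox 0 (2 *\<^sub>R 1) \<Longrightarrow> \<bar>d x\<bar> \<le> K" unfolding bounded_iff by auto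
  have inbox: "x + t *\<^sub>R a \<in> cbox 0 (2 *\<^sub>R 1)" if "x \<in> cell" "0 \<le> t" "t \<le> 1" for x t
  proof -
    have "0 \<le> a $ j \<and> a $ j \<le> 1" for j by (simp add: a_def axis_def)
    then have "0 \<le> t * a $ j" "t * a $ j \<le> 1" for j using that by (auto intro: mult_le_one)
    moreover have "0 \<le> x $ j" "x $ j < 1" for j using that by auto
    ultimately have "0 \<le> x $ j + t * a $ j \<and> x $ j + t * a $ j \<le> 2" for j
      using add_mono[OF less_imp_le[of "x $ j" 1], of "t * a $ j" 1] by (simp add: add_nonneg_nonneg)
    then show ?thesis by (simp add: mem_box_cart)
  qed
  define q where "q n x = (\<psi> (x + (1 / real (Suc n)) *\<^sub>R a) - \<psi> x) * real (Suc n)" for n x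
  have lim: "(\<lambda>n. q n x) \<longlonglongrightarrow> d x" for x
  proof -
    have "((\<lambda>t. (\<psi> (x + (0 + t) *\<^sub>R a) - \<psi> (x + 0 *\<^sub>R a)) / t) \<longlongrightarrow> d (x + 0 *\<^sub>R a)) (at 0)"
      using line[of x 0] unfolding DERIV_def .
    then have "((\<lambda>t. (\<psi> (x + t *\<^sub>R a) - \<psi> x) / t) \<longlongrightarrow> d x) (at 0)" by simp
    moreover have "filterlim (\<lambda>n. 1 / real (Suc n)) (at 0) sequentially"
      unfolding filterlim_at using LIMSEQ_inverse_real_of_nat by (auto simp: inverse_eq_divide)
    ultimately have "(\<lambda>n. (\<psi> (x + (1 / real (Suc n)) *\<^sub>R a) - \<psi> x) / (1 / real (Suc n))) \<longlonglongrightarrow> d x"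
      by (rule filterlim_compose)
    then show ?thesis unfolding q_def by simp
  qed
  have bd: "\<bar>q n x\<bar> \<le> K" if "x \<in> cell" for n x
  proof -
    define h where "h = 1 / real (Suc n)"
    have h: "0 < h" "h \<le> 1" by (auto simp: h_def)
    have "\<exists>z>0. z < h \<and> \<psi> (x + h *\<^sub>R a) - \<psi> (x + 0 *\<^sub>R a) = (h - 0) * d (x + z *\<^sub>R a)"
      by (rule MVT2[OF h(1), of "\<lambda>t. \<psi> (x + t *\<^sub>R a)"]) (rule line)
    then obtain z where z: "0 < z" "z < h" "\<psi> (x + h *\<^sub>R a) - \<psi> x = h * d (x + z *\<^sub>R a)" by auto
    then have "q n x = d (x + z *\<^sub>R a)" unfolding q_def h_def[symmetric] by (simp add: h_def)
    then show ?thesis using K[OF inbox[OF that, of z]] z h by simp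
  qed
  have bdd: "\<bar>d x\<bar> \<le> K" if "x \<in> cell" for x
    using K[OF inbox[OF that, of 0]] by simp
  have q0: "(\<integral>x. q n x \<partial>torus) = 0" for n
  proof -
    have b: "\<exists>C. \<forall>x\<in>cbox 0 (2 *\<^sub>R 1). norm (\<psi> x) \<le> C"
    proof -
      have "bounded (\<psi> ` cbox 0 (2 *\<^sub>R 1))"
        by (intro compact_imp_bounded compact_continuous_image continuous_on_subset[OF cont\<psi>]) auto
      then show ?thesis unfolding bounded_iff by auto
    qed
    then obtain C where C: "\<And>x. x \<in> cbox 0 (2 *\<^sub>R 1) \<Longrightarrow> norm (\<psi> x) \<le> C" by blast
    have i1: "integrable torus (\<lambda>x. \<psi> (x + (1 / real (Suc n)) *\<^sub>R a))"
      by (rule integrable_torus_bounded[where K=C], rule borel_measurable_torusI, measurable) (rule C, rule inbox, auto)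
    have i2: "integrable torus \<psi>"
      by (rule integrable_torus_bounded[where K=C], rule borel_measurable_torusI, measurable)
        (rule C, use inbox[of _ 0] in simp)
    have "(\<integral>x. \<psi> (x + (1 / real (Suc n)) *\<^sub>R a) \<partial>torus) = (\<integral>x. \<psi> x \<partial>torus)"
      unfolding a_def by (rule integral_torus_shift[OF cont\<psi> per]) auto
    then show ?thesis unfolding q_def using i1 i2 by simp
  qed
  have "(\<lambda>n. \<integral>x. q n x \<partial>torus) \<longlonglongrightarrow> (\<integral>x. d x \<partial>torus)"
  proof (rule integral_dominated_convergence[where w="\<lambda>_. K"])
    show "d \<in> borel_measurable torus" by (rule borel_measurable_torusI) measurable
    show "q n \<in> borel_measurable torus" for n
      unfolding q_def by (rule borel_measurable_torusI) measurable
  qed (use lim bd in \<open>auto intro!: AE_I2\<close>)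
  then have "(\<integral>x. d x \<partial>torus) = 0" by (simp add: q0 LIMSEQ_const_iff)
  then show ?thesis by (simp add: d_def a_def)
qed

section \<open>Uniqueness of weak derivatives\<close>

text \<open>The free phase c makes sines available as shifted cosines, so that the class is an
  algebra closed under partial derivatives.\<close>

inductive trigpoly :: "(real ^ 3 \<Rightarrow> real) \<Rightarrow> bool" where
  const: "trigpoly (\<lambda>_. c)"
| cos: "trigpoly (\<lambda>x. cos (2 * pi * (x $ i - c)))"
| add: "trigpoly f \<Longrightarrow> trigpoly g \<Longrightarrow> trigpoly (\<lambda>x. f x + g x)"
| mult: "trigpoly f \<Longrightarrow> trigpoly g \<Longrightarrow> trigpoly (\<lambda>x. f x * g x)"

lemma trigpoly_prod: "finite S \<Longrightarrow> (\<And>i. i \<in> S \<Longrightarrow> trigpoly (f i)) \<Longrightarrow> trigpoly (\<lambda>x. \<Prod>i\<in>S. f i x)"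
  by (induction S rule: finite_induct) (auto intro: trigpoly.intros)

lemma trigpoly_polynomial:
  assumes "real_polynomial_function (p :: real \<Rightarrow> real)" "trigpoly f"
  shows "trigpoly (\<lambda>x. p (f x))"
  using assms(1)
proof induction
  case (linear l)
  have "l y = y * l 1" for y
    using linear_scale[OF bounded_linear.linear[OF linear(1)], of y 1]
    unfolding real_scaleR_def mult_1_right .
  then have "(\<lambda>x. l (f x)) = (\<lambda>x. f x * l 1)" by blast
  then show ?case using trigpoly.mult[OF assms(2) trigpoly.const[of "l 1"]] by simp
qed (auto intro: trigpoly.intros)

lemma trigpoly_periodic: "trigpoly f \<Longrightarrow> f (x + axis j 1) = f x"
proof (induction rule: trigpoly.induct)
  case (cos i c)
  have "cos (2 * pi * ((x + axis j 1) $ i - c)) = cos (2 * pi * (x $ i - c) + (if i = j then 2 * pi else 0))"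
    by (simp add: axis_def algebra_simps)
  then show ?case by (auto split: if_splits)
qed auto

lemma trigpoly_derivative:
  "trigpoly f \<Longrightarrow> \<exists>D. (\<forall>i. trigpoly (D i)) \<and> (\<forall>x. (f has_derivative (\<lambda>h. \<Sum>i\<in>UNIV. h $ i * D i x)) (at x))"
proof (induction rule: trigpoly.induct)
  case (const c)
  show ?case by (rule exI[of _ "\<lambda>_ _. 0"]) (auto intro: trigpoly.const)
next
  case (cos i c)
  define D where "D j x = (if j = i then 2 * pi * cos (2 * pi * (x $ i - (c - 1/4))) else 0)" for j and x :: "real ^ 3"
  have "trigpoly (D j)" for j unfolding D_def
    by (cases "j = i") (auto intro: trigpoly.intros)
  moreover have "((\<lambda>x. cos (2 * pi * (x $ i - c))) has_derivative (\<lambda>h. \<Sum>j\<in>UNIV. h $ j * D j x)) (at x)" for x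
  proof -
    have "((\<lambda>x. cos (2 * pi * (x $ i - c))) has_derivative (\<lambda>h. - sin (2 * pi * (x $ i - c)) * (2 * pi * (h $ i)))) (at x)"
      by (auto intro!: derivative_eq_intros bounded_linear.has_derivative[OF bounded_linear_vec_nth])
    moreover have "(\<Sum>j\<in>UNIV. h $ j * D j x) = - sin (2 * pi * (x $ i - c)) * (2 * pi * (h $ i))" for h :: "real ^ 3"
    proof -
      have "(\<Sum>j\<in>UNIV. h $ j * D j x) = (\<Sum>j\<in>UNIV. if j = i then h $ i * (2 * pi * cos (2 * pi * (x $ i - (c - 1/4)))) else 0)"
        by (intro sum.cong) (auto simp: D_def)
      moreover have "cos (2 * pi * (x $ i - (c - 1/4))) = - sin (2 * pi * (x $ i - c))"
        using cos_add[of "2 * pi * (x $ i - c)" "pi / 2"] by (simp add: algebra_simps)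
      ultimately show ?thesis by simp
    qed
    ultimately show ?thesis by (simp only:)
  qed
  ultimately show ?case by blast
next
  case (add f g)
  then obtain D E where D: "\<forall>i. trigpoly (D i)" "\<forall>x. (f has_derivative (\<lambda>h. \<Sum>i\<in>UNIV. h $ i * D i x)) (at x)"
    and E: "\<forall>i. trigpoly (E i)" "\<forall>x. (g has_derivative (\<lambda>h. \<Sum>i\<in>UNIV. h $ i * E i x)) (at x)" by blast
  show ?case
    using has_derivative_add[OF D(2)[rule_format] E(2)[rule_format]] D E
    by (intro exI[of _ "\<lambda>i x. D i x + E i x"]) (auto intro: trigpoly.intros simp: distrib_left sum.distrib)
next
  case (mult f g)
  then obtain D E where D: "\<forall>i. trigpoly (D i)" "\<forall>x. (f has_derivative (\<lambda>h. \<Sum>i\<in>UNIV. h $ i * D i x)) (at x)"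
    and E: "\<forall>i. trigpoly (E i)" "\<forall>x. (g has_derivative (\<lambda>h. \<Sum>i\<in>UNIV. h $ i * E i x)) (at x)" by blast
  have *: "f x * (\<Sum>i\<in>UNIV. h $ i * E i x) + (\<Sum>i\<in>UNIV. h $ i * D i x) * g x
      = (\<Sum>i\<in>UNIV. h $ i * (f x * E i x + D i x * g x))" for h x
    by (simp add: sum_distrib_left sum_distrib_right sum.distrib[symmetric] algebra_simps)
  show ?case
    using has_derivative_mult[OF D(2)[rule_format] E(2)[rule_format]] D E mult unfolding *
    by (intro exI[of _ "\<lambda>i x. f x * E i x + D i x * g x"]) (auto intro!: trigpoly.intros)
qed

lemma trigpoly_smooth_periodic:
  assumes "trigpoly f" shows "smooth_periodic (\<lambda>x. f x *\<^sub>R c)"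
proof -
  have "\<exists>g. trigpoly g \<and> foldr pderiv_at js (\<lambda>x. f x *\<^sub>R c) = (\<lambda>x. g x *\<^sub>R c)" for js :: "3 list"
  proof (induction js)
    case Nil show ?case using assms by auto
  next
    case (Cons j js)
    then obtain g where g: "trigpoly g" "foldr pderiv_at js (\<lambda>x. f x *\<^sub>R c) = (\<lambda>x. g x *\<^sub>R c)" by blast
    obtain D where D: "\<forall>i. trigpoly (D i)" "\<forall>x. (g has_derivative (\<lambda>h. \<Sum>i\<in>UNIV. h $ i * D i x)) (at x)"
      using trigpoly_derivative[OF g(1)] by blast
    have "pderiv_at j (\<lambda>x. g x *\<^sub>R c) x = D j x *\<^sub>R c" for x
    proof -
      have "((\<lambda>x. g x *\<^sub>R c) has_derivative (\<lambda>h. (\<Sum>i\<in>UNIV. h $ i * D i x) *\<^sub>R c)) (at x)"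
        using D(2) by (auto intro!: has_derivative_scaleR_left)
      from frechet_derivative_at[OF this, symmetric]
      show ?thesis by (simp add: pderiv_at_def axis_def if_distrib[of "\<lambda>r. r * _"] cong: if_cong)
    qed
    then show ?case using g(2) D(1) by (auto intro!: exI[of _ "D j"])
  qed
  moreover have "(\<lambda>x. g x *\<^sub>R c) differentiable at x" if g: "trigpoly g" for g x
    using trigpoly_derivative[OF g] unfolding differentiable_def by (blast intro: has_derivative_scaleR_left)
  ultimately have "foldr pderiv_at js (\<lambda>x. f x *\<^sub>R c) differentiable at x" for js x by metis
  then show ?thesis unfolding smooth_periodic_def using trigpoly_periodic[OF assms] by auto
qed

text \<open>Weierstrass approximation of the ramps
  \<open>max 0 (min 1 (n * (s - \<gamma>)))\<close>, which tend to the step. The bound 2 is 1 for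
  the ramp plus an error of at most 1.\<close>

lemma step_polynomial_approximation:
  fixes \<gamma> :: real
  obtains P :: "nat \<Rightarrow> real \<Rightarrow> real" where "\<And>n. real_polynomial_function (P n)"
    "\<And>n s. s \<in> {-1..1} \<Longrightarrow> \<bar>P n s\<bar> \<le> 2"
    "\<And>s. s \<in> {-1..1} \<Longrightarrow> (\<lambda>n. P n s) \<longlonglongrightarrow> (if \<gamma> < s then 1 else 0)"
proof -
  define c where "c n s = max 0 (min 1 (real n * (s - \<gamma>)))" for n s
  have "\<exists>p. real_polynomial_function p \<and> (\<forall>s\<in>{-1..1}. \<bar>c n s - p s\<bar> < 1 / real (Suc n))" for n
  proof -
    obtain p where "real_polynomial_function p" "\<And>s. s \<in> {-1..1} \<Longrightarrow> \<bar>c n s - p s\<bar> < 1 / real (Suc n)"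
      by (rule Stone_Weierstrass_real_polynomial_function[of "{-1..1}" "c n" "1 / real (Suc n)"])
        (auto simp: c_def intro!: continuous_intros)
    then show ?thesis by blast
  qed
  then obtain P where P: "\<And>n. real_polynomial_function (P n)"
    "\<And>n s. s \<in> {-1..1} \<Longrightarrow> \<bar>c n s - P n s\<bar> < 1 / real (Suc n)" by metis
  show thesis
  proof
    show "real_polynomial_function (P n)" for n by (rule P)
    fix s :: real assume s: "s \<in> {-1..1}"
    have c01: "0 \<le> c n s" "c n s \<le> 1" for n by (auto simp: c_def)
    have "1 / real (Suc n) \<le> 1" for n by simp
    then show "\<bar>P n s\<bar> \<le> 2" for n using P(2)[OF s, of n] c01[of n] by (smt (verit))
    have clim: "(\<lambda>n. c n s) \<longlonglongrightarrow> (if \<gamma> < s then 1 else 0)"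
    proof (cases "\<gamma> < s")
      case True
      obtain N where N: "1 < real N * (s - \<gamma>)"
        using reals_Archimedean3[of "s - \<gamma>"] True by auto
      have "\<forall>\<^sub>F n in sequentially. c n s = 1"
        using eventually_ge_at_top[of N]
      proof eventually_elim
        case (elim n)
        have "real N * (s - \<gamma>) \<le> real n * (s - \<gamma>)" using elim True by (intro mult_right_mono) auto
        then show ?case using N by (simp add: c_def)
      qed
      then show ?thesis using True by (simp add: tendsto_eventually)
    next
      case False
      then have "real n * (s - \<gamma>) \<le> 0" for n by (intro mult_nonneg_nonpos) auto
      then have "c n s = 0" for n unfolding c_def by (smt (verit))
      then show ?thesis using False by simp
    qed
    have "(\<lambda>n. c n s - P n s) \<longlonglongrightarrow> 0"
    proof (rule Lim_null_comparison)
      show "\<forall>\<^sub>F n in sequentially. norm (c n s - P n s) \<le> 1 / real (Suc n)"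
        using P(2)[OF s] by (auto intro!: always_eventually less_imp_le)
      show "(\<lambda>n. 1 / real (Suc n)) \<longlonglongrightarrow> 0" using LIMSEQ_inverse_real_of_nat by (simp add: inverse_eq_divide)
    qed
    from tendsto_diff[OF clim this] show "(\<lambda>n. P n s) \<longlonglongrightarrow> (if \<gamma> < s then 1 else 0)" by simp
  qed
qed

text \<open>A shifted cosine decreases with the distance to its centre on the circle, so its
  superlevel sets are arcs. For points of [0,1) only distances up to 1 - w occur, where w is half
  the length of the interval, so wrapping around creates no second arc.\<close>

lemma cos_gt_iff_interval:
  fixes a b x :: real
  assumes "0 \<le> a" "a < b" "b \<le> 1" "0 \<le> x" "x < 1"
  shows "cos (pi * (b - a)) < cos (2 * pi * (x - (a + b) / 2)) \<longleftrightarrow> a < x \<and> x < b"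
proof -
  define y where "y = \<bar>x - (a + b) / 2\<bar>"
  define w where "w = (b - a) / 2"
  have w: "0 < w" "w \<le> 1 / 2" using assms by (auto simp: w_def)
  have y: "0 \<le> y" "y \<le> 1 - w" using assms by (auto simp: y_def w_def abs_if field_simps)
  have c1: "cos (2 * pi * (x - (a + b) / 2)) = cos (2 * pi * y)"
  proof -
    have "2 * pi * y = \<bar>2 * pi * (x - (a + b) / 2)\<bar>" by (simp add: y_def abs_mult)
    then show ?thesis by (simp only: cos_abs_real)
  qed
  have c2: "cos (pi * (b - a)) = cos (2 * pi * w)" by (simp add: w_def)
  have iff: "a < x \<and> x < b \<longleftrightarrow> y < w" by (auto simp: y_def w_def abs_if field_simps)
  have "cos (2 * pi * w) < cos (2 * pi * y) \<longleftrightarrow> y < w"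
  proof (cases "y \<le> 1 / 2")
    case True
    then show ?thesis using w y cos_mono_less_eq[of "2 * pi * w" "2 * pi * y"] by simp
  next
    case False
    have "cos (2 * pi * y) = cos (2 * pi * (1 - y))"
      using cos_periodic[of "- (2 * pi * y)"] by (simp add: algebra_simps)
    moreover have "\<not> cos (2 * pi * w) < cos (2 * pi * (1 - y))"
      using w y False cos_mono_less_eq[of "2 * pi * w" "2 * pi * (1 - y)"] by simp
    ultimately show ?thesis using False w by simp
  qed
  then show ?thesis using c1 c2 iff by simp
qed

lemma AE_lborel_component_nonzero: "AE x in lborel. (x :: real ^ 3) $ i \<noteq> 0"
proof -
  have "negligible {x :: real ^ 3. x $ i = 0}" by (rule negligible_standard_hyperplane_cart)
  moreover have "{x :: real ^ 3. x $ i = 0} \<in> sets borel" by measurable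
  ultimately have "{x :: real ^ 3. x $ i = 0} \<in> null_sets lborel"
    by (simp add: negligible_iff_null_sets null_sets_completion_iff)
  then show ?thesis by (rule AE_I') auto
qed

text \<open>Products of polynomials in shifted cosines converge boundedly to indicators of open
  boxes inside the cell, so G integrates to zero over every box; boxes are stable under intersection
  and generate the Borel sets.\<close>

lemma trigpoly_orthogonal_imp_zero:
  fixes G :: "real ^ 3 \<Rightarrow> real"
  assumes G: "integrable torus G" and orth: "\<And>f. trigpoly f \<Longrightarrow> (\<integral>x. G x * f x \<partial>torus) = 0"
  shows "AE x in torus. G x = 0"
proof -
  have Gm [measurable]: "G \<in> borel_measurable torus" using G by simp
  have tm: "f \<in> borel_measurable borel" if "trigpoly f" for f
    using trigpoly_derivative[OF that]
    by (intro borel_measurable_continuous_onI continuous_at_imp_continuous_on)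
      (blast intro: has_derivative_continuous)
  have bump: "(\<integral>x. G x * (if \<forall>i. a $ i < x $ i \<and> x $ i < b $ i then 1 else 0) \<partial>torus) = 0"
    if ab: "\<And>i. 0 \<le> a $ i" "\<And>i. a $ i < b $ i" "\<And>i. b $ i \<le> 1" for a b :: "real ^ 3"
  proof -
    define \<gamma> where "\<gamma> i = cos (pi * (b $ i - a $ i))" for i
    define \<theta> where "\<theta> i x = cos (2 * pi * (x $ i - (a $ i + b $ i) / 2))" for i and x :: "real ^ 3"
    define ok where "ok i P \<longleftrightarrow> (\<forall>n. real_polynomial_function (P n)) \<and> (\<forall>n. \<forall>s\<in>{-1..1}. \<bar>P n s\<bar> \<le> 2) \<and>
       (\<forall>s\<in>{-1..1}. (\<lambda>n. P n s) \<longlonglongrightarrow> (if \<gamma> i < s then 1 else 0))" for i and P :: "nat \<Rightarrow> real \<Rightarrow> real"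
    have "\<exists>P. ok i P" for i
    proof (rule step_polynomial_approximation[of "\<gamma> i"])
      fix Q :: "nat \<Rightarrow> real \<Rightarrow> real"
      assume "\<And>n. real_polynomial_function (Q n)" "\<And>n s. s \<in> {-1..1} \<Longrightarrow> \<bar>Q n s\<bar> \<le> 2"
        "\<And>s. s \<in> {-1..1} \<Longrightarrow> (\<lambda>n. Q n s) \<longlonglongrightarrow> (if \<gamma> i < s then 1 else 0)"
      then have "ok i Q" unfolding ok_def by simp
      then show ?thesis by (rule exI[of "ok i"])
    qed
    then have "\<forall>i. \<exists>P. ok i P" by simp
    from choice[OF this] obtain P where "\<And>i. ok i (P i)" by auto
    then have P: "\<And>i n. real_polynomial_function (P i n)"
       "\<And>i n s. s \<in> {-1..1} \<Longrightarrow> \<bar>P i n s\<bar> \<le> 2"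
       "\<And>i s. s \<in> {-1..1} \<Longrightarrow> (\<lambda>n. P i n s) \<longlonglongrightarrow> (if \<gamma> i < s then 1 else 0)"
      unfolding ok_def by simp_all
    define f where "f n x = (\<Prod>i\<in>UNIV. P i n (\<theta> i x))" for n x
    have tf: "trigpoly (f n)" for n unfolding f_def \<theta>_def
      by (rule trigpoly_prod) (simp, rule trigpoly_polynomial[OF P(1) trigpoly.cos])
    have \<theta>: "\<theta> i x \<in> {-1..1}" for i x by (simp add: \<theta>_def)
    have flim: "(\<lambda>n. f n x) \<longlonglongrightarrow> (if \<forall>i. a $ i < x $ i \<and> x $ i < b $ i then 1 else 0)" if x: "x \<in> cell" for x
    proof -
      have "(\<lambda>n. f n x) \<longlonglongrightarrow> (\<Prod>i\<in>UNIV. if \<gamma> i < \<theta> i x then 1 else 0)"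
        unfolding f_def by (intro tendsto_prod P \<theta>)
      moreover have "\<gamma> i < \<theta> i x \<longleftrightarrow> a $ i < x $ i \<and> x $ i < b $ i" for i
        unfolding \<gamma>_def \<theta>_def using ab[of i] x by (intro cos_gt_iff_interval) auto
      moreover have "(\<Prod>i\<in>UNIV. if Q i then 1 else 0 :: real) = (if \<forall>i. Q i then 1 else 0)" for Q :: "3 \<Rightarrow> bool"
        by (auto intro: prod.neutral)
      ultimately show ?thesis by simp
    qed
    \<comment> \<open>A factor 2 from \<open>step_polynomial_approximation\<close> for each of the
      three coordinates.\<close>
    have fb: "\<bar>f n x\<bar> \<le> 8" for n x
    proof -
      have "\<bar>f n x\<bar> = (\<Prod>i\<in>UNIV. \<bar>P i n (\<theta> i x)\<bar>)" by (simp add: f_def abs_prod)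
      also have "\<dots> \<le> (\<Prod>i\<in>(UNIV :: 3 set). 2)" by (intro prod_mono) (use P(2) \<theta> in auto)
      finally show ?thesis by simp
    qed
    have "(\<lambda>n. \<integral>x. G x * f n x \<partial>torus) \<longlonglongrightarrow> (\<integral>x. G x * (if \<forall>i. a $ i < x $ i \<and> x $ i < b $ i then 1 else 0) \<partial>torus)"
    proof (rule integral_dominated_convergence[where w="\<lambda>x. \<bar>G x\<bar> * 8"])
      show "integrable torus (\<lambda>x. \<bar>G x\<bar> * 8)" using G by simp
      show "(\<lambda>x. G x * f n x) \<in> borel_measurable torus" for n
        using borel_measurable_torusI[OF tm[OF tf]] by measurable
      show "(\<lambda>x. G x * (if \<forall>i. a $ i < x $ i \<and> x $ i < b $ i then 1 else 0)) \<in> borel_measurable torus"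
      proof (rule borel_measurable_times[OF Gm borel_measurable_torusI])
        show "(\<lambda>x :: real ^ 3. if \<forall>i. a $ i < x $ i \<and> x $ i < b $ i then 1 else 0 :: real) \<in> borel_measurable borel"
          by measurable
      qed
      show "AE x in torus. norm (G x * f n x) \<le> \<bar>G x\<bar> * 8" for n
        using fb[of n] by (auto intro!: AE_I2 simp: abs_mult mult_left_mono)
      show "AE x in torus. (\<lambda>n. G x * f n x) \<longlonglongrightarrow> G x * (if \<forall>i. a $ i < x $ i \<and> x $ i < b $ i then 1 else 0)"
        by (rule AE_I2) (intro tendsto_intros flim, simp)
    qed
    then show ?thesis by (simp add: orth[OF tf] LIMSEQ_const_iff)
  qed
  define H where "H x = indicator cell x * G x" for x
  have Hi: "integrable lborel H"
    using G unfolding torus_def H_def by (subst (asm) integrable_restrict_space) auto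
  then have [measurable]: "H \<in> borel_measurable borel" by auto
  have H0: "(\<integral>x. H x \<partial>lborel) = 0"
    using orth[OF trigpoly.const[of 1]] by (simp add: integral_torus H_def)
  have Hint: "integrable lborel (\<lambda>x. indicator A x * H x)" if "A \<in> sets borel" for A
    using integrable_mult_indicator[OF _ Hi, of A] that by simp
  have box0: "(\<integral>x. indicator (box a b) x * H x \<partial>lborel) = 0" for a b :: "real ^ 3"
  proof -
    define a' :: "real ^ 3" where "a' = (\<chi> i. max 0 (a $ i))"
    define b' :: "real ^ 3" where "b' = (\<chi> i. min 1 (b $ i))"
    show ?thesis
    proof (cases "\<forall>i. a' $ i < b' $ i")
      case True
      have "(\<integral>x. indicator (box a b) x * H x \<partial>lborel)
          = (\<integral>x. indicator cell x * (G x * (if \<forall>i. a' $ i < x $ i \<and> x $ i < b' $ i then 1 else 0)) \<partial>lborel)"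
      proof (rule integral_cong_AE)
        show "(\<lambda>x. indicator cell x * (G x * (if \<forall>i. a' $ i < x $ i \<and> x $ i < b' $ i then 1 else 0))) \<in> borel_measurable lborel"
        proof -
          have "(\<lambda>x :: real ^ 3. H x * (if \<forall>i. a' $ i < x $ i \<and> x $ i < b' $ i then 1 else 0 :: real)) \<in> borel_measurable lborel"
            by measurable
          then show ?thesis by (simp add: H_def mult.assoc)
        qed
        \<comment> \<open>The open box omits the faces of the half-open cell on which a coordinate
          is 0, a null set.\<close>
        have "AE x in lborel. \<forall>i. (x :: real ^ 3) $ i \<noteq> 0"
          using AE_lborel_component_nonzero by (subst AE_all_countable) auto
        then show "AE x in lborel. indicator (box a b) x * H x =
            indicator cell x * (G x * (if \<forall>i. a' $ i < x $ i \<and> x $ i < b' $ i then 1 else 0))"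
        proof eventually_elim
          case (elim x)
          have "x \<in> box a b \<longleftrightarrow> (\<forall>i. a' $ i < x $ i \<and> x $ i < b' $ i)" if "x \<in> cell"
          proof -
            have "0 < x $ i" "x $ i < 1" for i using elim that by (auto simp: less_le)
            then show ?thesis by (auto simp: a'_def b'_def mem_box_cart)
          qed
          then show ?case by (auto simp: H_def indicator_def)
        qed
      qed measurable
      also have "\<dots> = 0"
        unfolding integral_torus[symmetric] using True by (intro bump) (auto simp: a'_def b'_def)
      finally show ?thesis .
    next
      case False
      then obtain i where "b' $ i \<le> a' $ i" by (auto simp: not_less)
      then have "x \<notin> box a b \<or> x \<notin> cell" for x
        unfolding mem_box_cart a'_def b'_def mem_Collect_eq
        by (auto simp: max_def min_def split: if_splits intro!: exI[of _ i])
      then have "indicator (box a b) x * H x = 0" for x by (auto simp: H_def indicator_def)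
      then show ?thesis by (intro integral_eq_zero_AE AE_I2)
    qed
  qed
  have all0: "(\<integral>x. indicator A x * H x \<partial>lborel) = 0" if "A \<in> sets borel" for A
  proof -
    have st: "Int_stable (range (\<lambda>(a, b). box a b :: (real ^ 3) set))"
      by (auto simp: Int_stable_def box_Int_box)
    have "A \<in> sigma_sets UNIV (range (\<lambda>(a, b). box a b :: (real ^ 3) set))"
      using that by (subst (asm) borel_eq_box) simp
    from st subset_UNIV[of "range (\<lambda>(a, b). box a b :: (real ^ 3) set)", folded Pow_UNIV] this show ?thesis
    proof (induction rule: sigma_sets_induct_disjoint)
      case (basic A) then show ?case using box0 by auto
    next
      case (compl A)
      then have Am: "A \<in> sets borel" by (subst borel_eq_box) simp
      have "(\<integral>x. indicator (UNIV - A) x * H x \<partial>lborel) = (\<integral>x. H x - indicator A x * H x \<partial>lborel)"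
        by (rule Bochner_Integration.integral_cong) (auto simp: indicator_def)
      also have "\<dots> = 0" using Hi Hint[OF Am] compl H0 by simp
      finally show ?case .
    next
      case (union A)
      then have Am: "A i \<in> sets borel" for i by (subst borel_eq_box) auto
      have "(LINT x:(\<Union>i. A i)|lborel. H x) = (\<Sum>i. (LINT x:A i|lborel. H x))"
      proof (rule lebesgue_integral_countable_add)
        show "set_integrable lborel (\<Union>i. A i) H"
          unfolding set_integrable_def using Hint[of "\<Union>i. A i"] Am by simp
      qed (use Am union in \<open>auto simp: disjoint_family_on_def\<close>)
      then show ?case using union by (simp add: set_lebesgue_integral_def)
    qed simp_all
  qed
  have "AE x in lborel. H x = 0"
    using density_unique_real[OF Hi, of "\<lambda>_. 0"] all0 by (simp add: set_lebesgue_integral_def)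
  then have "AE x in lborel. x \<in> cell \<longrightarrow> G x = 0" by eventually_elim (auto simp: H_def indicator_def split: if_splits)
  then show ?thesis unfolding torus_def by (simp add: AE_restrict_space_iff)
qed

text \<open>Trigonometric polynomials times a coordinate vector are smooth periodic fields, so each
  component of g vanishes. This yields the uniqueness of weak derivatives.\<close>

lemma smooth_periodic_orthogonal_imp_zero:
  assumes "\<And>\<phi>. smooth_periodic \<phi> \<Longrightarrow> g \<bullet> field_of \<phi> = 0"
  shows "g = 0"
proof -
  have tc: "f \<in> borel_measurable borel" "\<exists>K. \<forall>x\<in>cell. \<bar>f x\<bar> \<le> K" if f: "trigpoly f" for f
  proof -
    have cont: "continuous_on UNIV f"
      using trigpoly_derivative[OF f] by (intro continuous_at_imp_continuous_on) (blast intro: has_derivative_continuous)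
    then show "f \<in> borel_measurable borel" by (rule borel_measurable_continuous_onI)
    have "bounded (f ` cbox 0 1)"
      by (intro compact_imp_bounded compact_continuous_image continuous_on_subset[OF cont]) auto
    then obtain K where "\<forall>x\<in>cbox 0 1. \<bar>f x\<bar> \<le> K" unfolding bounded_iff by auto
    moreover have "cell \<subseteq> cbox 0 1" by (auto simp: mem_box_cart less_imp_le)
    ultimately show "\<exists>K. \<forall>x\<in>cell. \<bar>f x\<bar> \<le> K" by blast
  qed
  have "AE x in torus. rep_vfield g x $ j = 0" for j
  proof (rule trigpoly_orthogonal_imp_zero)
    have "sq_integrable (\<lambda>_. axis j 1)" by (rule sq_integrable_bounded[where K=1]) auto
    from sq_integrable_inner[OF sq_integrable_rep[of g] this]
    show "integrable torus (\<lambda>x. rep_vfield g x $ j)" by (simp add: inner_axis)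
    fix f assume f: "trigpoly f"
    obtain K where K: "\<forall>x\<in>cell. \<bar>f x\<bar> \<le> K" using tc[OF f] by blast
    have sq: "sq_integrable (\<lambda>x. f x *\<^sub>R axis j (1::real))"
      by (rule sq_integrable_bounded[where K=K]) (use K tc(1)[OF f] in \<open>auto intro!: borel_measurable_torusI\<close>)
    have "g \<bullet> field_of (\<lambda>x. f x *\<^sub>R axis j 1) = 0"
      by (rule assms) (rule trigpoly_smooth_periodic[OF f])
    then show "(\<integral>x. rep_vfield g x $ j * f x \<partial>torus) = 0"
      by (simp add: inner_field_of_right[OF sq] inner_axis mult.commute)
  qed
  then have "AE x in torus. \<forall>j. rep_vfield g x $ j = 0" by (subst AE_all_countable) auto
  then have "AE x in torus. rep_vfield g x = 0" by eventually_elim (simp add: vec_eq_iff)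
  then have "field_of (rep_vfield g) = field_of (\<lambda>_. 0)" by (subst field_of_eq_iff) auto
  then show ?thesis using field_of_scaleR[of "\<lambda>_. 0" 0] by simp
qed

lemma weak_deriv_eqI:
  assumes "has_weak_deriv i u g" shows "weak_deriv i u = g"
proof -
  have "g' = g" if "has_weak_deriv i u g'" for g'
  proof -
    have "(g' - g) \<bullet> field_of \<phi> = 0" if "smooth_periodic \<phi>" for \<phi>
      using assms \<open>has_weak_deriv i u g'\<close> that unfolding has_weak_deriv_def by (auto simp: inner_diff_left)
    from smooth_periodic_orthogonal_imp_zero[OF this] show ?thesis by simp
  qed
  then have "(THE g. has_weak_deriv i u g) = g" by (rule the_equality[of "has_weak_deriv i u", OF assms])
  moreover have "\<exists>g. has_weak_deriv i u g" using assms by (rule exI[of "has_weak_deriv i u"])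
  ultimately show ?thesis unfolding weak_deriv_def by (simp only: if_True simp_thms)
qed

section \<open>Orthogonal families\<close>

lemma orthogonal_norm_sum:
  fixes v :: "'i \<Rightarrow> 'a :: real_inner"
  assumes "finite F" "\<And>i j. i \<in> F \<Longrightarrow> j \<in> F \<Longrightarrow> i \<noteq> j \<Longrightarrow> v i \<bullet> v j = 0"
  shows "(norm (\<Sum>i\<in>F. v i))\<^sup>2 = (\<Sum>i\<in>F. (norm (v i))\<^sup>2)"
proof -
  have "(norm (\<Sum>i\<in>F. v i))\<^sup>2 = (\<Sum>i\<in>F. \<Sum>j\<in>F. v i \<bullet> v j)"
    unfolding power2_norm_eq_inner inner_sum_left inner_sum_right by (rule sum.swap)
  also have "\<dots> = (\<Sum>i\<in>F. \<Sum>j\<in>F. if j = i then (norm (v i))\<^sup>2 else 0)"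
    using assms(2) by (intro sum.cong) (auto simp: power2_norm_eq_inner)
  finally show ?thesis using assms(1) by simp
qed

text \<open>By Pythagoras the squared distance between nested partial sums is a partial sum of the
  squared norms, so the net of finite sums is Cauchy.\<close>

lemma orthogonal_summable_on:
  fixes v :: "'i \<Rightarrow> 'a :: {real_inner, banach}"
  assumes orth: "\<And>i j. i \<noteq> j \<Longrightarrow> v i \<bullet> v j = 0"
    and sq: "(\<lambda>i. (norm (v i))\<^sup>2) summable_on UNIV"
  shows "v summable_on UNIV"
proof -
  have "\<exists>P. eventually P (finite_subsets_at_top UNIV) \<and> (\<forall>F G. P F \<and> P G \<longrightarrow> dist (sum v F) (sum v G) < d)"
    if d: "0 < d" for d
  proof -
    have "0 < (d / 2)\<^sup>2" using d by simp
    from has_sum_finite_approximation[OF has_sum_infsum[OF sq] this]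
    obtain F where F: "finite F" "dist (\<Sum>i\<in>F. (norm (v i))\<^sup>2) (\<Sum>\<^sub>\<infinity>i. (norm (v i))\<^sup>2) \<le> (d/2)\<^sup>2 / 1"
      by auto
    have "\<exists>F. finite F \<and> dist (\<Sum>i\<in>F. (norm (v i))\<^sup>2) (\<Sum>\<^sub>\<infinity>i. (norm (v i))\<^sup>2) < (d/2)\<^sup>2"
      using has_sum_finite_approximation[OF has_sum_infsum[OF sq], of "(d/2)\<^sup>2 / 2"] d
      by (metis (no_types, lifting) \<open>0 < (d / 2)\<^sup>2\<close> field_sum_of_halves half_gt_zero less_add_same_cancel1 order_le_less_trans)
    then obtain F where F: "finite F" "dist (\<Sum>i\<in>F. (norm (v i))\<^sup>2) (\<Sum>\<^sub>\<infinity>i. (norm (v i))\<^sup>2) < (d/2)\<^sup>2" by blast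
    have near: "dist (sum v G) (sum v F) < d / 2" if "finite G" "F \<subseteq> G" for G
    proof -
      have "sum v G - sum v F = sum v (G - F)" using that by (simp add: sum_diff)
      then have "(dist (sum v G) (sum v F))\<^sup>2 = (\<Sum>i\<in>G - F. (norm (v i))\<^sup>2)"
        using orthogonal_norm_sum[of "G - F" v] orth that by (simp add: dist_norm)
      also have "\<dots> = (\<Sum>i\<in>G. (norm (v i))\<^sup>2) - (\<Sum>i\<in>F. (norm (v i))\<^sup>2)"
        using that by (simp add: sum_diff)
      also have "(\<Sum>i\<in>G. (norm (v i))\<^sup>2) \<le> (\<Sum>\<^sub>\<infinity>i. (norm (v i))\<^sup>2)"
        using that sq by (intro finite_sum_le_infsum) auto
      finally have "(dist (sum v G) (sum v F))\<^sup>2 < (d/2)\<^sup>2" using F by (simp add: dist_real_def)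
      then show ?thesis using d power2_less_imp_less by fastforce
    qed
    have "eventually (\<lambda>G. finite G \<and> F \<subseteq> G) (finite_subsets_at_top UNIV)"
      using F(1) by (auto simp: eventually_finite_subsets_at_top)
    moreover have "dist (sum v G) (sum v H) < d" if "finite G \<and> F \<subseteq> G" "finite H \<and> F \<subseteq> H" for G H
      using near[of G] near[of H] that dist_triangle2[of "sum v G" "sum v H" "sum v F"] by simp
    ultimately show ?thesis by blast
  qed
  then have "cauchy_filter (filtermap (sum v) (finite_subsets_at_top UNIV))"
    by (simp add: cauchy_filter_metric_filtermap)
  moreover note complete_UNIV[where 'a='a]
  ultimately obtain L where "(sum v \<longlongrightarrow> L) (finite_subsets_at_top UNIV)"
    using complete_uniform[where S="UNIV :: 'a set"] by (force simp add: filterlim_def)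
  then show ?thesis using summable_on_def has_sum_def by blast
qed

lemma orthogonal_norm_has_sum:
  fixes v :: "'i \<Rightarrow> 'a :: real_inner"
  assumes orth: "\<And>i j. i \<noteq> j \<Longrightarrow> v i \<bullet> v j = 0"
    and s: "(v has_sum x) UNIV"
  shows "((\<lambda>i. (norm (v i))\<^sup>2) has_sum (norm x)\<^sup>2) UNIV"
proof -
  have "((\<lambda>F. (norm (sum v F))\<^sup>2) \<longlongrightarrow> (norm x)\<^sup>2) (finite_subsets_at_top UNIV)"
    using s unfolding has_sum_def by (intro tendsto_intros)
  moreover have "\<forall>\<^sub>F F in finite_subsets_at_top UNIV. (norm (sum v F))\<^sup>2 = (\<Sum>i\<in>F. (norm (v i))\<^sup>2)"
    using eventually_finite_subsets_at_top_weakI[of UNIV finite]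
    by (rule eventually_mono) (auto intro!: orthogonal_norm_sum orth)
  ultimately show ?thesis unfolding has_sum_def by (simp add: tendsto_cong)
qed

section \<open>Smooth periodic fields and plane waves\<close>

lemma smooth_periodic_pderiv:
  assumes "smooth_periodic \<phi>" shows "smooth_periodic (pderiv_at i \<phi>)"
proof -
  have "foldr pderiv_at js (pderiv_at i \<phi>) differentiable at x" for js x
  proof -
    have "foldr pderiv_at (js @ [i]) \<phi> differentiable at x"
      using assms unfolding smooth_periodic_def by blast
    then show ?thesis by simp
  qed
  moreover have "pderiv_at i \<phi> (x + axis j 1) = pderiv_at i \<phi> x" for x j
  proof -
    have d: "(\<phi> has_derivative frechet_derivative \<phi> (at y)) (at y)" for y
      using assms frechet_derivative_works[of \<phi> "at y"] unfolding smooth_periodic_def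
      by (metis foldr.simps(1) id_apply)
    have "((\<lambda>y. \<phi> (y + axis j 1)) has_derivative frechet_derivative \<phi> (at (x + axis j 1))) (at x)"
    proof -
      have "((\<lambda>y. y + axis j 1) has_derivative (\<lambda>h. h)) (at x)" by (auto intro!: derivative_eq_intros)
      from has_derivative_compose[OF this d] show ?thesis .
    qed
    then have "(\<phi> has_derivative frechet_derivative \<phi> (at (x + axis j 1))) (at x)"
      using assms by (simp add: smooth_periodic_def)
    then show ?thesis using frechet_derivative_at unfolding pderiv_at_def by metis
  qed
  ultimately show ?thesis unfolding smooth_periodic_def by blast
qed

context
  fixes \<phi> :: "real ^ 3 \<Rightarrow> real ^ 3" assumes sp: "smooth_periodic \<phi>"
begin

lemma smooth_periodic_has_derivative: "(\<phi> has_derivative frechet_derivative \<phi> (at x)) (at x)"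
  using sp frechet_derivative_works[of \<phi> "at x"] unfolding smooth_periodic_def
  by (metis foldr.simps(1) id_apply)

lemma smooth_periodic_continuous: "continuous_on S \<phi>"
  using smooth_periodic_has_derivative has_derivative_continuous
  by (blast intro: continuous_at_imp_continuous_on)

lemma smooth_periodic_measurable [measurable]: "\<phi> \<in> borel_measurable borel"
  using smooth_periodic_continuous by (rule borel_measurable_continuous_onI)

lemma smooth_periodic_bounded: "\<exists>K\<ge>0. \<forall>x\<in>cell. norm (\<phi> x) \<le> K"
proof -
  have "bounded (\<phi> ` cbox 0 1)"
    by (intro compact_imp_bounded compact_continuous_image smooth_periodic_continuous) auto
  then obtain K where "\<forall>x\<in>cbox 0 1. norm (\<phi> x) \<le> K" unfolding bounded_iff by auto
  then have "\<forall>x\<in>cell. norm (\<phi> x) \<le> max 0 K" by (auto simp: mem_box_cart less_imp_le le_max_iff_disj)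
  then show ?thesis by (intro exI[of _ "max 0 K"]) auto
qed

lemma smooth_periodic_torus [measurable]: "\<phi> \<in> borel_measurable torus"
  by (rule borel_measurable_torusI) measurable

lemma smooth_periodic_sq_integrable: "sq_integrable \<phi>"
  using smooth_periodic_bounded sq_integrable_bounded smooth_periodic_torus by blast

lemma smooth_periodic_shift: "\<phi> (x + axis i 1) = \<phi> x"
  using sp by (simp add: smooth_periodic_def)

end

lemma smooth_periodic_integration_by_parts:
  assumes u: "smooth_periodic u" and v: "smooth_periodic v"
  shows "field_of u \<bullet> field_of (pderiv_at i v) = - (field_of (pderiv_at i u) \<bullet> field_of v)"
proof -
  note su = smooth_periodic_sq_integrable[OF u] smooth_periodic_sq_integrable[OF smooth_periodic_pderiv[OF u, of i]]
  note sv = smooth_periodic_sq_integrable[OF v] smooth_periodic_sq_integrable[OF smooth_periodic_pderiv[OF v, of i]]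
  have "(\<integral>x. u x \<bullet> frechet_derivative v (at x) (axis i 1) + frechet_derivative u (at x) (axis i 1) \<bullet> v x \<partial>torus) = 0"
  proof (rule integral_torus_partial_derivative[of "\<lambda>x. u x \<bullet> v x"
        "\<lambda>x h. u x \<bullet> frechet_derivative v (at x) h + frechet_derivative u (at x) h \<bullet> v x"])
    show "((\<lambda>x. u x \<bullet> v x) has_derivative (\<lambda>h. u x \<bullet> frechet_derivative v (at x) h + frechet_derivative u (at x) h \<bullet> v x)) (at x)" for x
      by (rule has_derivative_inner[OF smooth_periodic_has_derivative[OF u] smooth_periodic_has_derivative[OF v]])
    show "continuous_on UNIV (\<lambda>x. u x \<bullet> frechet_derivative v (at x) (axis i 1) + frechet_derivative u (at x) (axis i 1) \<bullet> v x)"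
      unfolding pderiv_at_def[symmetric]
      by (intro continuous_intros smooth_periodic_continuous smooth_periodic_pderiv u v)
    show "u (x + axis i 1) \<bullet> v (x + axis i 1) = u x \<bullet> v x" for x
      by (simp add: smooth_periodic_shift[OF u] smooth_periodic_shift[OF v])
  qed
  then have "(\<integral>x. u x \<bullet> pderiv_at i v x + pderiv_at i u x \<bullet> v x \<partial>torus) = 0" unfolding pderiv_at_def .
  moreover have "(\<integral>x. u x \<bullet> pderiv_at i v x + pderiv_at i u x \<bullet> v x \<partial>torus)
      = field_of u \<bullet> field_of (pderiv_at i v) + field_of (pderiv_at i u) \<bullet> field_of v"
    using su sv by (simp add: inner_field_of sq_integrable_inner)
  ultimately show ?thesis by simp
qed

lemma has_weak_deriv_smooth: "smooth_periodic u \<Longrightarrow> has_weak_deriv i (field_of u) (field_of (pderiv_at i u))"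
  unfolding has_weak_deriv_def using smooth_periodic_integration_by_parts by blast

definition wave :: "real ^ 3 \<Rightarrow> real ^ 3 \<Rightarrow> real ^ 3 \<Rightarrow> real ^ 3 \<Rightarrow> real ^ 3" where
  "wave \<kappa> a b x = cos (\<kappa> \<bullet> x) *\<^sub>R a + sin (\<kappa> \<bullet> x) *\<^sub>R b"

lemma wave_has_derivative: "(wave \<kappa> a b has_derivative (\<lambda>h. (\<kappa> \<bullet> h) *\<^sub>R wave \<kappa> b (- a) x)) (at x)"
  unfolding wave_def[abs_def]
  by (auto intro!: derivative_eq_intros ext simp: scaleR_add_right scaleR_diff_right mult.commute)

text \<open>Differentiation only rotates the amplitude pair and multiplies it by a component of the
  frequency; waves of a fixed frequency are therefore closed under it.\<close>

lemma pderiv_wave: "pderiv_at i (wave \<kappa> a b) = wave \<kappa> ((\<kappa> $ i) *\<^sub>R b) (- (\<kappa> $ i) *\<^sub>R a)"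
  unfolding pderiv_at_def frechet_derivative_at[OF wave_has_derivative, symmetric]
  by (auto simp: wave_def inner_axis scaleR_add_right scaleR_diff_right mult.commute)

lemma foldr_pderiv_wave: "\<exists>c d. foldr pderiv_at js (wave \<kappa> a b) = wave \<kappa> c d"
proof (induction js)
  case (Cons i js)
  then obtain c d where "foldr pderiv_at js (wave \<kappa> a b) = wave \<kappa> c d" by blast
  then have "foldr pderiv_at (i # js) (wave \<kappa> a b) = wave \<kappa> ((\<kappa> $ i) *\<^sub>R d) (- (\<kappa> $ i) *\<^sub>R c)"
    by (simp add: pderiv_wave)
  then show ?case by blast
qed auto

lemma wave_vec_nth: "wave_vec m $ i = 2 * pi * real_of_int (m $ i)" by (simp add: wave_vec_def)

lemma smooth_periodic_wave: "smooth_periodic (wave (wave_vec m) a b)"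
proof -
  have "foldr pderiv_at js (wave (wave_vec m) a b) differentiable at x" for js x
  proof -
    obtain c d where "foldr pderiv_at js (wave (wave_vec m) a b) = wave (wave_vec m) c d"
      using foldr_pderiv_wave by blast
    then show ?thesis using differentiableI[OF wave_has_derivative] by (simp only:)
  qed
  moreover have "wave (wave_vec m) a b (x + axis i 1) = wave (wave_vec m) a b x" for x i
  proof -
    have "wave_vec m \<bullet> (x + axis i 1) = wave_vec m \<bullet> x + (m $ i) * (2 * pi)"
      by (simp add: inner_add_right inner_axis wave_vec_nth)
    then show ?thesis unfolding wave_def
      by (simp add: sin_add cos_add mult.commute[of _ "2 * pi"] sin_int_2pin cos_int_2pin)
  qed
  ultimately show ?thesis unfolding smooth_periodic_def by blast
qed

lemma norm_wave_le: "norm (wave \<kappa> a b x) \<le> norm a + norm b"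
proof -
  have "norm (wave \<kappa> a b x) \<le> norm (cos (\<kappa> \<bullet> x) *\<^sub>R a) + norm (sin (\<kappa> \<bullet> x) *\<^sub>R b)"
    unfolding wave_def by (rule norm_triangle_ineq)
  also have "\<dots> \<le> 1 * norm a + 1 * norm b"
    unfolding norm_scaleR by (intro add_mono mult_right_mono) auto
  finally show ?thesis by simp
qed

text \<open>A wave of non-zero frequency is a partial derivative of another wave, so integration by
  parts against a constant field gives zero.\<close>

lemma integral_trig:
  assumes "m \<noteq> 0"
  shows "(\<integral>x. cos (wave_vec m \<bullet> x) \<partial>torus) = 0" "(\<integral>x. sin (wave_vec m \<bullet> x) \<partial>torus) = 0"
proof -
  obtain i where i: "m $ i \<noteq> 0" using assms by (auto simp: vec_eq_iff)
  define \<kappa> where "\<kappa> = wave_vec m"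
  have \<kappa>i: "\<kappa> $ i \<noteq> 0" using i by (simp add: \<kappa>_def wave_vec_nth)
  define c :: "real ^ 3" where "c = axis 1 1"
  have c: "c \<bullet> c = 1" by (simp add: c_def inner_axis)
  have sq: "sq_integrable (\<lambda>_ :: real ^ 3. c)" by (rule sq_integrable_bounded[where K="norm c"]) auto
  have z: "(\<integral>x. wave \<kappa> ((\<kappa> $ i) *\<^sub>R b) (- (\<kappa> $ i) *\<^sub>R a) x \<bullet> c \<partial>torus) = 0" for a b
  proof -
    have w: "(\<lambda>_. c) = wave (wave_vec 0) c 0" by (auto simp: wave_def wave_vec_def zero_vec_def inner_vec_def)
    have "field_of (wave (wave_vec 0) c 0) \<bullet> field_of (pderiv_at i (wave \<kappa> a b))
      = - (field_of (pderiv_at i (wave (wave_vec 0) c 0)) \<bullet> field_of (wave \<kappa> a b))"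
      unfolding \<kappa>_def by (intro smooth_periodic_integration_by_parts smooth_periodic_wave)
    moreover have "pderiv_at i (wave (wave_vec 0) c 0) = (\<lambda>_. 0)"
      by (auto simp: pderiv_wave wave_def wave_vec_def)
    moreover have "field_of (\<lambda>_. 0) = 0" using field_of_scaleR[of "\<lambda>_. 0" 0] by simp
    ultimately have "field_of (wave \<kappa> ((\<kappa> $ i) *\<^sub>R b) (- (\<kappa> $ i) *\<^sub>R a)) \<bullet> field_of (\<lambda>_. c) = 0"
      by (simp add: w[symmetric] pderiv_wave inner_commute)
    then show ?thesis
      using inner_field_of[OF smooth_periodic_sq_integrable sq, of "wave \<kappa> ((\<kappa> $ i) *\<^sub>R b) (- (\<kappa> $ i) *\<^sub>R a)"]
        smooth_periodic_wave unfolding \<kappa>_def by simp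
  qed
  have "wave \<kappa> ((\<kappa> $ i) *\<^sub>R ((1 / \<kappa> $ i) *\<^sub>R c)) (- (\<kappa> $ i) *\<^sub>R 0) x \<bullet> c = cos (\<kappa> \<bullet> x)" for x
    using \<kappa>i c by (simp add: wave_def)
  with z[of "(1 / \<kappa> $ i) *\<^sub>R c" 0] show "(\<integral>x. cos (wave_vec m \<bullet> x) \<partial>torus) = 0" by (simp add: \<kappa>_def)
  have "wave \<kappa> ((\<kappa> $ i) *\<^sub>R 0) (- (\<kappa> $ i) *\<^sub>R ((- 1 / \<kappa> $ i) *\<^sub>R c)) x \<bullet> c = sin (\<kappa> \<bullet> x)" for x
    using \<kappa>i c by (simp add: wave_def)
  with z[of 0 "(- 1 / \<kappa> $ i) *\<^sub>R c"] show "(\<integral>x. sin (wave_vec m \<bullet> x) \<partial>torus) = 0" by (simp add: \<kappa>_def)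
qed

text \<open>The product is a constant plus waves of the doubled frequency, which integrate to zero
  because m + m is non-zero.\<close>

lemma inner_wave:
  assumes "m \<noteq> 0"
  shows "field_of (wave (wave_vec m) a b) \<bullet> field_of (wave (wave_vec m) c d) = (a \<bullet> c + b \<bullet> d) / 2"
proof -
  define \<kappa> where "\<kappa> = wave_vec m"
  have m2: "m + m \<noteq> 0" using assms by (auto simp: vec_eq_iff)
  have k2: "wave_vec (m + m) = 2 *\<^sub>R \<kappa>" by (simp add: \<kappa>_def vec_eq_iff wave_vec_nth)
  have tm: "(\<lambda>x. cos (2 * (\<kappa> \<bullet> x))) \<in> borel_measurable torus" "(\<lambda>x. sin (2 * (\<kappa> \<bullet> x))) \<in> borel_measurable torus"
    by (auto intro!: borel_measurable_torusI)
  have it: "integrable torus (\<lambda>x. cos (2 * (\<kappa> \<bullet> x)))" "integrable torus (\<lambda>x. sin (2 * (\<kappa> \<bullet> x)))"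
    by (rule integrable_torus_bounded[where K=1]; use tm in simp)+
  have z: "(\<integral>x. cos (2 * (\<kappa> \<bullet> x)) \<partial>torus) = 0" "(\<integral>x. sin (2 * (\<kappa> \<bullet> x)) \<partial>torus) = 0"
    using integral_trig[OF m2] unfolding k2 by simp_all
  have eq: "wave \<kappa> a b x \<bullet> wave \<kappa> c d x = (a \<bullet> c + b \<bullet> d) / 2 + cos (2 * (\<kappa> \<bullet> x)) * ((a \<bullet> c - b \<bullet> d) / 2)
      + sin (2 * (\<kappa> \<bullet> x)) * ((a \<bullet> d + b \<bullet> c) / 2)" for x
  proof -
    define C S where "C = cos (\<kappa> \<bullet> x)" and "S = sin (\<kappa> \<bullet> x)"
    have cs: "C\<^sup>2 + S\<^sup>2 = 1" by (simp add: C_def S_def)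
    have d: "cos (2 * (\<kappa> \<bullet> x)) = C\<^sup>2 - S\<^sup>2" "sin (2 * (\<kappa> \<bullet> x)) = 2 * S * C"
      by (simp_all add: C_def S_def cos_double sin_double)
    have "wave \<kappa> a b x \<bullet> wave \<kappa> c d x = C\<^sup>2 * (a \<bullet> c) + S\<^sup>2 * (b \<bullet> d) + S * C * (a \<bullet> d + b \<bullet> c)"
      by (simp add: wave_def C_def[symmetric] S_def[symmetric] inner_add_left inner_add_right algebra_simps power2_eq_square)
    moreover have "C\<^sup>2 = (1 + (C\<^sup>2 - S\<^sup>2)) / 2" "S\<^sup>2 = (1 - (C\<^sup>2 - S\<^sup>2)) / 2" using cs by auto
    ultimately show ?thesis unfolding d by (simp add: field_simps) (use cs in algebra)
  qed
  have "field_of (wave \<kappa> a b) \<bullet> field_of (wave \<kappa> c d) = (\<integral>x. wave \<kappa> a b x \<bullet> wave \<kappa> c d x \<partial>torus)"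
    unfolding \<kappa>_def by (intro inner_field_of smooth_periodic_sq_integrable smooth_periodic_wave)
  also have "\<dots> = (a \<bullet> c + b \<bullet> d) / 2" unfolding eq using it z torus.prob_space by simp
  finally show ?thesis by (simp add: \<kappa>_def)
qed

section \<open>The advection form\<close>

lemma borel_measurable_component [measurable (raw)]:
  fixes f :: "'a \<Rightarrow> real ^ 'n"
  assumes "f \<in> borel_measurable M" shows "(\<lambda>x. f x $ i) \<in> borel_measurable M"
proof -
  have "(\<lambda>x. f x \<bullet> axis i 1) \<in> borel_measurable M" using assms by simp
  then show ?thesis by (simp add: inner_axis)
qed

text \<open>One summand of the advection term, with v a derivative of u, or of its divergence form,
  with v = u and \<psi> a derivative of the test field. The third argument is a function because a
  product of two L^2 fields can be paired only with a bounded one.\<close>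

definition tri :: "3 \<Rightarrow> vfield \<Rightarrow> vfield \<Rightarrow> (real ^ 3 \<Rightarrow> real ^ 3) \<Rightarrow> real" where
  "tri i u v \<psi> = (\<integral>x. rep_vfield u x $ i * (rep_vfield v x \<bullet> \<psi> x) \<partial>torus)"

text \<open>The field that represents \<open>tri\<close> as an inner product with u; multiplication
  by a bounded \<psi> is a bounded operator, which gives continuity of \<open>tri\<close> in both
  fields.\<close>

definition mulop :: "3 \<Rightarrow> (real ^ 3 \<Rightarrow> real ^ 3) \<Rightarrow> vfield \<Rightarrow> vfield" where
  "mulop i \<psi> v = field_of (\<lambda>x. (rep_vfield v x \<bullet> \<psi> x) *\<^sub>R axis i 1)"

lemma field_of_cong_AE:
  assumes "sq_integrable f" "sq_integrable g" "AE x in torus. f x = g x"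
  shows "field_of f = field_of g"
  by (rule iffD2[OF field_of_eq_iff[OF assms(1,2)] assms(3)])

lemma sq_integrable_dominated:
  assumes "f \<in> borel_measurable torus" "sq_integrable g" "\<And>x. x \<in> cell \<Longrightarrow> norm (f x) \<le> K * norm (g x)"
  shows "sq_integrable f" and "0 \<le> K \<Longrightarrow> norm (field_of f) \<le> K * norm (field_of g)"
proof -
  have gi: "integrable torus (\<lambda>x. (norm (g x))\<^sup>2)" using assms(2) by (simp add: sq_integrable_def)
  have le: "(norm (f x))\<^sup>2 \<le> K\<^sup>2 * (norm (g x))\<^sup>2" if "x \<in> cell" for x
    using power_mono[OF assms(3)[OF that], of 2] by (simp add: power_mult_distrib)
  have fi: "integrable torus (\<lambda>x. (norm (f x))\<^sup>2)"
  proof (rule Bochner_Integration.integrable_bound[of _ "\<lambda>x. K\<^sup>2 * (norm (g x))\<^sup>2"])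
    show "(\<lambda>x. (norm (f x))\<^sup>2) \<in> borel_measurable torus" using assms(1) by measurable
    show "integrable torus (\<lambda>x. K\<^sup>2 * (norm (g x))\<^sup>2)" using gi by simp
    show "AE x in torus. norm ((norm (f x))\<^sup>2) \<le> norm (K\<^sup>2 * (norm (g x))\<^sup>2)"
    proof (rule AE_I2)
      fix x assume "x \<in> space torus"
      then show "norm ((norm (f x))\<^sup>2) \<le> norm (K\<^sup>2 * (norm (g x))\<^sup>2)" using le[of x] by simp
    qed
  qed
  then show sf: "sq_integrable f" using assms(1) by (simp add: sq_integrable_def)
  assume K: "0 \<le> K"
  have "(norm (field_of f))\<^sup>2 \<le> (\<integral>x. K\<^sup>2 * (norm (g x))\<^sup>2 \<partial>torus)"
    unfolding norm_field_of[OF sf] by (rule integral_mono[OF fi]) (use gi le in simp_all)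
  also have "\<dots> = K\<^sup>2 * (norm (field_of g))\<^sup>2"
    unfolding norm_field_of[OF assms(2)] by (rule integral_mult_right_zero)
  also have "\<dots> = (K * norm (field_of g))\<^sup>2" by (rule power_mult_distrib[symmetric])
  finally show "norm (field_of f) \<le> K * norm (field_of g)"
    by (rule power2_le_imp_le) (use K in simp)
qed

context
  fixes \<psi> :: "real ^ 3 \<Rightarrow> real ^ 3" and K :: real
  assumes \<psi>m [measurable]: "\<psi> \<in> borel_measurable torus" and \<psi>K: "\<And>x. x \<in> cell \<Longrightarrow> norm (\<psi> x) \<le> K" and K0: "0 \<le> K"
begin

lemma mulop_dominated:
  "norm ((rep_vfield v x \<bullet> \<psi> x) *\<^sub>R axis i (1::real)) \<le> K * norm (rep_vfield v x)" if "x \<in> cell"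
proof -
  have "\<bar>rep_vfield v x \<bullet> \<psi> x\<bar> \<le> norm (rep_vfield v x) * norm (\<psi> x)" by (rule Cauchy_Schwarz_ineq2)
  also have "\<dots> \<le> norm (rep_vfield v x) * K" using \<psi>K[OF that] by (intro mult_left_mono) auto
  finally show ?thesis by (simp add: mult.commute)
qed

lemma mulop_sq_integrable: "sq_integrable (\<lambda>x. (rep_vfield v x \<bullet> \<psi> x) *\<^sub>R axis i (1::real))"
  by (rule sq_integrable_dominated(1)[OF _ sq_integrable_rep mulop_dominated]) measurable

lemma norm_mulop: "norm (mulop i \<psi> v) \<le> K * norm v"
proof -
  have "norm (mulop i \<psi> v) \<le> K * norm (field_of (rep_vfield v))"
    unfolding mulop_def
    by (rule sq_integrable_dominated(2)[OF _ sq_integrable_rep mulop_dominated K0]) measurable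
  then show ?thesis by simp
qed

lemma tri_mulop: "tri i u v \<psi> = u \<bullet> mulop i \<psi> v"
  unfolding tri_def mulop_def inner_field_of_right[OF mulop_sq_integrable]
  by (simp add: inner_axis mult.commute)

lemma mulop_bounded_linear: "bounded_linear (mulop i \<psi>)"
proof (rule bounded_linear_intro[where K=K])
  fix u v :: vfield and c :: real
  have "mulop i \<psi> (u + v) = field_of (\<lambda>x. (rep_vfield u x \<bullet> \<psi> x) *\<^sub>R axis i 1 + (rep_vfield v x \<bullet> \<psi> x) *\<^sub>R axis i 1)"
    unfolding mulop_def using rep_add[of u v]
    by (intro field_of_cong_AE mulop_sq_integrable sq_integrable_add)
      (auto simp: inner_add_left scaleR_add_left)
  then show "mulop i \<psi> (u + v) = mulop i \<psi> u + mulop i \<psi> v"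
    by (simp add: field_of_add mulop_sq_integrable mulop_def)
  have "mulop i \<psi> (c *\<^sub>R v) = field_of (\<lambda>x. c *\<^sub>R ((rep_vfield v x \<bullet> \<psi> x) *\<^sub>R axis i 1))"
    unfolding mulop_def using rep_scaleR[of c v]
    by (intro field_of_cong_AE mulop_sq_integrable sq_integrable_scale) auto
  also have "\<dots> = c *\<^sub>R mulop i \<psi> v"
    unfolding mulop_def by (rule field_of_scaleR[OF mulop_sq_integrable])
  finally show "mulop i \<psi> (c *\<^sub>R v) = c *\<^sub>R mulop i \<psi> v" .
  show "norm (mulop i \<psi> v) \<le> norm v * K" using norm_mulop by (simp add: mult.commute)
qed

lemma tri_bound: "\<bar>tri i u v \<psi>\<bar> \<le> K * norm u * norm v"
proof -
  have "\<bar>tri i u v \<psi>\<bar> \<le> norm u * norm (mulop i \<psi> v)" unfolding tri_mulop by (rule Cauchy_Schwarz_ineq2)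
  also have "\<dots> \<le> norm u * (K * norm v)" by (intro mult_left_mono norm_mulop) simp
  finally show ?thesis by (simp add: mult_ac)
qed

lemma tri_diff:
  "tri i (u - u') v \<psi> = tri i u v \<psi> - tri i u' v \<psi>" "tri i u (v - v') \<psi> = tri i u v \<psi> - tri i u v' \<psi>"
  by (simp_all add: tri_mulop inner_diff_left inner_diff_right linear_diff[OF bounded_linear.linear[OF mulop_bounded_linear]])

lemma tri_tendsto:
  assumes "(f \<longlongrightarrow> u) F" "(g \<longlongrightarrow> v) F"
  shows "((\<lambda>n. tri i (f n) (g n) \<psi>) \<longlongrightarrow> tri i u v \<psi>) F"
  unfolding tri_mulop by (rule tendsto_inner[OF assms(1) bounded_linear.tendsto[OF mulop_bounded_linear assms(2)]])

lemma psi_sq_integrable: "sq_integrable \<psi>"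
  using sq_integrable_bounded[OF \<psi>m \<psi>K] .

text \<open>Here the supremum norm is taken on a field instead of the test function, whose L^2 norm
  then suffices; this is the form in which the embedding of H^2 into bounded fields enters.\<close>

lemma tri_bound_bounded_right:
  assumes [measurable]: "s \<in> borel_measurable torus" and s: "\<And>x. x \<in> cell \<Longrightarrow> norm (s x) \<le> L" and L: "0 \<le> L"
  shows "\<bar>tri i u (field_of s) \<psi>\<bar> \<le> L * norm u * norm (field_of \<psi>)"
proof -
  have ss: "sq_integrable s" by (rule sq_integrable_bounded) (use s in auto)
  have dom: "norm ((s x \<bullet> \<psi> x) *\<^sub>R axis i (1::real)) \<le> L * norm (\<psi> x)" if "x \<in> cell" for x
  proof -
    have "\<bar>s x \<bullet> \<psi> x\<bar> \<le> norm (s x) * norm (\<psi> x)" by (rule Cauchy_Schwarz_ineq2)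
    also have "\<dots> \<le> L * norm (\<psi> x)" using s[OF that] by (intro mult_right_mono) auto
    finally show ?thesis by simp
  qed
  have sm: "(\<lambda>x. (s x \<bullet> \<psi> x) *\<^sub>R axis i (1::real)) \<in> borel_measurable torus" by measurable
  note d = sq_integrable_dominated[OF sm psi_sq_integrable dom]
  have "mulop i \<psi> (field_of s) = field_of (\<lambda>x. (s x \<bullet> \<psi> x) *\<^sub>R axis i 1)"
    unfolding mulop_def using rep_field_of[OF ss]
    by (intro field_of_cong_AE mulop_sq_integrable d(1)) auto
  then have "norm (mulop i \<psi> (field_of s)) \<le> L * norm (field_of \<psi>)" using d(2)[OF _ L] by simp
  then have "norm u * norm (mulop i \<psi> (field_of s)) \<le> norm u * (L * norm (field_of \<psi>))"
    by (intro mult_left_mono) auto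
  moreover have "\<bar>tri i u (field_of s) \<psi>\<bar> \<le> norm u * norm (mulop i \<psi> (field_of s))"
    unfolding tri_mulop by (rule Cauchy_Schwarz_ineq2)
  ultimately show ?thesis by (simp add: mult_ac)
qed

lemma tri_bound_bounded_left:
  assumes [measurable]: "s \<in> borel_measurable torus" and s: "\<And>x. x \<in> cell \<Longrightarrow> norm (s x) \<le> L" and L: "0 \<le> L"
  shows "\<bar>tri i (field_of s) v \<psi>\<bar> \<le> L * norm v * norm (field_of \<psi>)"
proof -
  have ss: "sq_integrable s" by (rule sq_integrable_bounded) (use s in auto)
  have dom: "norm (s x $ i *\<^sub>R \<psi> x) \<le> L * norm (\<psi> x)" if "x \<in> cell" for x
    using s[OF that] component_le_norm_cart[of "s x" i] by (auto intro!: mult_right_mono)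
  have sm: "(\<lambda>x. s x $ i *\<^sub>R \<psi> x) \<in> borel_measurable torus" by measurable
  note d = sq_integrable_dominated[OF sm psi_sq_integrable dom]
  have "tri i (field_of s) v \<psi> = (\<integral>x. rep_vfield v x \<bullet> (s x $ i *\<^sub>R \<psi> x) \<partial>torus)"
    unfolding tri_def
  proof (rule integral_cong_AE)
    show "AE x in torus. rep_vfield (field_of s) x $ i * (rep_vfield v x \<bullet> \<psi> x) = rep_vfield v x \<bullet> (s x $ i *\<^sub>R \<psi> x)"
      using rep_field_of[OF ss] by eventually_elim simp
  qed measurable
  also have "\<dots> = v \<bullet> field_of (\<lambda>x. s x $ i *\<^sub>R \<psi> x)" by (rule inner_field_of_right[OF d(1), symmetric])
  finally have "\<bar>tri i (field_of s) v \<psi>\<bar> \<le> norm v * norm (field_of (\<lambda>x. s x $ i *\<^sub>R \<psi> x))"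
    using Cauchy_Schwarz_ineq2 by simp
  also have "\<dots> \<le> norm v * (L * norm (field_of \<psi>))" using d(2)[OF _ L] by (intro mult_left_mono) auto
  finally show ?thesis by (simp add: mult_ac)
qed

end

lemma advection_tri:
  assumes \<phi>: "smooth_periodic \<phi>"
  shows "advection u \<phi> = (\<Sum>i\<in>UNIV. tri i u (weak_deriv i u) \<phi>)"
proof -
  obtain K where K: "0 \<le> K" "\<And>x. x \<in> cell \<Longrightarrow> norm (\<phi> x) \<le> K"
    using smooth_periodic_bounded[OF \<phi>] by auto
  have "integrable torus (\<lambda>x. rep_vfield u x $ i * (rep_vfield (weak_deriv i u) x \<bullet> \<phi> x))" for i
    using sq_integrable_inner[OF sq_integrable_rep[of u]
       mulop_sq_integrable[OF smooth_periodic_torus[OF \<phi>] K(2) K(1), of "weak_deriv i u" i]]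
    by (simp add: inner_axis mult.commute)
  then show ?thesis unfolding advection_def tri_def
    by (subst Bochner_Integration.integral_sum[symmetric]) (auto simp: inner_sum_left)
qed

lemma tri_smooth:
  assumes "smooth_periodic s" "smooth_periodic s'" "\<psi> \<in> borel_measurable torus"
  shows "tri i (field_of s) (field_of s') \<psi> = (\<integral>x. s x $ i * (s' x \<bullet> \<psi> x) \<partial>torus)"
proof -
  note [measurable] = smooth_periodic_torus[OF assms(1)] smooth_periodic_torus[OF assms(2)] assms(3)
  show ?thesis unfolding tri_def
  proof (rule integral_cong_AE)
    show "AE x in torus. rep_vfield (field_of s) x $ i * (rep_vfield (field_of s') x \<bullet> \<psi> x) = s x $ i * (s' x \<bullet> \<psi> x)"
      using rep_field_of[OF smooth_periodic_sq_integrable[OF assms(1)]]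
        rep_field_of[OF smooth_periodic_sq_integrable[OF assms(2)]] by eventually_elim simp
  qed measurable
qed

lemma smooth_dfD: "s \<in> smooth_df \<Longrightarrow> smooth_periodic s"
  "s \<in> smooth_df \<Longrightarrow> (\<Sum>i\<in>UNIV. pderiv_at i s x $ i) = 0"
  by (auto simp: smooth_df_def)

text \<open>For divergence-free \<open>s\<close> the advection term is in divergence form, which moves the derivative
  to the test field and makes it continuous in \<open>L\<^sup>2\<close>.\<close>

lemma tri_smooth_divergence_form:
  assumes s: "s \<in> smooth_df" and \<phi>: "smooth_periodic \<phi>"
  shows "(\<Sum>i\<in>UNIV. tri i (field_of s) (field_of (pderiv_at i s)) \<phi>)
    = - (\<Sum>i\<in>UNIV. tri i (field_of s) (field_of s) (pderiv_at i \<phi>))"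
proof -
  note sp = smooth_dfD(1)[OF s]
  let ?D = "\<lambda>f x. frechet_derivative f (at x)"
  have cont: "continuous_on UNIV s" "continuous_on UNIV \<phi>" "continuous_on UNIV (pderiv_at i s)" "continuous_on UNIV (pderiv_at i \<phi>)" for i
    by (intro smooth_periodic_continuous smooth_periodic_pderiv sp \<phi>)+
  define A B C where "A i x = s x $ i * (pderiv_at i s x \<bullet> \<phi> x)"
    and "B i x = s x $ i * (s x \<bullet> pderiv_at i \<phi> x)" and "C i x = pderiv_at i s x $ i * (s x \<bullet> \<phi> x)" for i x
  have cABC: "continuous_on UNIV (A i)" "continuous_on UNIV (B i)" "continuous_on UNIV (C i)" for i
    unfolding A_def B_def C_def by (intro continuous_intros cont)+
  have int: "integrable torus f" if "continuous_on UNIV f" for f :: "real ^ 3 \<Rightarrow> real"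
  proof -
    have "bounded (f ` cbox 0 1)"
      by (intro compact_imp_bounded compact_continuous_image continuous_on_subset[OF that]) auto
    then obtain K where K: "\<forall>x\<in>cbox 0 1. \<bar>f x\<bar> \<le> K" unfolding bounded_iff by auto
    show ?thesis
      by (rule integrable_torus_bounded[where K=K])
        (use K borel_measurable_continuous_onI[OF that] in \<open>auto simp: mem_box_cart less_imp_le intro!: borel_measurable_torusI\<close>)
  qed
  \<comment> \<open>The integrand is the i-th derivative of s_i (s \<bullet> \<phi>). The sum of the
    terms \<open>C i\<close> over i carries the divergence of s and drops out.\<close>
  have zero: "(\<integral>x. A i x + B i x + C i x \<partial>torus) = 0" for i
  proof -
    define D where "D x h = (?D s x h) $ i * (s x \<bullet> \<phi> x) + s x $ i * (s x \<bullet> ?D \<phi> x h + ?D s x h \<bullet> \<phi> x)" for x h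
    have eq: "D x (axis i 1) = A i x + B i x + C i x" for x
      by (simp add: D_def A_def B_def C_def pderiv_at_def algebra_simps)
    have "(\<integral>x. D x (axis i 1) \<partial>torus) = 0"
    proof (rule integral_torus_partial_derivative)
      show "((\<lambda>x. s x $ i * (s x \<bullet> \<phi> x)) has_derivative D x) (at x)" for x
        unfolding D_def
        by (rule has_derivative_eq_rhs[OF has_derivative_mult[OF
              bounded_linear.has_derivative[OF bounded_linear_vec_nth smooth_periodic_has_derivative[OF sp]]
              has_derivative_inner[OF smooth_periodic_has_derivative[OF sp] smooth_periodic_has_derivative[OF \<phi>]]]])
          (auto simp: algebra_simps)
      show "continuous_on UNIV (\<lambda>x. D x (axis i 1))" unfolding eq by (intro continuous_intros cABC)
      show "s (x + axis i 1) $ i * (s (x + axis i 1) \<bullet> \<phi> (x + axis i 1)) = s x $ i * (s x \<bullet> \<phi> x)" for x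
        by (simp add: smooth_periodic_shift[OF sp] smooth_periodic_shift[OF \<phi>])
    qed
    then show ?thesis unfolding eq .
  qed
  have "(\<Sum>i\<in>UNIV. (\<integral>x. C i x \<partial>torus)) = (\<integral>x. (\<Sum>i\<in>UNIV. C i x) \<partial>torus)"
    by (rule Bochner_Integration.integral_sum[symmetric]) (intro int cABC)
  also have "\<dots> = 0" using smooth_dfD(2)[OF s] by (simp add: C_def sum_distrib_right[symmetric])
  finally have C0: "(\<Sum>i\<in>UNIV. (\<integral>x. C i x \<partial>torus)) = 0" .
  have "(\<Sum>i\<in>UNIV. (\<integral>x. A i x \<partial>torus)) + (\<Sum>i\<in>UNIV. (\<integral>x. B i x \<partial>torus)) + (\<Sum>i\<in>UNIV. (\<integral>x. C i x \<partial>torus))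
      = (\<Sum>i\<in>UNIV. (\<integral>x. A i x + B i x + C i x \<partial>torus))"
    by (simp add: sum.distrib[symmetric] int cABC continuous_intros)
  then have "(\<Sum>i\<in>UNIV. (\<integral>x. A i x \<partial>torus)) = - (\<Sum>i\<in>UNIV. (\<integral>x. B i x \<partial>torus))"
    using zero C0 by simp
  moreover have "tri i (field_of s) (field_of (pderiv_at i s)) \<phi> = (\<integral>x. A i x \<partial>torus)" for i
    unfolding A_def by (intro tri_smooth smooth_periodic_pderiv smooth_periodic_torus sp \<phi>)
  moreover have "tri i (field_of s) (field_of s) (pderiv_at i \<phi>) = (\<integral>x. B i x \<partial>torus)" for i
    unfolding B_def by (intro tri_smooth smooth_periodic_pderiv smooth_periodic_torus sp \<phi>)
  ultimately show ?thesis by simp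
qed

section \<open>Divergence-free fields and weak derivatives\<close>

lemma subspace_smooth_df:
  "(\<lambda>_. 0) \<in> smooth_df" "f \<in> smooth_df \<Longrightarrow> g \<in> smooth_df \<Longrightarrow> (\<lambda>x. f x + g x) \<in> smooth_df"
  "f \<in> smooth_df \<Longrightarrow> (\<lambda>x. c *\<^sub>R f x) \<in> smooth_df"
proof -
  have lin: "smooth_periodic (\<lambda>x. a *\<^sub>R f x + b *\<^sub>R g x)" "pderiv_at i (\<lambda>x. a *\<^sub>R f x + b *\<^sub>R g x) = (\<lambda>x. a *\<^sub>R pderiv_at i f x + b *\<^sub>R pderiv_at i g x)"
    if f: "smooth_periodic f" and g: "smooth_periodic g" for a b i and f g :: "real ^ 3 \<Rightarrow> real ^ 3"
  proof -
    have d: "((\<lambda>x. a *\<^sub>R f x + b *\<^sub>R g x) has_derivative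
      (\<lambda>h. a *\<^sub>R frechet_derivative f (at x) h + b *\<^sub>R frechet_derivative g (at x) h)) (at x)"
      if "smooth_periodic f" "smooth_periodic g" for x and f g :: "real ^ 3 \<Rightarrow> real ^ 3"
      using smooth_periodic_has_derivative[OF that(1)] smooth_periodic_has_derivative[OF that(2)]
      by (auto intro!: derivative_eq_intros)
    have p: "pderiv_at i (\<lambda>x. a *\<^sub>R f x + b *\<^sub>R g x) = (\<lambda>x. a *\<^sub>R pderiv_at i f x + b *\<^sub>R pderiv_at i g x)"
      if "smooth_periodic f" "smooth_periodic g" for i and f g :: "real ^ 3 \<Rightarrow> real ^ 3"
      using frechet_derivative_at[OF d[OF that], symmetric] by (auto simp: pderiv_at_def)
    show "pderiv_at i (\<lambda>x. a *\<^sub>R f x + b *\<^sub>R g x) = (\<lambda>x. a *\<^sub>R pderiv_at i f x + b *\<^sub>R pderiv_at i g x)" by (rule p[OF f g])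
    have ex: "\<exists>f' g'. smooth_periodic f' \<and> smooth_periodic g' \<and>
      foldr pderiv_at js (\<lambda>x. a *\<^sub>R f x + b *\<^sub>R g x) = (\<lambda>x. a *\<^sub>R f' x + b *\<^sub>R g' x)" for js :: "3 list"
    proof (induction js)
      case (Cons j js)
      then obtain f' g' where *: "smooth_periodic f'" "smooth_periodic g'"
        "foldr pderiv_at js (\<lambda>x. a *\<^sub>R f x + b *\<^sub>R g x) = (\<lambda>x. a *\<^sub>R f' x + b *\<^sub>R g' x)" by blast
      have "foldr pderiv_at (j # js) (\<lambda>x. a *\<^sub>R f x + b *\<^sub>R g x) = (\<lambda>x. a *\<^sub>R pderiv_at j f' x + b *\<^sub>R pderiv_at j g' x)"
        using *(3) p[OF *(1,2), of j] by simp
      then show ?case using smooth_periodic_pderiv[OF *(1)] smooth_periodic_pderiv[OF *(2)] by blast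
    qed (use f g in auto)
    have "foldr pderiv_at js (\<lambda>x. a *\<^sub>R f x + b *\<^sub>R g x) differentiable at x" for js x
    proof -
      from ex[of js] obtain f' g' where *: "smooth_periodic f'" "smooth_periodic g'"
        "foldr pderiv_at js (\<lambda>x. a *\<^sub>R f x + b *\<^sub>R g x) = (\<lambda>x. a *\<^sub>R f' x + b *\<^sub>R g' x)" by blast
      show ?thesis unfolding *(3) by (rule differentiableI[OF d[OF *(1,2)]])
    qed
    then show "smooth_periodic (\<lambda>x. a *\<^sub>R f x + b *\<^sub>R g x)"
      using smooth_periodic_shift[OF f] smooth_periodic_shift[OF g] unfolding smooth_periodic_def by simp
  qed
  have df: "(\<lambda>x. a *\<^sub>R f x + b *\<^sub>R g x) \<in> smooth_df" if "f \<in> smooth_df" "g \<in> smooth_df" for f g a b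
    using lin[OF smooth_dfD(1)[OF that(1)] smooth_dfD(1)[OF that(2)], where a=a and b=b] smooth_dfD(2)[OF that(1)] smooth_dfD(2)[OF that(2)]
    by (simp add: smooth_df_def sum.distrib sum_distrib_left[symmetric])
  show 0: "(\<lambda>_. 0) \<in> smooth_df"
  proof -
    have "wave (wave_vec 0) 0 0 = (\<lambda>_. 0)" by (auto simp: wave_def)
    moreover have "pderiv_at i (wave (wave_vec 0) 0 0) = (\<lambda>_. 0)" for i by (auto simp: pderiv_wave wave_def)
    ultimately show ?thesis using smooth_periodic_wave[of 0 0 0] by (simp add: smooth_df_def)
  qed
  show "(\<lambda>x. f x + g x) \<in> smooth_df" if "f \<in> smooth_df" "g \<in> smooth_df"
    using df[OF that, of 1 1] by simp
  show "(\<lambda>x. c *\<^sub>R f x) \<in> smooth_df" if "f \<in> smooth_df"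
    using df[OF that that, of c 0] by simp
qed

lemma field_of_zero [simp]: "field_of (\<lambda>_. 0) = 0"
  using field_of_scaleR[of "\<lambda>_. 0" 0] by simp

lemma field_of_smooth_sum:
  assumes "finite F" "\<And>i. i \<in> F \<Longrightarrow> s i \<in> smooth_df"
  shows "(\<lambda>x. \<Sum>i\<in>F. c i *\<^sub>R s i x) \<in> smooth_df \<and>
    field_of (\<lambda>x. \<Sum>i\<in>F. c i *\<^sub>R s i x) = (\<Sum>i\<in>F. c i *\<^sub>R field_of (s i))"
  using assms
proof (induction F rule: finite_induct)
  case (insert j F)
  have 1: "(\<lambda>x. c j *\<^sub>R s j x) \<in> smooth_df" "(\<lambda>x. \<Sum>i\<in>F. c i *\<^sub>R s i x) \<in> smooth_df"
    using insert.IH insert.prems by (auto intro: subspace_smooth_df(3))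
  have "field_of (\<lambda>x. c j *\<^sub>R s j x + (\<Sum>i\<in>F. c i *\<^sub>R s i x)) = field_of (\<lambda>x. c j *\<^sub>R s j x) + field_of (\<lambda>x. \<Sum>i\<in>F. c i *\<^sub>R s i x)"
    by (intro field_of_add smooth_periodic_sq_integrable smooth_dfD(1) 1)
  moreover have "field_of (\<lambda>x. c j *\<^sub>R s j x) = c j *\<^sub>R field_of (s j)"
    by (intro field_of_scaleR smooth_periodic_sq_integrable smooth_dfD(1) insert.prems) simp
  ultimately show ?case using subspace_smooth_df(2)[OF 1] insert by simp
qed (auto simp: subspace_smooth_df)

lemma subspace_closure:
  fixes S :: "'a :: real_normed_vector set"
  assumes "subspace S" shows "subspace (closure S)"
  unfolding subspace_def
proof (intro conjI ballI allI)
  show "0 \<in> closure S" using subspace_0[OF assms] closure_subset by blast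
  fix u v assume "u \<in> closure S" "v \<in> closure S"
  then obtain f g where "\<forall>n. f n \<in> S" "f \<longlonglongrightarrow> u" "\<forall>n. g n \<in> S" "g \<longlonglongrightarrow> v"
    unfolding closure_sequential by blast
  then have "\<forall>n. f n + g n \<in> S" "(\<lambda>n. f n + g n) \<longlonglongrightarrow> u + v"
    using subspace_add[OF assms] by (auto intro: tendsto_add)
  then show "u + v \<in> closure S" unfolding closure_sequential by (intro exI[of _ "\<lambda>n. f n + g n"] conjI)
next
  fix c u assume "u \<in> closure S"
  then obtain f where "\<forall>n. f n \<in> S" "f \<longlonglongrightarrow> u" unfolding closure_sequential by blast
  then have "\<forall>n. c *\<^sub>R f n \<in> S" "(\<lambda>n. c *\<^sub>R f n) \<longlonglongrightarrow> c *\<^sub>R u"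
    using subspace_scale[OF assms] by (auto intro: tendsto_intros)
  then show "c *\<^sub>R u \<in> closure S" unfolding closure_sequential by (intro exI[of _ "\<lambda>n. c *\<^sub>R f n"] conjI)
qed

lemma subspace_df_space: "subspace df_space"
proof -
  have "subspace (field_of ` smooth_df)"
    unfolding subspace_def
  proof (intro conjI ballI allI)
    show "0 \<in> field_of ` smooth_df" using imageI[OF subspace_smooth_df(1), of field_of] by simp
    fix u v assume "u \<in> field_of ` smooth_df" "v \<in> field_of ` smooth_df"
    then obtain f g where fg: "f \<in> smooth_df" "u = field_of f" "g \<in> smooth_df" "v = field_of g"
      by (elim imageE)
    then have "u + v = field_of (\<lambda>x. f x + g x)"
      using field_of_add[OF smooth_periodic_sq_integrable smooth_periodic_sq_integrable] smooth_dfD(1) by simp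
    then show "u + v \<in> field_of ` smooth_df" using imageI[OF subspace_smooth_df(2)[OF fg(1,3)], of field_of] by simp
  next
    fix c u assume "u \<in> field_of ` smooth_df"
    then obtain f where f: "f \<in> smooth_df" "u = field_of f" by (elim imageE)
    then have "c *\<^sub>R u = field_of (\<lambda>x. c *\<^sub>R f x)"
      using field_of_scaleR[OF smooth_periodic_sq_integrable] smooth_dfD(1) by simp
    then show "c *\<^sub>R u \<in> field_of ` smooth_df" using imageI[OF subspace_smooth_df(3)[OF f(1)], of field_of] by simp
  qed
  then show ?thesis unfolding df_space_def by (rule subspace_closure)
qed

lemma smooth_df_df_space: "s \<in> smooth_df \<Longrightarrow> field_of s \<in> df_space"
  unfolding df_space_def by (rule subsetD[OF closure_subset imageI])

text \<open>On divergence-free H^2 fields the Laplacian stays in the space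
  (\<open>stokes_df\<close>), so the projection inside the Stokes operator acts there as the
  identity.\<close>

lemma leray_df_space:
  assumes "u \<in> df_space" shows "leray u = u"
  unfolding leray_def
proof (rule the_equality)
  show "u \<in> df_space \<and> (\<forall>h\<in>df_space. (u - u) \<bullet> h = 0)" using assms by simp
  fix p assume p: "p \<in> df_space \<and> (\<forall>h\<in>df_space. (u - p) \<bullet> h = 0)"
  then have "u - p \<in> df_space" using assms subspace_df_space by (auto intro: subspace_diff)
  then have "(u - p) \<bullet> (u - p) = 0" using p by blast
  then show "p = u" by simp
qed

text \<open>A wave with amplitude parallel to its frequency is a gradient: it is the sum of the i-th
  derivatives of \<open>V i\<close>, and integration by parts produces the divergence of f.\<close>

lemma df_space_orthogonal_gradient:
  assumes "u \<in> df_space"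
  shows "u \<bullet> field_of (wave (wave_vec m) (s *\<^sub>R wave_vec m) (t *\<^sub>R wave_vec m)) = 0"
proof -
  define \<kappa> where "\<kappa> = wave_vec m"
  define V where "V i = wave \<kappa> (- t *\<^sub>R axis i 1) (s *\<^sub>R axis i 1)" for i :: 3
  have sV: "smooth_periodic (V i)" for i unfolding V_def \<kappa>_def by (rule smooth_periodic_wave)
  have dV: "pderiv_at i (V i) x = (s * cos (\<kappa> \<bullet> x) + t * sin (\<kappa> \<bullet> x)) *\<^sub>R (\<kappa> $ i *\<^sub>R axis i 1)" for i x
    by (simp add: V_def pderiv_wave wave_def algebra_simps)
  have W: "wave \<kappa> (s *\<^sub>R \<kappa>) (t *\<^sub>R \<kappa>) x = (\<Sum>i\<in>UNIV. pderiv_at i (V i) x)" for x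
  proof -
    have "(\<Sum>i\<in>UNIV. \<kappa> $ i *\<^sub>R axis i 1) = \<kappa>"
      using basis_expansion[of \<kappa>] by (simp add: scalar_mult_eq_scaleR)
    then show ?thesis unfolding dV scaleR_sum_right[symmetric] by (simp add: wave_def algebra_simps)
  qed
  have "field_of f \<bullet> field_of (wave \<kappa> (s *\<^sub>R \<kappa>) (t *\<^sub>R \<kappa>)) = 0" if f: "f \<in> smooth_df" for f
  proof -
    note sf = smooth_dfD(1)[OF f]
    note sq = smooth_periodic_sq_integrable[OF sf] smooth_periodic_sq_integrable[OF smooth_periodic_pderiv[OF sf]]
      smooth_periodic_sq_integrable[OF sV] smooth_periodic_sq_integrable[OF smooth_periodic_pderiv[OF sV]]
    have "field_of f \<bullet> field_of (wave \<kappa> (s *\<^sub>R \<kappa>) (t *\<^sub>R \<kappa>)) = (\<integral>x. f x \<bullet> wave \<kappa> (s *\<^sub>R \<kappa>) (t *\<^sub>R \<kappa>) x \<partial>torus)"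
      unfolding \<kappa>_def by (intro inner_field_of sq smooth_periodic_sq_integrable smooth_periodic_wave)
    also have "\<dots> = (\<Sum>i\<in>UNIV. \<integral>x. f x \<bullet> pderiv_at i (V i) x \<partial>torus)"
      unfolding W inner_sum_right by (intro Bochner_Integration.integral_sum sq_integrable_inner sq)
    also have "\<dots> = (\<Sum>i\<in>UNIV. - (\<integral>x. pderiv_at i f x \<bullet> V i x \<partial>torus))"
      using smooth_periodic_integration_by_parts[OF sf sV] by (simp add: inner_field_of sq)
    also have "\<dots> = - (\<integral>x. (\<Sum>i\<in>UNIV. pderiv_at i f x \<bullet> V i x) \<partial>torus)"
      unfolding sum_negf by (subst Bochner_Integration.integral_sum) (auto intro!: sq_integrable_inner sq)
    also have "(\<lambda>x. \<Sum>i\<in>UNIV. pderiv_at i f x \<bullet> V i x) = (\<lambda>x. 0)"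
    proof
      fix x
      have "(\<Sum>i\<in>UNIV. pderiv_at i f x \<bullet> V i x) = (\<Sum>i\<in>UNIV. pderiv_at i f x $ i) * (s * sin (\<kappa> \<bullet> x) - t * cos (\<kappa> \<bullet> x))"
        unfolding sum_distrib_right
        by (intro sum.cong) (auto simp: V_def wave_def inner_add_right inner_axis algebra_simps)
      then show "(\<Sum>i\<in>UNIV. pderiv_at i f x \<bullet> V i x) = 0" using smooth_dfD(2)[OF f] by simp
    qed
    finally show ?thesis by simp
  qed
  then have "field_of ` smooth_df \<subseteq> {u. u \<bullet> field_of (wave \<kappa> (s *\<^sub>R \<kappa>) (t *\<^sub>R \<kappa>)) = 0}" by auto
  moreover have "closed {u. u \<bullet> field_of (wave \<kappa> (s *\<^sub>R \<kappa>) (t *\<^sub>R \<kappa>)) = 0}"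
    by (intro closed_Collect_eq continuous_intros)
  ultimately show ?thesis using assms unfolding df_space_def \<kappa>_def[symmetric] using closure_minimal by blast
qed

lemma has_weak_deriv_has_sum:
  assumes "(v has_sum u) UNIV" "(g has_sum G) UNIV" "\<And>z. has_weak_deriv i (v z) (g z)"
  shows "has_weak_deriv i u G"
  unfolding has_weak_deriv_def
proof (intro allI impI)
  fix \<phi> assume \<phi>: "smooth_periodic \<phi>"
  have eq: "v z \<bullet> field_of (pderiv_at i \<phi>) = - (g z \<bullet> field_of \<phi>)" for z
    using assms(3)[of z] \<phi> unfolding has_weak_deriv_def by blast
  have "((\<lambda>z. v z \<bullet> field_of (pderiv_at i \<phi>)) has_sum (u \<bullet> field_of (pderiv_at i \<phi>))) UNIV"
    by (rule has_sum_bounded_linear[OF bounded_linear_inner_left assms(1)])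
  moreover have "((\<lambda>z. - (g z \<bullet> field_of \<phi>)) has_sum - (G \<bullet> field_of \<phi>)) UNIV"
    unfolding has_sum_uminus minus_minus by (rule has_sum_bounded_linear[OF bounded_linear_inner_left assms(2)])
  ultimately show "u \<bullet> field_of (pderiv_at i \<phi>) = - (G \<bullet> field_of \<phi>)"
    unfolding eq by (rule has_sum_unique)
qed

lemma has_weak_deriv_scaleR: "has_weak_deriv i u g \<Longrightarrow> has_weak_deriv i (c *\<^sub>R u) (c *\<^sub>R g)"
  unfolding has_weak_deriv_def by simp

section \<open>Lattice sums\<close>

lemma sum_le_card_fibre:
  fixes g :: "'b \<Rightarrow> real"
  assumes F: "finite F" and g: "\<And>y. 0 \<le> g y" and c: "\<And>y. card {x \<in> F. h x = y} \<le> c"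
  shows "(\<Sum>x\<in>F. g (h x)) \<le> real c * (\<Sum>y\<in>h ` F. g y)"
proof -
  have "(\<Sum>x\<in>F. g (h x)) = (\<Sum>y\<in>h ` F. \<Sum>x\<in>{x \<in> F. h x = y}. g (h x))"
    by (rule sum.image_gen[OF F])
  also have "\<dots> = (\<Sum>y\<in>h ` F. real (card {x \<in> F. h x = y}) * g y)"
    by (intro sum.cong) auto
  also have "\<dots> \<le> (\<Sum>y\<in>h ` F. real c * g y)"
    using c g by (intro sum_mono mult_right_mono) auto
  finally show ?thesis by (simp add: sum_distrib_left)
qed

text \<open>The summand decays like |n|^(-4/3), which is summable. The exponent 2/3 is a third of
  the exponent 2 of the lattice sum, one share for each coordinate.\<close>

lemma integer_sum_bounded: "\<exists>A\<ge>0. \<forall>N. finite N \<longrightarrow> (\<Sum>n\<in>N. (1 + (real_of_int n)\<^sup>2) powr (- 2 / 3)) \<le> A"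
proof -
  define b where "b j = (1 + (real j)\<^sup>2) powr (- 2 / 3)" for j :: nat
  have b0: "0 \<le> b j" for j by (simp add: b_def)
  have "summable b"
  proof (rule summable_comparison_test_ev)
    show "summable (\<lambda>n. real n powr (- 4 / 3))" by (subst summable_real_powr_iff) simp
    show "\<forall>\<^sub>F n in sequentially. norm (b n) \<le> real n powr (- 4 / 3)"
      using eventually_gt_at_top[of 0]
    proof eventually_elim
      case (elim n)
      have "b n \<le> ((real n)\<^sup>2) powr (- 2 / 3)" unfolding b_def
        using elim by (intro powr_mono2') auto
      also have "\<dots> = (real n powr 2) powr (- 2 / 3)" using elim by (simp add: powr_numeral)
      also have "\<dots> = real n powr (- 4 / 3)" unfolding powr_powr by simp
      finally show ?case using b0 by simp
    qed
  qed
  then have sb: "(\<Sum>j\<in>J. b j) \<le> suminf b" if "finite J" for J using that b0 by (intro sum_le_suminf) auto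
  have "(\<Sum>n\<in>N. (1 + (real_of_int n)\<^sup>2) powr (- 2 / 3)) \<le> 2 * suminf b" if "finite N" for N
  proof -
    have "(\<Sum>n\<in>N. (1 + (real_of_int n)\<^sup>2) powr (- 2 / 3)) = (\<Sum>n\<in>N. b (nat \<bar>n\<bar>))" by (simp add: b_def)
    also have "\<dots> \<le> real 2 * (\<Sum>j\<in>(\<lambda>n. nat \<bar>n\<bar>) ` N. b j)"
    proof (rule sum_le_card_fibre[OF that b0])
      fix y
      have "{x \<in> N. nat \<bar>x\<bar> = y} \<subseteq> {int y, - int y}" by auto
      then have "card {x \<in> N. nat \<bar>x\<bar> = y} \<le> card {int y, - int y}" by (intro card_mono) auto
      also have "\<dots> \<le> 2" by (simp add: card_insert_if)
      finally show "card {x \<in> N. nat \<bar>x\<bar> = y} \<le> 2" .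
    qed
    also have "\<dots> \<le> 2 * suminf b" using sb[of "(\<lambda>n. nat \<bar>n\<bar>) ` N"] that by simp
    finally show ?thesis .
  qed
  moreover have "0 \<le> 2 * suminf b" using sb[of "{}"] by simp
  ultimately show ?thesis by blast
qed

lemma norm_wave_vec_component: "1 + (real_of_int (m $ i))\<^sup>2 \<le> 1 + (norm (wave_vec m))\<^sup>2"
proof -
  have "\<bar>real_of_int (m $ i)\<bar> \<le> 2 * pi * \<bar>real_of_int (m $ i)\<bar>"
    using mult_right_mono[of 1 "2 * pi" "\<bar>real_of_int (m $ i)\<bar>"] pi_gt3 by simp
  also have "\<dots> = \<bar>wave_vec m $ i\<bar>" by (simp add: wave_vec_nth abs_mult)
  also have "\<dots> \<le> norm (wave_vec m)" by (rule component_le_norm_cart)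
  finally have "\<bar>real_of_int (m $ i)\<bar>\<^sup>2 \<le> (norm (wave_vec m))\<^sup>2" by (rule power_mono) simp
  then show ?thesis by simp
qed

text \<open>The bound holds because \<open>1 + |k|\<^sup>2\<close> dominates each \<open>1 + k\<^sub>i\<^sup>2\<close>, so that the sum is at most the
  cube of a convergent one-dimensional sum.\<close>

lemma lattice_sum_bounded:
  "\<exists>A\<ge>0. \<forall>M. finite M \<longrightarrow> (\<Sum>m\<in>M. (1 + (norm (wave_vec m))\<^sup>2) powr (- 2)) \<le> A"
proof -
  define a where "a n = (1 + (real_of_int n)\<^sup>2) powr (- 2 / 3)" for n
  obtain A where A: "0 \<le> A" "\<And>N. finite N \<Longrightarrow> (\<Sum>n\<in>N. a n) \<le> A"
    using integer_sum_bounded unfolding a_def by auto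
  have a0: "0 \<le> a n" for n by (simp add: a_def)
  have "(\<Sum>m\<in>M. (1 + (norm (wave_vec m))\<^sup>2) powr (- 2)) \<le> A ^ 3" if M: "finite M" for M
  proof -
    define N where "N = (\<Union>m\<in>M. range (\<lambda>i. m $ i))"
    have N: "finite N" unfolding N_def using M by auto
    have le: "(1 + (norm (wave_vec m))\<^sup>2) powr (- 2) \<le> (\<Prod>i\<in>UNIV. a (m $ i))" for m
    proof -
      have pos: "0 < 1 + (norm (wave_vec m))\<^sup>2" by (smt (verit) zero_le_power2)
      have "(1 + (norm (wave_vec m))\<^sup>2) powr (- 2) = ((1 + (norm (wave_vec m))\<^sup>2) powr (- 2 / 3)) ^ 3"
        using pos by (simp add: powr_power)
      also have "\<dots> = (\<Prod>i\<in>(UNIV :: 3 set). (1 + (norm (wave_vec m))\<^sup>2) powr (- 2 / 3))" by simp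
      also have "\<dots> \<le> (\<Prod>i\<in>UNIV. a (m $ i))"
      proof (rule prod_mono, rule conjI)
        fix i :: 3
        show "(1 + (norm (wave_vec m))\<^sup>2) powr (- 2 / 3) \<le> a (m $ i)"
          unfolding a_def
        proof (rule powr_mono2')
          show "0 < 1 + (real_of_int (m $ i))\<^sup>2" by (smt (verit) zero_le_power2)
        qed (use norm_wave_vec_component in auto)
      qed simp
      finally show ?thesis .
    qed
    have inj: "inj_on (\<lambda>m i. m $ i) M" by (auto simp: inj_on_def vec_eq_iff fun_eq_iff)
    have "(\<Sum>m\<in>M. (1 + (norm (wave_vec m))\<^sup>2) powr (- 2)) \<le> (\<Sum>m\<in>M. \<Prod>i\<in>UNIV. a (m $ i))"
      by (intro sum_mono le)
    also have "\<dots> = (\<Sum>g\<in>(\<lambda>m i. m $ i) ` M. \<Prod>i\<in>UNIV. a (g i))"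
      by (subst sum.reindex[OF inj]) (simp add: o_def)
    also have "\<dots> \<le> (\<Sum>g\<in>PiE (UNIV :: 3 set) (\<lambda>_. N). \<Prod>i\<in>UNIV. a (g i))"
    proof (rule sum_mono2)
      show "finite (PiE (UNIV :: 3 set) (\<lambda>_. N))" by (simp add: finite_PiE N)
      show "(\<lambda>m i. m $ i) ` M \<subseteq> PiE UNIV (\<lambda>_. N)" unfolding N_def by auto
      show "0 \<le> (\<Prod>i\<in>UNIV. a (g i))" for g :: "3 \<Rightarrow> int" by (intro prod_nonneg a0)
    qed
    also have "\<dots> = (\<Prod>i\<in>(UNIV :: 3 set). \<Sum>n\<in>N. a n)"
      by (rule prod_sum_PiE[symmetric]) (auto simp: N)
    also have "\<dots> \<le> (\<Prod>i\<in>(UNIV :: 3 set). A)"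
      using A(2)[OF N] by (intro prod_mono) (auto intro: sum_nonneg a0)
    finally show ?thesis by simp
  qed
  moreover have "0 \<le> A ^ 3" using A by simp
  ultimately show ?thesis by blast
qed

section \<open>The basis of plane waves\<close>

locale plane_waves =
  fixes e :: "'z \<Rightarrow> vfield" and k :: "'z \<Rightarrow> int ^ 3"
  assumes basis: "plane_wave_basis e k"
begin

definition freq :: "'z \<Rightarrow> real ^ 3" where "freq z = wave_vec (k z)"

lemma e_df: "e z \<in> df_space"
  and e_inner: "e z \<bullet> e z' = (if z = z' then 1 else 0)"
  and closure_span: "closure (span (range e)) = df_space"
  and e_wave: "\<exists>a b. e z = field_of (wave (freq z) a b)"
  and card_freq: "card {z. k z = m} = (if m = 0 then 3 else 2)"
  using basis unfolding plane_wave_basis_def wave_def[abs_def] freq_def by simp_all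

lemma norm_e [simp]: "norm (e z) = 1"
  using e_inner[of z z] by (simp add: norm_eq_sqrt_inner)

lemma eigval_freq: "eigval k z = (norm (freq z))\<^sup>2"
  by (simp add: eigval_def freq_def)

lemma eigval_nonneg [simp]: "0 \<le> eigval k z"
  by (simp add: eigval_def)

lemma eigval_sum: "(\<Sum>i\<in>UNIV. (freq z $ i)\<^sup>2) = eigval k z"
  unfolding eigval_freq power2_norm_eq_inner inner_vec_def by (simp add: power2_eq_square)

lemma freq_component: "(freq z $ i)\<^sup>2 \<le> eigval k z"
  unfolding eigval_sum[symmetric] by (rule member_le_sum) auto

text \<open>At frequency zero the sine is the zero field; its amplitude is normalised to zero so that the
  amplitudes are bounded.\<close>

definition amp :: "'z \<Rightarrow> (real ^ 3) \<times> (real ^ 3)" where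
  "amp z = (SOME p. e z = field_of (wave (freq z) (fst p) (snd p)) \<and> (k z = 0 \<longrightarrow> snd p = 0))"

text \<open>The smooth representative of \<open>e z\<close>; test fields are functions, not
  classes.\<close>

definition ew :: "'z \<Rightarrow> real ^ 3 \<Rightarrow> real ^ 3" where
  "ew z = wave (freq z) (fst (amp z)) (snd (amp z))"

text \<open>The quarter-period translate of \<open>ew z\<close>. Its gradient is proportional to
  \<open>ew z\<close>, so noise tested against it sees only Brownian motions of index z; the
  gradient of \<open>ew z\<close> is proportional to \<open>fw z\<close>.\<close>

definition fw :: "'z \<Rightarrow> real ^ 3 \<Rightarrow> real ^ 3" where
  "fw z = wave (freq z) (- snd (amp z)) (fst (amp z))"

lemma amp: "e z = field_of (ew z)" "k z = 0 \<Longrightarrow> snd (amp z) = 0"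
proof -
  obtain a b where ab: "e z = field_of (wave (freq z) a b)" using e_wave by blast
  define p where "p = (if k z = 0 then (a, 0) else (a, b))"
  have "freq z = 0" if "k z = 0" using that by (simp add: freq_def wave_vec_def vec_eq_iff)
  then have "wave (freq z) (fst p) (snd p) = wave (freq z) a b"
    by (auto simp: p_def wave_def fun_eq_iff)
  then have "e z = field_of (wave (freq z) (fst p) (snd p)) \<and> (k z = 0 \<longrightarrow> snd p = 0)"
    using ab by (simp add: p_def)
  then have "e z = field_of (wave (freq z) (fst (amp z)) (snd (amp z))) \<and> (k z = 0 \<longrightarrow> snd (amp z) = 0)"
    unfolding amp_def by (rule someI)
  then show "e z = field_of (ew z)" "k z = 0 \<Longrightarrow> snd (amp z) = 0" by (simp_all add: ew_def)
qed

lemma ew_smooth: "smooth_periodic (ew z)" and fw_smooth: "smooth_periodic (fw z)"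
  unfolding ew_def fw_def freq_def by (rule smooth_periodic_wave)+

text \<open>Normalisation gives |a|^2 + |b|^2 = 2 at non-zero frequency, and |a| = 1, b = 0 at
  frequency zero; then 2|a| \<le> 1 + |a|^2 and likewise for b.\<close>

lemma amp_norm: "norm (fst (amp z)) + norm (snd (amp z)) \<le> 2"
proof -
  define a b where "a = fst (amp z)" and "b = snd (amp z)"
  have one: "field_of (wave (freq z) a b) \<bullet> field_of (wave (freq z) a b) = 1"
    using e_inner[of z z] amp(1)[of z] by (simp add: ew_def a_def b_def)
  have "norm a ^ 2 + norm b ^ 2 \<le> 2"
  proof (cases "k z = 0")
    case True
    then have "b = 0" "freq z = 0" using amp(2) by (auto simp: b_def freq_def wave_vec_def vec_eq_iff)
    then have w: "wave (freq z) a b = (\<lambda>_. a)" by (auto simp: wave_def)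
    have "sq_integrable (\<lambda>_ :: real ^ 3. a)" by (rule sq_integrable_bounded[where K="norm a"]) auto
    then have "field_of (\<lambda>_. a) \<bullet> field_of (\<lambda>_. a) = a \<bullet> a"
      using torus.prob_space by (simp add: inner_field_of)
    then show ?thesis using one \<open>b = 0\<close> unfolding w by (simp add: power2_norm_eq_inner)
  next
    case False
    then show ?thesis using inner_wave[OF False, of a b a b] one
      unfolding freq_def by (simp add: power2_norm_eq_inner)
  qed
  moreover have "0 \<le> (norm a - 1)\<^sup>2" "0 \<le> (norm b - 1)\<^sup>2" by simp_all
  ultimately show ?thesis by (simp add: power2_diff a_def b_def)
qed

lemma norm_ew: "norm (ew z x) \<le> 2" and norm_fw: "norm (fw z x) \<le> 2"
  unfolding ew_def fw_def
  using norm_wave_le[of "freq z" "fst (amp z)" "snd (amp z)" x]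
    norm_wave_le[of "freq z" "- snd (amp z)" "fst (amp z)" x] amp_norm[of z] by simp_all

text \<open>\<open>e z\<close> is orthogonal to the gradient waves of its own frequency, which
  \<open>inner_wave\<close> turns into orthogonality of frequency and amplitudes.\<close>

lemma amp_orthogonal: "freq z \<bullet> fst (amp z) = 0" "freq z \<bullet> snd (amp z) = 0"
proof -
  have *: "freq z \<bullet> fst (amp z) = 0 \<and> freq z \<bullet> snd (amp z) = 0"
  proof (cases "k z = 0")
    case True
    then have "freq z = 0" by (simp add: freq_def wave_vec_def vec_eq_iff)
    then show ?thesis by simp
  next
    case False
    define a b where "a = fst (amp z)" and "b = snd (amp z)"
    have e: "e z = field_of (wave (wave_vec (k z)) a b)"
      using amp(1)[of z] by (simp only: ew_def freq_def a_def b_def)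
    have "(a \<bullet> (s *\<^sub>R freq z) + b \<bullet> (t *\<^sub>R freq z)) / 2 = 0" for s t
      using df_space_orthogonal_gradient[OF e_df[of z], of "k z" s t]
      unfolding e inner_wave[OF False] freq_def .
    from this[of 1 0] this[of 0 1] show ?thesis by (simp add: inner_commute a_def b_def)
  qed
  then show "freq z \<bullet> fst (amp z) = 0" "freq z \<bullet> snd (amp z) = 0" by auto
qed

lemma wave_smooth_df:
  assumes "freq z \<bullet> a = 0" "freq z \<bullet> b = 0"
  shows "wave (freq z) a b \<in> smooth_df"
proof -
  have "(\<Sum>i\<in>UNIV. pderiv_at i (wave (freq z) a b) x $ i) = 0" for x
  proof -
    have "(\<Sum>i\<in>UNIV. pderiv_at i (wave (freq z) a b) x $ i)
        = (\<Sum>i\<in>UNIV. cos (freq z \<bullet> x) * (freq z $ i * b $ i) - sin (freq z \<bullet> x) * (freq z $ i * a $ i))"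
      by (simp add: pderiv_wave wave_def mult_ac)
    also have "\<dots> = cos (freq z \<bullet> x) * (freq z \<bullet> b) - sin (freq z \<bullet> x) * (freq z \<bullet> a)"
      by (simp add: sum_subtractf sum_distrib_left inner_vec_def)
    finally show ?thesis using assms by simp
  qed
  then show ?thesis using smooth_periodic_wave unfolding smooth_df_def freq_def by blast
qed

lemma ew_df: "ew z \<in> smooth_df" and fw_df: "fw z \<in> smooth_df"
  unfolding ew_def fw_def using amp_orthogonal by (auto intro!: wave_smooth_df)

lemma pderiv_ew: "pderiv_at i (ew z) x = - (freq z $ i) *\<^sub>R fw z x"
  and pderiv_fw: "pderiv_at i (fw z) x = freq z $ i *\<^sub>R ew z x"
  unfolding ew_def fw_def pderiv_wave by (simp_all add: wave_def algebra_simps)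

definition de :: "3 \<Rightarrow> 'z \<Rightarrow> vfield" where "de i z = field_of (pderiv_at i (ew z))"

lemma de_fw: "de i z = - (freq z $ i) *\<^sub>R field_of (fw z)"
proof -
  have "pderiv_at i (ew z) = (\<lambda>x. - (freq z $ i) *\<^sub>R fw z x)" by (auto simp: pderiv_ew)
  then show ?thesis unfolding de_def
    by (simp only: field_of_scaleR[OF smooth_periodic_sq_integrable[OF fw_smooth]])
qed

lemma weak_deriv_e: "has_weak_deriv i (e z) (de i z)"
  by (subst amp(1)) (simp only: de_def has_weak_deriv_smooth[OF ew_smooth])

lemma weak_deriv_de: "has_weak_deriv i (de i z) (- (freq z $ i)\<^sup>2 *\<^sub>R e z)"
proof -
  have "has_weak_deriv i (field_of (fw z)) (field_of (pderiv_at i (fw z)))"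
    by (rule has_weak_deriv_smooth[OF fw_smooth])
  moreover have "field_of (pderiv_at i (fw z)) = freq z $ i *\<^sub>R e z"
  proof -
    have "pderiv_at i (fw z) = (\<lambda>x. freq z $ i *\<^sub>R ew z x)" by (auto simp: pderiv_fw)
    then have "field_of (pderiv_at i (fw z)) = field_of (\<lambda>x. freq z $ i *\<^sub>R ew z x)" by (rule arg_cong)
    also have "\<dots> = freq z $ i *\<^sub>R field_of (ew z)"
      by (rule field_of_scaleR[OF smooth_periodic_sq_integrable[OF ew_smooth]])
    finally show ?thesis by (simp only: amp(1)[of z, symmetric])
  qed
  ultimately have "has_weak_deriv i (de i z) (- (freq z $ i) *\<^sub>R (freq z $ i *\<^sub>R e z))"
    unfolding de_fw by (simp only: has_weak_deriv_scaleR)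
  then show ?thesis by (simp add: power2_eq_square)
qed

text \<open>Integration by parts moves the derivative across, so orthogonality of the waves carries
  over to their derivatives.\<close>

lemma de_inner: "de i z \<bullet> de i z' = (if z = z' then (freq z $ i)\<^sup>2 else 0)"
proof -
  have "de i z \<bullet> field_of (pderiv_at i (ew z')) = - ((- (freq z $ i)\<^sup>2 *\<^sub>R e z) \<bullet> field_of (ew z'))"
    by (rule weak_deriv_de[unfolded has_weak_deriv_def, rule_format, OF ew_smooth])
  then show ?thesis using e_inner[of z z'] by (simp add: de_def[symmetric] amp(1)[of z', symmetric])
qed

text \<open>An infinite set has \<open>card\<close> 0, which the prescribed values 2 and 3
  exclude.\<close>

lemma finite_freq: "finite {z. k z = m}"
proof (rule ccontr)
  assume "infinite {z. k z = m}"
  then show False using card_freq[of m] by (simp split: if_splits)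
qed

lemma card_fibre: "finite F \<Longrightarrow> card {z \<in> F. k z = m} \<le> 3"
proof -
  have "card {z \<in> F. k z = m} \<le> card {z. k z = m}" by (intro card_mono finite_freq) auto
  then show ?thesis using card_freq[of m] by (auto split: if_splits)
qed

lemma finite_eigval: "finite {z. eigval k z \<le> \<Lambda>}"
proof -
  obtain N :: nat where N: "\<Lambda> \<le> real N" using real_arch_simple by blast
  define S where "S = {m :: int ^ 3. \<forall>i. m $ i \<in> {- int N..int N}}"
  have "S \<subseteq> (\<lambda>g. \<chi> i. g i) ` PiE (UNIV :: 3 set) (\<lambda>_. {- int N..int N})"
  proof
    fix m assume "m \<in> S"
    then have "(\<lambda>i. m $ i) \<in> PiE UNIV (\<lambda>_. {- int N..int N})" unfolding S_def by auto
    then have "(\<chi> i. (\<lambda>i. m $ i) i) \<in> (\<lambda>g. \<chi> i. g i) ` PiE (UNIV :: 3 set) (\<lambda>_. {- int N..int N})"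
      by (rule imageI)
    then show "m \<in> (\<lambda>g. \<chi> i. g i) ` PiE (UNIV :: 3 set) (\<lambda>_. {- int N..int N})" by simp
  qed
  then have "finite S" by (rule finite_subset) (auto intro!: finite_imageI finite_PiE)
  moreover have "{z. eigval k z \<le> \<Lambda>} \<subseteq> (\<Union>m\<in>S. {z. k z = m})"
  proof
    fix z assume "z \<in> {z. eigval k z \<le> \<Lambda>}"
    then have l: "eigval k z \<le> real N" using N by simp
    have "k z $ i \<in> {- int N..int N}" for i
    proof -
      have "(real_of_int (k z $ i))\<^sup>2 \<le> real N"
        using norm_wave_vec_component[of "k z" i] l by (simp add: eigval_def)
      then have "real_of_int ((k z $ i)\<^sup>2) \<le> real_of_int (int N)" by simp
      then have "(k z $ i)\<^sup>2 \<le> int N" by (simp only: of_int_le_iff)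
      moreover have "\<bar>k z $ i\<bar> \<le> (k z $ i)\<^sup>2"
        using mult_right_mono[of 1 "\<bar>k z $ i\<bar>" "\<bar>k z $ i\<bar>"]
        by (cases "k z $ i = 0") (auto simp: power2_eq_square)
      ultimately show ?thesis by (simp add: abs_le_iff)
    qed
    then show "z \<in> (\<Union>m\<in>S. {z. k z = m})" by (simp add: S_def)
  qed
  ultimately show ?thesis using finite_freq by (auto intro: finite_subset)
qed

lemma countable_index: "countable (UNIV :: 'z set)"
proof -
  have "(UNIV :: 'z set) = (\<Union>n::nat. {z. eigval k z \<le> real n})"
    using real_arch_simple by auto
  moreover have "countable (\<Union>n::nat. {z. eigval k z \<le> real n})"
    by (rule countable_UN) (auto intro: countable_finite finite_eigval)
  ultimately show ?thesis by (simp only:)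
qed

text \<open>The sum behind the embedding of H^2 into bounded fields. It converges because its terms
  decay like |k|^(-4) and 4 exceeds the dimension.\<close>

definition S2 :: real where "S2 = (\<Sum>\<^sub>\<infinity>z. (1 + eigval k z) powr (- 2))"

lemma S2_sum: "finite F \<Longrightarrow> (\<Sum>z\<in>F. (1 + eigval k z) powr (- 2)) \<le> S2"
proof -
  obtain A where A: "0 \<le> A" "\<And>M. finite M \<Longrightarrow> (\<Sum>m\<in>M. (1 + (norm (wave_vec m))\<^sup>2) powr (- 2)) \<le> A"
    using lattice_sum_bounded by auto
  have b: "(\<Sum>z\<in>F. (1 + eigval k z) powr (- 2)) \<le> 3 * A" if "finite F" for F
  proof -
    have "(\<Sum>z\<in>F. (1 + (norm (wave_vec (k z)))\<^sup>2) powr (- 2)) \<le> real 3 * (\<Sum>m\<in>k ` F. (1 + (norm (wave_vec m))\<^sup>2) powr (- 2))"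
      by (rule sum_le_card_fibre[OF that]) (auto intro: card_fibre[OF that])
    also have "\<dots> \<le> real 3 * A" using A(2)[of "k ` F"] that by (intro mult_left_mono) auto
    finally show ?thesis by (simp add: eigval_def)
  qed
  have "(\<lambda>z. (1 + eigval k z) powr (- 2)) summable_on UNIV"
    by (rule nonneg_bdd_above_summable_on) (auto intro!: bdd_aboveI[of _ "3 * A"] b)
  then show "finite F \<Longrightarrow> (\<Sum>z\<in>F. (1 + eigval k z) powr (- 2)) \<le> S2"
    unfolding S2_def by (intro finite_sum_le_infsum) auto
qed

lemma S2_nonneg: "0 \<le> S2" using S2_sum[of "{}"] by simp

section \<open>Fourier expansion and Sobolev norms\<close>

definition proj :: "'z set \<Rightarrow> vfield \<Rightarrow> vfield" where
  "proj F u = (\<Sum>z\<in>F. (e z \<bullet> u) *\<^sub>R e z)"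

lemma e_proj: "finite F \<Longrightarrow> e z \<bullet> proj F u = (if z \<in> F then e z \<bullet> u else 0)"
  by (simp add: proj_def inner_sum_right e_inner if_distrib[of "\<lambda>r. _ * r"] cong: if_cong)

lemma norm_proj: "finite F \<Longrightarrow> (norm (proj F u))\<^sup>2 = (\<Sum>z\<in>F. (e z \<bullet> u)\<^sup>2)"
  unfolding proj_def by (subst orthogonal_norm_sum) (auto simp: e_inner)

lemma norm_diff_proj:
  assumes "finite F" shows "(norm (u - proj F u))\<^sup>2 = (norm u)\<^sup>2 - (norm (proj F u))\<^sup>2"
proof -
  have "proj F u \<bullet> v = (\<Sum>z\<in>F. (e z \<bullet> u) * (e z \<bullet> v))" for v by (simp add: proj_def inner_sum_left)
  then have "proj F u \<bullet> u = (norm (proj F u))\<^sup>2" using norm_proj[OF assms, of u] by (simp add: power2_eq_square)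
  moreover have "(norm (u - proj F u))\<^sup>2 = (norm u)\<^sup>2 - 2 * (proj F u \<bullet> u) + (norm (proj F u))\<^sup>2"
    by (simp add: power2_norm_eq_inner inner_diff_left inner_diff_right inner_commute)
  ultimately show ?thesis by simp
qed

text \<open>On the span every large enough truncation is the identity, and
  \<open>u - proj F u\<close> is no longer than u; density of the span carries the convergence to
  the whole space.\<close>

lemma fourier_has_sum:
  assumes u: "u \<in> df_space"
  shows "((\<lambda>z. (e z \<bullet> u) *\<^sub>R e z) has_sum u) UNIV"
proof -
  define R where "R y \<longleftrightarrow> (\<exists>F. finite F \<and> (\<forall>G. finite G \<and> F \<subseteq> G \<longrightarrow> proj G y = y))" for y
  have sp: "R y" if "y \<in> span (range e)" for y
    using that
  proof (rule span_induct)
    show "subspace (Collect R)"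
      unfolding subspace_def
    proof (intro conjI ballI allI)
      have "proj G 0 = 0" for G by (simp add: proj_def)
      then show "0 \<in> Collect R" unfolding R_def by auto
      fix x y assume "x \<in> Collect R" "y \<in> Collect R"
      then obtain F F' where "finite F" "\<And>G. finite G \<Longrightarrow> F \<subseteq> G \<Longrightarrow> proj G x = x"
        "finite F'" "\<And>G. finite G \<Longrightarrow> F' \<subseteq> G \<Longrightarrow> proj G y = y" unfolding R_def by auto
      moreover have "proj G (x + y) = proj G x + proj G y" for G
        by (simp add: proj_def inner_add_right scaleR_add_left sum.distrib)
      ultimately show "x + y \<in> Collect R" unfolding R_def by (auto intro!: exI[of _ "F \<union> F'"])
    next
      fix c x assume "x \<in> Collect R"
      then obtain F where "finite F" "\<And>G. finite G \<Longrightarrow> F \<subseteq> G \<Longrightarrow> proj G x = x" unfolding R_def by auto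
      moreover have "proj G (c *\<^sub>R x) = c *\<^sub>R proj G x" for G
        by (simp add: proj_def scaleR_sum_right)
      ultimately show "c *\<^sub>R x \<in> Collect R" unfolding R_def by (auto intro!: exI[of _ F])
    qed
    fix y assume "y \<in> range e"
    then obtain z where y: "y = e z" by auto
    have "proj G (e z) = e z" if "finite G" "{z} \<subseteq> G" for G
    proof -
      have "proj G (e z) = (\<Sum>\<xi>\<in>G. if \<xi> = z then e z else 0)"
        unfolding proj_def by (intro sum.cong) (auto simp: e_inner)
      then show ?thesis using that by simp
    qed
    then show "R y" unfolding R_def y by (intro exI[of _ "{z}"]) auto
  qed
  have "((\<lambda>F. proj F u) \<longlongrightarrow> u) (finite_subsets_at_top UNIV)"
  proof (rule tendstoI)
    fix d :: real assume d: "0 < d"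
    have "u \<in> closure (span (range e))" using u closure_span by simp
    then obtain y where y: "y \<in> span (range e)" "dist y u < d" using closure_approachable d by blast
    obtain F where F: "finite F" "\<And>G. finite G \<Longrightarrow> F \<subseteq> G \<Longrightarrow> proj G y = y" using sp[OF y(1)] unfolding R_def by auto
    have "dist (proj G u) u < d" if "finite G" "F \<subseteq> G" for G
    proof -
      have eq: "u - proj G u = (u - y) - proj G (u - y)"
        using F(2)[OF that] by (simp add: proj_def inner_diff_right scaleR_diff_left sum_subtractf)
      have "(norm ((u - y) - proj G (u - y)))\<^sup>2 \<le> (norm (u - y))\<^sup>2"
        using norm_diff_proj[OF that(1), of "u - y"] by simp
      then have "norm ((u - y) - proj G (u - y)) \<le> norm (u - y)" by (rule power2_le_imp_le) simp
      then have "norm (u - proj G u) \<le> norm (u - y)" by (simp only: eq)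
      then show ?thesis using y(2) by (simp add: dist_norm norm_minus_commute)
    qed
    then show "\<forall>\<^sub>F G in finite_subsets_at_top UNIV. dist (proj G u) u < d"
      using F(1) by (auto simp: eventually_finite_subsets_at_top)
  qed
  then show ?thesis unfolding has_sum_def proj_def .
qed

lemma parseval:
  assumes "u \<in> df_space" shows "((\<lambda>z. (e z \<bullet> u)\<^sup>2) has_sum (norm u)\<^sup>2) UNIV"
  using orthogonal_norm_has_sum[OF _ fourier_has_sum[OF assms]] by (simp add: e_inner)

abbreviation wgt :: "real \<Rightarrow> 'z \<Rightarrow> real" where "wgt \<gamma> z \<equiv> (1 + eigval k z) powr \<gamma>"

abbreviation sn :: "real \<Rightarrow> vfield \<Rightarrow> real" where "sn \<gamma> u \<equiv> sobolev_norm e k \<gamma> u"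

lemma wgt_simps: "wgt 1 z = 1 + eigval k z" "wgt 2 z = (1 + eigval k z)\<^sup>2"
  using eigval_nonneg[of z] by (simp_all add: powr_numeral)

lemma sn_nonneg [simp]: "0 \<le> sn \<gamma> u"
  unfolding sobolev_norm_def by (intro real_sqrt_ge_zero infsum_nonneg) simp

lemma sn_sq: "(sn \<gamma> u)\<^sup>2 = (\<Sum>\<^sub>\<infinity>z. wgt \<gamma> z * (e z \<bullet> u)\<^sup>2)"
  unfolding sobolev_norm_def by (intro real_sqrt_pow2 infsum_nonneg) simp

lemma sobolev_df: "u \<in> sobolev e k \<gamma> \<Longrightarrow> u \<in> df_space"
  and sobolev_summable: "u \<in> sobolev e k \<gamma> \<Longrightarrow> (\<lambda>z. wgt \<gamma> z * (e z \<bullet> u)\<^sup>2) summable_on UNIV"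
  by (simp_all add: sobolev_def)

lemma sn_partial:
  assumes "u \<in> sobolev e k \<gamma>" "finite F"
  shows "(\<Sum>z\<in>F. wgt \<gamma> z * (e z \<bullet> u)\<^sup>2) \<le> (sn \<gamma> u)\<^sup>2"
  unfolding sn_sq using assms sobolev_summable by (intro finite_sum_le_infsum) auto

text \<open>Working with finite partial sums gives membership and the norm bound together; the
  infinite sum alone would not, since it is 0 by convention when it diverges.\<close>

lemma sobolevI:
  assumes "u \<in> df_space" "\<And>F. finite F \<Longrightarrow> (\<Sum>z\<in>F. wgt \<gamma> z * (e z \<bullet> u)\<^sup>2) \<le> B\<^sup>2" "0 \<le> B"
  shows "u \<in> sobolev e k \<gamma>" "sn \<gamma> u \<le> B"
proof -
  have s: "(\<lambda>z. wgt \<gamma> z * (e z \<bullet> u)\<^sup>2) summable_on UNIV"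
    by (rule nonneg_bdd_above_summable_on) (auto intro!: bdd_aboveI[of _ "B\<^sup>2"] assms(2))
  then show "u \<in> sobolev e k \<gamma>" using assms(1) by (simp add: sobolev_def)
  have "(sn \<gamma> u)\<^sup>2 \<le> B\<^sup>2" unfolding sn_sq by (rule infsum_le_finite_sums[OF s]) (use assms in auto)
  then show "sn \<gamma> u \<le> B" by (rule power2_le_imp_le) (rule assms)
qed

lemma sobolev_scale:
  assumes "u \<in> sobolev e k \<gamma>" shows "c *\<^sub>R u \<in> sobolev e k \<gamma>" "sn \<gamma> (c *\<^sub>R u) \<le> \<bar>c\<bar> * sn \<gamma> u"
proof -
  have *: "(\<Sum>z\<in>F. wgt \<gamma> z * (e z \<bullet> (c *\<^sub>R u))\<^sup>2) \<le> (\<bar>c\<bar> * sn \<gamma> u)\<^sup>2" if "finite F" for F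
  proof -
    have "(\<Sum>z\<in>F. wgt \<gamma> z * (e z \<bullet> (c *\<^sub>R u))\<^sup>2) = c\<^sup>2 * (\<Sum>z\<in>F. wgt \<gamma> z * (e z \<bullet> u)\<^sup>2)"
      by (simp add: sum_distrib_left power_mult_distrib mult_ac)
    also have "\<dots> \<le> c\<^sup>2 * (sn \<gamma> u)\<^sup>2" using sn_partial[OF assms that] by (intro mult_left_mono) auto
    finally show ?thesis by (simp add: power_mult_distrib)
  qed
  have "c *\<^sub>R u \<in> df_space" using sobolev_df[OF assms] subspace_df_space by (auto intro: subspace_scale)
  from sobolevI[OF this *] show "c *\<^sub>R u \<in> sobolev e k \<gamma>" "sn \<gamma> (c *\<^sub>R u) \<le> \<bar>c\<bar> * sn \<gamma> u" by simp_all
qed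

lemma sobolev_add:
  assumes "u \<in> sobolev e k \<gamma>" "v \<in> sobolev e k \<gamma>"
  shows "u + v \<in> sobolev e k \<gamma>" "sn \<gamma> (u + v) \<le> sn \<gamma> u + sn \<gamma> v"
proof -
  have *: "(\<Sum>z\<in>F. wgt \<gamma> z * (e z \<bullet> (u + v))\<^sup>2) \<le> (sn \<gamma> u + sn \<gamma> v)\<^sup>2" if F: "finite F" for F
  proof -
    define c where "c u z = sqrt (wgt \<gamma> z) * (e z \<bullet> u)" for u z
    have cs: "(c u z)\<^sup>2 = wgt \<gamma> z * (e z \<bullet> u)\<^sup>2" for u z
      by (simp add: c_def power_mult_distrib)
    have L: "L2_set (c w) F \<le> sn \<gamma> w" if "w \<in> sobolev e k \<gamma>" for w
      unfolding L2_set_def cs using sn_partial[OF that F] by (intro real_le_lsqrt) (auto intro: sum_nonneg)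
    have "c (u + v) = (\<lambda>z. c u z + c v z)"
      by (auto simp: c_def inner_add_right distrib_left fun_eq_iff)
    then have "L2_set (c (u + v)) F = L2_set (\<lambda>z. c u z + c v z) F" by (simp only:)
    also have "\<dots> \<le> L2_set (c u) F + L2_set (c v) F" by (rule L2_set_triangle_ineq)
    also have "\<dots> \<le> sn \<gamma> u + sn \<gamma> v" by (intro add_mono L assms)
    finally have "(L2_set (c (u + v)) F)\<^sup>2 \<le> (sn \<gamma> u + sn \<gamma> v)\<^sup>2" by (rule power_mono) (rule L2_set_nonneg)
    then show ?thesis unfolding L2_set_def cs by (simp add: sum_nonneg)
  qed
  have "u + v \<in> df_space" using sobolev_df assms subspace_df_space by (auto intro: subspace_add)
  from sobolevI[OF this *] show "u + v \<in> sobolev e k \<gamma>" "sn \<gamma> (u + v) \<le> sn \<gamma> u + sn \<gamma> v" by simp_all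
qed

lemma sn_minus: "sn \<gamma> (u - v) = sn \<gamma> (v - u)"
  by (simp add: sobolev_norm_def inner_diff_right power2_commute)

lemma sobolev_diff:
  assumes "u \<in> sobolev e k \<gamma>" "v \<in> sobolev e k \<gamma>"
  shows "u - v \<in> sobolev e k \<gamma>" "sn \<gamma> (u - v) \<le> sn \<gamma> u + sn \<gamma> v"
  using sobolev_add[OF assms(1) sobolev_scale(1)[OF assms(2), of "-1"]] sobolev_scale(2)[OF assms(2), of "-1"] by simp_all

lemma sobolev_mono:
  assumes "u \<in> sobolev e k \<gamma>'" "\<gamma> \<le> \<gamma>'"
  shows "u \<in> sobolev e k \<gamma>" "sn \<gamma> u \<le> sn \<gamma>' u"
proof -
  have *: "(\<Sum>z\<in>F. wgt \<gamma> z * (e z \<bullet> u)\<^sup>2) \<le> (sn \<gamma>' u)\<^sup>2" if "finite F" for F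
  proof -
    have "(\<Sum>z\<in>F. wgt \<gamma> z * (e z \<bullet> u)\<^sup>2) \<le> (\<Sum>z\<in>F. wgt \<gamma>' z * (e z \<bullet> u)\<^sup>2)"
      using assms(2) by (intro sum_mono mult_right_mono powr_mono) auto
    then show ?thesis using sn_partial[OF assms(1) that] by simp
  qed
  from sobolevI[OF sobolev_df[OF assms(1)] *] show "u \<in> sobolev e k \<gamma>" "sn \<gamma> u \<le> sn \<gamma>' u" by simp_all
qed

lemma norm_le_sn:
  assumes "u \<in> sobolev e k \<gamma>" "0 \<le> \<gamma>" shows "norm u \<le> sn \<gamma> u"
proof -
  have "(norm u)\<^sup>2 \<le> (sn \<gamma> u)\<^sup>2"
  proof (rule has_sum_le_finite_sums[OF parseval[OF sobolev_df[OF assms(1)]]])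
    fix F :: "'z set" assume F: "finite F"
    have "(\<Sum>z\<in>F. (e z \<bullet> u)\<^sup>2) \<le> (\<Sum>z\<in>F. wgt \<gamma> z * (e z \<bullet> u)\<^sup>2)"
    proof (rule sum_mono)
      fix z
      have "1 * (e z \<bullet> u)\<^sup>2 \<le> wgt \<gamma> z * (e z \<bullet> u)\<^sup>2"
        by (rule mult_right_mono[OF ge_one_powr_ge_zero]) (use assms(2) in auto)
      then show "(e z \<bullet> u)\<^sup>2 \<le> wgt \<gamma> z * (e z \<bullet> u)\<^sup>2" by simp
    qed
    then show "(\<Sum>z\<in>F. (e z \<bullet> u)\<^sup>2) \<le> (sn \<gamma> u)\<^sup>2" using sn_partial[OF assms(1) F] by simp
  qed
  then show ?thesis by (rule power2_le_imp_le) simp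
qed

end

lemma has_sum_in_closed_subspace:
  assumes "(f has_sum s) UNIV" "subspace S" "closed S" "\<And>z. f z \<in> S"
  shows "s \<in> S"
proof (rule Lim_in_closed_set[OF assms(3)])
  show "\<forall>\<^sub>F F in finite_subsets_at_top UNIV. sum f F \<in> S"
    by (rule always_eventually) (use assms in \<open>auto intro: subspace_sum\<close>)
  show "(sum f \<longlongrightarrow> s) (finite_subsets_at_top UNIV)" using assms(1) by (simp only: has_sum_def)
qed simp

lemma closed_df_space: "closed df_space" unfolding df_space_def by (rule closed_closure)

lemma laplace_wave:
  "(\<Sum>i\<in>UNIV. u \<bullet> field_of (pderiv_at i (pderiv_at i (wave (wave_vec m) a b))))
    = - (norm (wave_vec m))\<^sup>2 * (u \<bullet> field_of (wave (wave_vec m) a b))"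
proof -
  define \<kappa> where "\<kappa> = wave_vec m"
  have sq: "sq_integrable (wave \<kappa> a b)" unfolding \<kappa>_def
    by (rule smooth_periodic_sq_integrable[OF smooth_periodic_wave])
  have "pderiv_at i (pderiv_at i (wave \<kappa> a b)) = (\<lambda>x. - (\<kappa> $ i)\<^sup>2 *\<^sub>R wave \<kappa> a b x)" for i
    by (simp add: pderiv_wave) (auto simp: wave_def algebra_simps power2_eq_square)
  then have "u \<bullet> field_of (pderiv_at i (pderiv_at i (wave \<kappa> a b))) = - (\<kappa> $ i)\<^sup>2 * (u \<bullet> field_of (wave \<kappa> a b))" for i
    by (simp only: field_of_scaleR[OF sq] inner_scaleR_right)
  then have "(\<Sum>i\<in>UNIV. u \<bullet> field_of (pderiv_at i (pderiv_at i (wave \<kappa> a b))))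
      = (\<Sum>i\<in>UNIV. - (\<kappa> $ i)\<^sup>2) * (u \<bullet> field_of (wave \<kappa> a b))"
    by (simp add: sum_distrib_right)
  also have "(\<Sum>i\<in>UNIV. - (\<kappa> $ i)\<^sup>2) = - (norm \<kappa>)\<^sup>2"
    unfolding power2_norm_eq_inner inner_vec_def by (simp add: power2_eq_square sum_negf)
  finally show ?thesis unfolding \<kappa>_def .
qed

text \<open>The Laplacian is symmetric and both waves are eigenfunctions, with distinct
  eigenvalues.\<close>

lemma wave_orthogonal:
  assumes "norm (wave_vec m) \<noteq> norm (wave_vec m')"
  shows "field_of (wave (wave_vec m) a b) \<bullet> field_of (wave (wave_vec m') c d) = 0"
proof -
  define f g where "f = wave (wave_vec m) a b" and "g = wave (wave_vec m') c d"
  have sf: "smooth_periodic f" "smooth_periodic g" unfolding f_def g_def by (rule smooth_periodic_wave)+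
  have "field_of f \<bullet> field_of (pderiv_at i (pderiv_at i g)) = field_of g \<bullet> field_of (pderiv_at i (pderiv_at i f))" for i
    using smooth_periodic_integration_by_parts[OF sf(1) smooth_periodic_pderiv[OF sf(2), of i], of i]
      smooth_periodic_integration_by_parts[OF sf(2) smooth_periodic_pderiv[OF sf(1), of i], of i]
    by (simp add: inner_commute)
  then have "(\<Sum>i\<in>UNIV. field_of f \<bullet> field_of (pderiv_at i (pderiv_at i g)))
      = (\<Sum>i\<in>UNIV. field_of g \<bullet> field_of (pderiv_at i (pderiv_at i f)))" by simp
  then have "(norm (wave_vec m'))\<^sup>2 * (field_of f \<bullet> field_of g) = (norm (wave_vec m))\<^sup>2 * (field_of f \<bullet> field_of g)"
    unfolding f_def g_def laplace_wave by (simp add: inner_commute)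
  then have "((norm (wave_vec m'))\<^sup>2 - (norm (wave_vec m))\<^sup>2) * (field_of f \<bullet> field_of g) = 0"
    by (simp add: algebra_simps)
  moreover have "(norm (wave_vec m'))\<^sup>2 \<noteq> (norm (wave_vec m))\<^sup>2"
    using assms power2_eq_imp_eq[OF _ norm_ge_zero norm_ge_zero] by metis
  ultimately show ?thesis by (simp add: f_def g_def)
qed

context plane_waves
begin

text \<open>The derivatives \<open>de i z\<close> are orthogonal with norm |freq_i|, dominated by
  the H^1 weight, so the differentiated Fourier series converges in L^2 and its sum is the weak
  derivative.\<close>

lemma sobolev_weak_deriv:
  assumes u: "u \<in> sobolev e k \<gamma>" and \<gamma>: "1 \<le> \<gamma>"
  shows "((\<lambda>z. (e z \<bullet> u) *\<^sub>R de i z) has_sum weak_deriv i u) UNIV"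
    and "has_weak_deriv i u (weak_deriv i u)"
    and "norm (weak_deriv i u) \<le> sn 1 u"
proof -
  note u1 = sobolev_mono(1)[OF u \<gamma>]
  have orth: "((e z \<bullet> u) *\<^sub>R de i z) \<bullet> ((e z' \<bullet> u) *\<^sub>R de i z') = 0" if "z \<noteq> z'" for z z'
    using that by (simp add: de_inner)
  have nrm: "(norm ((e z \<bullet> u) *\<^sub>R de i z))\<^sup>2 = (freq z $ i)\<^sup>2 * (e z \<bullet> u)\<^sup>2" for z
    using de_inner[of i z z] by (simp add: power_mult_distrib power2_norm_eq_inner)
  have le: "(norm ((e z \<bullet> u) *\<^sub>R de i z))\<^sup>2 \<le> wgt 1 z * (e z \<bullet> u)\<^sup>2" for z
    unfolding nrm wgt_simps using freq_component[of z i] by (intro mult_right_mono) auto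
  have sq: "(\<lambda>z. (norm ((e z \<bullet> u) *\<^sub>R de i z))\<^sup>2) summable_on UNIV"
    by (rule summable_on_comparison_test[OF sobolev_summable[OF u1]]) (use le in auto)
  from has_sum_infsum[OF orthogonal_summable_on[OF orth sq]]
  have hs: "((\<lambda>z. (e z \<bullet> u) *\<^sub>R de i z) has_sum (\<Sum>\<^sub>\<infinity>z. (e z \<bullet> u) *\<^sub>R de i z)) UNIV" by simp
  have w: "has_weak_deriv i u (\<Sum>\<^sub>\<infinity>z. (e z \<bullet> u) *\<^sub>R de i z)"
    by (rule has_weak_deriv_has_sum[OF fourier_has_sum[OF sobolev_df[OF u]] hs])
      (rule has_weak_deriv_scaleR[OF weak_deriv_e])
  note wd = weak_deriv_eqI[OF w]
  show hs': "((\<lambda>z. (e z \<bullet> u) *\<^sub>R de i z) has_sum weak_deriv i u) UNIV" unfolding wd by (rule hs)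
  show "has_weak_deriv i u (weak_deriv i u)" unfolding wd by (rule w)
  have "(norm (weak_deriv i u))\<^sup>2 \<le> (sn 1 u)\<^sup>2"
  proof (rule has_sum_le_finite_sums[OF orthogonal_norm_has_sum[OF orth hs']])
    fix F :: "'z set" assume F: "finite F"
    have "(\<Sum>z\<in>F. (norm ((e z \<bullet> u) *\<^sub>R de i z))\<^sup>2) \<le> (\<Sum>z\<in>F. wgt 1 z * (e z \<bullet> u)\<^sup>2)"
      by (intro sum_mono le)
    then show "(\<Sum>z\<in>F. (norm ((e z \<bullet> u) *\<^sub>R de i z))\<^sup>2) \<le> (sn 1 u)\<^sup>2"
      using sn_partial[OF u1 F] by linarith
  qed
  then show "norm (weak_deriv i u) \<le> sn 1 u" by (rule power2_le_imp_le) simp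
qed

lemma sobolev2_weak_deriv2:
  assumes u: "u \<in> sobolev e k 2"
  shows "has_weak_deriv i (weak_deriv i u) (weak_deriv i (weak_deriv i u))"
    and "weak_deriv i (weak_deriv i u) \<in> df_space"
proof -
  define v where "v z = (e z \<bullet> u) *\<^sub>R (- (freq z $ i)\<^sup>2 *\<^sub>R e z)" for z
  have orth: "v z \<bullet> v z' = 0" if "z \<noteq> z'" for z z'
    using that by (simp add: v_def e_inner)
  have le: "(norm (v z))\<^sup>2 \<le> wgt 2 z * (e z \<bullet> u)\<^sup>2" for z
  proof -
    have "(norm (v z))\<^sup>2 = ((freq z $ i)\<^sup>2)\<^sup>2 * (e z \<bullet> u)\<^sup>2"
      by (simp add: v_def power_mult_distrib)
    also have "((freq z $ i)\<^sup>2)\<^sup>2 \<le> (1 + eigval k z)\<^sup>2"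
      using freq_component[of z i] by (intro power_mono) auto
    finally show ?thesis unfolding wgt_simps by (simp add: mult_right_mono)
  qed
  have sq: "(\<lambda>z. (norm (v z))\<^sup>2) summable_on UNIV"
    by (rule summable_on_comparison_test[OF sobolev_summable[OF u]]) (use le in auto)
  have hs: "(v has_sum (infsum v UNIV)) UNIV"
    by (rule has_sum_infsum[OF orthogonal_summable_on[OF orth sq]])
  have w: "has_weak_deriv i (weak_deriv i u) (infsum v UNIV)"
    by (rule has_weak_deriv_has_sum[OF sobolev_weak_deriv(1)[OF u, of i] hs])
      (auto simp only: v_def intro!: has_weak_deriv_scaleR[OF weak_deriv_de])
  note wd = weak_deriv_eqI[OF w]
  show "has_weak_deriv i (weak_deriv i u) (weak_deriv i (weak_deriv i u))" unfolding wd by (rule w)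
  show "weak_deriv i (weak_deriv i u) \<in> df_space" unfolding wd
    by (rule has_sum_in_closed_subspace[OF hs subspace_df_space closed_df_space])
      (simp only: v_def, intro subspace_scale[OF subspace_df_space] e_df)
qed

lemma stokes_df:
  assumes "u \<in> sobolev e k 2" shows "stokes u = - laplace u" "stokes u \<in> df_space"
proof -
  have l: "laplace u \<in> df_space" unfolding laplace_def
    by (intro subspace_sum subspace_df_space sobolev2_weak_deriv2 assms)
  then show *: "stokes u = - laplace u" unfolding stokes_def by (simp add: leray_df_space)
  show "stokes u \<in> df_space" unfolding * by (rule subspace_neg[OF subspace_df_space l])
qed

text \<open>The projection acts trivially on H^2, so both derivatives move onto the test field; the
  right-hand side is continuous in u with respect to L^2.\<close>

lemma stokes_smooth:
  assumes u: "u \<in> sobolev e k 2" and \<phi>: "smooth_periodic \<phi>"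
  shows "stokes u \<bullet> field_of \<phi> = - (\<Sum>i\<in>UNIV. u \<bullet> field_of (pderiv_at i (pderiv_at i \<phi>)))"
proof -
  have "weak_deriv i (weak_deriv i u) \<bullet> field_of \<phi> = u \<bullet> field_of (pderiv_at i (pderiv_at i \<phi>))" for i
  proof -
    have "weak_deriv i u \<bullet> field_of (pderiv_at i \<phi>) = - (weak_deriv i (weak_deriv i u) \<bullet> field_of \<phi>)"
      using sobolev2_weak_deriv2(1)[OF u, of i] \<phi> unfolding has_weak_deriv_def by simp
    moreover have "u \<bullet> field_of (pderiv_at i (pderiv_at i \<phi>)) = - (weak_deriv i u \<bullet> field_of (pderiv_at i \<phi>))"
      using sobolev_weak_deriv(2)[OF u, of i] smooth_periodic_pderiv[OF \<phi>] unfolding has_weak_deriv_def by simp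
    ultimately show ?thesis by simp
  qed
  then show ?thesis unfolding stokes_df(1)[OF u] laplace_def by (simp add: inner_sum_left)
qed

lemma stokes_wave:
  assumes u: "u \<in> sobolev e k 2"
  shows "stokes u \<bullet> field_of (wave (freq z) a b) = eigval k z * (u \<bullet> field_of (wave (freq z) a b))"
  unfolding freq_def stokes_smooth[OF u smooth_periodic_wave] laplace_wave by (simp add: eigval_def)

lemma stokes_e: "u \<in> sobolev e k 2 \<Longrightarrow> stokes u \<bullet> field_of (ew z) = eigval k z * (u \<bullet> e z)"
  using stokes_wave[of u z] amp(1)[of z] by (simp only: ew_def)

lemma norm_stokes:
  assumes u: "u \<in> sobolev e k 2" shows "norm (stokes u) \<le> sn 2 u"
proof -
  have c: "e z \<bullet> stokes u = eigval k z * (e z \<bullet> u)" for z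
    using stokes_e[OF u, of z] amp(1)[of z] by (simp add: inner_commute)
  have "(norm (stokes u))\<^sup>2 \<le> (sn 2 u)\<^sup>2"
  proof (rule has_sum_le_finite_sums[OF parseval[OF stokes_df(2)[OF u]]])
    fix F :: "'z set" assume F: "finite F"
    have "(\<Sum>z\<in>F. (e z \<bullet> stokes u)\<^sup>2) \<le> (\<Sum>z\<in>F. wgt 2 z * (e z \<bullet> u)\<^sup>2)"
      unfolding c wgt_simps power_mult_distrib by (intro sum_mono mult_right_mono power_mono) auto
    then show "(\<Sum>z\<in>F. (e z \<bullet> stokes u)\<^sup>2) \<le> (sn 2 u)\<^sup>2" using sn_partial[OF u F] by linarith
  qed
  then show ?thesis by (rule power2_le_imp_le) simp
qed

lemma proj_smooth:
  assumes "finite F"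
  obtains s where "s \<in> smooth_df" "field_of s = proj F u" "s = (\<lambda>x. \<Sum>z\<in>F. (e z \<bullet> u) *\<^sub>R ew z x)"
proof
  define s where "s = (\<lambda>x. \<Sum>z\<in>F. (e z \<bullet> u) *\<^sub>R ew z x)"
  have "s \<in> smooth_df \<and> field_of s = (\<Sum>z\<in>F. (e z \<bullet> u) *\<^sub>R field_of (ew z))"
    unfolding s_def by (rule field_of_smooth_sum[OF assms]) (rule ew_df)
  then show "s \<in> smooth_df" "field_of s = proj F u"
    by (simp_all only: proj_def amp(1)[symmetric])
  show "s = (\<lambda>x. \<Sum>z\<in>F. (e z \<bullet> u) *\<^sub>R ew z x)" by (rule s_def)
qed

lemma weak_deriv_proj: "finite F \<Longrightarrow> has_weak_deriv i (proj F u) (\<Sum>z\<in>F. (e z \<bullet> u) *\<^sub>R de i z)"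
  using weak_deriv_e unfolding has_weak_deriv_def proj_def
  by (simp add: inner_sum_left sum_negf)

lemma proj_tendsto: "u \<in> df_space \<Longrightarrow> ((\<lambda>F. proj F u) \<longlongrightarrow> u) (finite_subsets_at_top UNIV)"
  using fourier_has_sum[of u] by (simp only: has_sum_def proj_def)

text \<open>The identity holds for Fourier truncations, which are smooth. Both sides pass to the
  limit, the left because the derivatives converge in L^2 for u in H^1.\<close>

lemma advection_divergence_form:
  assumes u: "u \<in> sobolev e k 1" and \<phi>: "smooth_periodic \<phi>"
  shows "advection u \<phi> = - (\<Sum>i\<in>UNIV. tri i u u (pderiv_at i \<phi>))"
proof -
  obtain K where K: "0 \<le> K" "\<And>x. x \<in> cell \<Longrightarrow> norm (\<phi> x) \<le> K"
    using smooth_periodic_bounded[OF \<phi>] by auto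
  have "\<exists>L. 0 \<le> L \<and> (\<forall>x\<in>cell. norm (pderiv_at i \<phi> x) \<le> L)" for i
    using smooth_periodic_bounded[OF smooth_periodic_pderiv[OF \<phi>, of i]] by blast
  then have "\<forall>i. \<exists>L. 0 \<le> L \<and> (\<forall>x\<in>cell. norm (pderiv_at i \<phi> x) \<le> L)" by simp
  from choice[OF this] obtain L where L: "\<And>i. 0 \<le> L i" "\<And>i x. x \<in> cell \<Longrightarrow> norm (pderiv_at i \<phi> x) \<le> L i" by auto
  let ?A = "finite_subsets_at_top (UNIV :: 'z set)"
  note pu = proj_tendsto[OF sobolev_df[OF u]]
  have pd: "((\<lambda>F. \<Sum>z\<in>F. (e z \<bullet> u) *\<^sub>R de i z) \<longlongrightarrow> weak_deriv i u) ?A" for i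
    using sobolev_weak_deriv(1)[OF u] by (simp add: has_sum_def)
  have 1: "((\<lambda>F. \<Sum>i\<in>UNIV. tri i (proj F u) (\<Sum>z\<in>F. (e z \<bullet> u) *\<^sub>R de i z) \<phi>) \<longlongrightarrow> (\<Sum>i\<in>UNIV. tri i u (weak_deriv i u) \<phi>)) ?A"
    by (rule tendsto_sum) (rule tri_tendsto[OF smooth_periodic_torus[OF \<phi>] K(2) K(1) pu pd])
  have 2: "((\<lambda>F. - (\<Sum>i\<in>UNIV. tri i (proj F u) (proj F u) (pderiv_at i \<phi>))) \<longlongrightarrow> - (\<Sum>i\<in>UNIV. tri i u u (pderiv_at i \<phi>))) ?A"
    by (rule tendsto_minus, rule tendsto_sum)
      (rule tri_tendsto[OF smooth_periodic_torus[OF smooth_periodic_pderiv[OF \<phi>]] L(2) L(1) pu pu])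
  have eq: "(\<Sum>i\<in>UNIV. tri i (proj F u) (\<Sum>z\<in>F. (e z \<bullet> u) *\<^sub>R de i z) \<phi>)
      = - (\<Sum>i\<in>UNIV. tri i (proj F u) (proj F u) (pderiv_at i \<phi>))" if F: "finite F" for F
  proof -
    obtain s where s: "s \<in> smooth_df" "field_of s = proj F u" by (rule proj_smooth[OF F])
    have "field_of (pderiv_at i s) = (\<Sum>z\<in>F. (e z \<bullet> u) *\<^sub>R de i z)" for i
    proof -
      have "has_weak_deriv i (proj F u) (field_of (pderiv_at i s))"
        unfolding s(2)[symmetric] by (rule has_weak_deriv_smooth[OF smooth_dfD(1)[OF s(1)]])
      from weak_deriv_eqI[OF this] weak_deriv_eqI[OF weak_deriv_proj[OF F]] show ?thesis by simp
    qed
    then show ?thesis using tri_smooth_divergence_form[OF s(1) \<phi>] unfolding s(2) by simp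
  qed
  have "((\<lambda>F. \<Sum>i\<in>UNIV. tri i (proj F u) (\<Sum>z\<in>F. (e z \<bullet> u) *\<^sub>R de i z) \<phi>) \<longlongrightarrow> - (\<Sum>i\<in>UNIV. tri i u u (pderiv_at i \<phi>))) ?A"
    by (rule Lim_transform_eventually[OF 2], rule eventually_finite_subsets_at_top_weakI) (use eq in simp)
  from tendsto_unique[OF _ 1 this] show ?thesis unfolding advection_tri[OF \<phi>] by simp
qed

lemma advection_bound:
  assumes u: "u \<in> sobolev e k 1" and \<phi>: "smooth_periodic \<phi>"
    and K: "\<And>x. x \<in> cell \<Longrightarrow> norm (\<phi> x) \<le> K" "0 \<le> K"
  shows "\<bar>advection u \<phi>\<bar> \<le> 3 * K * (sn 1 u)\<^sup>2"
proof -
  have "\<bar>tri i u (weak_deriv i u) \<phi>\<bar> \<le> K * (sn 1 u)\<^sup>2" for i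
  proof -
    have "\<bar>tri i u (weak_deriv i u) \<phi>\<bar> \<le> K * norm u * norm (weak_deriv i u)"
      by (rule tri_bound[OF smooth_periodic_torus[OF \<phi>] K])
    also have "\<dots> \<le> K * sn 1 u * sn 1 u"
      using norm_le_sn[OF u] sobolev_weak_deriv(3)[OF u] K(2) by (intro mult_mono) auto
    finally show ?thesis by (simp add: power2_eq_square)
  qed
  then have "(\<Sum>i\<in>UNIV. \<bar>tri i u (weak_deriv i u) \<phi>\<bar>) \<le> (\<Sum>i\<in>(UNIV :: 3 set). K * (sn 1 u)\<^sup>2)" by (intro sum_mono) auto
  then show ?thesis unfolding advection_tri[OF \<phi>]
    using order_trans[OF sum_abs] by (fastforce simp: mult.assoc)
qed

text \<open>The embedding constant of H^2 into bounded fields: \<open>sqrt S2\<close> from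
  Cauchy-Schwarz on the Fourier coefficients, 2 from \<open>norm_ew\<close>.\<close>

definition C2 :: real where "C2 = 2 * sqrt S2"

lemma C2_nonneg: "0 \<le> C2" by (simp add: C2_def S2_nonneg)

lemma proj_sup_bound:
  assumes F: "finite F" and u: "u \<in> sobolev e k 2"
  shows "norm (\<Sum>z\<in>F. (e z \<bullet> u) *\<^sub>R ew z x) \<le> C2 * sn 2 u"
proof -
  have "norm (\<Sum>z\<in>F. (e z \<bullet> u) *\<^sub>R ew z x) \<le> (\<Sum>z\<in>F. norm ((e z \<bullet> u) *\<^sub>R ew z x))" by (rule norm_sum)
  also have "\<dots> \<le> (\<Sum>z\<in>F. \<bar>e z \<bullet> u\<bar> * 2)"
    by (intro sum_mono) (auto intro!: mult_left_mono norm_ew)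
  also have "\<dots> = 2 * (\<Sum>z\<in>F. \<bar>inverse (1 + eigval k z)\<bar> * \<bar>(1 + eigval k z) * (e z \<bullet> u)\<bar>)"
  proof -
    have "0 < 1 + eigval k z" for z using eigval_nonneg[of z] by linarith
    then have "\<bar>inverse (1 + eigval k z)\<bar> * \<bar>(1 + eigval k z) * (e z \<bullet> u)\<bar> = \<bar>e z \<bullet> u\<bar>" for z
      by (simp add: abs_mult less_imp_neq[symmetric] mult.assoc[symmetric])
    then show ?thesis by (simp add: sum_distrib_left mult.commute)
  qed
  also have "\<dots> \<le> 2 * (L2_set (\<lambda>z. inverse (1 + eigval k z)) F * L2_set (\<lambda>z. (1 + eigval k z) * (e z \<bullet> u)) F)"
    by (intro mult_left_mono L2_set_mult_ineq) auto
  also have "\<dots> \<le> 2 * (sqrt S2 * sn 2 u)"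
  proof (intro mult_left_mono mult_mono)
    have "(inverse (1 + eigval k z))\<^sup>2 = (1 + eigval k z) powr (- 2)" for z
      using eigval_nonneg[of z] by (simp add: powr_minus powr_numeral power_inverse)
    then show "L2_set (\<lambda>z. inverse (1 + eigval k z)) F \<le> sqrt S2"
      unfolding L2_set_def using S2_sum[OF F] by simp
    show "L2_set (\<lambda>z. (1 + eigval k z) * (e z \<bullet> u)) F \<le> sn 2 u"
      unfolding L2_set_def power_mult_distrib using sn_partial[OF u F] unfolding wgt_simps
      by (intro real_le_lsqrt) (auto intro: sum_nonneg)
  qed (auto simp: S2_nonneg L2_set_nonneg)
  finally show ?thesis by (simp add: C2_def)
qed

text \<open>Truncations of v have representatives bounded by \<open>C2 * sn 2 v\<close>. The bound
  is uniform and \<open>tri\<close> is continuous in L^2, so it survives the limit.\<close>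

lemma tri_bound_sobolev:
  assumes \<psi>: "\<psi> \<in> borel_measurable torus" "\<And>x. x \<in> cell \<Longrightarrow> norm (\<psi> x) \<le> K" "0 \<le> K"
    and v: "v \<in> sobolev e k 2"
  shows "\<bar>tri i u v \<psi>\<bar> \<le> C2 * sn 2 v * norm u * norm (field_of \<psi>)"
    and "\<bar>tri i v u \<psi>\<bar> \<le> C2 * sn 2 v * norm u * norm (field_of \<psi>)"
proof -
  note pv = proj_tendsto[OF sobolev_df[OF v]]
  have L: "0 \<le> C2 * sn 2 v" using C2_nonneg by simp
  have b: "\<bar>tri i u (proj F v) \<psi>\<bar> \<le> C2 * sn 2 v * norm u * norm (field_of \<psi>) \<and>
    \<bar>tri i (proj F v) u \<psi>\<bar> \<le> C2 * sn 2 v * norm u * norm (field_of \<psi>)" if F: "finite F" for F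
  proof -
    obtain s where s: "s \<in> smooth_df" "field_of s = proj F v" "s = (\<lambda>x. \<Sum>z\<in>F. (e z \<bullet> v) *\<^sub>R ew z x)"
      by (rule proj_smooth[OF F])
    have sb: "norm (s x) \<le> C2 * sn 2 v" for x unfolding s(3) by (rule proj_sup_bound[OF F v])
    note sm = smooth_periodic_torus[OF smooth_dfD(1)[OF s(1)]]
    show ?thesis unfolding s(2)[symmetric]
      using tri_bound_bounded_right[OF \<psi> sm sb L] tri_bound_bounded_left[OF \<psi> sm sb L] by blast
  qed
  have ev: "\<forall>\<^sub>F F in finite_subsets_at_top (UNIV :: 'z set). finite F"
    by (rule eventually_finite_subsets_at_top_weakI)
  show "\<bar>tri i u v \<psi>\<bar> \<le> C2 * sn 2 v * norm u * norm (field_of \<psi>)"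
    by (rule tendsto_upperbound[OF tendsto_rabs[OF tri_tendsto[OF \<psi> tendsto_const pv]]])
      (use b in \<open>auto intro: eventually_mono[OF ev]\<close>)
  show "\<bar>tri i v u \<psi>\<bar> \<le> C2 * sn 2 v * norm u * norm (field_of \<psi>)"
    by (rule tendsto_upperbound[OF tendsto_rabs[OF tri_tendsto[OF \<psi> pv tendsto_const]]])
      (use b in \<open>auto intro: eventually_mono[OF ev]\<close>)
qed

text \<open>In contrast to \<open>advection_bound\<close> only the L^2 norm of the test field
  enters, at the price of the H^2 norm of u; this controls remainders of Fourier expansions of test
  fields.\<close>

lemma advection_bound_L2:
  assumes u: "u \<in> sobolev e k 2" and \<phi>: "smooth_periodic \<phi>"
  shows "\<bar>advection u \<phi>\<bar> \<le> 3 * C2 * (sn 2 u)\<^sup>2 * norm (field_of \<phi>)"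
proof -
  obtain K where K: "0 \<le> K" "\<And>x. x \<in> cell \<Longrightarrow> norm (\<phi> x) \<le> K"
    using smooth_periodic_bounded[OF \<phi>] by auto
  have "\<bar>tri i u (weak_deriv i u) \<phi>\<bar> \<le> C2 * (sn 2 u)\<^sup>2 * norm (field_of \<phi>)" for i
  proof -
    have "\<bar>tri i u (weak_deriv i u) \<phi>\<bar> \<le> C2 * sn 2 u * norm (weak_deriv i u) * norm (field_of \<phi>)"
      by (rule tri_bound_sobolev(2)[OF smooth_periodic_torus[OF \<phi>] K(2) K(1) u])
    also have "\<dots> \<le> C2 * sn 2 u * sn 2 u * norm (field_of \<phi>)"
    proof (intro mult_right_mono mult_left_mono)
      show "norm (weak_deriv i u) \<le> sn 2 u"
        using sobolev_weak_deriv(3)[OF u, of i] sobolev_mono(2)[OF u, of 1] by simp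
    qed (auto simp: C2_nonneg)
    finally show ?thesis by (simp add: power2_eq_square mult.assoc)
  qed
  then have "(\<Sum>i\<in>UNIV. \<bar>tri i u (weak_deriv i u) \<phi>\<bar>) \<le> (\<Sum>i\<in>(UNIV :: 3 set). C2 * (sn 2 u)\<^sup>2 * norm (field_of \<phi>))"
    by (intro sum_mono) auto
  then show ?thesis unfolding advection_tri[OF \<phi>]
    using order_trans[OF sum_abs] by (fastforce simp: mult.assoc)
qed

text \<open>By parts, the frequency times the coefficient of u along \<open>fw z\<close> is a
  coefficient of a weak derivative. A field bounded in H^1 thus has a coefficient of order
  1/|freq|.\<close>

lemma weak_deriv_fw:
  assumes u: "u \<in> sobolev e k 1"
  shows "\<bar>freq z $ i\<bar> * \<bar>u \<bullet> field_of (fw z)\<bar> \<le> sn 1 u"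
proof -
  have "u \<bullet> de i z = - (weak_deriv i u \<bullet> field_of (ew z))"
    using sobolev_weak_deriv(2)[OF u, of i] ew_smooth[of z] unfolding has_weak_deriv_def de_def by simp
  then have "freq z $ i * (u \<bullet> field_of (fw z)) = weak_deriv i u \<bullet> e z"
    using amp(1)[of z] by (simp add: de_fw)
  then have "\<bar>freq z $ i\<bar> * \<bar>u \<bullet> field_of (fw z)\<bar> = \<bar>weak_deriv i u \<bullet> e z\<bar>"
    by (simp only: abs_mult[symmetric])
  also have "\<dots> \<le> norm (weak_deriv i u) * norm (e z)" by (rule Cauchy_Schwarz_ineq2)
  also have "\<dots> \<le> sn 1 u" using sobolev_weak_deriv(3)[OF u, of i] by simp
  finally show ?thesis .
qed

text \<open>The i-th derivative of \<open>fw z\<close> is \<open>freq z $ i\<close> times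
  \<open>e z\<close>, and only i = 1 survives when the frequency lies on the first axis.\<close>

lemma noise_term_fw:
  assumes "freq z = axis 1 c"
  shows "noise_term e k \<beta> \<delta> B (fw z) t w = c * sqrtQ k \<beta> \<delta> z * B z 1 t w"
proof -
  have pd: "field_of (pderiv_at i (fw z)) = freq z $ i *\<^sub>R e z" for i
  proof -
    have "pderiv_at i (fw z) = (\<lambda>x. freq z $ i *\<^sub>R ew z x)" by (auto simp: pderiv_fw)
    then have "field_of (pderiv_at i (fw z)) = field_of (\<lambda>x. freq z $ i *\<^sub>R ew z x)" by (rule arg_cong)
    also have "\<dots> = freq z $ i *\<^sub>R field_of (ew z)"
      by (rule field_of_scaleR[OF smooth_periodic_sq_integrable[OF ew_smooth]])
    finally show ?thesis by (simp only: amp(1)[of z, symmetric])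
  qed
  have "noise_term e k \<beta> \<delta> B (fw z) t w
      = (\<Sum>\<^sub>\<infinity>p\<in>{(z, 1)}. case p of (z', i) \<Rightarrow> (field_of (pderiv_at i (fw z)) \<bullet> (sqrtQ k \<beta> \<delta> z' *\<^sub>R e z')) * B z' i t w)"
    unfolding noise_term_def pd
    by (rule infsum_cong_neutral) (auto simp: e_inner assms axis_def split: if_splits)
  also have "\<dots> = c * sqrtQ k \<beta> \<delta> z * B z 1 t w" by (simp add: pd e_inner assms)
  finally show ?thesis .
qed

text \<open>Waves with different |k| are orthogonal, so the gradient of \<open>ew z\<close> meets
  finitely many basis fields. Taking all eigenvalues up to that of z only adds zeros and gives an
  index set that is finite by \<open>finite_eigval\<close>.\<close>

lemma noise_term_ew:
  "noise_term e k \<beta> \<delta> B (ew z) t w =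
    (\<Sum>(z', i)\<in>{z'. eigval k z' \<le> eigval k z} \<times> UNIV. (de i z \<bullet> e z') * sqrtQ k \<beta> \<delta> z' * B z' i t w)"
proof -
  have z: "de i z \<bullet> e z' = 0" if "\<not> eigval k z' \<le> eigval k z" for i z'
  proof -
    have ne: "norm (wave_vec (k z)) \<noteq> norm (wave_vec (k z'))" using that by (auto simp: eigval_def)
    have "field_of (fw z) \<bullet> field_of (ew z') = 0"
      unfolding fw_def ew_def freq_def by (rule wave_orthogonal[OF ne])
    then show ?thesis using amp(1)[of z'] by (simp add: de_fw)
  qed
  have z': "eigval k z' \<le> eigval k z" if "de i z \<bullet> e z' \<noteq> 0" for i z'
    using z[of z' i] that by blast
  have "noise_term e k \<beta> \<delta> B (ew z) t w =
    (\<Sum>\<^sub>\<infinity>(z', i)\<in>{z'. eigval k z' \<le> eigval k z} \<times> UNIV. (de i z \<bullet> e z') * sqrtQ k \<beta> \<delta> z' * B z' i t w)"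
    unfolding noise_term_def de_def[symmetric]
    by (rule infsum_cong_neutral) (auto intro: z')
  also have "\<dots> = (\<Sum>(z', i)\<in>{z'. eigval k z' \<le> eigval k z} \<times> UNIV. (de i z \<bullet> e z') * sqrtQ k \<beta> \<delta> z' * B z' i t w)"
    by (rule infsum_finite) (auto intro!: finite_cartesian_product finite_eigval)
  finally show ?thesis .
qed

end

section \<open>Paths\<close>

lemma AE_lebesgue_iff_negligible:
  "(AE s in lebesgue. P (s :: real)) \<longleftrightarrow> negligible {s. \<not> P s}"
proof
  assume "AE s in lebesgue. P s"
  then obtain N where "N \<in> null_sets lebesgue" "{s \<in> space lebesgue. \<not> P s} \<subseteq> N"
    unfolding eventually_ae_filter by auto
  then show "negligible {s. \<not> P s}" by (auto simp: negligible_iff_null_sets[symmetric] intro: negligible_subset)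
next
  assume "negligible {s. \<not> P s}"
  then show "AE s in lebesgue. P s" by (intro AE_I'[of "{s. \<not> P s}"]) (auto simp: negligible_iff_null_sets)
qed

lemma AE_lebesgue_scale:
  assumes "AE s in lebesgue. P (s :: real)" "c \<noteq> 0" shows "AE s in lebesgue. P (s * c)"
proof -
  have "{s. \<not> P (s * c)} = (\<lambda>s. s / c) ` {s. \<not> P s}"
    using assms(2) by (auto simp: image_iff intro!: exI[of _ "_ * c"])
  moreover have "negligible ((\<lambda>s. s / c) ` {s. \<not> P s})"
    using assms(1) unfolding AE_lebesgue_iff_negligible
    by (intro negligible_differentiable_image_negligible bounded_linear_imp_differentiable_on bounded_linear_divide) auto
  ultimately show ?thesis unfolding AE_lebesgue_iff_negligible by simp
qed

text \<open>Optimising \<theta> at b/a recovers the triangle inequality from Young's inequality; the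
  shift by \<eta>/2 keeps the quotient defined when a or b vanishes.\<close>

lemma L2_triangle_aux:
  fixes a b c :: real
  assumes "0 \<le> a" "0 \<le> b" "0 \<le> c" "\<And>\<theta>. 0 < \<theta> \<Longrightarrow> c\<^sup>2 \<le> (1 + \<theta>) * a\<^sup>2 + (1 + 1 / \<theta>) * b\<^sup>2"
  shows "c \<le> a + b"
proof (rule field_le_epsilon)
  fix \<eta> :: real assume \<eta>: "0 < \<eta>"
  define a' b' where "a' = a + \<eta> / 2" and "b' = b + \<eta> / 2"
  have p: "0 < a'" "0 < b'" using assms \<eta> by (auto simp: a'_def b'_def)
  have "c\<^sup>2 \<le> (1 + b' / a') * a\<^sup>2 + (1 + 1 / (b' / a')) * b\<^sup>2" using p by (intro assms(4)) simp
  also have "\<dots> \<le> (1 + b' / a') * a'\<^sup>2 + (1 + 1 / (b' / a')) * b'\<^sup>2"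
    using p assms \<eta> by (intro add_mono mult_left_mono power_mono) (auto simp: a'_def b'_def)
  also have "\<dots> = (a' + b')\<^sup>2"
  proof -
    have "b' / a' * a'\<^sup>2 = a' * b'" "1 / (b' / a') * b'\<^sup>2 = a' * b'"
      using p by (simp_all add: power2_eq_square)
    then show ?thesis by (simp add: distrib_right power2_sum)
  qed
  finally have "c\<^sup>2 \<le> (a' + b')\<^sup>2" .
  then have "c \<le> a' + b'" by (rule power2_le_imp_le) (use p in linarith)
  then show "c \<le> a + b + \<eta>" by (simp add: a'_def b'_def)
qed

context plane_waves
begin

section \<open>Countable exhaustion of the index set\<close>

definition E :: "nat \<Rightarrow> 'z set" where "E n = from_nat_into UNIV ` {..n}"

lemma finite_E [simp]: "finite (E n)" by (simp add: E_def)

lemma E_mono: "m \<le> n \<Longrightarrow> E m \<subseteq> E n" by (auto simp: E_def)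

lemma E_covers: "finite F \<Longrightarrow> \<exists>n. F \<subseteq> E n"
proof (induction F rule: finite_induct)
  case (insert z F)
  then obtain n where n: "F \<subseteq> E n" by blast
  have "from_nat_into UNIV (to_nat_on UNIV z) = z"
    using countable_index by (intro from_nat_into_to_nat_on) auto
  then have "z \<in> E (to_nat_on UNIV z)" unfolding E_def by (metis atMost_iff image_eqI order_refl)
  then have "insert z F \<subseteq> E (max n (to_nat_on UNIV z))"
    using n E_mono[of n "max n (to_nat_on UNIV z)"] E_mono[of "to_nat_on UNIV z" "max n (to_nat_on UNIV z)"] by auto
  then show ?case by blast
qed simp

text \<open>Partial sums along a sequence of finite sets: they exhibit Sobolev norms as countable
  suprema and so make them Borel functions, and they allow dominated convergence.\<close>

definition psum :: "real \<Rightarrow> nat \<Rightarrow> vfield \<Rightarrow> real" where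
  "psum \<gamma> n u = (\<Sum>z\<in>E n. wgt \<gamma> z * (e z \<bullet> u)\<^sup>2)"

lemma psum_nonneg: "0 \<le> psum \<gamma> n u" unfolding psum_def by (intro sum_nonneg) simp

lemma psum_mono: "m \<le> n \<Longrightarrow> psum \<gamma> m u \<le> psum \<gamma> n u"
  unfolding psum_def by (intro sum_mono2 E_mono) auto

lemma sum_le_psum: "finite F \<Longrightarrow> \<exists>n. (\<Sum>z\<in>F. wgt \<gamma> z * (e z \<bullet> u)\<^sup>2) \<le> psum \<gamma> n u"
proof -
  assume "finite F"
  from E_covers[OF this] obtain n where "F \<subseteq> E n" by blast
  then have "(\<Sum>z\<in>F. wgt \<gamma> z * (e z \<bullet> u)\<^sup>2) \<le> psum \<gamma> n u" unfolding psum_def by (intro sum_mono2) auto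
  then show ?thesis by blast
qed

lemma psum_le: "u \<in> sobolev e k \<gamma> \<Longrightarrow> psum \<gamma> n u \<le> (sn \<gamma> u)\<^sup>2"
  unfolding psum_def by (rule sn_partial) auto

lemma sobolevI_psum:
  assumes "u \<in> df_space" "\<And>n. psum \<gamma> n u \<le> B\<^sup>2" "0 \<le> B"
  shows "u \<in> sobolev e k \<gamma>" "sn \<gamma> u \<le> B"
proof -
  have *: "(\<Sum>z\<in>F. wgt \<gamma> z * (e z \<bullet> u)\<^sup>2) \<le> B\<^sup>2" if F: "finite F" for F
    using sum_le_psum[OF F, of \<gamma> u] assms(2) order_trans by blast
  from sobolevI[OF assms(1) * assms(3)] show "u \<in> sobolev e k \<gamma>" "sn \<gamma> u \<le> B" by simp_all
qed

lemma psum_SUP_finite: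
  assumes "(SUP n. ennreal (psum \<gamma> n u)) \<noteq> \<infinity>"
  obtains b where "(SUP n. ennreal (psum \<gamma> n u)) = ennreal b"
    "\<And>F. finite F \<Longrightarrow> (\<Sum>z\<in>F. wgt \<gamma> z * (e z \<bullet> u)\<^sup>2) \<le> b"
proof
  define b where "b = enn2real (SUP n. ennreal (psum \<gamma> n u))"
  have "(SUP n. ennreal (psum \<gamma> n u)) < \<top>"
    using assms unfolding infinity_ennreal_def by (rule iffD1[OF top.not_eq_extremum])
  then show b: "(SUP n. ennreal (psum \<gamma> n u)) = ennreal b"
    unfolding b_def by (rule ennreal_enn2real[symmetric])
  fix F :: "'z set" assume "finite F"
  from sum_le_psum[OF this] obtain n where n: "(\<Sum>z\<in>F. wgt \<gamma> z * (e z \<bullet> u)\<^sup>2) \<le> psum \<gamma> n u" by blast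
  have "ennreal (psum \<gamma> n u) \<le> ennreal b" unfolding b[symmetric] by (rule SUP_upper) simp
  then have "psum \<gamma> n u \<le> b" by (simp add: b_def ennreal_le_iff)
  with n show "(\<Sum>z\<in>F. wgt \<gamma> z * (e z \<bullet> u)\<^sup>2) \<le> b" by linarith
qed

text \<open>Since \<open>enn2real \<infinity> = 0\<close> this also covers fields outside the Sobolev space, where the
  unconditional sum is zero by convention.\<close>

lemma sn_sq_SUP: "(sn \<gamma> u)\<^sup>2 = enn2real (SUP n. ennreal (psum \<gamma> n u))"
proof (cases "(SUP n. ennreal (psum \<gamma> n u)) = \<infinity>")
  case True
  have ns: "\<not> (\<lambda>z. wgt \<gamma> z * (e z \<bullet> u)\<^sup>2) summable_on UNIV"
  proof
    assume s: "(\<lambda>z. wgt \<gamma> z * (e z \<bullet> u)\<^sup>2) summable_on UNIV"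
    have "psum \<gamma> n u \<le> (sn \<gamma> u)\<^sup>2" for n
      unfolding sn_sq psum_def using s by (intro finite_sum_le_infsum) auto
    then have "(SUP n. ennreal (psum \<gamma> n u)) \<le> ennreal ((sn \<gamma> u)\<^sup>2)"
      by (intro SUP_least ennreal_leI)
    then show False using True by (simp add: top_unique)
  qed
  show ?thesis unfolding sn_sq True infsum_not_exists[OF ns] by simp
next
  case False
  then obtain b where b: "(SUP n. ennreal (psum \<gamma> n u)) = ennreal b"
    "\<And>F. finite F \<Longrightarrow> (\<Sum>z\<in>F. wgt \<gamma> z * (e z \<bullet> u)\<^sup>2) \<le> b" by (rule psum_SUP_finite) blast
  have b0: "0 \<le> b" using b(2)[of "{}"] by simp
  have s: "(\<lambda>z. wgt \<gamma> z * (e z \<bullet> u)\<^sup>2) summable_on UNIV"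
    by (rule nonneg_bdd_above_summable_on) (auto intro!: bdd_aboveI[of _ b] b(2))
  have "(sn \<gamma> u)\<^sup>2 \<le> b" unfolding sn_sq by (rule infsum_le_finite_sums[OF s b(2)])
  moreover have "psum \<gamma> n u \<le> (sn \<gamma> u)\<^sup>2" for n
    unfolding sn_sq psum_def using s by (intro finite_sum_le_infsum) auto
  then have "ennreal b \<le> ennreal ((sn \<gamma> u)\<^sup>2)"
    unfolding b(1)[symmetric] by (intro SUP_least ennreal_leI)
  then have "b \<le> (sn \<gamma> u)\<^sup>2" by (simp add: ennreal_le_iff)
  ultimately show ?thesis unfolding b(1) using b0 by simp
qed

lemma sn_zero [simp]: "sn \<gamma> 0 = 0" by (simp add: sobolev_norm_def)

text \<open>By \<open>sn_sq_SUP\<close> the squared norm comes from a countable supremum of finite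
  sums, each continuous along the path. The path itself is cut off to zero outside the interval, so
  that every coefficient is Borel on the whole line.\<close>

lemma sn_sq_measurable:
  fixes t :: real
  assumes x: "continuous_on {0..t} x"
  shows "(\<lambda>s. indicator {0..t} s * (sn \<gamma> (x s))\<^sup>2) \<in> borel_measurable borel"
proof -
  define y where "y s = indicator {0..t} s *\<^sub>R x s" for s :: real
  have [measurable]: "(\<lambda>s. e z \<bullet> y s) \<in> borel_measurable borel" for z
  proof -
    have "(\<lambda>s. indicator {0..t} s *\<^sub>R (e z \<bullet> x s)) \<in> borel_measurable borel"
      by (intro borel_measurable_continuous_on_indicator continuous_intros x) auto
    then show ?thesis by (simp add: y_def)
  qed
  have "(\<lambda>s. (sn \<gamma> (y s))\<^sup>2) \<in> borel_measurable borel"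
    unfolding sn_sq_SUP psum_def by measurable
  moreover have "(sn \<gamma> (y s))\<^sup>2 = indicator {0..t} s * (sn \<gamma> (x s))\<^sup>2" for s
    by (auto simp: y_def indicator_def)
  ultimately show ?thesis by simp
qed

text \<open>Membership in the path space, restricted to a closed interval. A path of lifetime \<tau>
  is good on [0,t] for every t < \<tau>, and there its norms are finite.\<close>

definition good :: "real \<Rightarrow> (real \<Rightarrow> vfield) \<Rightarrow> bool" where
  "good t x \<longleftrightarrow> (\<forall>s\<in>{0..t}. x s \<in> sobolev e k 1 \<and> ((\<lambda>r. sn 1 (x r - x s)) \<longlongrightarrow> 0) (at s within {0..t})) \<and>
     (AE s in lebesgue. s \<in> {0..t} \<longrightarrow> x s \<in> sobolev e k 2) \<and>
     set_integrable lebesgue {0..t} (\<lambda>s. (sn 2 (x s))\<^sup>2)"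

lemma goodD:
  assumes "good t x"
  shows "s \<in> {0..t} \<Longrightarrow> x s \<in> sobolev e k 1" "s \<in> {0..t} \<Longrightarrow> ((\<lambda>r. sn 1 (x r - x s)) \<longlongrightarrow> 0) (at s within {0..t})"
    "AE s in lebesgue. s \<in> {0..t} \<longrightarrow> x s \<in> sobolev e k 2" "set_integrable lebesgue {0..t} (\<lambda>s. (sn 2 (x s))\<^sup>2)"
proof -
  note c = assms[unfolded good_def]
  show "s \<in> {0..t} \<Longrightarrow> x s \<in> sobolev e k 1" by (rule conjunct1[OF bspec[OF conjunct1[OF c]]])
  show "s \<in> {0..t} \<Longrightarrow> ((\<lambda>r. sn 1 (x r - x s)) \<longlongrightarrow> 0) (at s within {0..t})"
    by (rule conjunct2[OF bspec[OF conjunct1[OF c]]])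
  show "AE s in lebesgue. s \<in> {0..t} \<longrightarrow> x s \<in> sobolev e k 2" by (rule conjunct1[OF conjunct2[OF c]])
  show "set_integrable lebesgue {0..t} (\<lambda>s. (sn 2 (x s))\<^sup>2)" by (rule conjunct2[OF conjunct2[OF c]])
qed

lemma goodI:
  assumes "\<And>s. s \<in> {0..t} \<Longrightarrow> x s \<in> sobolev e k 1"
    "\<And>s. s \<in> {0..t} \<Longrightarrow> ((\<lambda>r. sn 1 (x r - x s)) \<longlongrightarrow> 0) (at s within {0..t})"
    "AE s in lebesgue. s \<in> {0..t} \<longrightarrow> x s \<in> sobolev e k 2" "set_integrable lebesgue {0..t} (\<lambda>s. (sn 2 (x s))\<^sup>2)"
  shows "good t x"
  unfolding good_def
  by (rule conjI, rule ballI, rule conjI, erule assms(1), erule assms(2), rule conjI, rule assms(3), rule assms(4))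

lemma good_mono: "good t x \<Longrightarrow> t' \<le> t \<Longrightarrow> good t' x"
proof -
  assume g: "good t x" and t: "t' \<le> t"
  have t2: "((\<lambda>r. sn 1 (x r - x s)) \<longlongrightarrow> 0) (at s within {0..t'})" if "s \<in> {0..t'}" for s
    by (rule tendsto_within_subset[OF goodD(2)[OF g, of s]]) (use that t in auto)
  have t4: "set_integrable lebesgue {0..t'} (\<lambda>s. (sn 2 (x s))\<^sup>2)"
    by (rule set_integrable_subset[OF goodD(4)[OF g]]) (use t in auto)
  have t3: "AE s in lebesgue. s \<in> {0..t'} \<longrightarrow> x s \<in> sobolev e k 2"
    using goodD(3)[OF g] by eventually_elim (use t in auto)
  have t1: "x s \<in> sobolev e k 1" if "s \<in> {0..t'}" for s using goodD(1)[OF g, of s] that t by simp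
  show "good t' x" by (rule goodI[OF t1 t2 t3 t4])
qed

lemma good_continuous:
  assumes "good t x" shows "continuous_on {0..t} x"
  unfolding continuous_on_def
proof
  fix s assume s: "s \<in> {0..t}"
  have "((\<lambda>r. x r - x s) \<longlongrightarrow> 0) (at s within {0..t})"
  proof (rule Lim_null_comparison[OF _ goodD(2)[OF assms s]])
    show "\<forall>\<^sub>F r in at s within {0..t}. norm (x r - x s) \<le> sn 1 (x r - x s)"
      unfolding eventually_at_filter
      by (rule always_eventually) (use goodD(1)[OF assms] s in \<open>auto intro!: norm_le_sn sobolev_diff\<close>)
  qed
  then show "(x \<longlongrightarrow> x s) (at s within {0..t})" by (rule LIM_zero_cancel)
qed

lemma sn_reverse_triangle:
  assumes "u \<in> sobolev e k \<gamma>" "v \<in> sobolev e k \<gamma>"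
  shows "\<bar>sn \<gamma> u - sn \<gamma> v\<bar> \<le> sn \<gamma> (u - v)"
  using sobolev_add(2)[OF sobolev_diff(1)[OF assms] assms(2)] sobolev_add(2)[OF sobolev_diff(1)[OF assms(2,1)] assms(1)]
    sn_minus[of \<gamma> u v] by (simp add: abs_le_iff)

lemma good_sn1_continuous:
  assumes "good t x" shows "continuous_on {0..t} (\<lambda>s. sn 1 (x s))"
  unfolding continuous_on_def
proof
  fix s assume s: "s \<in> {0..t}"
  have "((\<lambda>r. sn 1 (x r) - sn 1 (x s)) \<longlongrightarrow> 0) (at s within {0..t})"
  proof (rule Lim_null_comparison[OF _ goodD(2)[OF assms s]])
    show "\<forall>\<^sub>F r in at s within {0..t}. norm (sn 1 (x r) - sn 1 (x s)) \<le> sn 1 (x r - x s)"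
      unfolding eventually_at_filter
      by (rule always_eventually) (use goodD(1)[OF assms] s in \<open>auto intro!: sn_reverse_triangle\<close>)
  qed
  then show "((\<lambda>r. sn 1 (x r)) \<longlongrightarrow> sn 1 (x s)) (at s within {0..t})" by (rule LIM_zero_cancel)
qed

lemma good_sn1_bounded:
  assumes "good t x" shows "\<exists>M>0. \<forall>s\<in>{0..t}. sn 1 (x s) \<le> M"
proof -
  have "bounded ((\<lambda>s. sn 1 (x s)) ` {0..t})"
    by (intro compact_imp_bounded compact_continuous_image good_sn1_continuous assms) auto
  then obtain M where "\<forall>s\<in>{0..t}. \<bar>sn 1 (x s)\<bar> \<le> M" unfolding bounded_iff by auto
  then have "\<forall>s\<in>{0..t}. sn 1 (x s) \<le> max 1 M" by (auto simp: le_max_iff_disj)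
  then show ?thesis by (intro exI[of _ "max 1 M"]) auto
qed

lemma sn2_young:
  assumes "u \<in> sobolev e k 2" "v \<in> sobolev e k 2" "0 < \<theta>"
  shows "(sn 2 (u - v))\<^sup>2 \<le> (1 + \<theta>) * (sn 2 u)\<^sup>2 + (1 + 1 / \<theta>) * (sn 2 v)\<^sup>2"
proof -
  define a b where "a = sn 2 u" and "b = sn 2 v"
  have "(sn 2 (u - v))\<^sup>2 \<le> (a + b)\<^sup>2"
    unfolding a_def b_def by (intro power_mono sobolev_diff assms) simp
  also have "(a + b)\<^sup>2 \<le> (1 + \<theta>) * a\<^sup>2 + (1 + 1 / \<theta>) * b\<^sup>2"
  proof -
    have "0 \<le> (\<theta> * a - b)\<^sup>2 / \<theta>" using assms(3) by simp
    also have "\<dots> = \<theta> * a\<^sup>2 + b\<^sup>2 / \<theta> - 2 * a * b"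
      using assms(3) by (simp add: power2_eq_square field_simps)
    finally show ?thesis by (simp add: power2_sum algebra_simps)
  qed
  finally show ?thesis by (simp add: a_def b_def)
qed

lemma good_diff:
  assumes x: "good t x" and y: "good t y" shows "good t (\<lambda>s. x s - y s)"
proof (rule goodI)
  fix s assume s: "s \<in> {0..t}"
  show "x s - y s \<in> sobolev e k 1" by (intro sobolev_diff goodD(1)[OF x s] goodD(1)[OF y s])
  show "((\<lambda>r. sn 1 (x r - y r - (x s - y s))) \<longlongrightarrow> 0) (at s within {0..t})"
  proof (rule Lim_null_comparison)
    show "((\<lambda>r. sn 1 (x r - x s) + sn 1 (y r - y s)) \<longlongrightarrow> 0) (at s within {0..t})"
      using tendsto_add[OF goodD(2)[OF x s] goodD(2)[OF y s]] by simp
    show "\<forall>\<^sub>F r in at s within {0..t}. norm (sn 1 (x r - y r - (x s - y s))) \<le> sn 1 (x r - x s) + sn 1 (y r - y s)"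
      unfolding eventually_at_filter
    proof (rule always_eventually, intro allI impI)
      fix r assume r: "r \<in> {0..t}"
      have "sn 1 ((x r - x s) - (y r - y s)) \<le> sn 1 (x r - x s) + sn 1 (y r - y s)"
        by (intro sobolev_diff goodD(1)[OF x] goodD(1)[OF y] s r)
      then show "norm (sn 1 (x r - y r - (x s - y s))) \<le> sn 1 (x r - x s) + sn 1 (y r - y s)"
        by (simp add: algebra_simps)
    qed
  qed
next
  show ae: "AE s in lebesgue. s \<in> {0..t} \<longrightarrow> x s - y s \<in> sobolev e k 2"
    using goodD(3)[OF x] goodD(3)[OF y] by eventually_elim (auto intro: sobolev_diff)
  have m: "(\<lambda>s. indicator {0..t} s * (sn 2 (x s - y s))\<^sup>2) \<in> borel_measurable lebesgue"
    by (rule measurable_completion)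
      (use sn_sq_measurable[OF continuous_on_diff[OF good_continuous[OF x] good_continuous[OF y]], of 2] in simp)
  show "set_integrable lebesgue {0..t} (\<lambda>s. (sn 2 (x s - y s))\<^sup>2)"
    unfolding set_integrable_def
  proof (rule Bochner_Integration.integrable_bound)
    show "integrable lebesgue (\<lambda>s. 2 * (indicator {0..t} s *\<^sub>R (sn 2 (x s))\<^sup>2) + 2 * (indicator {0..t} s *\<^sub>R (sn 2 (y s))\<^sup>2))"
      using goodD(4)[OF x] goodD(4)[OF y] unfolding set_integrable_def by auto
    show "(\<lambda>s. indicator {0..t} s *\<^sub>R (sn 2 (x s - y s))\<^sup>2) \<in> borel_measurable lebesgue" using m by simp
    show "AE s in lebesgue. norm (indicator {0..t} s *\<^sub>R (sn 2 (x s - y s))\<^sup>2)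
      \<le> norm (2 * (indicator {0..t} s *\<^sub>R (sn 2 (x s))\<^sup>2) + 2 * (indicator {0..t} s *\<^sub>R (sn 2 (y s))\<^sup>2))"
      using goodD(3)[OF x] goodD(3)[OF y]
    proof eventually_elim
      case (elim s)
      show ?case
      proof (cases "s \<in> {0..t}")
        case True
        then show ?thesis using sn2_young[of "x s" "y s" 1] elim by simp
      qed simp
    qed
  qed
qed

lemma L2H2_sq: "(L2H2_norm e k t x)\<^sup>2 = (LINT s:{0..t}|lebesgue. (sn 2 (x s))\<^sup>2)"
  unfolding L2H2_norm_def by (intro real_sqrt_pow2) (auto simp: set_lebesgue_integral_def intro: integral_nonneg_AE)

lemma L2H2_nonneg [simp]: "0 \<le> L2H2_norm e k t x"
  unfolding L2H2_norm_def by (intro real_sqrt_ge_zero) (auto simp: set_lebesgue_integral_def intro: integral_nonneg_AE)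

text \<open>Young's inequality is integrated for each \<theta> and optimised afterwards by
  \<open>L2_triangle_aux\<close>; this takes the place of Minkowski's inequality for H^2-valued
  functions.\<close>

lemma L2H2_triangle:
  assumes x: "good t x" and y: "good t y"
  shows "L2H2_norm e k t (\<lambda>s. x s - y s) \<le> L2H2_norm e k t x + L2H2_norm e k t y"
proof (rule L2_triangle_aux)
  fix \<theta> :: real assume \<theta>: "0 < \<theta>"
  note i = goodD(4)[OF x] goodD(4)[OF y] goodD(4)[OF good_diff[OF x y]]
  have "(LINT s:{0..t}|lebesgue. (sn 2 (x s - y s))\<^sup>2)
      \<le> (LINT s:{0..t}|lebesgue. (1 + \<theta>) * (sn 2 (x s))\<^sup>2 + (1 + 1 / \<theta>) * (sn 2 (y s))\<^sup>2)"
  proof (rule set_integral_mono_AE[OF i(3)])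
    show "set_integrable lebesgue {0..t} (\<lambda>s. (1 + \<theta>) * (sn 2 (x s))\<^sup>2 + (1 + 1 / \<theta>) * (sn 2 (y s))\<^sup>2)"
      using i by (intro set_integral_add set_integrable_mult_right) auto
    show "AE s \<in> {0..t} in lebesgue. (sn 2 (x s - y s))\<^sup>2 \<le> (1 + \<theta>) * (sn 2 (x s))\<^sup>2 + (1 + 1 / \<theta>) * (sn 2 (y s))\<^sup>2"
      using goodD(3)[OF x] goodD(3)[OF y] by eventually_elim (simp add: sn2_young \<theta>)
  qed
  also have "\<dots> = (1 + \<theta>) * (LINT s:{0..t}|lebesgue. (sn 2 (x s))\<^sup>2) + (1 + 1 / \<theta>) * (LINT s:{0..t}|lebesgue. (sn 2 (y s))\<^sup>2)"
    using i by (subst set_integral_add) auto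
  finally show "(L2H2_norm e k t (\<lambda>s. x s - y s))\<^sup>2 \<le> (1 + \<theta>) * (L2H2_norm e k t x)\<^sup>2 + (1 + 1 / \<theta>) * (L2H2_norm e k t y)\<^sup>2"
    unfolding L2H2_sq .
qed auto

lemma L2H2_mono:
  assumes "good t x" "t' \<le> t" shows "L2H2_norm e k t' x \<le> L2H2_norm e k t x"
  unfolding L2H2_norm_def
proof (rule real_sqrt_le_mono, unfold set_lebesgue_integral_def, rule integral_mono)
  show "integrable lebesgue (\<lambda>s. indicator {0..t'} s *\<^sub>R (sn 2 (x s))\<^sup>2)"
    using goodD(4)[OF good_mono[OF assms]] by (simp add: set_integrable_def)
  show "integrable lebesgue (\<lambda>s. indicator {0..t} s *\<^sub>R (sn 2 (x s))\<^sup>2)"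
    using goodD(4)[OF assms(1)] by (simp add: set_integrable_def)
  show "indicator {0..t'} s *\<^sub>R (sn 2 (x s))\<^sup>2 \<le> indicator {0..t} s *\<^sub>R (sn 2 (x s))\<^sup>2" for s
    using assms(2) by (auto simp: indicator_def)
qed

lemma L2H2_cong: "(\<And>s. s \<in> {0..t} \<Longrightarrow> x s = y s) \<Longrightarrow> L2H2_norm e k t x = L2H2_norm e k t y"
  unfolding L2H2_norm_def set_lebesgue_integral_def
  by (intro arg_cong[where f=sqrt] Bochner_Integration.integral_cong) (auto simp: indicator_def)

lemma L2H2_scale:
  assumes x: "continuous_on {0..t * c} x" and c: "0 < c"
  shows "(L2H2_norm e k (t * c) x)\<^sup>2 = c * (L2H2_norm e k t (\<lambda>s. x (s * c)))\<^sup>2"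
    and "set_integrable lebesgue {0..t * c} (\<lambda>s. (sn 2 (x s))\<^sup>2) \<Longrightarrow> set_integrable lebesgue {0..t} (\<lambda>s. (sn 2 (x (s * c)))\<^sup>2)"
proof -
  define g where "g s = indicator {0..t * c} s * (sn 2 (x s))\<^sup>2" for s
  have gm: "g \<in> borel_measurable borel" unfolding g_def by (rule sn_sq_measurable[OF x])
  have gm': "(\<lambda>s. g (c * s)) \<in> borel_measurable lborel" using gm by measurable
  have gs: "indicator {0..t} s *\<^sub>R (sn 2 (x (s * c)))\<^sup>2 = g (0 + c * s)" for s
    using c by (auto simp: g_def indicator_def mult.commute zero_le_mult_iff)
  have "(LINT s:{0..t * c}|lebesgue. (sn 2 (x s))\<^sup>2) = integral\<^sup>L lebesgue g"
    by (simp add: set_lebesgue_integral_def g_def[abs_def])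
  also have "\<dots> = (\<integral>s. g s \<partial>lborel)" by (rule integral_completion) (use gm in simp)
  also have "\<dots> = c * (\<integral>s. g (0 + c * s) \<partial>lborel)"
    using lborel_integral_real_affine[of c g 0] c by simp
  also have "(\<integral>s. g (0 + c * s) \<partial>lborel) = (LINT s:{0..t}|lebesgue. (sn 2 (x (s * c)))\<^sup>2)"
    unfolding set_lebesgue_integral_def gs using gm' by (simp add: integral_completion)
  finally show "(L2H2_norm e k (t * c) x)\<^sup>2 = c * (L2H2_norm e k t (\<lambda>s. x (s * c)))\<^sup>2"
    unfolding L2H2_sq .
  assume "set_integrable lebesgue {0..t * c} (\<lambda>s. (sn 2 (x s))\<^sup>2)"
  then have "integrable lebesgue g" by (simp add: set_integrable_def g_def[abs_def])
  then have "integrable lborel g" by (subst (asm) integrable_completion) (use gm in simp_all)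
  then have "integrable lborel (\<lambda>s. g (0 + c * s))" using c lborel_integrable_real_affine[of g c 0] by simp
  then show "set_integrable lebesgue {0..t} (\<lambda>s. (sn 2 (x (s * c)))\<^sup>2)"
    unfolding set_integrable_def gs using gm' by (simp add: integrable_completion)
qed

lemma Xst_good:
  assumes "x \<in> Xst e k \<tau>" "t < \<tau>" "0 \<le> t" shows "good t x"
proof -
  have *: "x s \<in> sobolev e k 1 \<and> ((\<lambda>r. sn 1 (x r - x s)) \<longlongrightarrow> 0) (at s within {0..<\<tau>})" if "s \<in> {0..<\<tau>}" for s
    using assms(1) that unfolding Xst_def by simp
  have t2: "((\<lambda>r. sn 1 (x r - x s)) \<longlongrightarrow> 0) (at s within {0..t})" if "s \<in> {0..t}" for s
    by (rule tendsto_within_subset[OF conjunct2[OF *[of s]]]) (use that assms(2) in auto)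
  have "AE s in lebesgue. s \<in> {0..<\<tau>} \<longrightarrow> x s \<in> sobolev e k 2" using assms(1) unfolding Xst_def by simp
  then have t3: "AE s in lebesgue. s \<in> {0..t} \<longrightarrow> x s \<in> sobolev e k 2"
    by eventually_elim (use assms(2) in auto)
  have t4: "set_integrable lebesgue {0..t} (\<lambda>s. (sn 2 (x s))\<^sup>2)" using assms unfolding Xst_def by auto
  have t1: "x s \<in> sobolev e k 1" if "s \<in> {0..t}" for s using *[of s] that assms(2) by simp
  show ?thesis by (rule goodI[OF t1 t2 t3 t4])
qed

end

section \<open>Neighbourhoods in the path space\<close>

context plane_waves
begin

text \<open>Non-strict, so that closeness is preserved under limits of paths
  (\<open>close_to_limit\<close>).\<close>

definition close_to :: "real \<Rightarrow> real \<Rightarrow> (real \<Rightarrow> vfield) \<Rightarrow> (real \<Rightarrow> vfield) \<Rightarrow> bool" where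
  "close_to t \<rho> y x \<longleftrightarrow> (\<forall>s\<in>{0..t}. sn 1 (y s - x s) \<le> \<rho>) \<and> L2H2_norm e k t (\<lambda>s. y s - x s) \<le> \<rho>"

text \<open>The slack \<open>\<rho>' < \<rho>\<close> makes this set open although
  \<open>close_to\<close> is a closed condition.\<close>

definition pball :: "real \<Rightarrow> (real \<Rightarrow> vfield) \<Rightarrow> real \<Rightarrow> real \<Rightarrow> path set" where
  "pball T u S \<rho> = {w \<in> Xst_loc e k T. S < lifetime w \<and> (\<exists>\<rho>'<\<rho>. close_to S \<rho>' (path_at w) u)}"

lemma close_to_mono:
  assumes "close_to t \<rho> y x" "t' \<le> t" "\<rho> \<le> \<rho>'" "good t y" "good t x"
  shows "close_to t' \<rho>' y x"
proof -
  have "L2H2_norm e k t' (\<lambda>s. y s - x s) \<le> L2H2_norm e k t (\<lambda>s. y s - x s)"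
    by (rule L2H2_mono[OF good_diff[OF assms(4,5)] assms(2)])
  moreover have "L2H2_norm e k t (\<lambda>s. y s - x s) \<le> \<rho>" using assms(1) by (simp add: close_to_def)
  ultimately have "L2H2_norm e k t' (\<lambda>s. y s - x s) \<le> \<rho>'" using assms(3) by linarith
  moreover have "sn 1 (y s - x s) \<le> \<rho>'" if "s \<in> {0..t'}" for s
  proof -
    have "s \<in> {0..t}" using that assms(2) by simp
    then have "sn 1 (y s - x s) \<le> \<rho>" using assms(1) by (simp add: close_to_def)
    then show ?thesis using assms(3) by linarith
  qed
  ultimately show ?thesis by (simp add: close_to_def)
qed

lemma close_to_triangle:
  assumes "close_to t \<rho> y x" "close_to t \<rho>' x u" "good t y" "good t x" "good t u"
  shows "close_to t (\<rho> + \<rho>') y u"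
proof -
  have eq: "y s - u s = (y s - x s) - (u s - x s)" for s by simp
  have "sn 1 (y s - u s) \<le> \<rho> + \<rho>'" if s: "s \<in> {0..t}" for s
  proof -
    have "sn 1 ((y s - x s) - (u s - x s)) \<le> sn 1 (y s - x s) + sn 1 (u s - x s)"
      by (intro sobolev_diff goodD(1)[OF assms(3) s] goodD(1)[OF assms(4) s] goodD(1)[OF assms(5) s])
    also have "\<dots> \<le> \<rho> + \<rho>'" using assms(1,2) s unfolding close_to_def sn_minus[of 1 "u s"] by (intro add_mono) auto
    finally show ?thesis by (simp only: eq[symmetric])
  qed
  moreover have "L2H2_norm e k t (\<lambda>s. y s - u s) \<le> \<rho> + \<rho>'"
  proof -
    have "L2H2_norm e k t (\<lambda>s. (y s - x s) - (u s - x s)) \<le> L2H2_norm e k t (\<lambda>s. y s - x s) + L2H2_norm e k t (\<lambda>s. u s - x s)"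
      by (rule L2H2_triangle[OF good_diff[OF assms(3,4)] good_diff[OF assms(5,4)]])
    also have "L2H2_norm e k t (\<lambda>s. u s - x s) = L2H2_norm e k t (\<lambda>s. x s - u s)"
      unfolding L2H2_norm_def by (simp only: sn_minus[of 2 "u _"])
    also have "L2H2_norm e k t (\<lambda>s. y s - x s) + \<dots> \<le> \<rho> + \<rho>'"
      using assms(1,2) unfolding close_to_def by (intro add_mono) auto
    finally show ?thesis by (simp only: eq[symmetric])
  qed
  ultimately show ?thesis unfolding close_to_def by blast
qed

lemma close_to_refl: "0 \<le> \<rho> \<Longrightarrow> close_to t \<rho> x x"
  unfolding close_to_def L2H2_norm_def by (simp add: set_lebesgue_integral_def)

lemma path_good:
  assumes "w \<in> Xst_loc e k T" "0 \<le> S" "S < lifetime w" shows "good S (path_at w)"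
proof -
  obtain \<tau> u where w: "w = Path \<tau> u" "u \<in> Xst e k \<tau>"
    using assms unfolding Xst_loc_def by auto
  have "path_at w = u" by (auto simp: w)
  then show ?thesis using Xst_good[OF w(2), of S] assms w(1) by simp
qed

lemma rescale_apply: "s \<in> {0..<1} \<Longrightarrow> rescale \<tau>' w s = path_at w (s * \<tau>')"
  by (simp add: rescale_def)

lemma rescale_Xst:
  assumes w: "w \<in> Xst_loc e k T" and \<tau>: "0 < \<tau>'" "\<tau>' < lifetime w"
  shows "rescale \<tau>' w \<in> Xst e k 1"
proof -
  define x where "x = path_at w"
  have g: "good \<tau>' x" unfolding x_def by (rule path_good[OF w _ \<tau>(2)]) (use \<tau> in simp)
  have in1: "s * \<tau>' \<in> {0..\<tau>'}" if "s \<in> {0..<1}" for s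
    using that \<tau> by (auto simp: mult_left_le_one_le)
  have lim: "((\<lambda>r. sn 1 (rescale \<tau>' w r - rescale \<tau>' w s)) \<longlongrightarrow> 0) (at s within {0..<1})" if s: "s \<in> {0..<1}" for s
    unfolding Lim_within
  proof (intro allI impI)
    fix \<epsilon> :: real assume "0 < \<epsilon>"
    with goodD(2)[OF g in1[OF s]] obtain d where d: "0 < d"
      "\<And>r. r \<in> {0..\<tau>'} \<Longrightarrow> 0 < dist r (s * \<tau>') \<Longrightarrow> dist r (s * \<tau>') < d \<Longrightarrow> dist (sn 1 (x r - x (s * \<tau>'))) 0 < \<epsilon>"
      unfolding Lim_within by meson
    show "\<exists>d>0. \<forall>r\<in>{0..<1}. 0 < dist r s \<and> dist r s < d \<longrightarrow> dist (sn 1 (rescale \<tau>' w r - rescale \<tau>' w s)) 0 < \<epsilon>"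
    proof (intro exI[of _ "d / \<tau>'"] conjI ballI impI)
      fix r assume r: "r \<in> {0..<1}" "0 < dist r s \<and> dist r s < d / \<tau>'"
      have "dist (r * \<tau>') (s * \<tau>') = dist r s * \<tau>'"
        using \<tau> by (simp add: dist_real_def left_diff_distrib[symmetric] abs_mult)
      then show "dist (sn 1 (rescale \<tau>' w r - rescale \<tau>' w s)) 0 < \<epsilon>"
        using d(2)[OF in1[OF r(1)]] r \<tau> s by (simp add: rescale_apply x_def pos_less_divide_eq)
    qed (use d \<tau> in simp)
  qed
  have ae: "AE s in lebesgue. s \<in> {0..<1} \<longrightarrow> rescale \<tau>' w s \<in> sobolev e k 2"
    using AE_lebesgue_scale[OF goodD(3)[OF g], of \<tau>'] \<tau>
    by (auto elim!: eventually_mono simp: rescale_apply x_def mult_left_le_one_le)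
  have int: "set_integrable lebesgue {0..t} (\<lambda>s. (sn 2 (rescale \<tau>' w s))\<^sup>2)" if t: "t \<in> {0..<1}" for t
  proof -
    have g': "good (t * \<tau>') x" by (rule good_mono[OF g]) (use in1[OF t] in simp)
    have "set_integrable lebesgue {0..t} (\<lambda>s. (sn 2 (x (s * \<tau>')))\<^sup>2)"
      by (rule L2H2_scale(2)[OF good_continuous[OF g'] \<tau>(1) goodD(4)[OF g']])
    then show ?thesis
      by (rule set_integrable_cong[THEN iffD1, rotated -1]) (use t in \<open>auto simp: rescale_apply x_def\<close>)
  qed
  have sob: "rescale \<tau>' w s \<in> sobolev e k 1" if s: "s \<in> {0..<1}" for s
    using goodD(1)[OF g in1[OF s]] s by (simp add: rescale_apply x_def)
  have ext: "rescale \<tau>' w \<in> extensional {0..<1}" unfolding rescale_def by (rule restrict_extensional)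
  show ?thesis unfolding Xst_def
    using ext sob lim ae int by simp
qed

text \<open>Rescaling time leaves suprema unchanged and, by substitution, divides the squared L^2
  H^2 seminorm by c.\<close>

lemma rescale_close:
  assumes w: "w \<in> Xst_loc e k T" "S < lifetime w" and v: "v \<in> Xst_loc e k T" "S < lifetime v"
    and c: "0 < c" and t: "0 \<le> t" "t < 1" and S: "S = t * c"
  shows "(\<forall>s\<in>{0..t}. sn 1 (rescale c w s - rescale c v s) \<le> \<rho>) \<longleftrightarrow> (\<forall>s\<in>{0..S}. sn 1 (path_at w s - path_at v s) \<le> \<rho>)"
    and "(L2H2_norm e k S (\<lambda>s. path_at w s - path_at v s))\<^sup>2 = c * (L2H2_norm e k t (\<lambda>s. rescale c w s - rescale c v s))\<^sup>2"
proof -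
  have S0: "0 \<le> S" using c t S by simp
  have r: "rescale c u s = path_at u (s * c)" if "s \<in> {0..t}" for u s
    using that t by (simp add: rescale_apply)
  show "(\<forall>s\<in>{0..t}. sn 1 (rescale c w s - rescale c v s) \<le> \<rho>) \<longleftrightarrow> (\<forall>s\<in>{0..S}. sn 1 (path_at w s - path_at v s) \<le> \<rho>)"
  proof
    assume L: "\<forall>s\<in>{0..t}. sn 1 (rescale c w s - rescale c v s) \<le> \<rho>"
    show "\<forall>s\<in>{0..S}. sn 1 (path_at w s - path_at v s) \<le> \<rho>"
    proof
      fix s assume "s \<in> {0..S}"
      then have s: "s / c \<in> {0..t}" using c S by (simp add: pos_divide_le_eq)
      from bspec[OF L this] show "sn 1 (path_at w s - path_at v s) \<le> \<rho>" using c by (simp add: r[OF s])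
    qed
  next
    assume R: "\<forall>s\<in>{0..S}. sn 1 (path_at w s - path_at v s) \<le> \<rho>"
    show "\<forall>s\<in>{0..t}. sn 1 (rescale c w s - rescale c v s) \<le> \<rho>"
    proof
      fix s assume s: "s \<in> {0..t}"
      then have "s * c \<in> {0..S}" using c S by simp
      from bspec[OF R this] show "sn 1 (rescale c w s - rescale c v s) \<le> \<rho>" by (simp add: r[OF s])
    qed
  qed
  have "good S (\<lambda>s. path_at w s - path_at v s)"
    by (intro good_diff path_good[OF w(1) S0 w(2)] path_good[OF v(1) S0 v(2)])
  from good_continuous[OF this] have "continuous_on {0..t * c} (\<lambda>s. path_at w s - path_at v s)" by (simp add: S)
  from L2H2_scale(1)[OF this c]
  have "(L2H2_norm e k S (\<lambda>s. path_at w s - path_at v s))\<^sup>2 = c * (L2H2_norm e k t (\<lambda>s. path_at w (s * c) - path_at v (s * c)))\<^sup>2"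
    by (simp add: S)
  also have "L2H2_norm e k t (\<lambda>s. path_at w (s * c) - path_at v (s * c)) = L2H2_norm e k t (\<lambda>s. rescale c w s - rescale c v s)"
    by (rule L2H2_cong) (simp add: r)
  finally show "(L2H2_norm e k S (\<lambda>s. path_at w s - path_at v s))\<^sup>2 = c * (L2H2_norm e k t (\<lambda>s. rescale c w s - rescale c v s))\<^sup>2" .
qed

lemma Xst1_sup_bdd:
  assumes "y \<in> Xst e k 1" "x \<in> Xst e k 1" "0 \<le> t" "t < 1"
  shows "bdd_above ((\<lambda>s. sn 1 (y s - x s)) ` {0..t})"
  using good_sn1_bounded[OF good_diff[OF Xst_good[OF assms(1,4,3)] Xst_good[OF assms(2,4,3)]]]
  by (auto intro: bdd_aboveI2)

text \<open>Both families of seminorms increase with t, so two conditions reduce to one at the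
  larger t with the smaller radius; a ball around another centre u contains one around x by the
  triangle inequality.\<close>

lemma Xst1_generated_nbhd:
  assumes "generate_topology_on
     ({{w \<in> Xst e k 1. (SUP s\<in>{0..t}. sn 1 (w s - u s)) < r} | u t r. u \<in> Xst e k 1 \<and> 0 \<le> t \<and> t < 1 \<and> 0 < r} \<union>
      {{w \<in> Xst e k 1. L2H2_norm e k t (\<lambda>s. w s - u s) < r} | u t r. u \<in> Xst e k 1 \<and> 0 \<le> t \<and> t < 1 \<and> 0 < r}) G"
    and "x \<in> G" "x \<in> Xst e k 1"
  shows "\<exists>t \<rho>. 0 \<le> t \<and> t < 1 \<and> 0 < \<rho> \<and> (\<forall>y\<in>Xst e k 1. close_to t \<rho> y x \<longrightarrow> y \<in> G)"
  using assms
proof (induction rule: generate_topology_on.induct)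
  case (Int a b)
  then obtain t \<rho> t' \<rho>' where 1: "0 \<le> t" "t < 1" "0 < \<rho>" "\<And>y. y \<in> Xst e k 1 \<Longrightarrow> close_to t \<rho> y x \<Longrightarrow> y \<in> a"
    and 2: "0 \<le> t'" "t' < 1" "0 < \<rho>'" "\<And>y. y \<in> Xst e k 1 \<Longrightarrow> close_to t' \<rho>' y x \<Longrightarrow> y \<in> b" by auto
  have "y \<in> a \<inter> b" if y: "y \<in> Xst e k 1" "close_to (max t t') (min \<rho> \<rho>') y x" for y
  proof -
    have gd: "good (max t t') y" "good (max t t') x"
      by (rule Xst_good[OF y(1)], use 1 2 in auto) (rule Xst_good[OF Int.prems(2)], use 1 2 in auto)
    show ?thesis
      using 1(4)[OF y(1) close_to_mono[OF y(2) _ _ gd]] 2(4)[OF y(1) close_to_mono[OF y(2) _ _ gd]] by simp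
  qed
  then show ?case using 1 2 by (intro exI[of _ "max t t'"] exI[of _ "min \<rho> \<rho>'"]) auto
next
  case (UN K)
  then obtain a where a: "a \<in> K" "x \<in> a" by blast
  from UN.IH[OF a(1) a(2) UN.prems(2)] obtain t \<rho> where
    "0 \<le> t" "t < 1" "0 < \<rho>" "\<forall>y\<in>Xst e k 1. close_to t \<rho> y x \<longrightarrow> y \<in> a" by blast
  then show ?case using a(1) by (intro exI[of _ t] exI[of _ \<rho>]) blast
next
  case (Basis s)
  then consider (sup) u t r where "s = {w \<in> Xst e k 1. (SUP s\<in>{0..t}. sn 1 (w s - u s)) < r}" "u \<in> Xst e k 1" "0 \<le> t" "t < 1" "0 < r"
    | (l2) u t r where "s = {w \<in> Xst e k 1. L2H2_norm e k t (\<lambda>s. w s - u s) < r}" "u \<in> Xst e k 1" "0 \<le> t" "t < 1" "0 < r"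
    by blast
  then show ?case
  proof cases
    case sup
    define m where "m = (SUP s\<in>{0..t}. sn 1 (x s - u s))"
    have m: "m < r" using Basis.prems(1) sup(1) by (simp add: m_def)
    have "y \<in> s" if y: "y \<in> Xst e k 1" "close_to t ((r - m) / 2) y x" for y
    proof -
      have "sn 1 (y s - u s) \<le> m + (r - m) / 2" if s: "s \<in> {0..t}" for s
      proof -
        have gd: "good t y" "good t x" "good t u" using Xst_good[OF _ sup(4,3)] y(1) Basis.prems(2) sup(2) by auto
        have "sn 1 ((y s - x s) - (u s - x s)) \<le> sn 1 (y s - x s) + sn 1 (u s - x s)"
          by (intro sobolev_diff goodD(1)[OF gd(1) s] goodD(1)[OF gd(2) s] goodD(1)[OF gd(3) s])
        also have "sn 1 (u s - x s) = sn 1 (x s - u s)" by (rule sn_minus)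
        also have "sn 1 (x s - u s) \<le> m" unfolding m_def
          by (rule cSUP_upper[OF s Xst1_sup_bdd[OF Basis.prems(2) sup(2,3,4)]])
        also have "sn 1 (y s - x s) \<le> (r - m) / 2" using y(2) s by (simp add: close_to_def)
        finally show ?thesis by simp
      qed
      then have "(SUP s\<in>{0..t}. sn 1 (y s - u s)) \<le> m + (r - m) / 2" using sup(3) by (intro cSUP_least) auto
      also have "\<dots> < r" using m by (simp add: field_simps)
      finally show ?thesis using sup(1) y(1) by simp
    qed
    then show ?thesis using sup m by (intro exI[of _ t] exI[of _ "(r - m) / 2"]) auto
  next
    case l2
    define m where "m = L2H2_norm e k t (\<lambda>s. x s - u s)"
    have m: "m < r" using Basis.prems(1) l2(1) by (simp add: m_def)
    have "y \<in> s" if y: "y \<in> Xst e k 1" "close_to t ((r - m) / 2) y x" for y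
    proof -
      have gd: "good t y" "good t x" "good t u" using Xst_good[OF _ l2(4,3)] y(1) Basis.prems(2) l2(2) by auto
      have eq: "y s - u s = (y s - x s) - (u s - x s)" for s by simp
      have "L2H2_norm e k t (\<lambda>s. (y s - x s) - (u s - x s)) \<le> L2H2_norm e k t (\<lambda>s. y s - x s) + L2H2_norm e k t (\<lambda>s. u s - x s)"
        by (rule L2H2_triangle[OF good_diff[OF gd(1,2)] good_diff[OF gd(3,2)]])
      also have "L2H2_norm e k t (\<lambda>s. u s - x s) = m"
        unfolding L2H2_norm_def m_def by (simp only: sn_minus[of 2 "u _"])
      also have "L2H2_norm e k t (\<lambda>s. y s - x s) \<le> (r - m) / 2" using y(2) by (simp add: close_to_def)
      finally have "L2H2_norm e k t (\<lambda>s. y s - u s) \<le> (r - m) / 2 + m" by (simp only: eq[symmetric])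
      also have "\<dots> < r" using m by (simp add: field_simps)
      finally show ?thesis using l2(1) y(1) by simp
    qed
    then show ?thesis using l2 m by (intro exI[of _ t] exI[of _ "(r - m) / 2"]) auto
  qed
qed auto

lemma pball_open:
  assumes u: "good S u" and S: "0 < S"
  shows "Xst_open e k T (pball T u S \<rho>)"
  unfolding Xst_open_def
proof (intro conjI ballI)
  show "pball T u S \<rho> \<subseteq> Xst_loc e k T" by (auto simp: pball_def)
  fix w assume "w \<in> pball T u S \<rho>"
  then obtain \<rho>' where w: "w \<in> Xst_loc e k T" "S < lifetime w" and \<rho>': "\<rho>' < \<rho>" "close_to S \<rho>' (path_at w) u"
    by (auto simp: pball_def)
  have wS: "w \<noteq> Star" using w S by auto
  \<comment> \<open>The rescaled seminorms are available only for t < 1, so the base neighbourhood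
    is taken at a time c strictly between S and the lifetime, with S = t c.\<close>
  define c where "c = (S + lifetime w) / 2"
  have c: "S < c" "c < lifetime w" "0 < c" using w S by (auto simp: c_def)
  define t where "t = S / c"
  have t: "0 \<le> t" "t < 1" "S = t * c" using c S by (auto simp: t_def)
  define \<eta> where "\<eta> = (\<rho> - \<rho>') / 2"
  have \<eta>: "0 < \<eta>" using \<rho>' by (simp add: \<eta>_def)
  \<comment> \<open>Compensates the factor c in \<open>rescale_close\<close>.\<close>
  define \<eta>2 where "\<eta>2 = \<eta> / sqrt c"
  have \<eta>2: "0 < \<eta>2" using \<eta> c by (simp add: \<eta>2_def)
  define w' where "w' = rescale c w"
  have w': "w' \<in> Xst e k 1" unfolding w'_def by (rule rescale_Xst[OF w(1) c(3,2)])
  define V1 where "V1 = {y \<in> Xst e k 1. (SUP s\<in>{0..t}. sn 1 (y s - w' s)) < \<eta>}"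
  define V2 where "V2 = {y \<in> Xst e k 1. L2H2_norm e k t (\<lambda>s. y s - w' s) < \<eta>2}"
  have o: "openin (Xst1_topology e k) (V1 \<inter> V2)"
  proof (rule openin_Int)
    show "openin (Xst1_topology e k) V1" unfolding Xst1_topology_def
      by (rule topology_generated_by_Basis, rule UnI1) (use w' t \<eta> V1_def in blast)
    show "openin (Xst1_topology e k) V2" unfolding Xst1_topology_def
      by (rule topology_generated_by_Basis, rule UnI2) (use w' t \<eta>2 V2_def in blast)
  qed
  have "w' \<in> V1 \<inter> V2"
    using w' \<eta> \<eta>2 t by (auto simp: V1_def V2_def L2H2_norm_def set_lebesgue_integral_def)
  then have nb: "nbhd_of (Xst1_topology e k) w' (V1 \<inter> V2)"
    unfolding nbhd_of_def using o openin_subset by blast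
  define N where "N = {v \<in> Xst_loc e k T. c < lifetime v \<and> rescale c v \<in> V1 \<inter> V2 \<and>
               min (exit_time e k T 1 v) (ereal (lifetime v)) < ereal (lifetime w + 1)}"
  have "N \<in> Xst_base e k T w"
    unfolding Xst_base_def if_not_P[OF wS] mem_Collect_eq
    by (rule exI[of _ c], rule exI[of _ "V1 \<inter> V2"], rule exI[of _ 1], rule exI[of _ 1])
      (use c nb in \<open>simp add: N_def w'_def\<close>)
  moreover have "N \<subseteq> pball T u S \<rho>"
  proof
    fix v assume "v \<in> N"
    then have v: "v \<in> Xst_loc e k T" "c < lifetime v" "rescale c v \<in> V1" "rescale c v \<in> V2" by (auto simp: N_def)
    have vS: "S < lifetime v" using v c by simp
    note rc = rescale_close[OF v(1) vS w c(3) t]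
    have "\<forall>s\<in>{0..t}. sn 1 (rescale c v s - rescale c w s) \<le> \<eta>"
    proof
      fix s assume s: "s \<in> {0..t}"
      have "sn 1 (rescale c v s - w' s) \<le> (SUP s\<in>{0..t}. sn 1 (rescale c v s - w' s))"
        using v(3) by (intro cSUP_upper[OF s] Xst1_sup_bdd t w') (simp add: V1_def)
      also have "\<dots> \<le> \<eta>" using v(3) by (simp add: V1_def)
      finally show "sn 1 (rescale c v s - rescale c w s) \<le> \<eta>" by (simp only: w'_def)
    qed
    then have 1: "\<forall>s\<in>{0..S}. sn 1 (path_at v s - path_at w s) \<le> \<eta>" unfolding rc(1) .
    have "L2H2_norm e k t (\<lambda>s. rescale c v s - rescale c w s) \<le> \<eta>2" using v(4) by (simp add: V2_def w'_def)
    then have "(L2H2_norm e k S (\<lambda>s. path_at v s - path_at w s))\<^sup>2 \<le> c * \<eta>2\<^sup>2"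
      unfolding rc(2) using c by (intro mult_left_mono power_mono) auto
    also have "\<dots> = \<eta>\<^sup>2" using c by (simp add: \<eta>2_def power_divide)
    finally have 2: "L2H2_norm e k S (\<lambda>s. path_at v s - path_at w s) \<le> \<eta>"
      using \<eta> by - (rule power2_le_imp_le, auto)
    have "close_to S \<eta> (path_at v) (path_at w)" using 1 2 by (simp add: close_to_def)
    from close_to_triangle[OF this \<rho>'(2) path_good[OF v(1) _ vS] path_good[OF w(1) _ w(2)] u] S
    have "close_to S (\<eta> + \<rho>') (path_at v) u" by simp
    moreover have "\<eta> + \<rho>' < \<rho>" using \<rho>' by (simp add: \<eta>_def field_simps)
    ultimately show "v \<in> pball T u S \<rho>" using v(1) vS by (auto simp: pball_def)
  qed
  ultimately show "\<exists>N\<in>Xst_base e k T w. N \<subseteq> pball T u S \<rho>" by blast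
qed

text \<open>A converse to \<open>pball_open\<close>: closeness is demanded only up to S, and
  afterwards only that the path dies or leaves the M-ball early. This freedom after S is what part
  (i) exploits.\<close>

lemma Xst_open_contains:
  assumes U: "Xst_open e k T \<U>" "v \<in> \<U>" "v \<noteq> Star"
  shows "\<exists>S \<rho> \<kappa> M. 0 < S \<and> S < lifetime v \<and> 0 < \<rho> \<and> 0 < \<kappa> \<and> 0 < M \<and>
    (\<forall>w\<in>Xst_loc e k T. S < lifetime w \<longrightarrow> close_to S \<rho> (path_at w) (path_at v) \<longrightarrow>
       min (exit_time e k T M w) (ereal (lifetime w)) < ereal (lifetime v + \<kappa>) \<longrightarrow> w \<in> \<U>)"
proof -
  have v: "v \<in> Xst_loc e k T" using U unfolding Xst_open_def by blast
  obtain N where N: "N \<in> Xst_base e k T v" "N \<subseteq> \<U>" using U unfolding Xst_open_def by blast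
  then obtain c V \<kappa> M where c: "0 < c" "c < lifetime v" and V: "nbhd_of (Xst1_topology e k) (rescale c v) V"
    and \<kappa>: "0 < \<kappa>" "0 < M" and N': "N = {w \<in> Xst_loc e k T. c < lifetime w \<and> rescale c w \<in> V \<and>
               min (exit_time e k T M w) (ereal (lifetime w)) < ereal (lifetime v + \<kappa>)}"
    using U(3) unfolding Xst_base_def by auto
  obtain G where G: "openin (Xst1_topology e k) G" "rescale c v \<in> G" "G \<subseteq> V" using V unfolding nbhd_of_def by blast
  note vX = rescale_Xst[OF v c]
  obtain t \<rho> where t: "0 \<le> t" "t < 1" "0 < \<rho>" "\<And>y. y \<in> Xst e k 1 \<Longrightarrow> close_to t \<rho> y (rescale c v) \<Longrightarrow> y \<in> G"
    using Xst1_generated_nbhd[OF openin_topology_generated_by[OF G(1)[unfolded Xst1_topology_def]] G(2) vX] by blast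
  define S where "S = t * c"
  have S: "0 \<le> S" "S \<le> c" using c t by (auto simp: S_def mult_left_le_one_le)
  \<comment> \<open>The second bound absorbs the factor sqrt c that rescaling puts on the L^2 H^2
    seminorm.\<close>
  define \<rho>' where "\<rho>' = min \<rho> (\<rho> * sqrt c)"
  have \<rho>': "0 < \<rho>'" "\<rho>' \<le> \<rho>" "\<rho>' \<le> \<rho> * sqrt c" using t c by (auto simp: \<rho>'_def)
  have "w \<in> \<U>" if w: "w \<in> Xst_loc e k T" "c < lifetime w" "close_to c \<rho>' (path_at w) (path_at v)"
    "min (exit_time e k T M w) (ereal (lifetime w)) < ereal (lifetime v + \<kappa>)" for w
  proof -
    have cl: "close_to S \<rho>' (path_at w) (path_at v)"
      by (rule close_to_mono[OF w(3) S(2) order_refl path_good[OF w(1) _ w(2)] path_good[OF v _ c(2)]]) (use c in auto)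
    have lt: "S < lifetime w" "S < lifetime v" using S c w by auto
    note rc = rescale_close[OF w(1) lt(1) v lt(2) c(1) t(1,2) S_def]
    have "\<forall>s\<in>{0..t}. sn 1 (rescale c w s - rescale c v s) \<le> \<rho>"
      unfolding rc(1)
    proof
      fix s assume "s \<in> {0..S}"
      then have "sn 1 (path_at w s - path_at v s) \<le> \<rho>'" using cl by (simp add: close_to_def)
      then show "sn 1 (path_at w s - path_at v s) \<le> \<rho>" using \<rho>'(2) by linarith
    qed
    moreover have "L2H2_norm e k t (\<lambda>s. rescale c w s - rescale c v s) \<le> \<rho>"
    proof -
      have "c * (L2H2_norm e k t (\<lambda>s. rescale c w s - rescale c v s))\<^sup>2 \<le> (\<rho> * sqrt c)\<^sup>2"
        unfolding rc(2)[symmetric] using cl \<rho>' unfolding close_to_def by (intro power_mono) auto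
      also have "\<dots> = c * \<rho>\<^sup>2" using c by (simp add: power_mult_distrib)
      finally have "(L2H2_norm e k t (\<lambda>s. rescale c w s - rescale c v s))\<^sup>2 \<le> \<rho>\<^sup>2" using c by simp
      then show ?thesis using t(3) by - (rule power2_le_imp_le, auto)
    qed
    ultimately have "rescale c w \<in> G"
      by (intro t(4)[OF rescale_Xst[OF w(1) c(1) w(2)]]) (simp add: close_to_def)
    then show ?thesis using w N(2) G(3) unfolding N' by auto
  qed
  then show ?thesis using c \<rho>' \<kappa> by (intro exI[of _ c] exI[of _ \<rho>'] exI[of _ \<kappa>] exI[of _ M]) auto
qed

lemma Xst_open_contains_Star:
  assumes U: "Xst_open e k T \<U>" "Star \<in> \<U>"
  shows "\<exists>\<kappa> M. 0 < \<kappa> \<and> 0 < M \<and>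
    (\<forall>w\<in>Xst_loc e k T. min (ereal (lifetime w)) (exit_time e k T M w) < ereal \<kappa> \<longrightarrow> w \<in> \<U>)"
proof -
  obtain N where N: "N \<in> Xst_base e k T Star" "N \<subseteq> \<U>" using U unfolding Xst_open_def by blast
  then obtain \<kappa> M where "0 < \<kappa>" "0 < M" "N = {v \<in> Xst_loc e k T. min (ereal (lifetime v)) (exit_time e k T M v) < ereal \<kappa>}"
    unfolding Xst_base_def by auto
  then show ?thesis using N(2) by blast
qed

lemma exit_time_gt:
  assumes w: "w = Path \<tau> u" and "ereal s < exit_time e k T M w" "s < \<tau>" "0 \<le> s"
  shows "sn 1 (u s) < M"
proof (rule ccontr)
  assume "\<not> sn 1 (u s) < M"
  then have "s \<in> {t \<in> {0..<\<tau>}. sn 1 (u t) \<ge> M \<or> L2H2_norm e k t u \<ge> M}" using assms by auto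
  then have "(INF t\<in>{t \<in> {0..<\<tau>}. sn 1 (u t) \<ge> M \<or> L2H2_norm e k t u \<ge> M}. ereal t) \<le> ereal s"
    by (rule INF_lower)
  then have "exit_time e k T M w \<le> ereal s" unfolding w exit_time.simps by (rule min.coboundedI1)
  then show False using assms(2) by simp
qed

end

section \<open>Stability of the equation under perturbations of the noise\<close>

text \<open>Gronwall's inequality for an accumulated coefficient A that is only continuous: while A
  grows by 1/2, the maximum of Y is at most its initial value plus half the maximum, so Y at most
  doubles.\<close>

lemma gronwall_increment:
  fixes A Y :: "real \<Rightarrow> real"
  assumes Y: "continuous_on {0..S} Y" "\<And>t. t \<in> {0..S} \<Longrightarrow> 0 \<le> Y t"
    and A: "continuous_on {0..S} A" "A 0 = 0" "\<And>s t. 0 \<le> s \<Longrightarrow> s \<le> t \<Longrightarrow> t \<le> S \<Longrightarrow> A s \<le> A t"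
    and inc: "\<And>s t B. 0 \<le> s \<Longrightarrow> s \<le> t \<Longrightarrow> t \<le> S \<Longrightarrow> (\<And>r. r \<in> {s..t} \<Longrightarrow> Y r \<le> B) \<Longrightarrow> Y t \<le> Y s + B * (A t - A s)"
  shows "t \<in> {0..S} \<Longrightarrow> A t \<le> real m / 2 \<Longrightarrow> Y t \<le> 2 ^ m * Y 0"
proof (induction m arbitrary: t)
  have max: "\<exists>r\<in>{s..t}. \<forall>q\<in>{s..t}. Y q \<le> Y r" if "0 \<le> s" "s \<le> t" "t \<le> S" for s t
  proof -
    have c: "continuous_on {s..t} Y" by (rule continuous_on_subset[OF Y(1)]) (use that in auto)
    show ?thesis by (rule continuous_attains_sup[OF compact_Icc _ c]) (use that in simp)
  qed
  {
    case 0
    then have t: "0 \<le> t" "t \<le> S" by auto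
    obtain r where r: "r \<in> {0..t}" "\<And>q. q \<in> {0..t} \<Longrightarrow> Y q \<le> Y r" using max[of 0 t] t by auto
    have "A r = 0" using A(3)[of 0 r] A(3)[of r t] A(2) 0 r(1) t by simp
    then have "Y r \<le> Y 0" using inc[of 0 r "Y r"] r t A(2) by simp
    then show ?case using r(2)[of t] t by simp
  next
    case (Suc m)
    then have t: "0 \<le> t" "t \<le> S" by auto
    show ?case
    proof (cases "A t \<le> real m / 2")
      case True
      have "Y t \<le> 2 ^ m * Y 0" by (rule Suc.IH[OF Suc.prems(1) True])
      also have "\<dots> \<le> 2 ^ Suc m * Y 0" using Y(2)[of 0] t by (intro mult_right_mono) auto
      finally show ?thesis .
    next
      case False
      \<comment> \<open>The last stretch starts at the time u where A reaches m/2; the induction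
        hypothesis covers the time before.\<close>
      obtain u where u: "0 \<le> u" "u \<le> t" "A u = real m / 2"
        using IVT'[of A 0 "real m / 2" t] A(2) False t continuous_on_subset[OF A(1), of "{0..t}"] by auto
      have Yu: "Y u \<le> 2 ^ m * Y 0" by (rule Suc.IH) (use u t in auto)
      obtain r where r: "r \<in> {u..t}" "\<And>q. q \<in> {u..t} \<Longrightarrow> Y q \<le> Y r" using max[of u t] u t by auto
      have "Y r \<le> Y u + Y r * (A r - A u)" using r u t by (intro inc) auto
      moreover have "Y r * (A r - A u) \<le> Y r * (1 / 2)"
      proof (rule mult_left_mono)
        have "A r \<le> A t" using A(3)[of r t] r u t by simp
        also have "\<dots> \<le> real m / 2 + 1 / 2" using Suc.prems(2) by (simp add: add_divide_distrib)
        finally show "A r - A u \<le> 1 / 2" using u by simp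
        show "0 \<le> Y r" using Y(2)[of r] r u t by simp
      qed
      ultimately have "Y r \<le> 2 * Y u" by simp
      then show ?thesis using Yu r(2)[of t] u by simp
    qed
  }
qed

text \<open>The Stokes term is controlled only at almost every time, where the path is in H^2; it
  agrees there with a continuous function, to which Henstock-Kurzweil calculus applies.\<close>

lemma LINT_spike_continuous:
  fixes f g :: "real \<Rightarrow> real"
  assumes g: "continuous_on {0..t} g" and ae: "AE s in lebesgue. s \<in> {0..t} \<longrightarrow> f s = g s"
  shows "(LINT s:{0..t}|lebesgue. f s) = integral {0..t} g" "f absolutely_integrable_on {0..t}"
proof -
  define N where "N = {s. \<not> (s \<in> {0..t} \<longrightarrow> f s = g s)}"
  have N: "negligible N" using ae unfolding AE_lebesgue_iff_negligible N_def .
  have ga: "g absolutely_integrable_on {0..t}" by (rule absolutely_integrable_continuous_real[OF g])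
  have eq: "f s = g s" if "s \<in> {0..t} - N" for s using that by (auto simp: N_def)
  show fa: "f absolutely_integrable_on {0..t}" by (rule absolutely_integrable_spike[OF ga N eq])
  have "(LINT s:{0..t}|lebesgue. f s) = integral {0..t} f" by (rule set_lebesgue_integral_eq_integral(2)[OF fa])
  also have "\<dots> = integral {0..t} g" by (rule integral_spike[OF N]) (simp add: eq)
  finally show "(LINT s:{0..t}|lebesgue. f s) = integral {0..t} g" .
qed

lemma tri_sum_right:
  assumes "finite F" and \<psi>: "\<And>z. z \<in> F \<Longrightarrow> smooth_periodic (\<psi> z)"
  shows "tri i u v (\<lambda>x. \<Sum>z\<in>F. c z *\<^sub>R \<psi> z x) = (\<Sum>z\<in>F. c z * tri i u v (\<psi> z))"
proof -
  have int: "integrable torus (\<lambda>x. rep_vfield u x $ i * (rep_vfield v x \<bullet> \<psi> z x))" if z: "z \<in> F" for z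
  proof -
    obtain K where K: "0 \<le> K" "\<And>x. x \<in> cell \<Longrightarrow> norm (\<psi> z x) \<le> K"
      using smooth_periodic_bounded[OF \<psi>[OF z]] by auto
    show ?thesis using sq_integrable_inner[OF sq_integrable_rep[of u]
       mulop_sq_integrable[OF smooth_periodic_torus[OF \<psi>[OF z]] K(2) K(1), of v i]]
      by (simp add: inner_axis mult.commute)
  qed
  have "tri i u v (\<lambda>x. \<Sum>z\<in>F. c z *\<^sub>R \<psi> z x) = (\<integral>x. (\<Sum>z\<in>F. c z * (rep_vfield u x $ i * (rep_vfield v x \<bullet> \<psi> z x))) \<partial>torus)"
    unfolding tri_def by (simp add: inner_sum_right sum_distrib_left mult_ac)
  also have "\<dots> = (\<Sum>z\<in>F. \<integral>x. c z * (rep_vfield u x $ i * (rep_vfield v x \<bullet> \<psi> z x)) \<partial>torus)"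
    by (rule Bochner_Integration.integral_sum) (use int in auto)
  finally show ?thesis by (simp add: tri_def)
qed

context plane_waves
begin

text \<open>On H^1, minus the advection term tested against \<open>e z\<close>, by the divergence
  form (\<open>advection_ew\<close>). Free of derivatives of the fields, it is continuous in
  L^2.\<close>

definition adv :: "'z \<Rightarrow> vfield \<Rightarrow> vfield \<Rightarrow> real" where
  "adv z u v = (\<Sum>i\<in>UNIV. tri i u v (pderiv_at i (ew z)))"

lemma smooth_pderiv_ew: "smooth_periodic (pderiv_at i (ew z))"
  by (rule smooth_periodic_pderiv[OF ew_smooth])

lemma tri_continuous:
  assumes "smooth_periodic \<psi>" "continuous_on A x" "continuous_on A y"
  shows "continuous_on A (\<lambda>s. tri i (x s) (y s) \<psi>)"
proof -
  obtain K where K: "0 \<le> K" "\<And>x. x \<in> cell \<Longrightarrow> norm (\<psi> x) \<le> K"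
    using smooth_periodic_bounded[OF assms(1)] by auto
  show ?thesis using assms(2,3) unfolding continuous_on_def
    by (auto intro!: tri_tendsto[OF smooth_periodic_torus[OF assms(1)] K(2) K(1)])
qed

lemma adv_continuous:
  assumes "continuous_on A x" shows "continuous_on A (\<lambda>s. adv z (x s) (x s))"
  unfolding adv_def by (intro continuous_on_sum tri_continuous[OF smooth_pderiv_ew assms assms])


text \<open>The equation as a system for the coefficients. The tested noise g is kept abstract so
  that solutions with different noises can be compared.\<close>

definition solves :: "real \<Rightarrow> (real \<Rightarrow> vfield) \<Rightarrow> vfield \<Rightarrow> ('z \<Rightarrow> real \<Rightarrow> real) \<Rightarrow> bool" where
  "solves S x U g \<longleftrightarrow> (\<forall>z. \<forall>t\<in>{0..S}. e z \<bullet> x t = e z \<bullet> U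
     - eigval k z * integral {0..t} (\<lambda>s. e z \<bullet> x s) + integral {0..t} (\<lambda>s. adv z (x s) (x s)) + g z t)"

text \<open>Outside F the H^1 weight is at least 1 + \<Lambda>.\<close>

lemma tail_bound:
  assumes F: "finite F" "\<And>z. z \<notin> F \<Longrightarrow> \<Lambda> \<le> eigval k z" "0 \<le> \<Lambda>" and w: "w \<in> sobolev e k 1"
  shows "(norm w)\<^sup>2 \<le> (\<Sum>z\<in>F. (e z \<bullet> w)\<^sup>2) + (sn 1 w)\<^sup>2 / (1 + \<Lambda>)"
proof -
  have df: "w - proj F w \<in> df_space"
    unfolding proj_def by (intro subspace_diff subspace_sum subspace_scale subspace_df_space e_df sobolev_df[OF w])
  have c: "e z \<bullet> (w - proj F w) = (if z \<in> F then 0 else e z \<bullet> w)" for z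
    by (simp add: inner_diff_right e_proj[OF F(1)])
  have "(norm (w - proj F w))\<^sup>2 \<le> (sn 1 w)\<^sup>2 / (1 + \<Lambda>)"
  proof (rule has_sum_le_finite_sums[OF parseval[OF df]])
    fix G :: "'z set" assume G: "finite G"
    have "(e z \<bullet> (w - proj F w))\<^sup>2 \<le> (wgt 1 z * (e z \<bullet> w)\<^sup>2) / (1 + \<Lambda>)" for z
    proof (cases "z \<in> F")
      case False
      have "(1 + \<Lambda>) * (e z \<bullet> w)\<^sup>2 \<le> wgt 1 z * (e z \<bullet> w)\<^sup>2"
        unfolding wgt_simps using F(2)[OF False] by (intro mult_right_mono) auto
      then show ?thesis using F(3) False by (simp add: c pos_le_divide_eq mult.commute)
    qed (use F(3) in \<open>simp add: c\<close>)
    then have "(\<Sum>z\<in>G. (e z \<bullet> (w - proj F w))\<^sup>2) \<le> (\<Sum>z\<in>G. wgt 1 z * (e z \<bullet> w)\<^sup>2 / (1 + \<Lambda>))"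
      by (intro sum_mono)
    also have "\<dots> \<le> (sn 1 w)\<^sup>2 / (1 + \<Lambda>)"
      unfolding sum_divide_distrib[symmetric] using sn_partial[OF w G] F(3) by (intro divide_right_mono) auto
    finally show "(\<Sum>z\<in>G. (e z \<bullet> (w - proj F w))\<^sup>2) \<le> (sn 1 w)\<^sup>2 / (1 + \<Lambda>)" .
  qed
  then show ?thesis using norm_diff_proj[OF F(1), of w] norm_proj[OF F(1), of w] by simp
qed

text \<open>\<open>\<psi> i\<close> is the i-th derivative of the combination of waves with
  coefficients h, so its L^2 norm is at most the square root of the dissipation. Supremum bounds on
  u and v from the H^2 embedding leave u - v in L^2, and 2ab \<le> a^2 + b^2 separates the
  dissipation.\<close>

lemma adv_diff_energy:
  assumes F: "finite F" and u: "u \<in> sobolev e k 2" and v: "v \<in> sobolev e k 2"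
  shows "2 * (\<Sum>z\<in>F. h z * (adv z u u - adv z v v))
    \<le> (\<Sum>z\<in>F. eigval k z * (h z)\<^sup>2) + 18 * C2\<^sup>2 * ((sn 2 u)\<^sup>2 + (sn 2 v)\<^sup>2) * (norm (u - v))\<^sup>2"
proof -
  define D where "D = (\<Sum>z\<in>F. eigval k z * (h z)\<^sup>2)"
  have D0: "0 \<le> D" unfolding D_def by (intro sum_nonneg) simp
  define a where "a = C2 * (sn 2 u + sn 2 v) * norm (u - v)"
  define \<psi> where "\<psi> i x = (\<Sum>z\<in>F. h z *\<^sub>R pderiv_at i (ew z) x)" for i x
  have b: "tri i u u (\<psi> i) - tri i v v (\<psi> i) \<le> a * sqrt D" for i
  proof -
    have "\<exists>K. \<forall>z. 0 \<le> K z \<and> (\<forall>x\<in>cell. norm (pderiv_at i (ew z) x) \<le> K z)"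
      by (rule choice) (use smooth_periodic_bounded[OF smooth_pderiv_ew] in simp)
    then obtain K where K: "\<And>z. 0 \<le> K z" "\<And>z x. x \<in> cell \<Longrightarrow> norm (pderiv_at i (ew z) x) \<le> K z" by auto
    define L where "L = (\<Sum>z\<in>F. \<bar>h z\<bar> * K z)"
    have L0: "0 \<le> L" unfolding L_def using K by (intro sum_nonneg) simp
    have \<psi>L: "norm (\<psi> i x) \<le> L" if "x \<in> cell" for x
      unfolding \<psi>_def L_def using K(2)[OF that] by (intro sum_norm_le) (auto intro: mult_left_mono)
    have \<psi>m: "\<psi> i \<in> borel_measurable torus" unfolding \<psi>_def
      by (intro borel_measurable_sum borel_measurable_scaleR borel_measurable_const smooth_periodic_torus smooth_pderiv_ew)
    have f\<psi>: "field_of (\<psi> i) = (\<Sum>z\<in>F. h z *\<^sub>R de i z)"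
    proof -
      define s where "s = (\<lambda>x. \<Sum>z\<in>F. h z *\<^sub>R (\<lambda>x. - (freq z $ i) *\<^sub>R fw z x) x)"
      have "\<psi> i = s" by (auto simp: \<psi>_def s_def pderiv_ew fun_eq_iff)
      moreover have "s \<in> smooth_df \<and> field_of s = (\<Sum>z\<in>F. h z *\<^sub>R field_of (\<lambda>x. - (freq z $ i) *\<^sub>R fw z x))"
        unfolding s_def by (rule field_of_smooth_sum[OF F]) (rule subspace_smooth_df(3)[OF fw_df])
      moreover have "field_of (\<lambda>x. - (freq z $ i) *\<^sub>R fw z x) = de i z" for z
        unfolding de_fw by (rule field_of_scaleR[OF smooth_periodic_sq_integrable[OF fw_smooth]])
      ultimately show ?thesis by simp
    qed
    have "(norm (field_of (\<psi> i)))\<^sup>2 = (\<Sum>z\<in>F. (h z)\<^sup>2 * (freq z $ i)\<^sup>2)"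
      unfolding f\<psi> using de_inner[of i]
      by (subst orthogonal_norm_sum[OF F]) (auto simp: power_mult_distrib power2_norm_eq_inner)
    also have "\<dots> \<le> D" unfolding D_def
    proof (rule sum_mono)
      fix z
      show "(h z)\<^sup>2 * (freq z $ i)\<^sup>2 \<le> eigval k z * (h z)\<^sup>2"
        using mult_right_mono[OF freq_component[of z i], of "(h z)\<^sup>2"] by (simp add: mult.commute)
    qed
    finally have n: "norm (field_of (\<psi> i)) \<le> sqrt D" by (rule real_le_rsqrt)
    \<comment> \<open>Bilinear splitting, so that each term has one factor u - v.\<close>
    have "tri i u u (\<psi> i) - tri i v v (\<psi> i) = tri i (u - v) u (\<psi> i) + tri i v (u - v) (\<psi> i)"
      using tri_diff[OF \<psi>m \<psi>L L0] by simp
    also have "\<dots> \<le> C2 * sn 2 u * norm (u - v) * norm (field_of (\<psi> i)) + C2 * sn 2 v * norm (u - v) * norm (field_of (\<psi> i))"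
      using tri_bound_sobolev(1)[OF \<psi>m \<psi>L L0 u, of i "u - v"] tri_bound_sobolev(2)[OF \<psi>m \<psi>L L0 v, of i "u - v"] by linarith
    also have "\<dots> = a * norm (field_of (\<psi> i))" by (simp add: a_def algebra_simps)
    also have "\<dots> \<le> a * sqrt D" using n C2_nonneg by (intro mult_left_mono) (auto simp: a_def)
    finally show ?thesis .
  qed
  have "(\<Sum>z\<in>F. h z * (adv z u u - adv z v v)) = (\<Sum>i\<in>UNIV. tri i u u (\<psi> i) - tri i v v (\<psi> i))"
  proof -
    have "(\<Sum>z\<in>F. h z * adv z w w) = (\<Sum>i\<in>UNIV. tri i w w (\<psi> i))" for w
    proof -
      have "tri i w w (\<psi> i) = (\<Sum>z\<in>F. h z * tri i w w (pderiv_at i (ew z)))" for i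
        unfolding \<psi>_def by (rule tri_sum_right[OF F smooth_pderiv_ew])
      then show ?thesis unfolding adv_def sum_distrib_left by (simp only:) (rule sum.swap)
    qed
    then show ?thesis by (simp add: right_diff_distrib sum_subtractf)
  qed
  also have "\<dots> \<le> (\<Sum>i\<in>(UNIV :: 3 set). a * sqrt D)" by (intro sum_mono b)
  \<comment> \<open>Three directions give 3 a; squaring it and (p + q)^2 \<le> 2 (p^2 + q^2) produce
    the constant 18.\<close>
  finally have "2 * (\<Sum>z\<in>F. h z * (adv z u u - adv z v v)) \<le> 2 * (3 * a) * sqrt D" by simp
  also have "\<dots> \<le> (3 * a)\<^sup>2 + (sqrt D)\<^sup>2" by (rule sum_squares_bound)
  also have "\<dots> = D + 9 * (C2\<^sup>2 * (sn 2 u + sn 2 v)\<^sup>2 * (norm (u - v))\<^sup>2)"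
    using D0 by (simp add: a_def power_mult_distrib)
  also have "\<dots> \<le> D + 9 * (C2\<^sup>2 * (2 * ((sn 2 u)\<^sup>2 + (sn 2 v)\<^sup>2)) * (norm (u - v))\<^sup>2)"
    using sum_squares_bound[of "sn 2 u" "sn 2 v"]
    by (intro add_left_mono mult_left_mono mult_right_mono) (auto simp: power2_sum)
  also have "\<dots> = D + 18 * C2\<^sup>2 * ((sn 2 u)\<^sup>2 + (sn 2 v)\<^sup>2) * (norm (u - v))\<^sup>2"
    by (simp add: algebra_simps)
  finally show ?thesis by (simp only: D_def)
qed

text \<open>Energy estimate for the difference of two solutions in the modes F. The difference of
  the noises is only continuous in time, so it is subtracted first and what remains is
  differentiable; it re-enters as an error of size \<eta>. The modes outside F are controlled by the
  H^1 bound M.\<close>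

lemma stability:
  assumes g1: "good S x" and g2: "good S y" and S: "0 \<le> S"
    and s1: "solves S x U g" and s2: "solves S y V h"
    and F: "finite F" "\<And>z. z \<notin> F \<Longrightarrow> \<Lambda> \<le> eigval k z" "0 \<le> \<Lambda>"
    and \<eta>: "\<And>z. z \<in> F \<Longrightarrow> \<bar>e z \<bullet> (U - V)\<bar> \<le> \<eta>" "\<And>z t. z \<in> F \<Longrightarrow> t \<in> {0..S} \<Longrightarrow> \<bar>g z t - h z t\<bar> \<le> \<eta>"
    and M: "\<And>t. t \<in> {0..S} \<Longrightarrow> sn 1 (x t) \<le> M" "\<And>t. t \<in> {0..S} \<Longrightarrow> sn 1 (y t) \<le> M"
    and A: "S + 36 * C2\<^sup>2 * ((L2H2_norm e k S x)\<^sup>2 + (L2H2_norm e k S y)\<^sup>2) \<le> real m / 2"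
    and t: "t \<in> {0..S}"
  shows "(norm (x t - y t))\<^sup>2 \<le> 2 ^ (m + 2) * (2 * \<eta>\<^sup>2 * (\<Sum>z\<in>F. 1 + eigval k z) + 4 * M\<^sup>2 / (1 + \<Lambda>))"
proof -
  \<comment> \<open>The first summand is twice the bound for the noise, and also for the datum, in
    F; the second bounds the tail, as the difference has H^1 norm at most 2 M.\<close>
  define d where "d = 2 * \<eta>\<^sup>2 * (\<Sum>z\<in>F. 1 + eigval k z) + 4 * M\<^sup>2 / (1 + \<Lambda>)"
  have sl: "0 \<le> (\<Sum>z\<in>F. 1 + eigval k z)" by (intro sum_nonneg) simp
  have d0: "0 \<le> d" unfolding d_def using sl F(3) by simp
  define w where "w s = x s - y s" for s
  define q where "q z s = g z s - h z s" for z s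
  define f where "f z s = - eigval k z * (e z \<bullet> w s) + (adv z (x s) (x s) - adv z (y s) (y s))" for z s
  \<comment> \<open>The coefficients of the difference with the noise removed, in the form of an
    integral that can be differentiated.\<close>
  define H where "H z t = e z \<bullet> (U - V) + integral {0..t} (f z)" for z t
  note cx = good_continuous[OF g1] and cy = good_continuous[OF g2]
  have cf: "continuous_on {0..S} (f z)" for z
    unfolding f_def w_def by (intro continuous_intros adv_continuous cx cy)
  have wH: "e z \<bullet> w s = H z s + q z s" if s: "s \<in> {0..S}" for z s
  proof -
    have sub: "{0..s} \<subseteq> {0..S}" using s by auto
    have i1: "(\<lambda>r. e z \<bullet> x r) integrable_on {0..s}" "(\<lambda>r. e z \<bullet> y r) integrable_on {0..s}"
      "(\<lambda>r. adv z (x r) (x r)) integrable_on {0..s}" "(\<lambda>r. adv z (y r) (y r)) integrable_on {0..s}"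
      by (intro integrable_continuous_real continuous_intros adv_continuous continuous_on_subset[OF cx sub] continuous_on_subset[OF cy sub])+
    have "((\<lambda>r. (- eigval k z) * (e z \<bullet> x r - e z \<bullet> y r) + (adv z (x r) (x r) - adv z (y r) (y r))) has_integral
        (- eigval k z) * (integral {0..s} (\<lambda>r. e z \<bullet> x r) - integral {0..s} (\<lambda>r. e z \<bullet> y r))
        + (integral {0..s} (\<lambda>r. adv z (x r) (x r)) - integral {0..s} (\<lambda>r. adv z (y r) (y r)))) {0..s}"
      by (intro has_integral_add has_integral_mult_right has_integral_diff integrable_integral i1)
    moreover have "f z = (\<lambda>r. (- eigval k z) * (e z \<bullet> x r - e z \<bullet> y r) + (adv z (x r) (x r) - adv z (y r) (y r)))"
      by (auto simp: f_def w_def inner_diff_right fun_eq_iff)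
    ultimately have int: "integral {0..s} (f z) = (- eigval k z) * (integral {0..s} (\<lambda>r. e z \<bullet> x r) - integral {0..s} (\<lambda>r. e z \<bullet> y r))
        + (integral {0..s} (\<lambda>r. adv z (x r) (x r)) - integral {0..s} (\<lambda>r. adv z (y r) (y r)))"
      by (simp only: integral_unique)
    have "e z \<bullet> x s = e z \<bullet> U - eigval k z * integral {0..s} (\<lambda>s. e z \<bullet> x s) + integral {0..s} (\<lambda>s. adv z (x s) (x s)) + g z s"
      "e z \<bullet> y s = e z \<bullet> V - eigval k z * integral {0..s} (\<lambda>s. e z \<bullet> y s) + integral {0..s} (\<lambda>s. adv z (y s) (y s)) + h z s"
      using s1 s2 s unfolding solves_def by blast+
    then show ?thesis unfolding H_def int q_def w_def by (simp add: inner_diff_right algebra_simps)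
  qed
  have dH: "(H z has_vector_derivative f z s) (at s within {0..S})" if "s \<in> {0..S}" for z s
    using has_vector_derivative_add[OF has_vector_derivative_const integral_has_vector_derivative[OF cf that]]
    unfolding H_def[abs_def] by simp
  \<comment> \<open>Adding d makes the differential inequality homogeneous, Y' \<le> \<alpha> Y, so
    that Gronwall applies directly.\<close>
  define Y where "Y s = (\<Sum>z\<in>F. (H z s)\<^sup>2) + d" for s
  define Y' where "Y' s = (\<Sum>z\<in>F. 2 * (H z s * f z s))" for s
  have dY: "(Y has_real_derivative Y' s) (at s within {0..S})" if "s \<in> {0..S}" for s
    unfolding Y_def[abs_def] Y'_def
    using dH[OF that] unfolding has_real_derivative_iff_has_vector_derivative[symmetric]
    by (auto intro!: derivative_eq_intros sum.cong simp: power2_eq_square)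
  have cY: "continuous_on {0..S} Y"
    using dY DERIV_continuous continuous_on_eq_continuous_within by blast
  \<comment> \<open>36 is twice the 18 of \<open>adv_diff_energy\<close>, because |w|^2 \<le> 2 Y;
    the 1 absorbs d \<le> Y.\<close>
  define \<alpha> where "\<alpha> s = 1 + 36 * C2\<^sup>2 * ((sn 2 (x s))\<^sup>2 + (sn 2 (y s))\<^sup>2)" for s
  have \<alpha>i: "\<alpha> integrable_on {0..S}"
    unfolding \<alpha>_def using goodD(4)[OF g1] goodD(4)[OF g2]
    by (intro integrable_add integrable_on_mult_right set_lebesgue_integral_eq_integral(1)) auto
  have \<alpha>0: "0 \<le> \<alpha> s" for s unfolding \<alpha>_def by simp
  define AA where "AA s = integral {0..s} \<alpha>" for s
  have \<alpha>sub: "\<alpha> integrable_on {s..r}" if "0 \<le> s" "r \<le> S" for s r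
    by (rule integrable_on_subinterval[OF \<alpha>i]) (use that in auto)
  have AAd: "AA r - AA s = integral {s..r} \<alpha>" if "0 \<le> s" "s \<le> r" "r \<le> S" for s r
    unfolding AA_def using Henstock_Kurzweil_Integration.integral_combine[of 0 s r \<alpha>] \<alpha>sub[of 0 r] that by simp
  have cA: "continuous_on {0..S} AA" unfolding AA_def by (rule indefinite_integral_continuous_1[OF \<alpha>i])
  have AS: "AA S \<le> real m / 2"
  proof -
    have "AA S = integral {0..S} (\<lambda>s. 1) + 36 * C2\<^sup>2 * (integral {0..S} (\<lambda>s. (sn 2 (x s))\<^sup>2) + integral {0..S} (\<lambda>s. (sn 2 (y s))\<^sup>2))"
      unfolding AA_def \<alpha>_def
      using set_lebesgue_integral_eq_integral(1)[OF goodD(4)[OF g1]] set_lebesgue_integral_eq_integral(1)[OF goodD(4)[OF g2]]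
      by (subst Henstock_Kurzweil_Integration.integral_add)
        (auto intro!: integrable_add integrable_on_mult_right simp: Henstock_Kurzweil_Integration.integral_add)
    then show ?thesis using A S
      unfolding L2H2_sq set_lebesgue_integral_eq_integral(2)[OF goodD(4)[OF g1]] set_lebesgue_integral_eq_integral(2)[OF goodD(4)[OF g2]]
      by simp
  qed
  have w2: "(norm (w s))\<^sup>2 \<le> 2 * Y s" and q2: "(\<Sum>z\<in>F. eigval k z * (q z s)\<^sup>2) \<le> d" if s: "s \<in> {0..S}" for s
  proof -
    have ql: "(q z s)\<^sup>2 \<le> \<eta>\<^sup>2" if "z \<in> F" for z
      using power_mono[OF \<eta>(2)[OF that s], of 2] by (simp add: q_def)
    have e1: "(\<Sum>z\<in>F. eigval k z * (q z s)\<^sup>2) \<le> (\<Sum>z\<in>F. \<eta>\<^sup>2 * (1 + eigval k z))"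
      and e2: "(\<Sum>z\<in>F. (q z s)\<^sup>2) \<le> (\<Sum>z\<in>F. \<eta>\<^sup>2 * (1 + eigval k z))"
    proof -
      have "eigval k z * (q z s)\<^sup>2 \<le> \<eta>\<^sup>2 * (1 + eigval k z)" "(q z s)\<^sup>2 \<le> \<eta>\<^sup>2 * (1 + eigval k z)" if "z \<in> F" for z
      proof -
        have "eigval k z * (q z s)\<^sup>2 \<le> (1 + eigval k z) * \<eta>\<^sup>2" using ql[OF that] by (intro mult_mono) auto
        then show "eigval k z * (q z s)\<^sup>2 \<le> \<eta>\<^sup>2 * (1 + eigval k z)" by (simp add: mult.commute)
        have "1 * (q z s)\<^sup>2 \<le> (1 + eigval k z) * \<eta>\<^sup>2" using ql[OF that] by (intro mult_mono) auto
        then show "(q z s)\<^sup>2 \<le> \<eta>\<^sup>2 * (1 + eigval k z)" by (simp add: mult.commute)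
      qed
      then show "(\<Sum>z\<in>F. eigval k z * (q z s)\<^sup>2) \<le> (\<Sum>z\<in>F. \<eta>\<^sup>2 * (1 + eigval k z))"
        "(\<Sum>z\<in>F. (q z s)\<^sup>2) \<le> (\<Sum>z\<in>F. \<eta>\<^sup>2 * (1 + eigval k z))" by (simp_all add: sum_mono)
    qed
    define c where "c = 4 * M\<^sup>2 / (1 + \<Lambda>)"
    have dd: "(\<Sum>z\<in>F. \<eta>\<^sup>2 * (1 + eigval k z)) = (d - c) / 2"
      unfolding sum_distrib_left[symmetric] d_def c_def by simp
    have M0: "0 \<le> c" using F(3) by (simp add: c_def)
    have "(d - c) / 2 \<le> d" using M0 d0 by simp
    then show "(\<Sum>z\<in>F. eigval k z * (q z s)\<^sup>2) \<le> d" by (rule order_trans[OF e1[unfolded dd]])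
    have ws: "w s \<in> sobolev e k 1" unfolding w_def by (rule sobolev_diff(1)[OF goodD(1)[OF g1 s] goodD(1)[OF g2 s]])
    have "sn 1 (w s) \<le> 2 * M" unfolding w_def
      using sobolev_diff(2)[OF goodD(1)[OF g1 s] goodD(1)[OF g2 s]] M(1)[OF s] M(2)[OF s] by linarith
    then have "(sn 1 (w s))\<^sup>2 / (1 + \<Lambda>) \<le> (2 * M)\<^sup>2 / (1 + \<Lambda>)"
      using F(3) by (intro divide_right_mono power_mono) auto
    then have "(sn 1 (w s))\<^sup>2 / (1 + \<Lambda>) \<le> c" by (simp add: c_def power_mult_distrib)
    moreover have "(\<Sum>z\<in>F. (e z \<bullet> w s)\<^sup>2) \<le> (\<Sum>z\<in>F. 2 * (H z s)\<^sup>2 + 2 * (q z s)\<^sup>2)"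
    proof (rule sum_mono)
      fix z
      show "(e z \<bullet> w s)\<^sup>2 \<le> 2 * (H z s)\<^sup>2 + 2 * (q z s)\<^sup>2"
        unfolding wH[OF s] using sum_squares_bound[of "H z s" "q z s"] by (simp add: power2_sum)
    qed
    moreover have "(\<Sum>z\<in>F. 2 * (H z s)\<^sup>2 + 2 * (q z s)\<^sup>2) = 2 * (\<Sum>z\<in>F. (H z s)\<^sup>2) + 2 * (\<Sum>z\<in>F. (q z s)\<^sup>2)"
      by (simp add: sum.distrib sum_distrib_left)
    moreover have "(norm (w s))\<^sup>2 \<le> (\<Sum>z\<in>F. (e z \<bullet> w s)\<^sup>2) + (sn 1 (w s))\<^sup>2 / (1 + \<Lambda>)"
      by (rule tail_bound[OF F(1) _ F(3) ws]) (rule F(2))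
    moreover have "n \<le> 2 * (a2 + d)"
      if "b \<le> c" "a1 \<le> z" "z = 2 * a2 + 2 * a3" "n \<le> a1 + b" "a3 \<le> (d - c) / 2" for n a1 a2 a3 b z :: real
      using that M0 d0 by simp
    ultimately show "(norm (w s))\<^sup>2 \<le> 2 * Y s"
      using e2 unfolding dd Y_def by blast
  qed
  have Y0: "0 \<le> Y s" for s unfolding Y_def using d0 by (simp add: sum_nonneg)
  have der: "Y' s \<le> \<alpha> s * Y s" if s: "s \<in> {0..S}" "x s \<in> sobolev e k 2" "y s \<in> sobolev e k 2" for s
  proof -
    define D where "D = (\<Sum>z\<in>F. eigval k z * (H z s)\<^sup>2)"
    have e: "2 * (H z s * f z s) \<le> - (eigval k z * (H z s)\<^sup>2) + eigval k z * (q z s)\<^sup>2 + 2 * (H z s * (adv z (x s) (x s) - adv z (y s) (y s)))" for z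
    proof -
      \<comment> \<open>Half of the dissipation is kept; with this square the other half turns the
        cross term into the error eigval * q^2.\<close>
      have "0 \<le> eigval k z * (H z s + q z s)\<^sup>2" by simp
      then show ?thesis unfolding f_def wH[OF s(1)] by (simp add: power2_eq_square algebra_simps)
    qed
    have "Y' s \<le> (\<Sum>z\<in>F. - (eigval k z * (H z s)\<^sup>2) + eigval k z * (q z s)\<^sup>2 + 2 * (H z s * (adv z (x s) (x s) - adv z (y s) (y s))))"
      unfolding Y'_def by (intro sum_mono e)
    also have "\<dots> = - D + (\<Sum>z\<in>F. eigval k z * (q z s)\<^sup>2) + 2 * (\<Sum>z\<in>F. H z s * (adv z (x s) (x s) - adv z (y s) (y s)))"
      by (simp add: D_def sum.distrib sum_negf sum_subtractf sum_distrib_left)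
    also have "\<dots> \<le> - D + d + (D + 18 * C2\<^sup>2 * ((sn 2 (x s))\<^sup>2 + (sn 2 (y s))\<^sup>2) * (norm (w s))\<^sup>2)"
      using q2[OF s(1)] adv_diff_energy[OF F(1) s(2,3), of "\<lambda>z. H z s"] unfolding D_def w_def by linarith
    also have "\<dots> \<le> d + 18 * C2\<^sup>2 * ((sn 2 (x s))\<^sup>2 + (sn 2 (y s))\<^sup>2) * (2 * Y s)"
      using mult_left_mono[OF w2[OF s(1)], of "18 * C2\<^sup>2 * ((sn 2 (x s))\<^sup>2 + (sn 2 (y s))\<^sup>2)"] by simp
    also have "\<dots> \<le> Y s + 18 * C2\<^sup>2 * ((sn 2 (x s))\<^sup>2 + (sn 2 (y s))\<^sup>2) * (2 * Y s)"
      by (simp add: Y_def sum_nonneg)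
    also have "\<dots> = \<alpha> s * Y s" by (simp add: \<alpha>_def algebra_simps)
    finally show ?thesis .
  qed
  have inc: "Y r \<le> Y s + B * (AA r - AA s)"
    if sr: "0 \<le> s" "s \<le> r" "r \<le> S" and B: "\<And>p. p \<in> {s..r} \<Longrightarrow> Y p \<le> B" for s r B
  proof -
    have "(Y' has_integral Y r - Y s) {s..r}"
    proof (rule fundamental_theorem_of_calculus[OF sr(2)])
      fix p assume "p \<in> {s..r}"
      then show "(Y has_vector_derivative Y' p) (at p within {s..r})"
        using dY[of p] sr unfolding has_real_derivative_iff_has_vector_derivative
        by (auto intro: has_vector_derivative_within_subset)
    qed
    then have I: "Y' integrable_on {s..r}" "integral {s..r} Y' = Y r - Y s" by (auto simp: has_integral_iff)
    define N where "N = {p. \<not> (p \<in> {0..S} \<longrightarrow> x p \<in> sobolev e k 2)} \<union> {p. \<not> (p \<in> {0..S} \<longrightarrow> y p \<in> sobolev e k 2)}"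
    have N: "negligible N" unfolding N_def
      by (intro negligible_Un) (use goodD(3)[OF g1] goodD(3)[OF g2] in \<open>simp_all only: AE_lebesgue_iff_negligible\<close>)
    \<comment> \<open>On the null set of times at which a path is not in H^2, the integrand is
      replaced by the desired bound.\<close>
    define Z where "Z p = (if p \<in> N then B * \<alpha> p else Y' p)" for p
    have ZY: "Z p = Y' p" if "p \<in> {s..r} - N" for p using that by (simp add: Z_def)
    have "integral {s..r} Y' = integral {s..r} Z" by (rule integral_spike[OF N]) (rule ZY)
    also have "\<dots> \<le> integral {s..r} (\<lambda>p. B * \<alpha> p)"
    proof (rule integral_le)
      show "Z integrable_on {s..r}" by (rule integrable_spike[OF I(1) N ZY])
      show "(\<lambda>p. B * \<alpha> p) integrable_on {s..r}" by (intro integrable_on_mult_right \<alpha>sub sr)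
      fix p assume p: "p \<in> {s..r}"
      show "Z p \<le> B * \<alpha> p"
      proof (cases "p \<in> N")
        case False
        have pS: "p \<in> {0..S}" using p sr by auto
        then have "Y' p \<le> \<alpha> p * Y p" using False by (intro der) (auto simp: N_def)
        also have "\<dots> \<le> \<alpha> p * B" by (intro mult_left_mono B p \<alpha>0)
        finally show ?thesis using False by (simp add: Z_def mult.commute)
      qed (simp add: Z_def)
    qed
    finally have "integral {s..r} Y' \<le> integral {s..r} (\<lambda>p. B * \<alpha> p)" .
    then have "Y r - Y s \<le> B * integral {s..r} \<alpha>" by (simp add: I)
    then show ?thesis using AAd[OF sr] by simp
  qed
  have YG: "Y t \<le> 2 ^ m * Y 0"
  proof (rule gronwall_increment[OF cY Y0 cA])
    show "AA 0 = 0" by (simp add: AA_def)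
    show "AA s \<le> AA r" if "0 \<le> s" "s \<le> r" "r \<le> S" for s r
      using AAd[OF that] integral_nonneg[OF \<alpha>sub[OF that(1,3)]] \<alpha>0 by simp
    show "AA t \<le> real m / 2"
      using AAd[of t S] integral_nonneg[OF \<alpha>sub[of t S]] \<alpha>0 AS t by simp
  qed (use inc t in auto)
  have Y02: "Y 0 \<le> 2 * d"
  proof -
    have "(H z 0)\<^sup>2 \<le> \<eta>\<^sup>2 * (1 + eigval k z)" if "z \<in> F" for z
    proof -
      have "(H z 0)\<^sup>2 \<le> \<eta>\<^sup>2 * 1" using power_mono[OF \<eta>(1)[OF that], of 2] by (simp add: H_def)
      also have "\<dots> \<le> \<eta>\<^sup>2 * (1 + eigval k z)" by (intro mult_left_mono) auto
      finally show ?thesis .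
    qed
    then have "(\<Sum>z\<in>F. (H z 0)\<^sup>2) \<le> (\<Sum>z\<in>F. \<eta>\<^sup>2 * (1 + eigval k z))" by (rule sum_mono)
    also have "\<dots> = \<eta>\<^sup>2 * (\<Sum>z\<in>F. 1 + eigval k z)" by (rule sum_distrib_left[symmetric])
    also have "\<dots> \<le> d" using sl F(3) by (simp add: d_def)
    finally show ?thesis by (simp add: Y_def)
  qed
  have "2 ^ m * Y 0 \<le> 2 ^ m * (2 * d)" by (rule mult_left_mono[OF Y02]) simp
  from order_trans[OF YG this] have "Y t \<le> 2 ^ m * (2 * d)" .
  \<comment> \<open>The power collects 2^m from Gronwall, 2 from Y 0 \<le> 2 d and 2 from |w|^2
    \<le> 2 Y.\<close>
  then have "2 * Y t \<le> 2 ^ (m + 2) * d" by (simp add: mult_ac)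
  then show ?thesis using w2[OF t] unfolding d_def w_def by linarith
qed

section \<open>Lower semicontinuity of closeness\<close>

lemma psum_tendsto:
  assumes u: "u \<in> sobolev e k \<gamma>" shows "(\<lambda>n. psum \<gamma> n u) \<longlonglongrightarrow> (sn \<gamma> u)\<^sup>2"
proof -
  have "incseq (\<lambda>n. psum \<gamma> n u)" by (simp add: incseq_def psum_mono)
  from incseq_convergent[OF this, of "(sn \<gamma> u)\<^sup>2"] psum_le[OF u]
  obtain L where L: "(\<lambda>n. psum \<gamma> n u) \<longlonglongrightarrow> L" "\<And>n. psum \<gamma> n u \<le> L" by auto
  have "L \<le> (sn \<gamma> u)\<^sup>2" by (rule LIMSEQ_le_const2[OF L(1)]) (use psum_le[OF u] in auto)
  moreover have "(sn \<gamma> u)\<^sup>2 \<le> L" unfolding sn_sq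
  proof (rule infsum_le_finite_sums[OF sobolev_summable[OF u]])
    fix F :: "'z set" assume "finite F"
    from sum_le_psum[OF this] obtain n where "(\<Sum>z\<in>F. wgt \<gamma> z * (e z \<bullet> u)\<^sup>2) \<le> psum \<gamma> n u" by blast
    then show "(\<Sum>z\<in>F. wgt \<gamma> z * (e z \<bullet> u)\<^sup>2) \<le> L" using L(2)[of n] by linarith
  qed
  ultimately show ?thesis using L(1) by simp
qed

lemma psum_continuous:
  assumes "continuous_on A x" shows "continuous_on A (\<lambda>s. psum \<gamma> n (x s))"
  unfolding psum_def by (intro continuous_intros assms)


text \<open>Finite Fourier sums converge when the paths converge in L^2 at each time, and they keep
  their bounds; letting the sums grow recovers the H^1 norm and, after integration in time, the L^2
  H^2 norm.\<close>

lemma close_to_limit: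
  assumes x: "good S x" and u: "good S u" and y: "\<And>j. good S (y j)" and S: "0 \<le> S"
    and cl: "\<And>j. close_to S r (y j) u"
    and lim: "\<And>s. s \<in> {0..S} \<Longrightarrow> (\<lambda>j. y j s) \<longlonglongrightarrow> x s"
    and bd: "\<And>j s. s \<in> {0..S} \<Longrightarrow> sn 1 (y j s - u s) \<le> r"
  shows "close_to S r x u"
proof -
  have r0: "0 \<le> r" by (rule order_trans[OF sn_nonneg bd[of 0 0]]) (use S in simp)
  have plim: "(\<lambda>j. psum \<gamma> n (y j s - u s)) \<longlonglongrightarrow> psum \<gamma> n (x s - u s)" if "s \<in> {0..S}" for \<gamma> n s
    unfolding psum_def by (intro tendsto_intros lim that)
  have 1: "sn 1 (x s - u s) \<le> r" if s: "s \<in> {0..S}" for s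
  proof (rule sobolevI_psum(2)[OF _ _ r0])
    show "x s - u s \<in> df_space" by (rule sobolev_df[OF goodD(1)[OF good_diff[OF x u] s]])
    fix n
    show "psum 1 n (x s - u s) \<le> r\<^sup>2"
    proof (rule LIMSEQ_le_const2[OF plim[OF s]], intro exI[of _ 0] allI impI)
      fix j
      have "psum 1 n (y j s - u s) \<le> (sn 1 (y j s - u s))\<^sup>2"
        by (rule psum_le[OF goodD(1)[OF good_diff[OF y u] s]])
      also have "\<dots> \<le> r\<^sup>2" by (intro power_mono bd s) simp
      finally show "psum 1 n (y j s - u s) \<le> r\<^sup>2" .
    qed
  qed
  define P where "P n z s = indicator {0..S} s *\<^sub>R psum 2 n (z s - u s)" for n and z :: "real \<Rightarrow> vfield" and s :: real
  have Pm: "P n z \<in> borel_measurable borel" if "good S z" for n z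
    unfolding P_def
    by (intro borel_measurable_continuous_on_indicator psum_continuous good_continuous[OF good_diff[OF that u]]) simp
  have Pm': "P n z \<in> borel_measurable lebesgue" if "good S z" for n z
    by (rule measurable_completion) (use Pm[OF that] in simp)
  have i2: "integrable lebesgue (\<lambda>s. indicator {0..S} s *\<^sub>R (sn 2 (z s - u s))\<^sup>2)" if "good S z" for z
    using goodD(4)[OF good_diff[OF that u]] by (simp add: set_integrable_def)
  have Ple: "AE s in lebesgue. norm (P n z s) \<le> indicator {0..S} s *\<^sub>R (sn 2 (z s - u s))\<^sup>2" if "good S z" for n z
    using goodD(3)[OF good_diff[OF that u]]
    by eventually_elim (auto simp: P_def indicator_def psum_nonneg intro: psum_le)
  have yn: "(\<integral>s. P n (y j) s \<partial>lebesgue) \<le> r\<^sup>2" for n j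
  proof -
    have "(\<integral>s. P n (y j) s \<partial>lebesgue) \<le> (\<integral>s. indicator {0..S} s *\<^sub>R (sn 2 (y j s - u s))\<^sup>2 \<partial>lebesgue)"
    proof (rule integral_mono_AE[OF _ i2[OF y]])
      show "integrable lebesgue (P n (y j))"
        by (rule Bochner_Integration.integrable_bound[OF i2[OF y[of j]] Pm'[OF y]]) (use Ple[OF y] in auto)
      show "AE s in lebesgue. P n (y j) s \<le> indicator {0..S} s *\<^sub>R (sn 2 (y j s - u s))\<^sup>2"
        using Ple[OF y[of j], of n] by eventually_elim auto
    qed
    also have "\<dots> = (L2H2_norm e k S (\<lambda>s. y j s - u s))\<^sup>2" unfolding L2H2_sq set_lebesgue_integral_def ..
    also have "\<dots> \<le> r\<^sup>2" using cl[of j] unfolding close_to_def by (intro power_mono) auto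
    finally show ?thesis .
  qed
  have xn: "(\<integral>s. P n x s \<partial>lebesgue) \<le> r\<^sup>2" for n
  proof (rule LIMSEQ_le_const2)
    \<comment> \<open>Dominates the n-th partial sums uniformly in j and s, since
      \<open>y j - u\<close> has H^1 norm at most r.\<close>
    define K where "K = (\<Sum>z\<in>E n. wgt 2 z * r\<^sup>2)"
    show "(\<lambda>j. \<integral>s. P n (y j) s \<partial>lebesgue) \<longlonglongrightarrow> (\<integral>s. P n x s \<partial>lebesgue)"
    proof (rule integral_dominated_convergence[where w="\<lambda>s. indicator {0..S} s * K"])
      show "integrable lebesgue (\<lambda>s. indicator {0..S} s * K)"
        by (intro integrable_mult_left integrable_real_indicator) (use S in \<open>auto simp: emeasure_completion\<close>)
      show "AE s in lebesgue. (\<lambda>j. P n (y j) s) \<longlonglongrightarrow> P n x s"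
        unfolding P_def by (rule AE_I2) (auto simp: indicator_def intro: plim)
      show "AE s in lebesgue. norm (P n (y j) s) \<le> indicator {0..S} s * K" for j
      proof (rule AE_I2)
        fix s :: real
        show "norm (P n (y j) s) \<le> indicator {0..S} s * K"
        proof (cases "s \<in> {0..S}")
          case True
          have "(e z \<bullet> (y j s - u s))\<^sup>2 \<le> r\<^sup>2" for z
          proof -
            have "\<bar>e z \<bullet> (y j s - u s)\<bar> \<le> norm (e z) * norm (y j s - u s)" by (rule Cauchy_Schwarz_ineq2)
            also have "\<dots> \<le> sn 1 (y j s - u s)"
              using norm_le_sn[OF goodD(1)[OF good_diff[OF y u] True]] by simp
            also have "\<dots> \<le> r" by (rule bd[OF True])
            finally show ?thesis using power_mono[of "\<bar>e z \<bullet> (y j s - u s)\<bar>" r 2] by simp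
          qed
          then have "psum 2 n (y j s - u s) \<le> K" unfolding psum_def K_def by (intro sum_mono mult_left_mono) auto
          then show ?thesis using True psum_nonneg by (simp add: P_def)
        qed (simp add: P_def)
      qed
    qed (use Pm'[OF x] Pm'[OF y] in auto)
  qed (use yn in auto)
  have "(\<integral>s. indicator {0..S} s *\<^sub>R (sn 2 (x s - u s))\<^sup>2 \<partial>lebesgue) \<le> r\<^sup>2"
  proof (rule LIMSEQ_le_const2)
    show "(\<lambda>n. \<integral>s. P n x s \<partial>lebesgue) \<longlonglongrightarrow> (\<integral>s. indicator {0..S} s *\<^sub>R (sn 2 (x s - u s))\<^sup>2 \<partial>lebesgue)"
    proof (rule integral_dominated_convergence[OF _ _ i2[OF x]])
      show "(\<lambda>s. indicator {0..S} s *\<^sub>R (sn 2 (x s - u s))\<^sup>2) \<in> borel_measurable lebesgue"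
        using i2[OF x] by (rule borel_measurable_integrable)
      show "P n x \<in> borel_measurable lebesgue" for n by (rule Pm'[OF x])
      show "AE s in lebesgue. (\<lambda>n. P n x s) \<longlonglongrightarrow> indicator {0..S} s *\<^sub>R (sn 2 (x s - u s))\<^sup>2"
        using goodD(3)[OF good_diff[OF x u]]
        by eventually_elim (auto simp: P_def indicator_def intro: psum_tendsto)
      show "AE s in lebesgue. norm (P n x s) \<le> indicator {0..S} s *\<^sub>R (sn 2 (x s - u s))\<^sup>2" for n
        by (rule Ple[OF x])
    qed
  qed (use xn in auto)
  then have "(L2H2_norm e k S (\<lambda>s. x s - u s))\<^sup>2 \<le> r\<^sup>2" unfolding L2H2_sq set_lebesgue_integral_def .
  then have "L2H2_norm e k S (\<lambda>s. x s - u s) \<le> r" by (rule power2_le_imp_le) (rule r0)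
  then show ?thesis using 1 by (simp add: close_to_def)
qed

text \<open>Tolerance for the modes \<open>E j\<close>, small enough that the first error term of
  \<open>stability\<close> is at most 2/(j+1) despite the growth of the eigenvalue sum.\<close>

definition eta :: "nat \<Rightarrow> real" where "eta j = 1 / (real (Suc j) * (1 + (\<Sum>z\<in>E j. 1 + eigval k z)))"

lemma eta_pos: "0 < eta j"
  unfolding eta_def by (intro divide_pos_pos mult_pos_pos add_pos_nonneg sum_nonneg) auto

lemma eta_bound: "2 * (eta j)\<^sup>2 * (\<Sum>z\<in>E j. 1 + eigval k z) \<le> 2 / real (Suc j)"
proof -
  define s where "s = (\<Sum>z\<in>E j. 1 + eigval k z)"
  have s: "0 \<le> s" unfolding s_def by (intro sum_nonneg) simp
  have "(eta j)\<^sup>2 * s \<le> eta j * (eta j * (1 + s))"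
    using eta_pos[of j] s by (simp add: power2_eq_square mult.assoc mult_left_mono)
  also have "eta j * (1 + s) = 1 / real (Suc j)"
    using s unfolding eta_def s_def[symmetric] by (simp add: add_nonneg_eq_0_iff)
  also have "eta j * (1 / real (Suc j)) \<le> 1 * (1 / real (Suc j))"
  proof (rule mult_right_mono)
    have "1 \<le> real (Suc j) * (1 + s)" using s mult_mono[of 1 "real (Suc j)" 1 "1 + s"] by simp
    then show "eta j \<le> 1" unfolding eta_def s_def[symmetric] by simp
  qed simp
  finally show ?thesis by (simp add: s_def)
qed

text \<open>If solutions close to u approximate the datum and the noise of x in more and more modes,
  stability gives L^2 convergence to x and \<open>close_to_limit\<close> applies. The bounds that
  stability needs uniformly in j come from closeness of \<open>y j\<close> to u.\<close>

lemma solution_limit_close: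
  assumes x: "good S x" "solves S x U g" and u: "good S u" and S: "0 \<le> S"
    and y: "\<And>j. good S (y j)" "\<And>j. solves S (y j) (V j) (h j)" "\<And>j. close_to S r (y j) u"
    and V: "\<And>j z. z \<in> E j \<Longrightarrow> \<bar>e z \<bullet> (U - V j)\<bar> \<le> eta j"
    and h: "\<And>j z t. z \<in> E j \<Longrightarrow> t \<in> {0..S} \<Longrightarrow> \<bar>g z t - h j z t\<bar> \<le> eta j"
  shows "close_to S r x u"
proof (rule close_to_limit[OF x(1) u y(1) S y(3)])
  have bd: "sn 1 (y j s - u s) \<le> r" if "s \<in> {0..S}" for j s
    using y(3)[of j] that by (simp add: close_to_def)
  then show "sn 1 (y j s - u s) \<le> r" if "s \<in> {0..S}" for j s using that .
  have r0: "0 \<le> r" by (rule order_trans[OF sn_nonneg bd[of 0 0]]) (use S in simp)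
  obtain Mu where Mu: "0 < Mu" "\<And>s. s \<in> {0..S} \<Longrightarrow> sn 1 (u s) \<le> Mu" using good_sn1_bounded[OF u] by blast
  obtain Mx where Mx: "0 < Mx" "\<And>s. s \<in> {0..S} \<Longrightarrow> sn 1 (x s) \<le> Mx" using good_sn1_bounded[OF x(1)] by blast
  define M where "M = max Mx (r + Mu)"
  have yM: "sn 1 (y j s) \<le> r + Mu" if s: "s \<in> {0..S}" for j s
  proof -
    have "sn 1 ((y j s - u s) + u s) \<le> sn 1 (y j s - u s) + sn 1 (u s)"
      by (intro sobolev_add sobolev_diff goodD(1)[OF y(1) s] goodD(1)[OF u s])
    then show ?thesis using bd[OF s, of j] Mu(2)[OF s] by simp
  qed
  define L where "L = r + L2H2_norm e k S u"
  have yL: "L2H2_norm e k S (y j) \<le> L" for j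
  proof -
    \<comment> \<open>The zero path, used to write y as (y - u) - (0 - u) for
      \<open>L2H2_triangle\<close>.\<close>
    have "good S (\<lambda>s. u s - u s)" by (rule good_diff[OF u u])
    have "L2H2_norm e k S (\<lambda>s. (y j s - u s) - (0 - u s)) \<le> L2H2_norm e k S (\<lambda>s. y j s - u s) + L2H2_norm e k S (\<lambda>s. 0 - u s)"
      using L2H2_triangle[OF good_diff[OF y(1)[of j] u] good_diff[OF \<open>good S (\<lambda>s. u s - u s)\<close> u]] by simp
    also have "L2H2_norm e k S (\<lambda>s. 0 - u s) = L2H2_norm e k S u"
      unfolding L2H2_norm_def sn_minus[of 2 0] by simp
    finally show ?thesis using y(3)[of j] by (simp add: L_def close_to_def)
  qed
  obtain m where m: "S + 36 * C2\<^sup>2 * ((L2H2_norm e k S x)\<^sup>2 + L\<^sup>2) \<le> real m / 2"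
  proof -
    obtain m where "2 * (S + 36 * C2\<^sup>2 * ((L2H2_norm e k S x)\<^sup>2 + L\<^sup>2)) \<le> real m" using real_arch_simple by blast
    then show ?thesis using that[of m] by simp
  qed
  have key: "(norm (x t - y j t))\<^sup>2 \<le> 2 ^ (m + 2) * (2 / real (Suc j) + 4 * M\<^sup>2 / (1 + \<Lambda>))"
    if t: "t \<in> {0..S}" and \<Lambda>: "0 \<le> \<Lambda>" "\<And>z. z \<notin> E j \<Longrightarrow> \<Lambda> \<le> eigval k z" for t j \<Lambda>
  proof -
    have m': "S + 36 * C2\<^sup>2 * ((L2H2_norm e k S x)\<^sup>2 + (L2H2_norm e k S (y j))\<^sup>2) \<le> real m / 2"
    proof -
      have "(L2H2_norm e k S (y j))\<^sup>2 \<le> L\<^sup>2" by (intro power_mono yL) simp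
      then have "36 * C2\<^sup>2 * ((L2H2_norm e k S x)\<^sup>2 + (L2H2_norm e k S (y j))\<^sup>2) \<le> 36 * C2\<^sup>2 * ((L2H2_norm e k S x)\<^sup>2 + L\<^sup>2)"
        by (intro mult_left_mono add_left_mono) auto
      then show ?thesis using m by linarith
    qed
    have b1: "sn 1 (x s) \<le> M" "sn 1 (y j s) \<le> M" if "s \<in> {0..S}" for s
      using Mx(2)[OF that] yM[OF that, of j] by (auto simp: M_def le_max_iff_disj)
    have "(norm (x t - y j t))\<^sup>2 \<le> 2 ^ (m + 2) * (2 * (eta j)\<^sup>2 * (\<Sum>z\<in>E j. 1 + eigval k z) + 4 * M\<^sup>2 / (1 + \<Lambda>))"
      by (rule stability[where g=g and h="h j" and U=U and V="V j" and S=S and \<eta>="eta j" and F="E j"])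
        (use x y(1,2) S \<Lambda> V h b1 m' t in auto)
    also have "\<dots> \<le> 2 ^ (m + 2) * (2 / real (Suc j) + 4 * M\<^sup>2 / (1 + \<Lambda>))"
      by (intro mult_left_mono add_right_mono eta_bound) simp
    finally show ?thesis .
  qed
  show "(\<lambda>j. y j s) \<longlonglongrightarrow> x s" if s: "s \<in> {0..S}" for s
  proof (rule LIMSEQ_I)
    fix \<epsilon> :: real assume \<epsilon>: "0 < \<epsilon>"
    define c where "c = (2::real) ^ (m + 2)"
    have c: "0 < c" by (simp add: c_def)
    \<comment> \<open>Makes the tail term at most \<epsilon>^2/2; N below does the same for the term
      2/(j+1).\<close>
    define \<Lambda> where "\<Lambda> = 8 * M\<^sup>2 * c / \<epsilon>\<^sup>2"
    have \<Lambda>: "0 \<le> \<Lambda>" using c by (simp add: \<Lambda>_def)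
    obtain n where n: "{z. eigval k z \<le> \<Lambda>} \<subseteq> E n" using E_covers[OF finite_eigval] by blast
    obtain N where N: "4 * c / \<epsilon>\<^sup>2 < real N" using reals_Archimedean2 by blast
    show "\<exists>no. \<forall>j\<ge>no. norm (y j s - x s) < \<epsilon>"
    proof (intro exI allI impI)
      fix j assume j: "max n N \<le> j"
      have "\<Lambda> \<le> eigval k z" if "z \<notin> E j" for z
        using n E_mono[of n j] j that by (force simp: not_le intro: less_imp_le)
      from key[OF s \<Lambda> this, of j] have "(norm (x s - y j s))\<^sup>2 \<le> c * (2 / real (Suc j)) + c * (4 * M\<^sup>2 / (1 + \<Lambda>))"
        by (simp add: c_def distrib_left)
      also have "c * (2 / real (Suc j)) < \<epsilon>\<^sup>2 / 2"
      proof -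
        have "4 * c / \<epsilon>\<^sup>2 < real (Suc j)" using N j by simp
        then show ?thesis using \<epsilon> c by (simp add: field_simps)
      qed
      also have "c * (4 * M\<^sup>2 / (1 + \<Lambda>)) \<le> \<epsilon>\<^sup>2 / 2"
      proof -
        have "8 * M\<^sup>2 * c = \<epsilon>\<^sup>2 * \<Lambda>" using \<epsilon> by (simp add: \<Lambda>_def)
        also have "\<dots> \<le> \<epsilon>\<^sup>2 * (1 + \<Lambda>)" by (intro mult_left_mono) auto
        finally show ?thesis using \<Lambda> by (simp add: field_simps)
      qed
      finally have "(norm (x s - y j s))\<^sup>2 < \<epsilon>\<^sup>2" by simp
      then have "norm (x s - y j s) < \<epsilon>" by (rule power2_less_imp_less) (use \<epsilon> in simp)
      then show "norm (y j s - x s) < \<epsilon>" by (simp add: norm_minus_commute)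
    qed
  qed
qed

section \<open>Weak formulation on waves\<close>

lemma LINT_stokes_wave:
  assumes x: "good t x"
  shows "(LINT s:{0..t}|lebesgue. stokes (x s) \<bullet> field_of (wave (freq z) a b))
    = integral {0..t} (\<lambda>s. eigval k z * (x s \<bullet> field_of (wave (freq z) a b)))"
proof (rule LINT_spike_continuous(1))
  show "continuous_on {0..t} (\<lambda>s. eigval k z * (x s \<bullet> field_of (wave (freq z) a b)))"
    by (intro continuous_intros good_continuous x)
  show "AE s in lebesgue. s \<in> {0..t} \<longrightarrow> stokes (x s) \<bullet> field_of (wave (freq z) a b) = eigval k z * (x s \<bullet> field_of (wave (freq z) a b))"
    using goodD(3)[OF x] by eventually_elim (simp add: stokes_wave)
qed

lemma advection_continuous:
  assumes x: "good t x" and \<phi>: "smooth_periodic \<phi>"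
  shows "continuous_on {0..t} (\<lambda>s. advection (x s) \<phi>)"
proof -
  have "continuous_on {0..t} (\<lambda>s. - (\<Sum>i\<in>UNIV. tri i (x s) (x s) (pderiv_at i \<phi>)))"
    by (intro continuous_intros tri_continuous smooth_periodic_pderiv \<phi> good_continuous x)
  then show ?thesis
    by (rule continuous_on_cong[THEN iffD1, rotated -1]) (simp_all add: advection_divergence_form[OF goodD(1)[OF x] \<phi>])
qed

lemma LINT_advection:
  assumes x: "good t x" and \<phi>: "smooth_periodic \<phi>"
  shows "(LINT s:{0..t}|lebesgue. advection (x s) \<phi>) = integral {0..t} (\<lambda>s. advection (x s) \<phi>)"
  by (rule LINT_spike_continuous(1)[OF advection_continuous[OF x \<phi>]]) simp

lemma advection_ew: "u \<in> sobolev e k 1 \<Longrightarrow> advection u (ew z) = - adv z u u"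
  unfolding adv_def by (rule advection_divergence_form[OF _ ew_smooth])

lemma weak_solves:
  assumes x: "good S x"
    and eq: "\<And>z t. t \<in> {0..S} \<Longrightarrow>
        x t \<bullet> field_of (ew z) + (LINT s:{0..t}|lebesgue. stokes (x s) \<bullet> field_of (ew z)) =
        U \<bullet> field_of (ew z) - (LINT s:{0..t}|lebesgue. advection (x s) (ew z)) + g z t"
  shows "solves S x U g"
  unfolding solves_def
proof (intro allI ballI)
  fix z t assume t: "t \<in> {0..S}"
  have gt: "good t x" by (rule good_mono[OF x]) (use t in simp)
  have 1: "(LINT s:{0..t}|lebesgue. stokes (x s) \<bullet> field_of (ew z)) = eigval k z * integral {0..t} (\<lambda>s. e z \<bullet> x s)"
    using LINT_stokes_wave[OF gt, of z "fst (amp z)" "snd (amp z)"] amp(1)[of z]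
    by (simp add: ew_def[symmetric] inner_commute)
  have 2: "(LINT s:{0..t}|lebesgue. advection (x s) (ew z)) = - integral {0..t} (\<lambda>s. adv z (x s) (x s))"
  proof -
    have "integral {0..t} (\<lambda>s. advection (x s) (ew z)) = integral {0..t} (\<lambda>s. - adv z (x s) (x s))"
      by (rule Henstock_Kurzweil_Integration.integral_cong) (simp add: advection_ew[OF goodD(1)[OF gt]])
    then show ?thesis unfolding LINT_advection[OF gt ew_smooth] by simp
  qed
  show "e z \<bullet> x t = e z \<bullet> U - eigval k z * integral {0..t} (\<lambda>s. e z \<bullet> x s) + integral {0..t} (\<lambda>s. adv z (x s) (x s)) + g z t"
    using eq[OF t, of z, unfolded 1 2] amp(1)[of z] by (simp add: inner_commute)
qed


text \<open>The noise increment is the increment of the coefficient along \<open>fw z\<close>, at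
  most 2 M / c by \<open>weak_deriv_fw\<close>, plus the time integral of c^2 times that coefficient
  and of the advection, at most c M and 6 M^2 per unit time; 6 is 3 times the bound 2 on the
  wave.\<close>

lemma spike:
  assumes x: "good t1 x" and t: "0 \<le> t0" "t0 \<le> t1"
    and fr: "freq z = axis 1 c" "0 < c"
    and M: "\<And>s. s \<in> {0..t1} \<Longrightarrow> sn 1 (x s) \<le> M"
    and eq: "\<And>t. t = t0 \<or> t = t1 \<Longrightarrow>
        x t \<bullet> field_of (fw z) + (LINT s:{0..t}|lebesgue. stokes (x s) \<bullet> field_of (fw z)) =
        a - (LINT s:{0..t}|lebesgue. advection (x s) (fw z)) + n t"
  shows "\<bar>n t1 - n t0\<bar> \<le> 2 * M / c + c * M * (t1 - t0) + 6 * M\<^sup>2 * (t1 - t0)"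
proof -
  have M0: "0 \<le> M" by (rule order_trans[OF sn_nonneg M[of 0]]) (use t in simp)
  have lam: "eigval k z = c\<^sup>2" unfolding eigval_freq fr power2_norm_eq_inner inner_axis by (simp add: power2_eq_square)
  have xf: "\<bar>x s \<bullet> field_of (fw z)\<bar> \<le> M / c" if s: "s \<in> {0..t1}" for s
  proof -
    have "c * \<bar>x s \<bullet> field_of (fw z)\<bar> \<le> sn 1 (x s)"
      using weak_deriv_fw[OF goodD(1)[OF x s], of z 1] fr by (simp add: axis_def)
    then show ?thesis using M[OF s] fr(2) by (simp add: pos_le_divide_eq mult.commute)
  qed
  define F where "F s = c\<^sup>2 * (x s \<bullet> field_of (fw z)) + advection (x s) (fw z)" for s
  have cF: "continuous_on {0..t1} F" unfolding F_def
    by (intro continuous_intros good_continuous x advection_continuous fw_smooth)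
  have n: "n t = x t \<bullet> field_of (fw z) - a + integral {0..t} F" if tt: "t = t0 \<or> t = t1" for t
  proof -
    have gt: "good t x" by (rule good_mono[OF x]) (use tt t in auto)
    have 1: "(LINT s:{0..t}|lebesgue. stokes (x s) \<bullet> field_of (fw z)) = integral {0..t} (\<lambda>s. c\<^sup>2 * (x s \<bullet> field_of (fw z)))"
      using LINT_stokes_wave[OF gt, of z "- snd (amp z)" "fst (amp z)"] by (simp add: fw_def[symmetric] lam)
    have i1: "(\<lambda>s. c\<^sup>2 * (x s \<bullet> field_of (fw z))) integrable_on {0..t}"
      by (intro integrable_continuous_real continuous_intros good_continuous gt)
    have i2: "(\<lambda>s. advection (x s) (fw z)) integrable_on {0..t}"
      by (intro integrable_continuous_real advection_continuous gt fw_smooth)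
    have "integral {0..t} F = integral {0..t} (\<lambda>s. c\<^sup>2 * (x s \<bullet> field_of (fw z))) + integral {0..t} (\<lambda>s. advection (x s) (fw z))"
      unfolding F_def by (rule Henstock_Kurzweil_Integration.integral_add[OF i1 i2])
    then show ?thesis using eq[OF tt] unfolding 1 LINT_advection[OF gt fw_smooth] by simp
  qed
  have Fb: "norm (F s) \<le> c * M + 6 * M\<^sup>2" if s: "s \<in> {0..t1}" for s
  proof -
    have "\<bar>c\<^sup>2 * (x s \<bullet> field_of (fw z))\<bar> \<le> c\<^sup>2 * (M / c)"
      unfolding abs_mult using xf[OF s] by (intro mult_mono) auto
    also have "\<dots> = c * M" using fr(2) by (simp add: power2_eq_square)
    finally have A: "\<bar>c\<^sup>2 * (x s \<bullet> field_of (fw z))\<bar> \<le> c * M" .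
    have "\<bar>advection (x s) (fw z)\<bar> \<le> 3 * 2 * (sn 1 (x s))\<^sup>2"
      by (rule advection_bound[OF goodD(1)[OF x s] fw_smooth]) (auto intro: norm_fw)
    also have "\<dots> \<le> 3 * 2 * M\<^sup>2" using M[OF s] by (intro mult_left_mono power_mono) auto
    finally show ?thesis using A unfolding F_def by simp
  qed
  have "n t1 - n t0 = (x t1 \<bullet> field_of (fw z) - x t0 \<bullet> field_of (fw z)) + integral {t0..t1} F"
    using n[of t0] n[of t1] Henstock_Kurzweil_Integration.integral_combine[OF t integrable_continuous_real[OF cF]] by simp
  moreover have "norm (integral {t0..t1} F) \<le> (c * M + 6 * M\<^sup>2) * (t1 - t0)"
    by (rule integral_bound[OF t(2)]) (use t Fb in \<open>auto intro: continuous_on_subset[OF cF]\<close>)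
  moreover have "\<bar>x t1 \<bullet> field_of (fw z) - x t0 \<bullet> field_of (fw z)\<bar> \<le> M / c + M / c"
    using xf[of t1] xf[of t0] t by (intro order_trans[OF abs_triangle_ineq4 add_mono]) auto
  ultimately show ?thesis by (simp add: algebra_simps)
qed

end

section \<open>Solutions and their residuals on waves\<close>

lemma tri_add_right:
  assumes "smooth_periodic \<phi>" "smooth_periodic \<psi>"
  shows "tri i u v (\<lambda>x. \<phi> x + \<psi> x) = tri i u v \<phi> + tri i u v \<psi>"
proof -
  have "tri i u v (\<lambda>x. \<Sum>b\<in>(UNIV :: bool set). 1 *\<^sub>R (if b then \<phi> else \<psi>) x) = (\<Sum>b\<in>UNIV. 1 * tri i u v (if b then \<phi> else \<psi>))"
    by (rule tri_sum_right) (use assms in auto)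
  then show ?thesis by (simp add: UNIV_bool add.commute)
qed

context plane_waves
begin

text \<open>The part of the equation that is a functional of the path: it equals datum plus noise
  for a random solution (\<open>solves_resid\<close>) and the datum alone for Navier-Stokes.\<close>

definition resid :: "'z \<Rightarrow> real \<Rightarrow> (real \<Rightarrow> vfield) \<Rightarrow> real" where
  "resid z t x = e z \<bullet> x t + eigval k z * integral {0..t} (\<lambda>s. e z \<bullet> x s) - integral {0..t} (\<lambda>s. adv z (x s) (x s))"

lemma solves_resid: "solves S x U g \<Longrightarrow> t \<in> {0..S} \<Longrightarrow> resid z t x = e z \<bullet> U + g z t"
  unfolding solves_def resid_def by simp

text \<open>The quadratic term is Lipschitz because all close paths stay in the L^2 ball of radius
  Mv + 1; C adds up the Lipschitz constants of the three terms.\<close>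

lemma resid_continuous:
  assumes v: "good S v" and t: "t \<in> {0..S}" and \<eta>: "0 < \<eta>"
  shows "\<exists>\<rho>>0. \<forall>w. good S w \<longrightarrow> close_to S \<rho> w v \<longrightarrow> \<bar>resid z t w - resid z t v\<bar> \<le> \<eta>"
proof -
  obtain Mv where Mv: "0 < Mv" "\<And>s. s \<in> {0..S} \<Longrightarrow> sn 1 (v s) \<le> Mv" using good_sn1_bounded[OF v] by blast
  have "\<exists>K. \<forall>i. 0 \<le> K i \<and> (\<forall>x\<in>cell. norm (pderiv_at i (ew z) x) \<le> K i)"
    by (rule choice) (use smooth_periodic_bounded[OF smooth_pderiv_ew] in simp)
  then obtain K where K: "\<And>i. 0 \<le> K i" "\<And>i x. x \<in> cell \<Longrightarrow> norm (pderiv_at i (ew z) x) \<le> K i" by auto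
  define L where "L = (\<Sum>i\<in>UNIV. K i) * (2 * Mv + 1)"
  have L0: "0 \<le> L" unfolding L_def using K Mv by (intro mult_nonneg_nonneg sum_nonneg) auto
  define C where "C = 1 + eigval k z * t + L * t"
  have t0: "0 \<le> t" using t by simp
  have C: "1 \<le> C" unfolding C_def using t0 L0 by simp
  define \<rho> where "\<rho> = min 1 (\<eta> / C)"
  have \<rho>: "0 < \<rho>" "\<rho> \<le> 1" "\<rho> * C \<le> \<eta>" using C \<eta> by (auto simp: \<rho>_def min_def field_simps)
  have "\<bar>resid z t w - resid z t v\<bar> \<le> \<eta>" if w: "good S w" and cl: "close_to S \<rho> w v" for w
  proof -
    have nwv: "norm (w s - v s) \<le> \<rho>" if s: "s \<in> {0..S}" for s
    proof -
      have "norm (w s - v s) \<le> sn 1 (w s - v s)" by (rule norm_le_sn[OF goodD(1)[OF good_diff[OF w v] s]]) simp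
      then show ?thesis using cl s unfolding close_to_def by force
    qed
    have ed: "\<bar>e z \<bullet> w s - e z \<bullet> v s\<bar> \<le> \<rho>" if s: "s \<in> {0..S}" for s
      using Cauchy_Schwarz_ineq2[of "e z" "w s - v s"] nwv[OF s] by (simp add: inner_diff_right)
    have ad: "\<bar>adv z (w s) (w s) - adv z (v s) (v s)\<bar> \<le> L * \<rho>" if s: "s \<in> {0..S}" for s
    proof -
      have nv: "norm (v s) \<le> Mv" using norm_le_sn[OF goodD(1)[OF v s]] Mv(2)[OF s] by simp
      have nw: "norm (w s) \<le> Mv + 1" using norm_triangle_ineq[of "w s - v s" "v s"] nwv[OF s] nv \<rho>(2) by simp
      have "\<bar>tri i (w s) (w s) (pderiv_at i (ew z)) - tri i (v s) (v s) (pderiv_at i (ew z))\<bar> \<le> K i * ((2 * Mv + 1) * \<rho>)" for i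
      proof -
        have tb: "\<bar>tri i f g (pderiv_at i (ew z))\<bar> \<le> K i * norm f * norm g" for f g
          by (rule tri_bound[OF smooth_periodic_torus[OF smooth_pderiv_ew] K(2) K(1)])
        have td: "tri i (w s) (w s) (pderiv_at i (ew z)) - tri i (v s) (v s) (pderiv_at i (ew z))
          = tri i (w s - v s) (w s) (pderiv_at i (ew z)) + tri i (v s) (w s - v s) (pderiv_at i (ew z))"
        proof -
          have "tri i (w s - v s) (w s) (pderiv_at i (ew z)) = tri i (w s) (w s) (pderiv_at i (ew z)) - tri i (v s) (w s) (pderiv_at i (ew z))"
            by (rule tri_diff(1)[OF smooth_periodic_torus[OF smooth_pderiv_ew] K(2) K(1)])
          moreover have "tri i (v s) (w s - v s) (pderiv_at i (ew z)) = tri i (v s) (w s) (pderiv_at i (ew z)) - tri i (v s) (v s) (pderiv_at i (ew z))"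
            by (rule tri_diff(2)[OF smooth_periodic_torus[OF smooth_pderiv_ew] K(2) K(1)])
          ultimately show ?thesis by simp
        qed
        have "\<bar>tri i (w s) (w s) (pderiv_at i (ew z)) - tri i (v s) (v s) (pderiv_at i (ew z))\<bar> \<le> K i * norm (w s - v s) * norm (w s) + K i * norm (v s) * norm (w s - v s)"
          unfolding td using tb[of "w s - v s" "w s"] tb[of "v s" "w s - v s"] by linarith
        also have "\<dots> \<le> K i * \<rho> * (Mv + 1) + K i * Mv * \<rho>"
          using K(1) nwv[OF s] nv nw Mv \<rho> by (intro add_mono mult_mono) auto
        finally show ?thesis by (simp add: algebra_simps)
      qed
      then have "\<bar>adv z (w s) (w s) - adv z (v s) (v s)\<bar> \<le> (\<Sum>i\<in>UNIV. K i * ((2 * Mv + 1) * \<rho>))"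
        unfolding adv_def sum_subtractf[symmetric] by (intro order_trans[OF sum_abs sum_mono])
      then show ?thesis by (simp add: L_def sum_distrib_right mult.assoc)
    qed
    have sub: "{0..t} \<subseteq> {0..S}" using t by auto
    have cw: "continuous_on {0..t} w" and cv: "continuous_on {0..t} v"
      by (rule continuous_on_subset[OF good_continuous[OF w] sub], rule continuous_on_subset[OF good_continuous[OF v] sub])
    have i1: "(\<lambda>s. e z \<bullet> w s) integrable_on {0..t}" "(\<lambda>s. e z \<bullet> v s) integrable_on {0..t}"
      "(\<lambda>s. adv z (w s) (w s)) integrable_on {0..t}" "(\<lambda>s. adv z (v s) (v s)) integrable_on {0..t}"
      by (intro integrable_continuous_real continuous_intros adv_continuous cw cv)+
    have I1: "norm (integral {0..t} (\<lambda>s. e z \<bullet> w s - e z \<bullet> v s)) \<le> \<rho> * (t - 0)"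
      by (rule integral_bound[OF t0]) (use ed sub in \<open>auto intro!: continuous_intros cw cv\<close>)
    have I2: "norm (integral {0..t} (\<lambda>s. adv z (w s) (w s) - adv z (v s) (v s))) \<le> (L * \<rho>) * (t - 0)"
      by (rule integral_bound[OF t0]) (use ad sub in \<open>auto intro!: continuous_intros adv_continuous cw cv\<close>)
    have "resid z t w - resid z t v = (e z \<bullet> w t - e z \<bullet> v t)
       + eigval k z * integral {0..t} (\<lambda>s. e z \<bullet> w s - e z \<bullet> v s) - integral {0..t} (\<lambda>s. adv z (w s) (w s) - adv z (v s) (v s))"
      using i1 by (simp add: resid_def Henstock_Kurzweil_Integration.integral_diff algebra_simps)
    moreover have "\<bar>eigval k z * integral {0..t} (\<lambda>s. e z \<bullet> w s - e z \<bullet> v s)\<bar> \<le> eigval k z * (\<rho> * t)"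
      unfolding abs_mult using I1 by (intro mult_mono) auto
    ultimately have "\<bar>resid z t w - resid z t v\<bar> \<le> \<rho> + eigval k z * (\<rho> * t) + L * \<rho> * t"
      using ed[OF t] I2 unfolding real_norm_def by (simp only: diff_zero)
    also have "\<dots> = \<rho> * C" by (simp add: C_def algebra_simps)
    finally show ?thesis using \<rho>(3) by linarith
  qed
  then show ?thesis using \<rho>(1) by blast
qed

text \<open>Matching residuals give the equation for waves and hence for their finite combinations.
  The error for a general test field equals that for its Fourier remainder, which is bounded by the
  L^2 norm of the remainder and tends to zero.\<close>

lemma NS_from_waves:
  assumes x: "good t x" and t: "0 \<le> t" and u0: "u0 \<in> df_space"
    and res: "\<And>z. resid z t x = e z \<bullet> u0" and \<phi>: "\<phi> \<in> smooth_df"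
  shows "x t \<bullet> field_of \<phi> + (LINT s:{0..t}|lebesgue. stokes (x s) \<bullet> field_of \<phi>) =
        u0 \<bullet> field_of \<phi> - (LINT s:{0..t}|lebesgue. advection (x s) \<phi>)"
proof -
  \<comment> \<open>A version of the Stokes and advection terms that is continuous at every
    time.\<close>
  define J where "J \<phi> s = - (\<Sum>i\<in>UNIV. x s \<bullet> field_of (pderiv_at i (pderiv_at i \<phi>))) + advection (x s) \<phi>" for \<phi> s
  have J: "continuous_on {0..t} (J \<phi>)" "AE s in lebesgue. s \<in> {0..t} \<longrightarrow> stokes (x s) \<bullet> field_of \<phi> + advection (x s) \<phi> = J \<phi> s"
    "(LINT s:{0..t}|lebesgue. stokes (x s) \<bullet> field_of \<phi>) + (LINT s:{0..t}|lebesgue. advection (x s) \<phi>) = integral {0..t} (J \<phi>)"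
    if \<phi>: "smooth_periodic \<phi>" for \<phi>
  proof -
    have c1: "continuous_on {0..t} (\<lambda>s. - (\<Sum>i\<in>UNIV. x s \<bullet> field_of (pderiv_at i (pderiv_at i \<phi>))))"
      by (intro continuous_intros good_continuous x)
    note c2 = advection_continuous[OF x \<phi>]
    show "continuous_on {0..t} (J \<phi>)" unfolding J_def[abs_def] by (intro continuous_on_add c1 c2)
    have ae: "AE s in lebesgue. s \<in> {0..t} \<longrightarrow> stokes (x s) \<bullet> field_of \<phi> = - (\<Sum>i\<in>UNIV. x s \<bullet> field_of (pderiv_at i (pderiv_at i \<phi>)))"
      using goodD(3)[OF x] by eventually_elim (simp add: stokes_smooth[OF _ \<phi>])
    then show "AE s in lebesgue. s \<in> {0..t} \<longrightarrow> stokes (x s) \<bullet> field_of \<phi> + advection (x s) \<phi> = J \<phi> s"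
      by eventually_elim (simp add: J_def)
    show "(LINT s:{0..t}|lebesgue. stokes (x s) \<bullet> field_of \<phi>) + (LINT s:{0..t}|lebesgue. advection (x s) \<phi>) = integral {0..t} (J \<phi>)"
      unfolding LINT_spike_continuous(1)[OF c1 ae] LINT_advection[OF x \<phi>] J_def[abs_def]
      by (rule Henstock_Kurzweil_Integration.integral_add[symmetric])
        (intro integrable_continuous_real c1 c2)+
  qed
  define C where "C = t + (1 + 3 * C2) * (L2H2_norm e k t x)\<^sup>2"
  have bound: "\<bar>integral {0..t} (J \<psi>)\<bar> \<le> C * norm (field_of \<psi>)" if \<psi>: "smooth_periodic \<psi>" for \<psi>
  proof -
    define N where "N = norm (field_of \<psi>)"
    define G where "G s = stokes (x s) \<bullet> field_of \<psi> + advection (x s) \<psi>" for s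
    note sp = LINT_spike_continuous[OF J(1)[OF \<psi>] J(2)[OF \<psi>], folded G_def]
    have si: "set_integrable lebesgue {0..t} (\<lambda>s. N + (1 + 3 * C2) * N * (sn 2 (x s))\<^sup>2)"
      using goodD(4)[OF x] absolutely_integrable_continuous_real[of 0 t "\<lambda>_. N"]
      by (intro set_integral_add set_integrable_mult_right) auto
    have "\<bar>LINT s:{0..t}|lebesgue. G s\<bar> \<le> (LINT s:{0..t}|lebesgue. \<bar>G s\<bar>)"
      using sp(2) unfolding set_lebesgue_integral_def set_integrable_def
      by (intro order_trans[OF integral_abs_bound]) (simp add: abs_mult)
    also have "\<dots> \<le> (LINT s:{0..t}|lebesgue. N + (1 + 3 * C2) * N * (sn 2 (x s))\<^sup>2)"
    proof (rule set_integral_mono_AE[OF set_integrable_abs[OF sp(2)] si])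
      show "AE s\<in>{0..t} in lebesgue. \<bar>G s\<bar> \<le> N + (1 + 3 * C2) * N * (sn 2 (x s))\<^sup>2"
        using goodD(3)[OF x]
      proof eventually_elim
        case (elim s)
        show ?case
        proof
          assume "s \<in> {0..t}"
          with elim have xs: "x s \<in> sobolev e k 2" by simp
          have "\<bar>stokes (x s) \<bullet> field_of \<psi>\<bar> \<le> norm (stokes (x s)) * N" unfolding N_def by (rule Cauchy_Schwarz_ineq2)
          also have "\<dots> \<le> (1 + (sn 2 (x s))\<^sup>2) * N"
          proof (rule mult_right_mono)
            \<comment> \<open>Gives p \<le> 1 + p^2, so that only the integrable square of the H^2
              norm occurs.\<close>
            have "0 \<le> (sn 2 (x s) - 1)\<^sup>2" by simp
            then have "sn 2 (x s) \<le> 1 + (sn 2 (x s))\<^sup>2"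
              using sn_nonneg[of 2 "x s"] by (simp add: power2_diff del: sn_nonneg)
            then show "norm (stokes (x s)) \<le> 1 + (sn 2 (x s))\<^sup>2" using norm_stokes[OF xs] by linarith
          qed (simp add: N_def)
          finally have "\<bar>stokes (x s) \<bullet> field_of \<psi>\<bar> \<le> (1 + (sn 2 (x s))\<^sup>2) * N" .
          moreover have "\<bar>advection (x s) \<psi>\<bar> \<le> 3 * C2 * (sn 2 (x s))\<^sup>2 * N"
            unfolding N_def by (rule advection_bound_L2[OF xs \<psi>])
          ultimately show "\<bar>G s\<bar> \<le> N + (1 + 3 * C2) * N * (sn 2 (x s))\<^sup>2"
            unfolding G_def by (simp add: algebra_simps)
        qed
      qed
    qed
    also have "\<dots> = t * N + (1 + 3 * C2) * N * (L2H2_norm e k t x)\<^sup>2"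
      unfolding L2H2_sq using goodD(4)[OF x] absolutely_integrable_continuous_real[of 0 t "\<lambda>_. N"] t
      by (subst set_integral_add) (auto simp: set_lebesgue_integral_eq_integral(2))
    finally show ?thesis unfolding sp(1) C_def N_def by (simp add: algebra_simps)
  qed
  define f where "f = field_of \<phi>"
  have f: "f \<in> df_space" unfolding f_def by (rule smooth_df_df_space[OF \<phi>])
  \<comment> \<open>The error in the equation; it vanishes on waves, so only the Fourier remainder
    of f contributes.\<close>
  define R where "R = x t \<bullet> f - u0 \<bullet> f + integral {0..t} (J \<phi>)"
  have Rb: "\<bar>R\<bar> \<le> (norm (x t - u0) + C) * norm (f - proj F f)" if F: "finite F" for F
  proof -
    obtain s where s: "s \<in> smooth_df" "field_of s = proj F f" "s = (\<lambda>y. \<Sum>z\<in>F. (e z \<bullet> f) *\<^sub>R ew z y)"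
      by (rule proj_smooth[OF F])
    define \<psi> where "\<psi> y = \<phi> y + (- 1) *\<^sub>R s y" for y
    have \<psi>df: "\<psi> \<in> smooth_df" unfolding \<psi>_def by (intro subspace_smooth_df(2,3) \<phi> s(1))
    note \<psi> = smooth_dfD(1)[OF \<psi>df] and ss = smooth_dfD(1)[OF s(1)]
    have \<phi>eq: "\<phi> = (\<lambda>y. \<psi> y + s y)" by (simp add: \<psi>_def)
    have f\<psi>: "field_of \<psi> = f - proj F f"
    proof -
      have "f = field_of \<psi> + field_of s" unfolding f_def
        by (subst \<phi>eq) (rule field_of_add[OF smooth_periodic_sq_integrable[OF \<psi>] smooth_periodic_sq_integrable[OF ss]])
      then show ?thesis unfolding s(2) by (metis add_diff_cancel_right')
    qed
    have adv_lin: "advection u \<phi> = advection u \<psi> + (\<Sum>z\<in>F. (e z \<bullet> f) * advection u (ew z))" for u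
    proof -
      have "advection u \<phi> = (\<Sum>i\<in>UNIV. tri i u (weak_deriv i u) \<psi> + tri i u (weak_deriv i u) s)"
        unfolding advection_tri[OF smooth_dfD(1)[OF \<phi>]] by (subst \<phi>eq) (simp only: tri_add_right[OF \<psi> ss])
      also have "\<dots> = advection u \<psi> + (\<Sum>i\<in>UNIV. \<Sum>z\<in>F. (e z \<bullet> f) * tri i u (weak_deriv i u) (ew z))"
        unfolding advection_tri[OF \<psi>] s(3) by (simp only: sum.distrib tri_sum_right[OF F ew_smooth])
      also have "(\<Sum>i\<in>UNIV. \<Sum>z\<in>F. (e z \<bullet> f) * tri i u (weak_deriv i u) (ew z)) = (\<Sum>z\<in>F. (e z \<bullet> f) * advection u (ew z))"
        unfolding advection_tri[OF ew_smooth] sum_distrib_left by (rule sum.swap)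
      finally show ?thesis .
    qed
    have Jae: "AE s in lebesgue. s \<in> {0..t} \<longrightarrow> J \<phi> s = J \<psi> s + (\<Sum>z\<in>F. (e z \<bullet> f) * J (ew z) s)"
      using goodD(3)[OF x]
    proof eventually_elim
      case (elim r)
      show ?case
      proof
        assume "r \<in> {0..t}"
        with elim have xs: "x r \<in> sobolev e k 2" by simp
        have Jr: "J \<theta> r = stokes (x r) \<bullet> field_of \<theta> + advection (x r) \<theta>" if "smooth_periodic \<theta>" for \<theta>
          unfolding J_def stokes_smooth[OF xs that] ..
        have "stokes (x r) \<bullet> f = stokes (x r) \<bullet> field_of \<psi> + (\<Sum>z\<in>F. (e z \<bullet> f) * (stokes (x r) \<bullet> field_of (ew z)))"
          unfolding f\<psi> amp(1)[symmetric] by (simp add: inner_diff_right proj_def inner_sum_right)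
        then show "J \<phi> r = J \<psi> r + (\<Sum>z\<in>F. (e z \<bullet> f) * J (ew z) r)"
          unfolding Jr[OF smooth_dfD(1)[OF \<phi>]] Jr[OF \<psi>] Jr[OF ew_smooth] adv_lin f_def[symmetric]
          by (simp add: distrib_left sum.distrib)
      qed
    qed
    have cJ: "continuous_on {0..t} (\<lambda>s. J \<psi> s + (\<Sum>z\<in>F. (e z \<bullet> f) * J (ew z) s))"
      by (intro continuous_intros J(1)[OF \<psi>] J(1)[OF ew_smooth])
    have "integral {0..t} (J \<phi>) = integral {0..t} (\<lambda>s. J \<psi> s + (\<Sum>z\<in>F. (e z \<bullet> f) * J (ew z) s))"
    proof -
      have "(LINT s:{0..t}|lebesgue. J \<phi> s) = integral {0..t} (J \<phi>)"
        by (rule LINT_spike_continuous(1)[OF J(1)[OF smooth_dfD(1)[OF \<phi>]]]) simp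
      then show ?thesis using LINT_spike_continuous(1)[OF cJ Jae] by simp
    qed
    also have "\<dots> = integral {0..t} (J \<psi>) + (\<Sum>z\<in>F. (e z \<bullet> f) * integral {0..t} (J (ew z)))"
    proof (rule integral_unique, rule has_integral_add)
      show "(J \<psi> has_integral integral {0..t} (J \<psi>)) {0..t}"
        by (rule integrable_integral[OF integrable_continuous_real[OF J(1)[OF \<psi>]]])
      show "((\<lambda>s. \<Sum>z\<in>F. (e z \<bullet> f) * J (ew z) s) has_integral (\<Sum>z\<in>F. (e z \<bullet> f) * integral {0..t} (J (ew z)))) {0..t}"
        by (rule has_integral_sum[OF F], rule has_integral_mult_right)
          (rule integrable_integral[OF integrable_continuous_real[OF J(1)[OF ew_smooth]]])
    qed
    finally have IJ0: "integral {0..t} (J \<phi>) = integral {0..t} (J \<psi>) + (\<Sum>z\<in>F. (e z \<bullet> f) * integral {0..t} (J (ew z)))" .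
    have Je: "integral {0..t} (J (ew z)) = - (e z \<bullet> (x t - u0))" for z
    proof -
      have "integral {0..t} (J (ew z)) = integral {0..t} (\<lambda>s. eigval k z * (e z \<bullet> x s) - adv z (x s) (x s))"
      proof (rule Henstock_Kurzweil_Integration.integral_cong)
        fix s assume s: "s \<in> {0..t}"
        have "- (\<Sum>i\<in>UNIV. x s \<bullet> field_of (pderiv_at i (pderiv_at i (ew z)))) = eigval k z * (x s \<bullet> field_of (ew z))"
          unfolding ew_def freq_def laplace_wave by (simp add: eigval_def)
        then show "J (ew z) s = eigval k z * (e z \<bullet> x s) - adv z (x s) (x s)"
          using amp(1)[of z] unfolding J_def advection_ew[OF goodD(1)[OF x s]] by (simp add: inner_commute)
      qed
      also have "\<dots> = eigval k z * integral {0..t} (\<lambda>s. e z \<bullet> x s) - integral {0..t} (\<lambda>s. adv z (x s) (x s))"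
      proof -
        have i: "(\<lambda>s. e z \<bullet> x s) integrable_on {0..t}" "(\<lambda>s. adv z (x s) (x s)) integrable_on {0..t}"
          by (intro integrable_continuous_real continuous_intros adv_continuous good_continuous x)+
        show ?thesis by (intro integral_unique has_integral_diff has_integral_mult_right integrable_integral i)
      qed
      also have "\<dots> = - (e z \<bullet> (x t - u0))" using res[of z] unfolding resid_def by (simp add: inner_diff_right)
      finally show ?thesis .
    qed
    have IJ: "integral {0..t} (J \<phi>) = integral {0..t} (J \<psi>) + (\<Sum>z\<in>F. (e z \<bullet> f) * (- (e z \<bullet> (x t - u0))))"
      using IJ0 unfolding Je .
    have "(x t - u0) \<bullet> proj F f = (\<Sum>z\<in>F. (e z \<bullet> f) * (e z \<bullet> (x t - u0)))"
      by (simp add: proj_def inner_sum_right inner_commute)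
    then have "R = (x t - u0) \<bullet> (f - proj F f) + integral {0..t} (J \<psi>)"
      unfolding R_def IJ mult_minus_right sum_negf by (simp only: inner_diff_left inner_diff_right)
    also have "\<bar>\<dots>\<bar> \<le> norm (x t - u0) * norm (f - proj F f) + C * norm (f - proj F f)"
      using Cauchy_Schwarz_ineq2[of "x t - u0" "f - proj F f"] bound[OF \<psi>] unfolding f\<psi> by linarith
    finally show ?thesis by (simp add: distrib_right)
  qed
  have "((\<lambda>F. (norm (x t - u0) + C) * norm (f - proj F f)) \<longlongrightarrow> (norm (x t - u0) + C) * norm (f - f)) (finite_subsets_at_top UNIV)"
    by (intro tendsto_intros proj_tendsto f)
  then have "\<bar>R\<bar> \<le> (norm (x t - u0) + C) * norm (f - f)"
    by (rule tendsto_lowerbound) (auto intro: eventually_finite_subsets_at_top_weakI Rb)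
  then have "R = 0" by simp
  then show ?thesis using J(3)[OF smooth_dfD(1)[OF \<phi>]] unfolding R_def f_def by simp
qed

end

section \<open>Brownian motion and independence\<close>

context prob_space
begin

text \<open>Beyond a, the density of variance \<sigma>^2 is at most K times the density of variance
  2 \<sigma>^2, which has mass one.\<close>

lemma normal_upper_tail:
  assumes X: "distributed M lborel X (normal_density 0 \<sigma>)" and \<sigma>: "0 < \<sigma>" and a: "0 < a"
  shows "prob {w \<in> space M. a \<le> \<bar>X w\<bar>} \<le> sqrt 2 * exp (- a\<^sup>2 / (4 * \<sigma>\<^sup>2))"
proof -
  define K where "K = sqrt 2 * exp (- a\<^sup>2 / (4 * \<sigma>\<^sup>2))"
  have K: "0 \<le> K" by (simp add: K_def)
  have dens: "normal_density 0 \<sigma> x \<le> K * normal_density 0 (sqrt 2 * \<sigma>) x" if x: "a \<le> \<bar>x\<bar>" for x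
  proof -
    have "a\<^sup>2 \<le> x\<^sup>2" using x a by (metis abs_le_square_iff abs_of_pos)
    then have "- x\<^sup>2 / (2 * \<sigma>\<^sup>2) \<le> - a\<^sup>2 / (4 * \<sigma>\<^sup>2) + - x\<^sup>2 / (4 * \<sigma>\<^sup>2)" using \<sigma> by (simp add: field_simps)
    then have *: "exp (- x\<^sup>2 / (2 * \<sigma>\<^sup>2)) \<le> exp (- a\<^sup>2 / (4 * \<sigma>\<^sup>2)) * exp (- x\<^sup>2 / (4 * \<sigma>\<^sup>2))"
      unfolding exp_add[symmetric] by simp
    have "sqrt (2 * pi * (sqrt 2 * \<sigma>)\<^sup>2) = sqrt 2 * sqrt (2 * pi * \<sigma>\<^sup>2)"
      by (simp add: real_sqrt_mult power_mult_distrib)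
    moreover have "- x\<^sup>2 / (2 * (sqrt 2 * \<sigma>)\<^sup>2) = - x\<^sup>2 / (4 * \<sigma>\<^sup>2)" by (simp add: power_mult_distrib)
    ultimately have "K * normal_density 0 (sqrt 2 * \<sigma>) x
        = (exp (- a\<^sup>2 / (4 * \<sigma>\<^sup>2)) * exp (- x\<^sup>2 / (4 * \<sigma>\<^sup>2))) / sqrt (2 * pi * \<sigma>\<^sup>2)"
      unfolding normal_density_def K_def by simp
    then show ?thesis using * \<sigma> unfolding normal_density_def by (simp add: divide_right_mono)
  qed
  have "{w \<in> space M. a \<le> \<bar>X w\<bar>} = X -` {x. a \<le> \<bar>x\<bar>} \<inter> space M" by auto
  then have "emeasure M {w \<in> space M. a \<le> \<bar>X w\<bar>}
      = (\<integral>\<^sup>+x. ennreal (normal_density 0 \<sigma> x) * indicator {x. a \<le> \<bar>x\<bar>} x \<partial>lborel)"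
    using distributed_emeasure[OF X, of "{x. a \<le> \<bar>x\<bar>}"] by simp
  also have "\<dots> \<le> (\<integral>\<^sup>+x. ennreal K * ennreal (normal_density 0 (sqrt 2 * \<sigma>) x) \<partial>lborel)"
    using dens K by (intro nn_integral_mono) (auto simp: indicator_def ennreal_mult[symmetric])
  also have "\<dots> = ennreal K * (\<integral>\<^sup>+x. ennreal (normal_density 0 (sqrt 2 * \<sigma>) x) \<partial>lborel)"
    by (rule nn_integral_cmult) simp
  also have "(\<integral>\<^sup>+x. ennreal (normal_density 0 (sqrt 2 * \<sigma>) x) \<partial>lborel) = 1"
  proof -
    have s: "0 < sqrt 2 * \<sigma>" using \<sigma> by simp
    show ?thesis
      using prob_space.emeasure_space_1[OF prob_space_normal_density[OF s, of 0]]
      by (simp add: emeasure_density)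
  qed
  finally show ?thesis using K by (simp add: emeasure_eq_measure K_def)
qed

text \<open>The bound is the length of the interval (a, a + \<sigma>] times the density at its right
  end, where it is smallest.\<close>

lemma normal_lower_tail:
  assumes X: "distributed M lborel X (normal_density 0 \<sigma>)" and \<sigma>: "0 < \<sigma>" and a: "0 \<le> a"
  shows "exp (- (a / \<sigma> + 1)\<^sup>2 / 2) / sqrt (2 * pi) \<le> prob {w \<in> space M. a < \<bar>X w\<bar>}"
proof -
  define K where "K = exp (- (a / \<sigma> + 1)\<^sup>2 / 2) / (\<sigma> * sqrt (2 * pi))"
  have K: "0 \<le> K" using \<sigma> by (simp add: K_def)
  have dens: "K \<le> normal_density 0 \<sigma> x" if x: "a < x" "x \<le> a + \<sigma>" for x
  proof -
    have "x\<^sup>2 \<le> (a + \<sigma>)\<^sup>2" using x a by (intro power_mono) auto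
    moreover have "(a / \<sigma> + 1)\<^sup>2 * \<sigma>\<^sup>2 = (a + \<sigma>)\<^sup>2"
    proof -
      have "(a / \<sigma> + 1) * \<sigma> = a + \<sigma>" using \<sigma> by (simp add: field_simps)
      then show ?thesis unfolding power_mult_distrib[symmetric] by simp
    qed
    ultimately have "- (a / \<sigma> + 1)\<^sup>2 / 2 \<le> - x\<^sup>2 / (2 * \<sigma>\<^sup>2)" using \<sigma> by (simp add: field_simps)
    then have "K \<le> exp (- x\<^sup>2 / (2 * \<sigma>\<^sup>2)) / (\<sigma> * sqrt (2 * pi))"
      unfolding K_def using \<sigma> by (intro divide_right_mono) auto
    also have "\<sigma> * sqrt (2 * pi) = sqrt (2 * pi * \<sigma>\<^sup>2)" using \<sigma> by (simp add: real_sqrt_mult)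
    finally show ?thesis unfolding normal_density_def by simp
  qed
  have "ennreal (K * \<sigma>) = (\<integral>\<^sup>+x. ennreal K * indicator {a<..a + \<sigma>} x \<partial>lborel)"
    using \<sigma> K by (simp add: nn_integral_cmult ennreal_mult)
  also have "\<dots> \<le> (\<integral>\<^sup>+x. ennreal (normal_density 0 \<sigma> x) * indicator {x. a < \<bar>x\<bar>} x \<partial>lborel)"
    using dens a by (intro nn_integral_mono) (auto simp: indicator_def)
  also have "\<dots> = emeasure M {w \<in> space M. a < \<bar>X w\<bar>}"
  proof -
    have "{w \<in> space M. a < \<bar>X w\<bar>} = X -` {x. a < \<bar>x\<bar>} \<inter> space M" by auto
    then show ?thesis using distributed_emeasure[OF X, of "{x. a < \<bar>x\<bar>}"] by simp
  qed
  finally have "K * \<sigma> \<le> prob {w \<in> space M. a < \<bar>X w\<bar>}"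
    by (simp add: emeasure_eq_measure)
  then show ?thesis using \<sigma> by (simp add: K_def)
qed

text \<open>Time 0 is treated separately because the normal law of increments is prescribed for s <
  t only.\<close>

lemma brownian_upper_tail:
  assumes b: "standard_brownian M b" and t: "0 \<le> t" "t \<le> T'" "0 < T'" and a: "0 < a"
  shows "prob {w \<in> space M. a \<le> \<bar>b t w\<bar>} \<le> sqrt 2 * exp (- a\<^sup>2 / (4 * T'))"
proof (cases "t = 0")
  case True
  have "AE w in M. b 0 w = 0" using b by (simp add: standard_brownian_def)
  then have "AE w in M. \<not> a \<le> \<bar>b t w\<bar>" by eventually_elim (use True a in auto)
  then have "prob {w \<in> space M. a \<le> \<bar>b t w\<bar>} = 0"
  proof -
    have [measurable]: "b t \<in> borel_measurable M" using b t by (simp add: standard_brownian_def)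
    have "prob {w \<in> space M. a \<le> \<bar>b t w\<bar>} = prob {}"
    proof (rule finite_measure_eq_AE)
      show "AE x in M. (x \<in> {w \<in> space M. a \<le> \<bar>b t w\<bar>}) = (x \<in> {})"
        using \<open>AE w in M. \<not> a \<le> \<bar>b t w\<bar>\<close> by eventually_elim simp
    qed measurable
    then show ?thesis by simp
  qed
  then show ?thesis by simp
next
  case False
  with t have t: "0 < t" "t \<le> T'" by auto
  have m: "b t \<in> borel_measurable M" "b 0 \<in> borel_measurable M" using b t by (auto simp: standard_brownian_def)
  have z: "AE w in M. b 0 w = 0" using b by (simp add: standard_brownian_def)
  have d: "distributed M lborel (\<lambda>w. b t w - b 0 w) (normal_density 0 (sqrt t))"
    using b t by (auto simp: standard_brownian_def dest: spec[of _ 0])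
  have "prob {w \<in> space M. a \<le> \<bar>b t w\<bar>} = prob {w \<in> space M. a \<le> \<bar>b t w - b 0 w\<bar>}"
    using z m by (intro finite_measure_eq_AE) auto
  also have "\<dots> \<le> sqrt 2 * exp (- a\<^sup>2 / (4 * (sqrt t)\<^sup>2))"
    by (rule normal_upper_tail[OF d _ a]) (use t in simp)
  also have "\<dots> \<le> sqrt 2 * exp (- a\<^sup>2 / (4 * T'))"
    using t a by (auto intro!: divide_left_mono)
  finally show ?thesis .
qed

lemma brownian_lower_tail:
  assumes b: "standard_brownian M b" and t: "0 \<le> s" "s < t" and a: "0 \<le> a"
  shows "exp (- (a / sqrt (t - s) + 1)\<^sup>2 / 2) / sqrt (2 * pi) \<le> prob {w \<in> space M. a < \<bar>b t w - b s w\<bar>}"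
proof -
  have "distributed M lborel (\<lambda>w. b t w - b s w) (normal_density 0 (sqrt (t - s)))"
    using b t unfolding standard_brownian_def by blast
  then show ?thesis by (rule normal_lower_tail) (use t a in auto)
qed

text \<open>Up to the value at 0, past values are partial sums of increments over a sorted grid from
  0 to \<open>s\<^sub>0\<close>; the increment from \<open>s\<^sub>0\<close> to t is the next one
  and independent of them.\<close>

lemma brownian_increment_indep:
  assumes b: "standard_brownian M b" and J: "finite J" "J \<subseteq> {0..s\<^sub>0}" and s: "0 \<le> s\<^sub>0" "s\<^sub>0 < t"
    and C: "\<And>s. C s \<in> sets borel" and D: "D \<in> sets borel"
  shows "prob {w \<in> space M. (\<forall>s\<in>J. b s w \<in> C s) \<and> b t w - b s\<^sub>0 w \<in> D}
    = prob {w \<in> space M. \<forall>s\<in>J. b s w \<in> C s} * prob {w \<in> space M. b t w - b s\<^sub>0 w \<in> D}"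
proof -
  have bm: "b s \<in> borel_measurable M" if "0 \<le> s" for s using b that by (simp add: standard_brownian_def)
  define xs where "xs = sorted_list_of_set (insert 0 (insert s\<^sub>0 J))"
  define m where "m = length xs - 1"
  have fin: "finite (insert 0 (insert s\<^sub>0 J))" using J by simp
  have set_xs: "set xs = insert 0 (insert s\<^sub>0 J)" and so: "sorted xs"
    unfolding xs_def by (rule set_sorted_list_of_set[OF fin], rule sorted_sorted_list_of_set)
  have len: "length xs = Suc m" using set_xs unfolding m_def by (cases xs) auto
  have in_range: "xs ! j \<in> {0..s\<^sub>0}" if "j \<le> m" for j
    using nth_mem[of j xs] that len set_xs J s by auto
  have x0: "xs ! 0 = 0"
  proof -
    obtain j where j: "j < length xs" "xs ! j = 0" using set_xs by (metis in_set_conv_nth insertI1)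
    have "xs ! 0 \<le> xs ! j" by (rule sorted_nth_mono[OF so]) (use j in auto)
    then show ?thesis using j in_range[of 0] by auto
  qed
  have xm: "xs ! m = s\<^sub>0"
  proof -
    obtain j where j: "j < length xs" "xs ! j = s\<^sub>0" using set_xs by (metis in_set_conv_nth insertI1 insertI2)
    have "xs ! j \<le> xs ! m" by (rule sorted_nth_mono[OF so]) (use j len in auto)
    then show ?thesis using j in_range[of m] by auto
  qed
  \<comment> \<open>The sequence is constantly t after m, so increment number m runs from
    \<open>s\<^sub>0\<close> to t.\<close>
  define tt where "tt j = (if j \<le> m then xs ! j else t)" for j
  have mono: "mono tt"
  proof (rule monoI)
    fix i j :: nat assume ij: "i \<le> j"
    consider "j \<le> m" | "i \<le> m" "m < j" | "m < i" by linarith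
    then show "tt i \<le> tt j"
    proof cases
      case 1 then show ?thesis using ij len sorted_nth_mono[OF so, of i j] by (simp add: tt_def)
    next
      case 2 then show ?thesis using in_range[of i] s by (simp add: tt_def)
    next
      case 3 then show ?thesis using ij by (simp add: tt_def)
    qed
  qed
  define X where "X j w = b (tt (Suc j)) w - b (tt j) w" for j w
  have t0: "tt 0 = 0" by (simp add: tt_def x0)
  have ind: "indep_vars (\<lambda>_. borel) X {..<Suc m}"
  proof -
    have "\<forall>n (t :: nat \<Rightarrow> real). 0 \<le> t 0 \<and> mono t \<longrightarrow>
        indep_vars (\<lambda>_. borel) (\<lambda>j w. b (t (Suc j)) w - b (t j) w) {..<n}"
      using b unfolding standard_brownian_def by blast
    then have "0 \<le> tt 0 \<and> mono tt \<longrightarrow> indep_vars (\<lambda>_. borel) (\<lambda>j w. b (tt (Suc j)) w - b (tt j) w) {..<Suc m}"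
      by (elim allE)
    then show ?thesis using mono t0 unfolding X_def[abs_def] by simp
  qed
  have iv: "indep_var (PiM {..<m} (\<lambda>_. borel)) (\<lambda>w. restrict (\<lambda>i. X i w) {..<m})
      (PiM {m} (\<lambda>_. borel)) (\<lambda>w. restrict (\<lambda>i. X i w) {m})"
    by (rule indep_var_restrict[OF ind]) auto
  define Q where "Q = {x \<in> space (PiM {..<m} (\<lambda>_. borel :: real measure)). \<forall>l\<in>{l. l \<le> m \<and> xs ! l \<in> J}. (\<Sum>j<l. x j) \<in> C (xs ! l)}"
  have Q: "Q \<in> sets (PiM {..<m} (\<lambda>_. borel))"
    unfolding Q_def
  proof (rule sets.sets_Collect_finite_All)
    fix l assume l: "l \<in> {l. l \<le> m \<and> xs ! l \<in> J}"
    have [measurable]: "(\<lambda>x. \<Sum>j<l. x j) \<in> borel_measurable (PiM {..<m} (\<lambda>_. borel :: real measure))"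
      by (rule borel_measurable_sum, rule measurable_component_singleton) (use l in auto)
    note [measurable] = C
    show "{x \<in> space (PiM {..<m} (\<lambda>_. borel :: real measure)). (\<Sum>j<l. x j) \<in> C (xs ! l)} \<in> sets (PiM {..<m} (\<lambda>_. borel))"
      by measurable
  qed simp
  define R where "R = {x \<in> space (PiM {m} (\<lambda>_. borel :: real measure)). x m \<in> D}"
  note [measurable] = D
  have R: "R \<in> sets (PiM {m} (\<lambda>_. borel))" unfolding R_def by measurable
  have Xsum: "(\<Sum>j<l. X j w) = b (tt l) w - b 0 w" for l w
    using sum_lessThan_telescope[of "\<lambda>j. b (tt j) w" l] by (simp add: X_def t0)
  have Xm: "X m w = b t w - b s\<^sub>0 w" for w by (simp add: X_def tt_def xm)
  have evQ: "(\<lambda>w. restrict (\<lambda>i. X i w) {..<m}) -` Q \<inter> space M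
     = {w \<in> space M. \<forall>s\<in>J. b s w - b 0 w \<in> C s}"
  proof -
    have "(\<forall>l\<in>{l. l \<le> m \<and> xs ! l \<in> J}. (\<Sum>j<l. restrict (\<lambda>i. X i w) {..<m} j) \<in> C (xs ! l))
       \<longleftrightarrow> (\<forall>s\<in>J. b s w - b 0 w \<in> C s)" for w
    proof -
      have *: "(\<Sum>j<l. restrict (\<lambda>i. X i w) {..<m} j) = b (xs ! l) w - b 0 w" if "l \<le> m" for l
      proof -
        have "(\<Sum>j<l. restrict (\<lambda>i. X i w) {..<m} j) = (\<Sum>j<l. X j w)" by (rule sum.cong) (use that in auto)
        then show ?thesis using that by (simp add: Xsum tt_def)
      qed
      show ?thesis
      proof
        assume L: "\<forall>l\<in>{l. l \<le> m \<and> xs ! l \<in> J}. (\<Sum>j<l. restrict (\<lambda>i. X i w) {..<m} j) \<in> C (xs ! l)"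
        show "\<forall>s\<in>J. b s w - b 0 w \<in> C s"
        proof
          fix s assume s: "s \<in> J"
          then obtain l where l: "l < length xs" "xs ! l = s" using set_xs by (metis in_set_conv_nth insertCI)
          then have "l \<le> m" "l \<in> {l. l \<le> m \<and> xs ! l \<in> J}" using s len by auto
          then show "b s w - b 0 w \<in> C s" using bspec[OF L] *[of l] l(2) by metis
        qed
      qed (use * in auto)
    qed
    then show ?thesis by (auto simp: Q_def space_PiM)
  qed
  have evR: "(\<lambda>w. restrict (\<lambda>i. X i w) {m}) -` R \<inter> space M = {w \<in> space M. b t w - b s\<^sub>0 w \<in> D}"
    by (auto simp: R_def space_PiM Xm)
  have evQR: "(\<lambda>w. (restrict (\<lambda>i. X i w) {..<m}, restrict (\<lambda>i. X i w) {m})) -` (Q \<times> R) \<inter> space M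
     = ((\<lambda>w. restrict (\<lambda>i. X i w) {..<m}) -` Q \<inter> space M) \<inter> ((\<lambda>w. restrict (\<lambda>i. X i w) {m}) -` R \<inter> space M)"
    by auto
  have main: "prob ({w \<in> space M. \<forall>s\<in>J. b s w - b 0 w \<in> C s} \<inter> {w \<in> space M. b t w - b s\<^sub>0 w \<in> D})
    = prob {w \<in> space M. \<forall>s\<in>J. b s w - b 0 w \<in> C s} * prob {w \<in> space M. b t w - b s\<^sub>0 w \<in> D}"
    using indep_varD[OF iv Q R] unfolding evQR evQ evR .
  \<comment> \<open>The grid yields values relative to \<open>b 0\<close>, which vanishes only
    almost surely.\<close>
  have z: "AE w in M. b 0 w = 0" using b by (simp add: standard_brownian_def)
  have m0: "{w \<in> space M. b t w - b s\<^sub>0 w \<in> D} \<in> events"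
  proof -
    have [measurable]: "b t \<in> borel_measurable M" "b s\<^sub>0 \<in> borel_measurable M" using bm s by auto
    show ?thesis by measurable
  qed
  have m1: "{w \<in> space M. \<forall>s\<in>J. b s w - b 0 w \<in> C s} \<in> events"
  proof (rule sets.sets_Collect_finite_All[OF _ J(1)])
    fix s assume "s \<in> J"
    then have [measurable]: "b s \<in> borel_measurable M" "b 0 \<in> borel_measurable M" using bm J by auto
    note [measurable] = C
    show "{w \<in> space M. b s w - b 0 w \<in> C s} \<in> events" by measurable
  qed
  have m2: "{w \<in> space M. \<forall>s\<in>J. b s w \<in> C s} \<in> events"
  proof (rule sets.sets_Collect_finite_All[OF _ J(1)])
    fix s assume "s \<in> J"
    then have [measurable]: "b s \<in> borel_measurable M" using bm J by auto
    note [measurable] = C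
    show "{w \<in> space M. b s w \<in> C s} \<in> events" by measurable
  qed
  have e1: "prob {w \<in> space M. \<forall>s\<in>J. b s w \<in> C s} = prob {w \<in> space M. \<forall>s\<in>J. b s w - b 0 w \<in> C s}"
    using z by (intro finite_measure_eq_AE m1 m2) auto
  have sp: "{w \<in> space M. (\<forall>s\<in>J. b s w \<in> C s) \<and> b t w - b s\<^sub>0 w \<in> D}
    = {w \<in> space M. \<forall>s\<in>J. b s w \<in> C s} \<inter> {w \<in> space M. b t w - b s\<^sub>0 w \<in> D}" by auto
  have "prob ({w \<in> space M. \<forall>s\<in>J. b s w \<in> C s} \<inter> {w \<in> space M. b t w - b s\<^sub>0 w \<in> D})
    = prob ({w \<in> space M. \<forall>s\<in>J. b s w - b 0 w \<in> C s} \<inter> {w \<in> space M. b t w - b s\<^sub>0 w \<in> D})"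
    using z by (intro finite_measure_eq_AE sets.Int m0 m1 m2) auto
  then show ?thesis unfolding sp e1 main .
qed

text \<open>The Brownian motions are independent as processes, so the joint probability splits over
  the indices; only at the index (z, i) must the past be separated from the increment, by
  \<open>brownian_increment_indep\<close>.\<close>

lemma noise_past_indep:
  fixes B :: "'z \<Rightarrow> 3 \<Rightarrow> real \<Rightarrow> 'a \<Rightarrow> real"
  assumes W: "white_noise M B" and J: "finite J" "\<And>p s. (p, s) \<in> J \<Longrightarrow> s \<in> {0..s\<^sub>0}" and s: "0 \<le> s\<^sub>0" "s\<^sub>0 < t"
    and C: "\<And>p s. C p s \<in> sets borel" and D: "D \<in> sets borel"
  shows "prob {w \<in> space M. (\<forall>(p, s)\<in>J. B (fst p) (snd p) s w \<in> C p s) \<and> B z i t w - B z i s\<^sub>0 w \<in> D}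
    = prob {w \<in> space M. \<forall>(p, s)\<in>J. B (fst p) (snd p) s w \<in> C p s} * prob {w \<in> space M. B z i t w - B z i s\<^sub>0 w \<in> D}"
proof -
  define Z where "Z = (\<lambda>(z, i) w. \<lambda>t\<in>{0..}. B z i t w)"
  have ind: "indep_vars (\<lambda>_. PiM {0..} (\<lambda>_. borel)) Z UNIV" using W by (simp add: white_noise_def Z_def)
  have sb: "standard_brownian M (B (fst p) (snd p))" for p using W by (simp add: white_noise_def)
  define p\<^sub>0 where "p\<^sub>0 = (z, i)"
  define I where "I = insert p\<^sub>0 (fst ` J)"
  have I: "finite I" "I \<noteq> {}" "p\<^sub>0 \<in> I" using J by (auto simp: I_def)
  define L where "L p = {s. (p, s) \<in> J}" for p
  have L: "finite (L p)" "L p \<subseteq> {0..s\<^sub>0}" for p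
  proof -
    have "L p \<subseteq> snd ` J" unfolding L_def by force
    then show "finite (L p)" by (rule finite_subset) (use J in simp)
    show "L p \<subseteq> {0..s\<^sub>0}" unfolding L_def using J(2) by blast
  qed
  let ?P = "PiM {0..} (\<lambda>_::real. borel :: real measure)"
  define a where "a p = {f \<in> space ?P. \<forall>s\<in>L p. f s \<in> C p s}" for p
  define g where "g = {f \<in> space ?P. f t - f s\<^sub>0 \<in> D}"
  have am: "a p \<in> sets ?P" for p
    unfolding a_def
  proof (rule sets.sets_Collect_finite_All[OF _ L(1)])
    fix s assume "s \<in> L p"
    then have s: "s \<in> {0..}" using L(2)[of p] by auto
    have [measurable]: "(\<lambda>f. f s) \<in> measurable ?P borel" using s by (rule measurable_component_singleton)
    note [measurable] = C
    show "{f \<in> space ?P. f s \<in> C p s} \<in> sets ?P" by measurable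
  qed
  have gm: "g \<in> sets ?P"
  proof -
    have [measurable]: "(\<lambda>f. f s\<^sub>0) \<in> measurable ?P borel" "(\<lambda>f. f t) \<in> measurable ?P borel"
      using s by (auto intro!: measurable_component_singleton)
    note [measurable] = D
    show ?thesis unfolding g_def by measurable
  qed
  have Zs: "Z p w \<in> space ?P" for p w by (cases p) (simp add: Z_def space_PiM)
  have Zp: "Z p w s = B (fst p) (snd p) s w" if "0 \<le> s" for p w s using that by (cases p) (simp add: Z_def)
  have Za: "Z p -` a p \<inter> space M = {w \<in> space M. \<forall>s\<in>L p. B (fst p) (snd p) s w \<in> C p s}" for p
  proof -
    have "\<And>s w. s \<in> L p \<Longrightarrow> Z p w s = B (fst p) (snd p) s w" by (rule Zp) (use L(2)[of p] in auto)
    then show ?thesis using Zs by (auto simp: a_def)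
  qed
  have Zg: "Z p\<^sub>0 -` g \<inter> space M = {w \<in> space M. B z i t w - B z i s\<^sub>0 w \<in> D}"
    using Zs[of p\<^sub>0] Zp[of t p\<^sub>0] Zp[of s\<^sub>0 p\<^sub>0] s by (auto simp: g_def p\<^sub>0_def)
  have one: "prob (Z p\<^sub>0 -` (a p\<^sub>0 \<inter> g) \<inter> space M) = prob (Z p\<^sub>0 -` a p\<^sub>0 \<inter> space M) * prob (Z p\<^sub>0 -` g \<inter> space M)"
  proof -
    have "Z p\<^sub>0 -` (a p\<^sub>0 \<inter> g) \<inter> space M = (Z p\<^sub>0 -` a p\<^sub>0 \<inter> space M) \<inter> (Z p\<^sub>0 -` g \<inter> space M)" by auto
    also have "\<dots> = {w \<in> space M. (\<forall>s\<in>L p\<^sub>0. B (fst p\<^sub>0) (snd p\<^sub>0) s w \<in> C p\<^sub>0 s) \<and> B (fst p\<^sub>0) (snd p\<^sub>0) t w - B (fst p\<^sub>0) (snd p\<^sub>0) s\<^sub>0 w \<in> D}"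
      unfolding Za Zg by (auto simp: p\<^sub>0_def)
    finally have eq: "Z p\<^sub>0 -` (a p\<^sub>0 \<inter> g) \<inter> space M = \<dots>" .
    have "prob {w \<in> space M. (\<forall>s\<in>L p\<^sub>0. B (fst p\<^sub>0) (snd p\<^sub>0) s w \<in> C p\<^sub>0 s) \<and> B (fst p\<^sub>0) (snd p\<^sub>0) t w - B (fst p\<^sub>0) (snd p\<^sub>0) s\<^sub>0 w \<in> D}
      = prob {w \<in> space M. \<forall>s\<in>L p\<^sub>0. B (fst p\<^sub>0) (snd p\<^sub>0) s w \<in> C p\<^sub>0 s}
        * prob {w \<in> space M. B (fst p\<^sub>0) (snd p\<^sub>0) t w - B (fst p\<^sub>0) (snd p\<^sub>0) s\<^sub>0 w \<in> D}"
      by (rule brownian_increment_indep[OF sb L s C D])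
    then show ?thesis unfolding eq Za Zg by (simp add: p\<^sub>0_def)
  qed
  have all: "prob (\<Inter>p\<in>I. Z p -` a p \<inter> space M) = (\<Prod>p\<in>I. prob (Z p -` a p \<inter> space M))"
    by (rule indep_varsD[OF ind]) (use I am in auto)
  have "prob (\<Inter>p\<in>I. Z p -` (if p = p\<^sub>0 then a p \<inter> g else a p) \<inter> space M)
    = (\<Prod>p\<in>I. prob (Z p -` (if p = p\<^sub>0 then a p \<inter> g else a p) \<inter> space M))"
    by (rule indep_varsD[OF ind]) (use I am gm in auto)
  also have "\<dots> = prob (Z p\<^sub>0 -` (a p\<^sub>0 \<inter> g) \<inter> space M) * (\<Prod>p\<in>I - {p\<^sub>0}. prob (Z p -` (if p = p\<^sub>0 then a p \<inter> g else a p) \<inter> space M))"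
    by (subst prod.remove[OF I(1,3)]) simp
  also have "(\<Prod>p\<in>I - {p\<^sub>0}. prob (Z p -` (if p = p\<^sub>0 then a p \<inter> g else a p) \<inter> space M)) = (\<Prod>p\<in>I - {p\<^sub>0}. prob (Z p -` a p \<inter> space M))"
    by (rule prod.cong) auto
  also have "prob (Z p\<^sub>0 -` (a p\<^sub>0 \<inter> g) \<inter> space M) * (\<Prod>p\<in>I - {p\<^sub>0}. prob (Z p -` a p \<inter> space M))
     = (\<Prod>p\<in>I. prob (Z p -` a p \<inter> space M)) * prob (Z p\<^sub>0 -` g \<inter> space M)"
    unfolding one by (subst prod.remove[OF I(1,3)]) simp
  finally have *: "prob (\<Inter>p\<in>I. Z p -` (if p = p\<^sub>0 then a p \<inter> g else a p) \<inter> space M)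
     = prob (\<Inter>p\<in>I. Z p -` a p \<inter> space M) * prob (Z p\<^sub>0 -` g \<inter> space M)" unfolding all .
  have E1: "(\<Inter>p\<in>I. Z p -` a p \<inter> space M) = {w \<in> space M. \<forall>(p, s)\<in>J. B (fst p) (snd p) s w \<in> C p s}"
    unfolding Za using I(3) by (force simp: L_def I_def)
  have "(\<Inter>p\<in>I. Z p -` (if p = p\<^sub>0 then a p \<inter> g else a p) \<inter> space M) = (\<Inter>p\<in>I. Z p -` a p \<inter> space M) \<inter> (Z p\<^sub>0 -` g \<inter> space M)"
    using I(3) by (auto split: if_splits)
  then have E2: "(\<Inter>p\<in>I. Z p -` (if p = p\<^sub>0 then a p \<inter> g else a p) \<inter> space M)
     = {w \<in> space M. (\<forall>(p, s)\<in>J. B (fst p) (snd p) s w \<in> C p s) \<and> B z i t w - B z i s\<^sub>0 w \<in> D}"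
    unfolding E1 Zg by auto
  show ?thesis using * unfolding E1 E2 Zg .
qed

text \<open>Events fixing the datum and finitely many past values, together with null sets, form an
  intersection-stable generator; on it, independence of datum and noise combines with
  \<open>noise_past_indep\<close>.\<close>

lemma filtration_indep_increment:
  fixes B :: "'z \<Rightarrow> 3 \<Rightarrow> real \<Rightarrow> 'a \<Rightarrow> real"
  assumes W: "white_noise M B" and U0: "U0 \<in> borel_measurable M" and iU: "indep_of_noise M B U0"
    and s: "0 \<le> s\<^sub>0" "s\<^sub>0 < t" and D: "D \<in> sets borel" and A: "A \<in> sets (noise_filtration M B U0 s\<^sub>0)"
  shows "A \<in> events" "prob (A \<inter> {w \<in> space M. B z i t w - B z i s\<^sub>0 w \<in> D})
    = prob A * prob {w \<in> space M. B z i t w - B z i s\<^sub>0 w \<in> D}"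
proof -
  define G where "G = {w \<in> space M. B z i t w - B z i s\<^sub>0 w \<in> D}"
  have Bm: "B z i s \<in> borel_measurable M" if "0 \<le> s" for z i s
    using W that by (simp add: white_noise_def standard_brownian_def)
  have G: "G \<in> events"
  proof -
    have [measurable]: "B z i s\<^sub>0 \<in> borel_measurable M" "B z i t \<in> borel_measurable M" using Bm s by auto
    note [measurable] = D
    show ?thesis unfolding G_def by measurable
  qed
  define N where "N J C = {w \<in> space M. \<forall>(p, s)\<in>J. B (fst p) (snd p) s w \<in> C p s}" for J :: "(('z \<times> 3) \<times> real) set" and C
  define \<P> where "\<P> = null_sets M \<union> {(U0 -` V \<inter> space M) \<inter> N J C | V J C. V \<in> sets borel \<and> finite J \<and>
     (\<forall>(p, s)\<in>J. s \<in> {0..s\<^sub>0}) \<and> (\<forall>p s. C p s \<in> sets borel)}"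
  have Nm: "N J C \<in> events" if J: "finite J" "\<forall>(p, s)\<in>J. s \<in> {0..s\<^sub>0}" and C: "\<forall>p s. C p s \<in> sets borel" for J C
    unfolding N_def
  proof (rule sets.sets_Collect_finite_All[OF _ J(1)])
    fix q assume q: "q \<in> J"
    obtain p s where qq: "q = (p, s)" by (cases q)
    have [measurable]: "B (fst p) (snd p) s \<in> borel_measurable M" by (rule Bm) (use J(2) q qq in auto)
    have [measurable]: "C p s \<in> sets borel" using C by blast
    show "{w \<in> space M. case q of (p, s) \<Rightarrow> B (fst p) (snd p) s w \<in> C p s} \<in> events" unfolding qq prod.case by measurable
  qed
  have Pev: "\<P> \<subseteq> events"
  proof
    fix a assume "a \<in> \<P>"
    then consider "a \<in> null_sets M" | V J C where "a = (U0 -` V \<inter> space M) \<inter> N J C" "V \<in> sets borel" "finite J"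
      "\<forall>(p, s)\<in>J. s \<in> {0..s\<^sub>0}" "\<forall>p s. C p s \<in> sets borel" unfolding \<P>_def by blast
    then show "a \<in> events"
    proof cases
      case 2 then show ?thesis using sets.Int[OF measurable_sets[OF U0] Nm] by blast
    qed auto
  qed
  have stable: "Int_stable \<P>"
  proof (rule Int_stableI)
    fix a b assume a: "a \<in> \<P>" and b: "b \<in> \<P>"
    have ev: "a \<in> events" "b \<in> events" using a b Pev by auto
    consider "a \<in> null_sets M" | "b \<in> null_sets M" | "a \<notin> null_sets M" "b \<notin> null_sets M" by blast
    then show "a \<inter> b \<in> \<P>"
    proof cases
      case 1 then show ?thesis using null_set_Int2[of a M b] ev by (simp add: \<P>_def)
    next
      case 2 then show ?thesis using null_set_Int1[of b M a] ev by (simp add: \<P>_def)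
    next
      case 3
      obtain V J C where 1: "a = (U0 -` V \<inter> space M) \<inter> N J C" "V \<in> sets borel" "finite J" "\<forall>(p, s)\<in>J. s \<in> {0..s\<^sub>0}" "\<forall>p s. C p s \<in> sets borel"
        using a 3 unfolding \<P>_def by blast
      obtain V' J' C' where 2: "b = (U0 -` V' \<inter> space M) \<inter> N J' C'" "V' \<in> sets borel" "finite J'" "\<forall>(p, s)\<in>J'. s \<in> {0..s\<^sub>0}" "\<forall>p s. C' p s \<in> sets borel"
        using b 3 unfolding \<P>_def by blast
      \<comment> \<open>A time constrained in only one of the two events gets \<open>UNIV\<close>
        from the other.\<close>
      define C2 where "C2 p s = (if (p, s) \<in> J then C p s else UNIV) \<inter> (if (p, s) \<in> J' then C' p s else UNIV)" for p s
      have "a \<inter> b = (U0 -` (V \<inter> V') \<inter> space M) \<inter> N (J \<union> J') C2"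
        unfolding 1(1) 2(1) N_def C2_def by (auto split: if_splits)
      moreover have "V \<inter> V' \<in> sets borel" "finite (J \<union> J')" "\<forall>(p, s)\<in>J \<union> J'. s \<in> {0..s\<^sub>0}" "\<forall>p s. C2 p s \<in> sets borel"
        using 1 2 by (auto simp: C2_def)
      ultimately show ?thesis unfolding \<P>_def by blast
    qed
  qed
  have prod: "prob (a \<inter> b) = prob a * prob b" if a: "a \<in> \<P>" and b: "b \<in> {G}" for a b
  proof (cases "a \<in> null_sets M")
    case True
    then have "a \<inter> G \<in> null_sets M" using G by (rule null_set_Int2)
    then show ?thesis using True b by (simp add: measure_def null_setsD1)
  next
    case False
    obtain V J C where 1: "a = (U0 -` V \<inter> space M) \<inter> N J C" "V \<in> sets borel" "finite J" "\<forall>(p, s)\<in>J. s \<in> {0..s\<^sub>0}" "\<forall>p s. C p s \<in> sets borel"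
      using a False unfolding \<P>_def by blast
    let ?P = "PiM (UNIV \<times> UNIV \<times> {0..}) (\<lambda>_. borel :: real measure)"
    let ?Z = "\<lambda>w. \<lambda>(z, i, t)\<in>UNIV \<times> UNIV \<times> {0..}. B z i t w"
    have indU: "prob ((U0 -` V \<inter> space M) \<inter> (?Z -` Y \<inter> space M)) = prob (U0 -` V \<inter> space M) * prob (?Z -` Y \<inter> space M)"
      if Y: "Y \<in> sets ?P" for Y
      by (rule indep_setD[OF iU[unfolded indep_of_noise_def]]) (rule in_vimage_algebra, fact)+
    define Y1 where "Y1 = {f \<in> space ?P. \<forall>q\<in>J. f (fst (fst q), snd (fst q), snd q) \<in> C (fst q) (snd q)}"
    define Y2 where "Y2 = {f \<in> space ?P. f (z, i, t) - f (z, i, s\<^sub>0) \<in> D}"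
    have Y1: "Y1 \<in> sets ?P"
      unfolding Y1_def
    proof (rule sets.sets_Collect_finite_All[OF _ 1(3)])
      fix q assume q: "q \<in> J"
      have [measurable]: "(\<lambda>f. f (fst (fst q), snd (fst q), snd q)) \<in> measurable ?P borel"
        by (rule measurable_component_singleton) (use 1(4) q in auto)
      have [measurable]: "C (fst q) (snd q) \<in> sets borel" using 1(5) by blast
      show "{f \<in> space ?P. f (fst (fst q), snd (fst q), snd q) \<in> C (fst q) (snd q)} \<in> sets ?P" by measurable
    qed
    have Y2: "Y2 \<in> sets ?P"
    proof -
      have [measurable]: "(\<lambda>f. f (z, i, t)) \<in> measurable ?P borel" "(\<lambda>f. f (z, i, s\<^sub>0)) \<in> measurable ?P borel"
        by (rule measurable_component_singleton, use s in simp)+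
      note [measurable] = D
      show ?thesis unfolding Y2_def by measurable
    qed
    have Zs: "?Z w \<in> space ?P" for w by (simp add: space_PiM)
    have Z1: "?Z -` Y1 \<inter> space M = N J C"
    proof -
      have "\<And>q. q \<in> J \<Longrightarrow> ?Z w (fst (fst q), snd (fst q), snd q) = B (fst (fst q)) (snd (fst q)) (snd q) w" for w
        using 1(4) by auto
      then show ?thesis unfolding Y1_def N_def using Zs by (auto simp: case_prod_unfold)
    qed
    have Z2: "?Z -` Y2 \<inter> space M = G" unfolding Y2_def G_def using Zs s by auto
    have Z12: "?Z -` (Y1 \<inter> Y2) \<inter> space M = N J C \<inter> G" using Z1 Z2 by blast
    have NG: "prob (N J C \<inter> G) = prob (N J C) * prob G"
    proof -
      have "N J C \<inter> G = {w \<in> space M. (\<forall>(p, s)\<in>J. B (fst p) (snd p) s w \<in> C p s) \<and> B z i t w - B z i s\<^sub>0 w \<in> D}"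
        unfolding N_def G_def by auto
      then show ?thesis using noise_past_indep[OF W 1(3) _ s _ D, of C z i] 1(4,5) unfolding N_def G_def by fastforce
    qed
    have "a \<inter> b = (U0 -` V \<inter> space M) \<inter> (N J C \<inter> G)" using b 1(1) by auto
    then have "prob (a \<inter> b) = prob (U0 -` V \<inter> space M) * (prob (N J C) * prob G)"
      using indU[OF sets.Int[OF Y1 Y2]] unfolding Z12 NG by simp
    moreover have "prob a = prob (U0 -` V \<inter> space M) * prob (N J C)"
      using indU[OF Y1] unfolding Z1 1(1) .
    ultimately show ?thesis using b by simp
  qed
  have ind: "indep_set (sigma_sets (space M) \<P>) (sigma_sets (space M) {G})"
    by (rule indep_set_sigma_sets[OF indep_setI[OF Pev _ prod] stable]) (use G in \<open>auto simp: Int_stable_def\<close>)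
  let ?F = "null_sets M \<union> {U0 -` A \<inter> space M | A. A \<in> sets borel} \<union>
      {B z i s -` A \<inter> space M | z i s A. 0 \<le> s \<and> s \<le> s\<^sub>0 \<and> A \<in> sets borel}"
  have sub: "?F \<subseteq> \<P>"
  proof (intro Un_least)
    show "{U0 -` A \<inter> space M | A. A \<in> sets borel} \<subseteq> \<P>"
    proof safe
      fix A :: "vfield set" assume "A \<in> sets borel"
      moreover have "U0 -` A \<inter> space M = (U0 -` A \<inter> space M) \<inter> N {} (\<lambda>_ _. UNIV)" by (auto simp: N_def)
      ultimately show "U0 -` A \<inter> space M \<in> \<P>" unfolding \<P>_def by fastforce
    qed
    show "{B z i s -` A \<inter> space M | z i s A. 0 \<le> s \<and> s \<le> s\<^sub>0 \<and> A \<in> sets borel} \<subseteq> \<P>"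
    proof safe
      fix z i s and A :: "real set" assume a: "0 \<le> s" "s \<le> s\<^sub>0" "A \<in> sets borel"
      have "B z i s -` A \<inter> space M = (U0 -` UNIV \<inter> space M) \<inter> N {((z, i), s)} (\<lambda>_ _. A)" by (auto simp: N_def)
      moreover have "(UNIV :: vfield set) \<in> sets borel" "finite {((z, i), s)}" "\<forall>(p, s)\<in>{((z, i), s)}. s \<in> {0..s\<^sub>0}"
        using a by auto
      ultimately show "B z i s -` A \<inter> space M \<in> \<P>" unfolding \<P>_def using a(3) by blast
    qed
  qed (auto simp: \<P>_def)
  have "?F \<subseteq> Pow (space M)" using sets.sets_into_space by (auto simp: null_sets_def)
  then have "sets (noise_filtration M B U0 s\<^sub>0) = sigma_sets (space M) ?F"
    unfolding noise_filtration_def by (rule sets_measure_of)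
  then have A': "A \<in> sigma_sets (space M) \<P>" using A sigma_sets_mono'[OF sub] by auto
  show "A \<in> events" using A' indep_setD_ev1[OF ind] by auto
  show "prob (A \<inter> {w \<in> space M. B z i t w - B z i s\<^sub>0 w \<in> D}) = prob A * prob {w \<in> space M. B z i t w - B z i s\<^sub>0 w \<in> D}"
    unfolding G_def[symmetric] by (rule indep_setD[OF ind A']) auto
qed

end

section \<open>The random solution\<close>

lemma sqrtQ_le_1: "0 < \<delta> \<Longrightarrow> 0 \<le> sqrtQ k \<beta> \<delta> z \<and> sqrtQ k \<beta> \<delta> z \<le> 1"
  unfolding sqrtQ_def by (auto simp: inverse_le_1_iff)

text \<open>In a fixed mode the regularisation disappears as \<delta> tends to 0.\<close>

lemma sqrtQ_eventually:
  assumes "(\<delta> \<longlongrightarrow> 0) (at_right 0)" "\<And>\<epsilon>. 0 < \<epsilon> \<Longrightarrow> 0 < \<delta> \<epsilon>"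
  shows "eventually (\<lambda>\<epsilon>. 1 / 2 \<le> sqrtQ k \<beta> (\<delta> \<epsilon>) z) (at_right 0)"
proof -
  have "((\<lambda>\<epsilon>. sqrtQ k \<beta> (\<delta> \<epsilon>) z) \<longlongrightarrow> sqrt (inverse (1 + 0 * eigval k z powr (2 * \<beta>)))) (at_right 0)"
    unfolding sqrtQ_def by (intro tendsto_intros assms(1)) auto
  then have "((\<lambda>\<epsilon>. sqrtQ k \<beta> (\<delta> \<epsilon>) z) \<longlongrightarrow> 1) (at_right 0)" by simp
  then have "eventually (\<lambda>\<epsilon>. 1 / 2 < sqrtQ k \<beta> (\<delta> \<epsilon>) z) (at_right 0)" by (rule order_tendstoD) simp
  then show ?thesis by eventually_elim simp
qed

locale random_solution = plane_waves e k + prob_space M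
  for e :: "'z \<Rightarrow> vfield" and k :: "'z \<Rightarrow> int ^ 3" and M :: "'w measure" +
  fixes B :: "'z \<Rightarrow> 3 \<Rightarrow> real \<Rightarrow> 'w \<Rightarrow> real" and \<beta> T \<epsilon> \<delta> :: real
    and U0 :: "'w \<Rightarrow> vfield" and U :: "'w \<Rightarrow> real \<Rightarrow> vfield" and \<tau> :: "'w \<Rightarrow> real"
  assumes T_pos: "0 < T" and noise: "white_noise M B" and eps: "0 < \<epsilon>"
    and U0_measurable: "U0 \<in> borel_measurable M" and datum_indep: "indep_of_noise M B U0"
    and solution: "strong_solution e k \<beta> T M B \<epsilon> \<delta> U0 U \<tau>"
begin

abbreviation XX :: "'w \<Rightarrow> path" where "XX w \<equiv> path_of (\<tau> w) (U w)"

abbreviation \<F> :: "real \<Rightarrow> 'w measure" where "\<F> \<equiv> noise_filtration M B U0"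

definition NN :: "(real ^ 3 \<Rightarrow> real ^ 3) \<Rightarrow> real \<Rightarrow> 'w \<Rightarrow> real" where
  "NN \<phi> t w = sqrt \<epsilon> * noise_term e k \<beta> \<delta> B \<phi> t w"

text \<open>Collects the almost sure properties for all modes, test fields and times at once, so
  that later arguments are pathwise.\<close>

definition reg :: "'w \<Rightarrow> bool" where
  "reg w \<longleftrightarrow> w \<in> space M \<and> XX w \<in> Xst_loc e k T \<and> (\<forall>z i. continuous_on {0..} (\<lambda>t. B z i t w)) \<and>
     (\<forall>\<phi>\<in>smooth_df. \<forall>t\<in>{0..<\<tau> w}.
        U w t \<bullet> field_of \<phi> + (LINT s:{0..t}|lebesgue. stokes (U w s) \<bullet> field_of \<phi>) =
        U0 w \<bullet> field_of \<phi> - (LINT s:{0..t}|lebesgue. advection (U w s) \<phi>) + NN \<phi> t w)"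

lemma AE_reg: "AE w in M. reg w"
proof -
  have "AE w in M. \<forall>p\<in>(UNIV :: ('z \<times> 3) set). continuous_on {0..} (\<lambda>t. B (fst p) (snd p) t w)"
  proof (subst AE_ball_countable)
    show "countable (UNIV :: ('z \<times> 3) set)"
      unfolding UNIV_Times_UNIV[symmetric] by (intro countable_SIGMA countable_index) simp
    show "\<forall>p\<in>(UNIV :: ('z \<times> 3) set). AE w in M. continuous_on {0..} (\<lambda>t. B (fst p) (snd p) t w)"
      using noise by (simp add: white_noise_def standard_brownian_def)
  qed
  moreover have "AE w in M. XX w \<in> Xst_loc e k T" using solution unfolding strong_solution_def by blast
  moreover have "AE w in M. \<forall>\<phi>\<in>smooth_df. \<forall>t\<in>{0..<\<tau> w}.
        U w t \<bullet> field_of \<phi> + (LINT s:{0..t}|lebesgue. stokes (U w s) \<bullet> field_of \<phi>) =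
        U0 w \<bullet> field_of \<phi> - (LINT s:{0..t}|lebesgue. advection (U w s) \<phi>) + NN \<phi> t w"
    using solution unfolding strong_solution_def NN_def by blast
  ultimately show ?thesis using AE_space
    by eventually_elim (simp only: reg_def, auto)
qed

lemma lifetime_XX [simp]: "lifetime (XX w) = \<tau> w" and XX_not_Star [simp]: "XX w \<noteq> Star"
  by (simp_all add: path_of_def)

lemma reg_good: "reg w \<Longrightarrow> 0 \<le> S \<Longrightarrow> S < \<tau> w \<Longrightarrow> good S (path_at (XX w))"
  by (rule path_good) (auto simp: reg_def)

lemma reg_equation:
  assumes "reg w" "\<phi> \<in> smooth_df" "0 \<le> t" "t < \<tau> w"
  shows "path_at (XX w) t \<bullet> field_of \<phi> + (LINT s:{0..t}|lebesgue. stokes (path_at (XX w) s) \<bullet> field_of \<phi>) =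
        U0 w \<bullet> field_of \<phi> - (LINT s:{0..t}|lebesgue. advection (path_at (XX w) s) \<phi>) + NN \<phi> t w"
proof -
  have *: "path_at (XX w) s = U w s" if "s \<in> {0..t}" for s using that assms by (simp add: path_of_def)
  have 1: "(LINT s:{0..t}|lebesgue. stokes (path_at (XX w) s) \<bullet> field_of \<phi>) = (LINT s:{0..t}|lebesgue. stokes (U w s) \<bullet> field_of \<phi>)"
    by (rule set_lebesgue_integral_cong) (use * in auto)
  have 2: "(LINT s:{0..t}|lebesgue. advection (path_at (XX w) s) \<phi>) = (LINT s:{0..t}|lebesgue. advection (U w s) \<phi>)"
    by (rule set_lebesgue_integral_cong) (use * in auto)
  have "t \<in> {0..<\<tau> w}" "t \<in> {0..t}" using assms by auto
  then show ?thesis using assms(1,2) unfolding 1 2 reg_def by (simp only: *)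
qed

lemma reg_solves: "reg w \<Longrightarrow> S < \<tau> w \<Longrightarrow> 0 \<le> S \<Longrightarrow> solves S (path_at (XX w)) (U0 w) (\<lambda>z t. NN (ew z) t w)"
  by (rule weak_solves[OF reg_good]) (auto intro!: reg_equation ew_df)

lemma NN_ew: "NN (ew z) t w = sqrt \<epsilon> *
    (\<Sum>(z', i)\<in>{z'. eigval k z' \<le> eigval k z} \<times> UNIV. (de i z \<bullet> e z') * sqrtQ k \<beta> \<delta> z' * B z' i t w)"
  unfolding NN_def noise_term_ew ..

lemma NN_continuous: "reg w \<Longrightarrow> continuous_on {0..} (\<lambda>t. NN (ew z) t w)"
  unfolding NN_ew case_prod_unfold by (intro continuous_intros) (auto simp: reg_def)

lemma space_\<F>: "space (\<F> t) = space M"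
  unfolding noise_filtration_def by (rule space_measure_of) (use sets.sets_into_space in \<open>auto simp: null_sets_def\<close>)

lemma sets_\<F>I: "A \<in> null_sets M \<union> {U0 -` A \<inter> space M | A. A \<in> sets borel} \<union>
      {B z i s -` A \<inter> space M | z i s A. 0 \<le> s \<and> s \<le> t \<and> A \<in> sets borel} \<Longrightarrow> A \<in> sets (\<F> t)"
proof -
  have "null_sets M \<union> {U0 -` A \<inter> space M | A. A \<in> sets borel} \<union>
      {B z i s -` A \<inter> space M | z i s A. 0 \<le> s \<and> s \<le> t \<and> A \<in> sets borel} \<subseteq> Pow (space M)"
    using sets.sets_into_space by (auto simp: null_sets_def)
  from sets_measure_of[OF this] show "A \<in> null_sets M \<union> {U0 -` A \<inter> space M | A. A \<in> sets borel} \<union>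
      {B z i s -` A \<inter> space M | z i s A. 0 \<le> s \<and> s \<le> t \<and> A \<in> sets borel} \<Longrightarrow> A \<in> sets (\<F> t)"
    unfolding noise_filtration_def by (simp only: sigma_sets.Basic)
qed

lemma U0_\<F>: "U0 \<in> borel_measurable (\<F> t)"
proof (rule measurableI)
  fix A :: "vfield set" assume "A \<in> sets borel"
  then show "U0 -` A \<inter> space (\<F> t) \<in> sets (\<F> t)" unfolding space_\<F> by (intro sets_\<F>I) blast
qed simp

lemma B_\<F>: "0 \<le> s \<Longrightarrow> s \<le> t \<Longrightarrow> B z i s \<in> borel_measurable (\<F> t)"
proof (rule measurableI)
  fix A :: "real set" assume "0 \<le> s" "s \<le> t" "A \<in> sets borel"
  then show "B z i s -` A \<inter> space (\<F> t) \<in> sets (\<F> t)" unfolding space_\<F> by (intro sets_\<F>I) blast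
qed simp

lemma NN_\<F>: "0 \<le> s \<Longrightarrow> s \<le> t \<Longrightarrow> NN (ew z) s \<in> borel_measurable (\<F> t)"
  unfolding NN_ew[abs_def] case_prod_unfold by (intro borel_measurable_times borel_measurable_sum borel_measurable_const B_\<F>)

lemma \<tau>_\<F>: "{w \<in> space M. t < \<tau> w} \<in> sets (\<F> t)"
proof -
  have "stopping_time \<F> \<tau>" using solution unfolding strong_solution_def by blast
  then have "Measurable.pred (\<F> t) (\<lambda>w. \<tau> w \<le> t)" unfolding stopping_time_def by blast
  then have "{w \<in> space (\<F> t). \<tau> w \<le> t} \<in> sets (\<F> t)" by (simp add: pred_def)
  then have "space (\<F> t) - {w \<in> space (\<F> t). \<tau> w \<le> t} \<in> sets (\<F> t)" by (rule sets.compl_sets)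
  moreover have "space (\<F> t) - {w \<in> space (\<F> t). \<tau> w \<le> t} = {w \<in> space M. t < \<tau> w}" by (auto simp: space_\<F>)
  ultimately show ?thesis by simp
qed

text \<open>The solution up to time \<open>S\<close> depends continuously on the datum and on finitely many noise
  coefficients, uniformly in time; a path enters these only through its modulus of continuity and
  its values on a finite grid, so closeness to \<open>u\<close> is decided by countably many measurable
  conditions.\<close>

lemma near_event_adapted:
  assumes u: "good S u" and S: "0 < S"
  shows "\<exists>A\<in>sets (\<F> S). \<forall>w. reg w \<longrightarrow> (w \<in> A \<longleftrightarrow> S < \<tau> w \<and> close_to S \<rho> (path_at (XX w)) u)"
proof -
  define W where "W = {w. reg w \<and> S < \<tau> w \<and> close_to S \<rho> (path_at (XX w)) u}"
  \<comment> \<open>Coarse grid of mesh S/(m+1); below, f divides its cells into p+1 equal steps.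
    Only countably many times occur.\<close>
  define g where "g m i = S * (real i / real (Suc m))" for m i :: nat
  define f where "f m i p l = S * ((real i + real l / real (Suc p)) / real (Suc m))" for m i p l :: nat
  have g: "g m i \<in> {0..S}" if "i \<le> m" for m i
  proof -
    have "g m i \<le> S * 1" unfolding g_def using S that by (intro mult_left_mono) auto
    then show ?thesis using S unfolding g_def by simp
  qed
  have f: "f m i p l \<in> {0..S}" if "i \<le> m" "l \<le> Suc p" for m i p l
  proof -
    have "real l / real (Suc p) \<le> 1" using that by simp
    then have "real i + real l / real (Suc p) \<le> real (Suc m)" using that by linarith
    then have "(real i + real l / real (Suc p)) / real (Suc m) \<le> 1" by simp
    then have "f m i p l \<le> S * 1" unfolding f_def using S by (intro mult_left_mono) auto
    then show ?thesis using S unfolding f_def by simp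
  qed
  \<comment> \<open>Bounds the oscillation of the noise on each coarse cell along all refinements: a
    countable condition that by continuity controls the whole cell.\<close>
  define V where "V j m w \<longleftrightarrow> (\<forall>z\<in>E j. \<forall>i\<in>{..m}. \<forall>p. \<forall>l\<in>{..Suc p}.
     \<bar>NN (ew z) (f m i p l) w - NN (ew z) (g m i) w\<bar> \<le> eta j / 4)" for j m w
  \<comment> \<open>Index set of the recorded numbers: datum coefficients on the left, noise values
    at coarse grid times on the right.\<close>
  define K where "K j m = Inl ` E j \<union> Inr ` (E j \<times> {..m})" for j and m :: nat
  define y where "y m \<kappa> w = (case \<kappa> of Inl z \<Rightarrow> e z \<bullet> U0 w | Inr (z, i) \<Rightarrow> NN (ew z) (g m i) w)" for m and \<kappa> :: "'z + 'z \<times> nat" and w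
  have finK: "finite (K j m)" for j m
    unfolding K_def by simp
  define N where "N j m q = {w \<in> space M. \<forall>\<kappa>\<in>K j m. \<bar>y m \<kappa> w - q \<kappa>\<bar> < eta j / 8}" for j m q
  \<comment> \<open>Rational vectors near the record of some outcome in W. Although defined through
    W, whose measurability is not known here, Q is a subset of a countable set, so unions over it
    are measurable.\<close>
  define Q where "Q j m = {q \<in> PiE (K j m) (\<lambda>_. \<rat>). \<exists>w\<in>W. V j m w \<and> w \<in> N j m q}" for j m
  define A where "A = {w \<in> space M. \<forall>j. \<exists>m. V j m w \<and> (\<exists>q\<in>Q j m. w \<in> N j m q)} \<inter> {w \<in> space M. S < \<tau> w}"
  have Vm: "{w \<in> space (\<F> S). V j m w} \<in> sets (\<F> S)" for j m
  proof -
    have "{w \<in> space (\<F> S). \<bar>NN (ew z) (f m i p l) w - NN (ew z) (g m i) w\<bar> \<le> eta j / 4} \<in> sets (\<F> S)"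
      if "i \<in> {..m}" "l \<in> {..Suc p}" for z i p l
    proof -
      have [measurable]: "NN (ew z) (f m i p l) \<in> borel_measurable (\<F> S)" "NN (ew z) (g m i) \<in> borel_measurable (\<F> S)"
        using f[of i m l p] g[of i m] that by (auto intro!: NN_\<F>)
      show ?thesis by measurable
    qed
    then show ?thesis unfolding V_def
      by (intro sets.sets_Collect_finite_All sets.sets_Collect_countable_All finite_E finite_atMost)
  qed
  have Nm: "N j m q \<in> sets (\<F> S)" for j m q
    unfolding N_def space_\<F>[of S, symmetric]
  proof (rule sets.sets_Collect_finite_All[OF _ finK])
    fix \<kappa> assume \<kappa>: "\<kappa> \<in> K j m"
    have [measurable]: "y m \<kappa> \<in> borel_measurable (\<F> S)"
    proof (cases \<kappa>)
      case (Inl z)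
      have "(\<lambda>w. e z \<bullet> U0 w) \<in> borel_measurable (\<F> S)"
        by (rule measurable_compose[OF U0_\<F> borel_measurable_continuous_onI]) (intro continuous_intros)
      then show ?thesis unfolding y_def[abs_def] Inl by simp
    next
      case (Inr p)
      obtain z i where p: "p = (z, i)" by (cases p)
      have "i \<le> m" using \<kappa> unfolding K_def Inr p by auto
      then have "NN (ew z) (g m i) \<in> borel_measurable (\<F> S)" using g[of i m] by (intro NN_\<F>) auto
      then show ?thesis unfolding y_def[abs_def] Inr p by simp
    qed
    show "{w \<in> space (\<F> S). \<bar>y m \<kappa> w - q \<kappa>\<bar> < eta j / 8} \<in> sets (\<F> S)" by measurable
  qed
  have cQ: "countable (Q j m)" for j m
  proof (rule countable_subset)
    show "Q j m \<subseteq> PiE (K j m) (\<lambda>_. \<rat>)" unfolding Q_def by blast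
    show "countable (PiE (K j m) (\<lambda>_. \<rat> :: real set))" by (intro countable_PiE finK countable_rat)
  qed
  have QN: "{w \<in> space (\<F> S). \<exists>q\<in>Q j m. w \<in> N j m q} \<in> sets (\<F> S)" for j m
  proof -
    have "{w \<in> space (\<F> S). \<exists>q\<in>Q j m. w \<in> N j m q} = (\<Union>q\<in>Q j m. N j m q)"
      unfolding space_\<F> by (auto simp: N_def)
    moreover have "N j m ` Q j m \<subseteq> sets (\<F> S)" using Nm by blast
    ultimately show ?thesis using sets.countable_UN'[OF cQ[of j m], of "N j m" "\<F> S"] by simp
  qed
  have Am: "A \<in> sets (\<F> S)"
  proof -
    have "{w \<in> space (\<F> S). \<forall>j. \<exists>m. V j m w \<and> (\<exists>q\<in>Q j m. w \<in> N j m q)} \<in> sets (\<F> S)"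
      by (intro sets.sets_Collect_countable_All sets.sets_Collect_countable_Ex sets.sets_Collect_conj Vm QN)
    then show ?thesis unfolding A_def space_\<F> by (intro sets.Int \<tau>_\<F>)
  qed
  \<comment> \<open>Fine grid points converge to t and the noise is continuous, so the countable
    bound extends to every t of the cell.\<close>
  have osc: "\<bar>NN (ew z) t w - NN (ew z) (g m i) w\<bar> \<le> eta j / 4"
    if r: "reg w" and v: "V j m w" and z: "z \<in> E j" and i: "i \<le> m" and t: "t \<in> {g m i..g m (Suc i)}" for w j m z i t
  proof -
    define x where "x = t / S * real (Suc m) - real i"
    have x: "0 \<le> x" "x \<le> 1"
    proof -
      have "g m i / S * real (Suc m) = real i" "g m (Suc i) / S * real (Suc m) = real (Suc i)" using S by (auto simp: g_def)
      moreover have "g m i / S * real (Suc m) \<le> t / S * real (Suc m)" "t / S * real (Suc m) \<le> g m (Suc i) / S * real (Suc m)"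
        using S t by (auto intro!: mult_right_mono divide_right_mono)
      ultimately show "0 \<le> x" "x \<le> 1" unfolding x_def by linarith+
    qed
    define l where "l p = nat \<lfloor>x * real (Suc p)\<rfloor>" for p
    have l: "real (l p) \<le> x * real (Suc p)" "x * real (Suc p) < real (l p) + 1" for p
    proof -
      have "0 \<le> x * real (Suc p)" using x by simp
      then show "real (l p) \<le> x * real (Suc p)" "x * real (Suc p) < real (l p) + 1" unfolding l_def by linarith+
    qed
    have l_le: "l p \<le> Suc p" for p
    proof -
      have "x * real (Suc p) \<le> 1 * real (Suc p)" using x by (intro mult_right_mono) auto
      with l(1)[of p] have "real (l p) \<le> 1 * real (Suc p)" by (rule order_trans)
      then show ?thesis by (simp only: mult_1 of_nat_le_iff)
    qed
    have lim: "(\<lambda>p. real (l p) / real (Suc p)) \<longlonglongrightarrow> x"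
    proof (rule real_tendsto_sandwich)
      show "(\<lambda>p. x - 1 / real (Suc p)) \<longlonglongrightarrow> x"
        using tendsto_diff[OF tendsto_const[of x] LIMSEQ_inverse_real_of_nat] by (simp add: inverse_eq_divide)
      show "(\<lambda>p. x) \<longlonglongrightarrow> x" by simp
      have "x - 1 / real (Suc p) \<le> real (l p) / real (Suc p)" for p
      proof -
        have "x * real (Suc p) - 1 \<le> real (l p)" unfolding diff_le_eq by (rule less_imp_le[OF l(2)])
        then have "(x * real (Suc p) - 1) / real (Suc p) \<le> real (l p) / real (Suc p)" by (rule divide_right_mono) simp
        then show ?thesis by (simp add: diff_divide_distrib del: of_nat_Suc)
      qed
      then show "\<forall>\<^sub>F p in sequentially. x - 1 / real (Suc p) \<le> real (l p) / real (Suc p)" by simp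
      have "real (l p) / real (Suc p) \<le> x" for p
      proof -
        have "0 < real (Suc p)" by simp
        from pos_divide_le_eq[OF this] show ?thesis using l(1) by blast
      qed
      then show "\<forall>\<^sub>F p in sequentially. real (l p) / real (Suc p) \<le> x" by simp
    qed
    have "(\<lambda>p. f m i p (l p)) \<longlonglongrightarrow> S * ((real i + x) / real (Suc m))"
      unfolding f_def by (intro tendsto_intros lim) simp
    also have "S * ((real i + x) / real (Suc m)) = t" using S by (simp add: x_def)
    finally have ft: "(\<lambda>p. f m i p (l p)) \<longlonglongrightarrow> t" .
    have t0: "t \<in> {0..}" using g[OF i] t by auto
    have "(\<lambda>p. NN (ew z) (f m i p (l p)) w) \<longlonglongrightarrow> NN (ew z) t w"
    proof (rule continuous_on_tendsto_compose[OF NN_continuous[OF r] ft t0])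
      show "\<forall>\<^sub>F p in sequentially. f m i p (l p) \<in> {0..}" using f[OF i l_le] by (auto intro!: always_eventually)
    qed
    then have lim2: "(\<lambda>p. \<bar>NN (ew z) (f m i p (l p)) w - NN (ew z) (g m i) w\<bar>) \<longlonglongrightarrow> \<bar>NN (ew z) t w - NN (ew z) (g m i) w\<bar>"
      by (intro tendsto_intros)
    show ?thesis
    proof (rule LIMSEQ_le_const2[OF lim2], intro exI[of _ 0] allI impI)
      fix p show "\<bar>NN (ew z) (f m i p (l p)) w - NN (ew z) (g m i) w\<bar> \<le> eta j / 4"
        using v z i l_le unfolding V_def by blast
    qed
  qed
  have grid: "\<exists>i\<le>m. t \<in> {g m i..g m (Suc i)}" if t: "t \<in> {0..S}" for t m
  proof (cases "t = S")
    case True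
    then show ?thesis by (intro exI[of _ m]) (use S in \<open>auto simp: g_def field_simps\<close>)
  next
    case False
    define z where "z = t / S * real (Suc m)"
    have "t / S * real (Suc m) < 1 * real (Suc m)" by (rule mult_strict_right_mono) (use t S False in auto)
    then have z: "0 \<le> z" "z < real (Suc m)" using t S by (simp_all add: z_def)
    define i where "i = nat \<lfloor>z\<rfloor>"
    have i: "real i \<le> z" "z < real i + 1" using z unfolding i_def by linarith+
    have tz: "t = S * (z / real (Suc m))" using S by (simp add: z_def)
    have "g m i \<le> t" unfolding g_def tz using i S by (intro mult_left_mono divide_right_mono) auto
    moreover have "t \<le> g m (Suc i)" unfolding g_def tz using i S by (intro mult_left_mono divide_right_mono) auto
    moreover have "i \<le> m" using i z by linarith
    ultimately show ?thesis by auto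
  qed
  have ex: "\<exists>m. V j m w" if r: "reg w" for j w
  proof -
    have "\<exists>d>0. \<forall>z\<in>F. \<forall>s\<in>{0..S}. \<forall>t\<in>{0..S}. \<bar>t - s\<bar> < d \<longrightarrow> \<bar>NN (ew z) t w - NN (ew z) s w\<bar> \<le> eta j / 4"
      if "finite F" for F
      using that
    proof (induction rule: finite_induct)
      case empty
      show ?case by (intro exI[of _ 1]) auto
    next
      case (insert z F)
      then obtain d1 where d1: "0 < d1" "\<And>z s t. z \<in> F \<Longrightarrow> s \<in> {0..S} \<Longrightarrow> t \<in> {0..S} \<Longrightarrow> \<bar>t - s\<bar> < d1 \<Longrightarrow> \<bar>NN (ew z) t w - NN (ew z) s w\<bar> \<le> eta j / 4"
        by blast
      have "uniformly_continuous_on {0..S} (\<lambda>t. NN (ew z) t w)"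
        by (rule compact_uniformly_continuous[OF continuous_on_subset[OF NN_continuous[OF r]]]) auto
      moreover have "0 < eta j / 4" using eta_pos[of j] by simp
      ultimately obtain d2 where d2: "0 < d2" "\<And>s t. s \<in> {0..S} \<Longrightarrow> t \<in> {0..S} \<Longrightarrow> dist t s < d2 \<Longrightarrow> dist (NN (ew z) t w) (NN (ew z) s w) < eta j / 4"
        unfolding uniformly_continuous_on_def by blast
      show ?case
      proof (intro exI[of _ "min d1 d2"] conjI ballI impI)
        fix \<xi> s t assume a: "\<xi> \<in> insert z F" "s \<in> {0..S}" "t \<in> {0..S}" "\<bar>t - s\<bar> < min d1 d2"
        show "\<bar>NN (ew \<xi>) t w - NN (ew \<xi>) s w\<bar> \<le> eta j / 4"
        proof (cases "\<xi> = z")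
          case True
          then show ?thesis using d2(2)[OF a(2,3)] a(4) by (simp add: dist_real_def)
        next
          case False
          then show ?thesis using d1(2)[OF _ a(2,3)] a by simp
        qed
      qed (use d1 d2 in simp)
    qed
    from this[OF finite_E[of j]]
    obtain d where d: "0 < d" "\<And>z s t. z \<in> E j \<Longrightarrow> s \<in> {0..S} \<Longrightarrow> t \<in> {0..S} \<Longrightarrow> \<bar>t - s\<bar> < d \<Longrightarrow> \<bar>NN (ew z) t w - NN (ew z) s w\<bar> \<le> eta j / 4"
      by blast
    obtain m :: nat where m: "S / d < real m" using reals_Archimedean2 by blast
    have "V j m w"
      unfolding V_def
    proof (intro ballI allI)
      fix z i p l assume a: "z \<in> E j" "i \<in> {..m}" "l \<in> {..Suc p}"
      have "real l / real (Suc p) \<le> 1" using a by simp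
      then have "\<bar>f m i p l - g m i\<bar> \<le> S * (1 / real (Suc m))"
      proof -
        assume "real l / real (Suc p) \<le> 1"
        then have "S * ((real l / real (Suc p)) / real (Suc m)) \<le> S * (1 / real (Suc m))"
          using S by (intro mult_left_mono divide_right_mono) auto
        moreover have "f m i p l - g m i = S * ((real l / real (Suc p)) / real (Suc m))"
          unfolding f_def g_def by (simp add: add_divide_distrib distrib_left)
        moreover have "0 \<le> S * ((real l / real (Suc p)) / real (Suc m))" using S by simp
        ultimately show ?thesis by linarith
      qed
      also have "\<dots> < d"
      proof -
        have "S < real m * d" using m d(1) by (simp add: field_simps)
        also have "\<dots> \<le> real (Suc m) * d" using d(1) by simp
        finally show ?thesis using pos_divide_less_eq[of "real (Suc m)" S d] by (simp add: mult.commute del: of_nat_Suc)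
      qed
      finally show "\<bar>NN (ew z) (f m i p l) w - NN (ew z) (g m i) w\<bar> \<le> eta j / 4"
        using a f[of i m l p] g[of i m] by (intro d(2)) auto
    qed
    then show ?thesis ..
  qed
  have WA: "w \<in> A" if w: "w \<in> W" for w
  proof -
    have r: "reg w" "S < \<tau> w" "w \<in> space M" using w by (auto simp: W_def reg_def)
    have "\<exists>m. V j m w \<and> (\<exists>q\<in>Q j m. w \<in> N j m q)" for j
    proof -
      obtain m where m: "V j m w" using ex[OF r(1)] by blast
      have "\<exists>q. q \<in> \<rat> \<and> \<bar>y m \<kappa> w - q\<bar> < eta j / 8" for \<kappa>
      proof -
        obtain q where "q \<in> \<rat>" "y m \<kappa> w < q" "q < y m \<kappa> w + eta j / 8"
          using Rats_dense_in_real[of "y m \<kappa> w" "y m \<kappa> w + eta j / 8"] eta_pos[of j] by auto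
        then show ?thesis by (intro exI[of _ q]) auto
      qed
      then obtain q where q: "\<And>\<kappa>. q \<kappa> \<in> \<rat>" "\<And>\<kappa>. \<bar>y m \<kappa> w - q \<kappa>\<bar> < eta j / 8" by metis
      have n: "w \<in> N j m (restrict q (K j m))" unfolding N_def using q r by simp
      then have "restrict q (K j m) \<in> Q j m" unfolding Q_def using q w m by (auto simp del: restrict_apply)
      then show ?thesis using m n by blast
    qed
    then show ?thesis using r by (simp add: A_def)
  qed
  have A\<tau>: "S < \<tau> w" if "w \<in> A" for w
    using that unfolding A_def by blast
  have AW: "close_to S \<rho> (path_at (XX w)) u" if a: "w \<in> A" and r: "reg w" for w
  proof -
    note \<tau> = A\<tau>[OF a]
    \<comment> \<open>A shared rational vector puts the two records within
      \<open>2 * eta j / 8\<close> of each other; the two oscillations add at most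
      \<open>2 * eta j / 4\<close>, and the total stays below \<open>eta j\<close>.\<close>
    have "\<exists>w'. w' \<in> W \<and> (\<forall>z\<in>E j. \<bar>e z \<bullet> (U0 w - U0 w')\<bar> \<le> eta j \<and> (\<forall>t\<in>{0..S}. \<bar>NN (ew z) t w - NN (ew z) t w'\<bar> \<le> eta j))" for j
    proof -
      obtain m q where m: "V j m w" "q \<in> Q j m" "w \<in> N j m q" using a unfolding A_def by blast
      obtain w' where w: "w' \<in> W" "V j m w'" "w' \<in> N j m q" using m(2) unfolding Q_def by blast
      have r': "reg w'" using w(1) by (simp add: W_def)
      have yy: "\<bar>y m \<kappa> w - y m \<kappa> w'\<bar> < eta j / 4" if "\<kappa> \<in> K j m" for \<kappa>
      proof -
        have "\<bar>y m \<kappa> w - q \<kappa>\<bar> < eta j / 8" "\<bar>y m \<kappa> w' - q \<kappa>\<bar> < eta j / 8" using m(3) w(3) that by (auto simp: N_def)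
        then show ?thesis by linarith
      qed
      show ?thesis
      proof (intro exI[of _ w'] conjI ballI w(1))
        fix z assume z: "z \<in> E j"
        have "\<bar>y m (Inl z) w - y m (Inl z) w'\<bar> < eta j / 4" by (rule yy) (use z in \<open>simp add: K_def\<close>)
        then show "\<bar>e z \<bullet> (U0 w - U0 w')\<bar> \<le> eta j" using eta_pos[of j] by (simp add: y_def inner_diff_right)
        fix t assume t: "t \<in> {0..S}"
        obtain i where i: "i \<le> m" "t \<in> {g m i..g m (Suc i)}" using grid[OF t, of m] by blast
        have "\<bar>y m (Inr (z, i)) w - y m (Inr (z, i)) w'\<bar> < eta j / 4" by (rule yy) (use z i in \<open>auto simp: K_def\<close>)
        then have 1: "\<bar>NN (ew z) (g m i) w - NN (ew z) (g m i) w'\<bar> < eta j / 4" by (simp add: y_def)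
        show "\<bar>NN (ew z) t w - NN (ew z) t w'\<bar> \<le> eta j"
          using 1 osc[OF r m(1) z i] osc[OF r' w(2) z i] eta_pos[of j] by linarith
      qed
    qed
    then obtain w' where w: "\<And>j. w' j \<in> W" "\<And>j z. z \<in> E j \<Longrightarrow> \<bar>e z \<bullet> (U0 w - U0 (w' j))\<bar> \<le> eta j"
      "\<And>j z t. z \<in> E j \<Longrightarrow> t \<in> {0..S} \<Longrightarrow> \<bar>NN (ew z) t w - NN (ew z) t (w' j)\<bar> \<le> eta j" by metis
    have S0: "0 \<le> S" using S by simp
    have wr: "reg (w' j)" "S < \<tau> (w' j)" "close_to S \<rho> (path_at (XX (w' j))) u" for j using w(1)[of j] by (auto simp: W_def)
    show ?thesis
      by (rule solution_limit_close[where y="\<lambda>j. path_at (XX (w' j))" and V="\<lambda>j. U0 (w' j)" and h="\<lambda>j z t. NN (ew z) t (w' j)"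
          and g="\<lambda>z t. NN (ew z) t w" and U="U0 w", OF reg_good[OF r S0 \<tau>] reg_solves[OF r \<tau> S0] u S0
            reg_good[OF wr(1) S0 wr(2)] reg_solves[OF wr(1,2) S0] wr(3) w(2,3)])
  qed
  show ?thesis
  proof (rule bexI[OF _ Am], intro allI impI)
    fix w assume "reg w"
    then show "w \<in> A \<longleftrightarrow> S < \<tau> w \<and> close_to S \<rho> (path_at (XX w)) u"
      using WA[of w] AW[of w] A\<tau>[of w] unfolding W_def by blast
  qed
qed

section \<open>Forced exit and tail bounds for the tested noise\<close>

lemma reg_exit:
  assumes r: "reg w" and s: "0 \<le> s" "s \<le> t" and z: "freq z = axis 1 c" "0 < c"
    and big: "2 * K / c + c * K * (t - s) + 6 * K\<^sup>2 * (t - s) < \<bar>NN (fw z) t w - NN (fw z) s w\<bar>"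
  shows "min (exit_time e k T K (XX w)) (ereal (\<tau> w)) \<le> ereal t"
proof (rule ccontr)
  assume "\<not> ?thesis"
  then have *: "ereal t < exit_time e k T K (XX w)" "t < \<tau> w" by (auto simp: not_le)
  have t: "0 \<le> t" using s by simp
  have "\<bar>NN (fw z) t w - NN (fw z) s w\<bar> \<le> 2 * K / c + c * K * (t - s) + 6 * K\<^sup>2 * (t - s)"
  proof (rule spike[OF reg_good[OF r t *(2)] s z])
    fix r assume r: "r \<in> {0..t}"
    have "ereal r \<le> ereal t" using r by simp
    then have "ereal r < exit_time e k T K (XX w)" using *(1) by (rule order.strict_trans1)
    then have "sn 1 (restrict (U w) {0..<\<tau> w} r) < K"
      by (rule exit_time_gt[OF path_of_def]) (use r *(2) in auto)
    then show "sn 1 (path_at (XX w) r) \<le> K" by (simp add: path_of_def)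
  next
    fix q assume "q = s \<or> q = t"
    then have "0 \<le> q" "q < \<tau> w" using s *(2) by auto
    then show "path_at (XX w) q \<bullet> field_of (fw z) + (LINT s:{0..q}|lebesgue. stokes (path_at (XX w) s) \<bullet> field_of (fw z)) =
        U0 w \<bullet> field_of (fw z) - (LINT s:{0..q}|lebesgue. advection (path_at (XX w) s) (fw z)) + NN (fw z) q w"
      by (rule reg_equation[OF r fw_df])
  qed
  then show False using big by linarith
qed

text \<open>Over a time 1/c^2 the Brownian increment has standard deviation 1/c and its coefficient
  is at least \<open>sqrt \<epsilon> * c / 2\<close>, so the normalised threshold x is at most 2 K /
  sqrt \<epsilon>. Independence of the past gives the product.\<close>

lemma spike_probability:
  assumes A: "A \<in> sets (\<F> s)" and s: "0 \<le> s" and z: "freq z = axis 1 c" "0 < c" and K: "0 \<le> K"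
    and Q: "1 / 2 \<le> sqrtQ k \<beta> \<delta> z"
  shows "prob A * (exp (- 4 * K\<^sup>2 / \<epsilon>) * (exp (- 1) / sqrt (2 * pi)))
     \<le> prob (A \<inter> {w \<in> space M. K < \<bar>NN (fw z) (s + 1 / c\<^sup>2) w - NN (fw z) s w\<bar>})"
proof -
  define t where "t = s + 1 / c\<^sup>2"
  have t: "s < t" using z by (simp add: t_def)
  define b where "b = sqrt \<epsilon> * (c * sqrtQ k \<beta> \<delta> z)"
  have b: "sqrt \<epsilon> * (c / 2) \<le> b" "0 < b"
  proof -
    have "c * (1 / 2) \<le> c * sqrtQ k \<beta> \<delta> z" by (rule mult_left_mono[OF Q]) (use z in simp)
    then show "sqrt \<epsilon> * (c / 2) \<le> b" unfolding b_def using eps by (intro mult_left_mono) auto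
    then show "0 < b" using eps z by (smt (verit) divide_pos_pos mult_pos_pos real_sqrt_gt_zero)
  qed
  have NNb: "NN (fw z) t w - NN (fw z) s w = b * (B z 1 t w - B z 1 s w)" for w
    unfolding NN_def noise_term_fw[OF z(1)] b_def by (simp add: algebra_simps)
  define D where "D = {x :: real. K / b < \<bar>x\<bar>}"
  have D: "D \<in> sets borel" unfolding D_def by measurable
  define G where "G = {w \<in> space M. B z 1 t w - B z 1 s w \<in> D}"
  have G: "{w \<in> space M. K < \<bar>NN (fw z) t w - NN (fw z) s w\<bar>} = G"
    unfolding NNb G_def D_def abs_mult using b(2) by (auto simp: field_simps)
  have sb: "standard_brownian M (B z 1)" using noise by (simp add: white_noise_def)
  have ts: "sqrt (t - s) = 1 / c" using z(2) by (simp add: t_def real_sqrt_divide)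
  have "exp (- 4 * K\<^sup>2 / \<epsilon>) * (exp (- 1) / sqrt (2 * pi)) \<le> exp (- (K / b / sqrt (t - s) + 1)\<^sup>2 / 2) / sqrt (2 * pi)"
  proof -
    define x where "x = K / b / sqrt (t - s)"
    have "x = K * c / b" using ts z(2) by (simp add: x_def)
    also have "\<dots> \<le> K * c / (sqrt \<epsilon> * (c / 2))"
      using b K z eps by (intro divide_left_mono mult_pos_pos mult_nonneg_nonneg) auto
    also have "\<dots> = 2 * K / sqrt \<epsilon>" using z by simp
    finally have x: "x \<le> 2 * K / sqrt \<epsilon>" .
    have x0: "0 \<le> x" unfolding x_def using K b t by simp
    have "x\<^sup>2 \<le> (2 * K / sqrt \<epsilon>)\<^sup>2" by (rule power_mono[OF x x0])
    also have "\<dots> = 4 * K\<^sup>2 / \<epsilon>" using eps by (simp add: power_divide power_mult_distrib)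
    finally have x2: "x\<^sup>2 \<le> 4 * K\<^sup>2 / \<epsilon>" .
    \<comment> \<open>Used as (x + 1)^2 / 2 \<le> x^2 + 1, which is where the constant
      \<open>exp (- 1)\<close> comes from.\<close>
    have "0 \<le> (x - 1)\<^sup>2" by simp
    then have "(x + 1)\<^sup>2 / 2 \<le> x\<^sup>2 + 1" by (simp add: power2_eq_square algebra_simps)
    with x2 have "- 4 * K\<^sup>2 / \<epsilon> + - 1 \<le> - (x + 1)\<^sup>2 / 2" by simp
    then have "exp (- 4 * K\<^sup>2 / \<epsilon>) * exp (- 1) \<le> exp (- (x + 1)\<^sup>2 / 2)" unfolding exp_add[symmetric] by simp
    then have "exp (- 4 * K\<^sup>2 / \<epsilon>) * exp (- 1) / sqrt (2 * pi) \<le> exp (- (x + 1)\<^sup>2 / 2) / sqrt (2 * pi)"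
      by (rule divide_right_mono) simp
    then show ?thesis unfolding x_def by simp
  qed
  also have "\<dots> \<le> prob {w \<in> space M. K / b < \<bar>B z 1 t w - B z 1 s w\<bar>}"
    by (rule brownian_lower_tail[OF sb s t]) (use K b in simp)
  also have "\<dots> = prob G" by (simp add: G_def D_def)
  finally have "prob A * (exp (- 4 * K\<^sup>2 / \<epsilon>) * (exp (- 1) / sqrt (2 * pi))) \<le> prob A * prob G"
    by (rule mult_left_mono) simp
  also have "\<dots> = prob (A \<inter> G)"
    unfolding G_def by (rule filtration_indep_increment(2)[OF noise U0_measurable datum_indep s t D A, symmetric])
  finally show ?thesis unfolding t_def[symmetric] G .
qed

end

context plane_waves
begin

text \<open>For a finite sum to reach \<Delta>, one of its n terms must reach \<Delta>/n. The
  constants do not depend on \<delta> because \<open>sqrtQ\<close> is at most 1.\<close>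

lemma noise_upper:
  assumes M: "prob_space M" and W: "white_noise M B" and t: "0 \<le> t" and \<Delta>: "0 < \<Delta>"
  shows "\<exists>C>0. \<exists>c>0. \<forall>\<epsilon> \<delta>. 0 < \<epsilon> \<longrightarrow> 0 < \<delta> \<longrightarrow>
     measure M {w \<in> space M. \<Delta> \<le> \<bar>sqrt \<epsilon> * noise_term e k \<beta> \<delta> B (ew z) t w\<bar>} \<le> C * exp (- c / \<epsilon>)"
proof -
  interpret prob_space M by fact
  define G where "G = {z'. eigval k z' \<le> eigval k z} \<times> (UNIV :: 3 set)"
  have G: "finite G" unfolding G_def by (intro finite_cartesian_product finite_eigval) simp
  have Gne: "(z, 1) \<in> G" by (simp add: G_def)
  define n where "n = real (card G)"
  have n: "0 < n" unfolding n_def using G Gne by (auto simp: card_gt_0_iff)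
  \<comment> \<open>A common bound for the coefficients; the 1 keeps it positive.\<close>
  define d where "d = 1 + (\<Sum>(z', i)\<in>G. \<bar>de i z \<bullet> e z'\<bar>)"
  have d: "1 \<le> d" unfolding d_def by (simp add: sum_nonneg case_prod_unfold)
  have dle: "\<bar>de i z \<bullet> e z'\<bar> \<le> d" if "(z', i) \<in> G" for z' i
  proof -
    have "\<bar>de i z \<bullet> e z'\<bar> = (\<lambda>(z', i). \<bar>de i z \<bullet> e z'\<bar>) (z', i)" by simp
    also have "\<dots> \<le> (\<Sum>(z', i)\<in>G. \<bar>de i z \<bullet> e z'\<bar>)" by (rule member_le_sum[OF that]) (use G in auto)
    finally show ?thesis by (simp add: d_def)
  qed
  define c where "c = (\<Delta> / (n * d))\<^sup>2 / (4 * (t + 1))"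
  have c: "0 < c" unfolding c_def using \<Delta> n d t by simp
  show ?thesis
  proof (intro exI conjI allI impI)
    show "0 < n * sqrt 2" using n by simp
    show "0 < c" by (fact c)
    fix \<epsilon> \<delta> :: real assume eps: "0 < \<epsilon>" and del: "0 < \<delta>"
    define a where "a = \<Delta> / (n * d) / sqrt \<epsilon>"
    have a: "0 < a" unfolding a_def using \<Delta> n d eps by simp
    have Bm [measurable]: "B z i t \<in> borel_measurable M" for z i using W t by (simp add: white_noise_def standard_brownian_def)
    have "{w \<in> space M. \<Delta> \<le> \<bar>sqrt \<epsilon> * noise_term e k \<beta> \<delta> B (ew z) t w\<bar>} \<subseteq> (\<Union>p\<in>G. {w \<in> space M. a \<le> \<bar>B (fst p) (snd p) t w\<bar>})"
    proof (rule subsetI, rule ccontr)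
      fix w assume w: "w \<in> {w \<in> space M. \<Delta> \<le> \<bar>sqrt \<epsilon> * noise_term e k \<beta> \<delta> B (ew z) t w\<bar>}"
        and "w \<notin> (\<Union>p\<in>G. {w \<in> space M. a \<le> \<bar>B (fst p) (snd p) t w\<bar>})"
      then have lt: "\<bar>B (fst p) (snd p) t w\<bar> < a" if "p \<in> G" for p using that by auto
      have tm: "\<bar>(de (snd p) z \<bullet> e (fst p)) * sqrtQ k \<beta> \<delta> (fst p) * B (fst p) (snd p) t w\<bar> < d * a" if p: "p \<in> G" for p
      proof -
        have "\<bar>de (snd p) z \<bullet> e (fst p)\<bar> * \<bar>sqrtQ k \<beta> \<delta> (fst p)\<bar> \<le> d * 1"
          using dle[of "fst p" "snd p"] p sqrtQ_le_1[OF del, of k \<beta> "fst p"] d by (intro mult_mono) auto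
        then have "\<bar>de (snd p) z \<bullet> e (fst p)\<bar> * \<bar>sqrtQ k \<beta> \<delta> (fst p)\<bar> * \<bar>B (fst p) (snd p) t w\<bar> \<le> d * \<bar>B (fst p) (snd p) t w\<bar>"
          by (intro mult_right_mono) auto
        also have "\<dots> < d * a" using lt[OF p] d by simp
        finally show ?thesis by (simp add: abs_mult)
      qed
      have "\<bar>noise_term e k \<beta> \<delta> B (ew z) t w\<bar> \<le> (\<Sum>p\<in>G. \<bar>(de (snd p) z \<bullet> e (fst p)) * sqrtQ k \<beta> \<delta> (fst p) * B (fst p) (snd p) t w\<bar>)"
        unfolding noise_term_ew G_def[symmetric] case_prod_unfold by (rule sum_abs)
      also have "\<dots> < (\<Sum>p\<in>G. d * a)" by (rule sum_strict_mono[OF G]) (use Gne tm in auto)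
      also have "\<dots> = n * (d * a)" by (simp add: n_def)
      finally have "\<bar>sqrt \<epsilon> * noise_term e k \<beta> \<delta> B (ew z) t w\<bar> < sqrt \<epsilon> * (n * (d * a))"
        unfolding abs_mult using eps by simp
      also have "\<dots> = \<Delta>" using eps n d by (simp add: a_def)
      finally show False using w by simp
    qed
    then have "prob {w \<in> space M. \<Delta> \<le> \<bar>sqrt \<epsilon> * noise_term e k \<beta> \<delta> B (ew z) t w\<bar>}
       \<le> prob (\<Union>p\<in>G. {w \<in> space M. a \<le> \<bar>B (fst p) (snd p) t w\<bar>})"
    proof (rule finite_measure_mono)
      show "(\<Union>p\<in>G. {w \<in> space M. a \<le> \<bar>B (fst p) (snd p) t w\<bar>}) \<in> events"
        by (intro sets.finite_UN G) measurable
    qed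
    also have "\<dots> \<le> (\<Sum>p\<in>G. prob {w \<in> space M. a \<le> \<bar>B (fst p) (snd p) t w\<bar>})"
      by (rule finite_measure_subadditive_finite[OF G]) (auto intro: measurable_sets)
    also have "\<dots> \<le> (\<Sum>p\<in>G. sqrt 2 * exp (- a\<^sup>2 / (4 * (t + 1))))"
      using W t by (intro sum_mono brownian_upper_tail a) (auto simp: white_noise_def)
    also have "\<dots> = n * sqrt 2 * exp (- c / \<epsilon>)"
    proof -
      have "a\<^sup>2 / (4 * (t + 1)) = c / \<epsilon>" using eps by (simp add: a_def c_def power_divide power_mult_distrib)
      then show ?thesis by (simp add: n_def)
    qed
    finally show "prob {w \<in> space M. \<Delta> \<le> \<bar>sqrt \<epsilon> * noise_term e k \<beta> \<delta> B (ew z) t w\<bar>} \<le> n * sqrt 2 * exp (- c / \<epsilon>)" .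
  qed
qed

end

section \<open>Logarithmic asymptotics\<close>

lemma eventually_pos: "eventually (\<lambda>\<epsilon>::real. 0 < \<epsilon>) (at_right 0)"
  by (simp add: eventually_at_right_less)

text \<open>Losing the factor exp (- a) \<gamma> in probability costs (a - ln \<gamma>) / r on the
  logarithmic scale.\<close>

lemma scaled_log_prob_mono_perturbed:
  assumes r: "0 < r" and e: "0 < e" and p: "0 \<le> p" and q: "0 \<le> q" and \<gamma>: "0 < \<gamma>"
    and le: "q * (exp (- a) * \<gamma>) \<le> p" and err: "a / r \<le> e / 2" "- ln \<gamma> / r \<le> e / 2"
  shows "ereal (inverse r) * log_prob q \<le> ereal (inverse r) * log_prob p + ereal e"
proof (cases "q = 0")
  case True
  then show ?thesis using r by (simp add: log_prob_def)
next
  case False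
  then have q: "0 < q" using q by simp
  have "0 < q * (exp (- a) * \<gamma>)" using q \<gamma> by simp
  then have p: "0 < p" using le by linarith
  have "ln (q * (exp (- a) * \<gamma>)) \<le> ln p" using le p q \<gamma> by simp
  then have "ln q + (- a + ln \<gamma>) \<le> ln p" using q \<gamma> by (simp add: ln_mult)
  then have "ln q / r \<le> (ln p + a - ln \<gamma>) / r" using r by (intro divide_right_mono) auto
  also have "\<dots> = ln p / r + a / r + - ln \<gamma> / r" by (simp add: add_divide_distrib diff_divide_distrib)
  also have "\<dots> \<le> ln p / r + e" using err by linarith
  finally show ?thesis using p q by (simp add: log_prob_def divide_inverse mult.commute)
qed

text \<open>As \<epsilon> r stays above c, the loss exp (- \<eta>/\<epsilon>) costs at most \<eta>/c
  on the scale r, and the constant \<gamma> costs nothing in the limit; \<eta> is arbitrary.\<close>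

lemma Liminf_log_prob_le:
  fixes r p q :: "real \<Rightarrow> real"
  assumes r: "\<And>\<epsilon>. 0 < \<epsilon> \<Longrightarrow> 0 < r \<epsilon>" and r_lim: "filterlim r at_top (at_right 0)"
    and c: "0 < c" "\<And>\<epsilon>. 0 < \<epsilon> \<Longrightarrow> c \<le> \<epsilon> * r \<epsilon>"
    and p: "\<And>\<epsilon>. 0 \<le> p \<epsilon>" and q: "\<And>\<epsilon>. 0 \<le> q \<epsilon>"
    and le: "\<And>\<eta>. 0 < \<eta> \<Longrightarrow> \<exists>\<gamma>>0. eventually (\<lambda>\<epsilon>. q \<epsilon> * (exp (- (\<eta> / \<epsilon>)) * \<gamma>) \<le> p \<epsilon>) (at_right 0)"
  shows "Liminf (at_right 0) (\<lambda>\<epsilon>. ereal (inverse (r \<epsilon>)) * log_prob (q \<epsilon>))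
     \<le> Liminf (at_right 0) (\<lambda>\<epsilon>. ereal (inverse (r \<epsilon>)) * log_prob (p \<epsilon>))"
proof (rule ereal_le_epsilon2)
  fix x :: real assume x: "0 < x"
  define \<eta> where "\<eta> = c * x / 2"
  have \<eta>: "0 < \<eta>" using c x by (simp add: \<eta>_def)
  obtain \<gamma> where \<gamma>: "0 < \<gamma>" "eventually (\<lambda>\<epsilon>. q \<epsilon> * (exp (- (\<eta> / \<epsilon>)) * \<gamma>) \<le> p \<epsilon>) (at_right 0)" using le[OF \<eta>] by blast
  have "eventually (\<lambda>\<epsilon>. - ln \<gamma> * 2 / x \<le> r \<epsilon>) (at_right 0)" using r_lim unfolding filterlim_at_top by blast
  moreover note eventually_pos
  ultimately have "eventually (\<lambda>\<epsilon>. ereal (inverse (r \<epsilon>)) * log_prob (q \<epsilon>) \<le> ereal (inverse (r \<epsilon>)) * log_prob (p \<epsilon>) + ereal x) (at_right 0)"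
    using \<gamma>(2)
  proof eventually_elim
    case (elim \<epsilon>)
    have "\<eta> / \<epsilon> / r \<epsilon> = \<eta> / (\<epsilon> * r \<epsilon>)" by simp
    also have "\<dots> \<le> \<eta> / c" using c(1) c(2)[OF elim(2)] \<eta> by (intro divide_left_mono) auto
    also have "\<dots> = x / 2" using c by (simp add: \<eta>_def)
    finally have 1: "\<eta> / \<epsilon> / r \<epsilon> \<le> x / 2" .
    have 2: "- ln \<gamma> / r \<epsilon> \<le> x / 2" using elim(1) x r[OF elim(2)] by (simp add: field_simps)
    show ?case by (rule scaled_log_prob_mono_perturbed[OF r[OF elim(2)] x p q \<gamma>(1) elim(3) 1 2])
  qed
  then have "Liminf (at_right 0) (\<lambda>\<epsilon>. ereal (inverse (r \<epsilon>)) * log_prob (q \<epsilon>))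
     \<le> Liminf (at_right 0) (\<lambda>\<epsilon>. ereal (inverse (r \<epsilon>)) * log_prob (p \<epsilon>) + ereal x)" by (rule Liminf_mono)
  also have "\<dots> = Liminf (at_right 0) (\<lambda>\<epsilon>. ereal (inverse (r \<epsilon>)) * log_prob (p \<epsilon>)) + ereal x"
    by (rule Liminf_add_ereal_right) auto
  finally show "Liminf (at_right 0) (\<lambda>\<epsilon>. ereal (inverse (r \<epsilon>)) * log_prob (q \<epsilon>))
     \<le> Liminf (at_right 0) (\<lambda>\<epsilon>. ereal (inverse (r \<epsilon>)) * log_prob (p \<epsilon>)) + ereal x" .
qed

text \<open>Here b/(\<epsilon> r) tends to infinity, so an exponential bound on the scale
  1/\<epsilon> is super-exponential on the scale r.\<close>

lemma Limsup_log_prob_exp: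
  fixes r p :: "real \<Rightarrow> real"
  assumes r: "\<And>\<epsilon>. 0 < \<epsilon> \<Longrightarrow> 0 < r \<epsilon>" and r_lim: "filterlim r at_top (at_right 0)"
    and er: "((\<lambda>\<epsilon>. \<epsilon> * r \<epsilon>) \<longlongrightarrow> 0) (at_right 0)"
    and p: "\<And>\<epsilon>. 0 \<le> p \<epsilon>" and C: "0 < C" and b: "0 < b"
    and le: "eventually (\<lambda>\<epsilon>. p \<epsilon> \<le> C * exp (- (b / \<epsilon>))) (at_right 0)"
  shows "Limsup (at_right 0) (\<lambda>\<epsilon>. ereal (inverse (r \<epsilon>)) * log_prob (p \<epsilon>)) = -\<infinity>"
proof (rule ereal_bot)
  fix m :: real
  define m' where "m' = 1 + \<bar>m\<bar>"
  have m': "0 < m'" by (simp add: m'_def)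
  have "eventually (\<lambda>\<epsilon>. ln C \<le> r \<epsilon>) (at_right 0)" using r_lim unfolding filterlim_at_top by blast
  moreover have "eventually (\<lambda>\<epsilon>. \<epsilon> * r \<epsilon> < b / m') (at_right 0)"
    by (rule order_tendstoD(2)[OF er]) (use b m' in simp)
  moreover note eventually_pos
  ultimately have "eventually (\<lambda>\<epsilon>. ereal (inverse (r \<epsilon>)) * log_prob (p \<epsilon>) \<le> ereal m) (at_right 0)"
    using le
  proof eventually_elim
    case (elim \<epsilon>)
    note r = r[OF elim(3)]
    show ?case
    proof (cases "p \<epsilon> = 0")
      case True
      then show ?thesis using r by (simp add: log_prob_def)
    next
      case False
      then have p: "0 < p \<epsilon>" using p[of \<epsilon>] by simp
      have "ln (p \<epsilon>) \<le> ln (C * exp (- (b / \<epsilon>)))" using elim(4) p C by simp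
      also have "\<dots> = ln C - b / \<epsilon>" using C by (simp add: ln_mult)
      finally have "ln (p \<epsilon>) / r \<epsilon> \<le> (ln C - b / \<epsilon>) / r \<epsilon>" using r by (intro divide_right_mono) auto
      also have "\<dots> = ln C / r \<epsilon> - b / (\<epsilon> * r \<epsilon>)" by (simp add: diff_divide_distrib)
      also have "\<dots> \<le> 1 - m'"
      proof -
        have "ln C / r \<epsilon> \<le> 1" using elim(1) r by simp
        moreover have "m' \<le> b / (\<epsilon> * r \<epsilon>)" using elim(2,3) r m' by (simp add: field_simps)
        ultimately show ?thesis by linarith
      qed
      also have "\<dots> \<le> m" by (simp add: m'_def)
      finally show ?thesis using p by (simp add: log_prob_def divide_inverse mult.commute)
    qed
  qed
  then show "Limsup (at_right 0) (\<lambda>\<epsilon>. ereal (inverse (r \<epsilon>)) * log_prob (p \<epsilon>)) \<le> ereal m" by (rule Limsup_bounded)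
qed

section \<open>Weak topology and rate function\<close>

lemma topspace_weak_topology: "topspace weak_topology = df_space"
proof -
  have "0 \<in> df_space" unfolding df_space_def by (metis closure_subset df_space_def subsetD subspace_0 subspace_df_space)
  then have "{h \<in> df_space. h \<bullet> 0 \<in> (UNIV :: real set)} \<in> {{h \<in> df_space. h \<bullet> g \<in> G} | g G. g \<in> df_space \<and> open G}" by blast
  then show ?thesis unfolding weak_topology_def topology_generated_by_topspace by auto
qed

lemma openin_weak_halfspace: "g \<in> df_space \<Longrightarrow> open G \<Longrightarrow> openin weak_topology {h \<in> df_space. h \<bullet> g \<in> G}"
  unfolding weak_topology_def by (rule topology_generated_by_Basis) blast

text \<open>Complements of the sublevel sets at 1/(n+1) cover the compact set
  \<open>F \<inter> L 1\<close>, and a finite subcover leaves a positive level.\<close>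

lemma rate_function_positive:
  assumes rate: "good_rate_function X I" and F: "closedin X F" and pos: "\<And>x. x \<in> F \<Longrightarrow> I x \<noteq> 0"
  shows "\<exists>a::real>0. \<forall>x\<in>F. ereal a \<le> I x"
proof -
  define L where "L a = {x \<in> topspace X. I x \<le> ereal a}" for a :: real
  have L: "closedin X (L a)" "compactin X (L a)" for a using rate by (auto simp: good_rate_function_def L_def)
  have FX: "F \<subseteq> topspace X" using F by (rule closedin_subset)
  have comp: "compactin X (F \<inter> L 1)" by (rule closed_Int_compactin[OF F L(2)])
  define \<U> where "\<U> = range (\<lambda>n. topspace X - L (1 / real (Suc n)))"
  have "F \<inter> L 1 \<subseteq> \<Union>\<U>"
  proof
    fix x assume x: "x \<in> F \<inter> L 1"
    then have xX: "x \<in> topspace X" using FX by auto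
    then have "0 < I x" using rate pos[of x] x unfolding good_rate_function_def by (metis IntD1 antisym_conv1)
    then obtain y :: real where y: "0 < y" "ereal y < I x" using ereal_dense2[of 0 "I x"] by (metis ereal_less(2))
    obtain n where n: "1 / real (Suc n) < y" using nat_approx_posE[OF y(1)] .
    have "ereal (1 / real (Suc n)) \<le> ereal y" using n by simp
    then have "\<not> I x \<le> ereal (1 / real (Suc n))" using y(2) by (metis leD order.trans)
    then show "x \<in> \<Union>\<U>" using xX unfolding \<U>_def L_def by blast
  qed
  moreover have "\<And>V. V \<in> \<U> \<Longrightarrow> openin X V" using L(1) unfolding \<U>_def by auto
  ultimately obtain \<V> where V: "finite \<V>" "\<V> \<subseteq> \<U>" "F \<inter> L 1 \<subseteq> \<Union>\<V>" using compactinD[OF comp] by metis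
  obtain N where N: "finite N" "\<V> = (\<lambda>n. topspace X - L (1 / real (Suc n))) ` N"
    using finite_subset_image[OF V(1) V(2)[unfolded \<U>_def]] by blast
  define n where "n = Max (insert 0 N)"
  show ?thesis
  proof (intro exI conjI ballI)
    show "0 < 1 / real (Suc n)" by simp
    fix x assume x: "x \<in> F"
    show "ereal (1 / real (Suc n)) \<le> I x"
    proof (cases "x \<in> L 1")
      case True
      then obtain i where i: "i \<in> N" "x \<notin> L (1 / real (Suc i))" using V(3) x N by auto
      then have "ereal (1 / real (Suc i)) \<le> I x" using x FX by (auto simp: L_def not_le intro: less_imp_le)
      moreover have "i \<le> n" unfolding n_def using i N by (intro Max_ge) auto
      then have "ereal (1 / real (Suc n)) \<le> ereal (1 / real (Suc i))" by (simp add: frac_le)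
      ultimately show ?thesis by (rule order.trans[rotated])
    next
      case False
      then have "ereal 1 < I x" using x FX by (auto simp: L_def not_le)
      moreover have "ereal (1 / real (Suc n)) \<le> ereal 1" by simp
      ultimately show ?thesis by (metis order.trans less_imp_le)
    qed
  qed
qed

context plane_waves
begin

lemma close_to_cong:
  assumes "\<And>s. s \<in> {0..t} \<Longrightarrow> x s = x' s"
  shows "close_to t \<rho> y x \<longleftrightarrow> close_to t \<rho> y x'"
proof -
  have "(\<lambda>s. indicator {0..t} s *\<^sub>R (sn 2 (y s - x s))\<^sup>2) = (\<lambda>s. indicator {0..t} s *\<^sub>R (sn 2 (y s - x' s))\<^sup>2)"
  proof
    fix s show "indicator {0..t} s *\<^sub>R (sn 2 (y s - x s))\<^sup>2 = indicator {0..t} s *\<^sub>R (sn 2 (y s - x' s))\<^sup>2"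
      by (cases "s \<in> {0..t}") (simp_all add: assms)
  qed
  then show ?thesis unfolding close_to_def L2H2_norm_def set_lebesgue_integral_def using assms by simp
qed

lemma lifetime_pos: "v \<in> Xst_loc e k T \<Longrightarrow> v \<noteq> Star \<Longrightarrow> 0 < lifetime v"
  by (auto simp: Xst_loc_def)

lemma ball_around:
  assumes "v \<in> Xst_loc e k T" "v \<noteq> Star" "0 < S" "S < lifetime v" "0 < \<rho>"
  shows "Xst_open e k T (pball T (path_at v) S \<rho>)" "v \<in> pball T (path_at v) S \<rho>"
proof -
  show "Xst_open e k T (pball T (path_at v) S \<rho>)"
    by (rule pball_open[OF path_good[OF assms(1)] assms(3)]) (use assms in auto)
  have "close_to S (\<rho> / 2) (path_at v) (path_at v)" by (rule close_to_refl) (use assms in simp)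
  then show "v \<in> pball T (path_at v) S \<rho>"
    unfolding pball_def using assms by (auto intro!: exI[of _ "\<rho> / 2"])
qed

lemma Xst_open_Xst_loc: "Xst_open e k T (Xst_loc e k T)"
  unfolding Xst_open_def
proof (intro conjI ballI order_refl)
  fix u assume u: "u \<in> Xst_loc e k T"
  show "\<exists>N\<in>Xst_base e k T u. N \<subseteq> Xst_loc e k T"
  proof (cases "u = Star")
    case True
    then have "{v \<in> Xst_loc e k T. min (ereal (lifetime v)) (exit_time e k T 1 v) < ereal 1} \<in> Xst_base e k T u"
      unfolding Xst_base_def by (auto intro!: exI[of _ "1::real"])
    then show ?thesis by (rule rev_bexI) blast
  next
    case False
    note p = lifetime_pos[OF u False]
    note b = ball_around[OF u False, of "lifetime u / 2" 1]
    have "Xst_open e k T (pball T (path_at u) (lifetime u / 2) 1)" "u \<in> pball T (path_at u) (lifetime u / 2) 1"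
      using b p by auto
    then show ?thesis unfolding Xst_open_def by blast
  qed
qed

text \<open>All error terms are O(1/c) for c \<ge> 1, and L is the sum of their constants. Waves of
  frequency 2 \<pi> n along the first axis exist because the multiplicity there is 2.\<close>

lemma wave_high_frequency:
  assumes "0 \<le> K" "0 < \<kappa>" "0 < \<eta>"
  shows "\<exists>z c. 0 < c \<and> freq z = axis 1 c \<and> 1 / c\<^sup>2 < \<kappa> \<and> 4 * (2 * K / c + K / c + 6 * K\<^sup>2 / c\<^sup>2)\<^sup>2 \<le> \<eta>"
proof -
  define L where "L = 3 * K + 6 * K\<^sup>2"
  have L: "0 \<le> L" using assms by (simp add: L_def)
  obtain n :: nat where n: "max 1 (max (1 / \<kappa>) (4 * L\<^sup>2 / \<eta>)) < real n" using reals_Archimedean2 by blast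
  define c where "c = 2 * pi * real n"
  have "1 * real n \<le> 2 * pi * real n" using pi_gt3 by (intro mult_right_mono) auto
  then have "real n \<le> c" by (simp add: c_def)
  moreover have "1 < real n" "1 / \<kappa> < real n" "4 * L\<^sup>2 / \<eta> < real n" using n by (simp_all only: max_less_iff_conj)
  ultimately have c: "1 < c" "1 / \<kappa> < c" "4 * L\<^sup>2 / \<eta> < c" by linarith+
  have n0: "n \<noteq> 0" using n by auto
  have "axis 1 (int n) \<noteq> (0 :: int ^ 3)" using n0 by (simp add: axis_eq_0_iff)
  then have "card {z. k z = axis 1 (int n)} = 2" using card_freq[of "axis 1 (int n)"] by simp
  then obtain z where z: "k z = axis 1 (int n)" by (metis (mono_tags, lifting) card.empty empty_Collect_eq zero_neq_numeral)
  have fr: "freq z = axis 1 c" unfolding freq_def wave_vec_def z by (simp add: vec_eq_iff axis_def c_def)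
  have cc: "c \<le> c\<^sup>2" using c by (simp add: power2_eq_square)
  have "1 / c\<^sup>2 \<le> 1 / c" using cc c by (simp add: frac_le)
  also have "\<dots> < \<kappa>" using c(1,2) assms by (simp add: field_simps)
  finally have k: "1 / c\<^sup>2 < \<kappa>" .
  have "6 * K\<^sup>2 / c\<^sup>2 \<le> 6 * K\<^sup>2 / c" using cc c by (intro divide_left_mono) auto
  then have 1: "2 * K / c + K / c + 6 * K\<^sup>2 / c\<^sup>2 \<le> L / c" unfolding L_def by (simp add: add_divide_distrib)
  have "0 \<le> 2 * K / c + K / c + 6 * K\<^sup>2 / c\<^sup>2" using assms c by simp
  then have "(2 * K / c + K / c + 6 * K\<^sup>2 / c\<^sup>2)\<^sup>2 \<le> (L / c)\<^sup>2" by (rule power_mono[OF 1])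
  also have "\<dots> = L\<^sup>2 / c\<^sup>2" by (simp add: power_divide)
  also have "\<dots> \<le> L\<^sup>2 / c" using cc c by (intro divide_left_mono) auto
  finally have "4 * (2 * K / c + K / c + 6 * K\<^sup>2 / c\<^sup>2)\<^sup>2 \<le> 4 * L\<^sup>2 / c" by simp
  also have "\<dots> \<le> \<eta>" using c assms by (simp add: field_simps)
  finally show ?thesis using fr k c by (intro exI[of _ z] exI[of _ c]) auto
qed

end

section \<open>Lower and upper bounds\<close>

locale random_family = plane_waves e k + prob_space M
  for e :: "'z \<Rightarrow> vfield" and k :: "'z \<Rightarrow> int ^ 3" and M :: "'w measure" +
  fixes B :: "'z \<Rightarrow> 3 \<Rightarrow> real \<Rightarrow> 'w \<Rightarrow> real" and \<beta> T :: real and \<delta> :: "real \<Rightarrow> real"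
    and U0 :: "real \<Rightarrow> 'w \<Rightarrow> vfield" and U :: "real \<Rightarrow> 'w \<Rightarrow> real \<Rightarrow> vfield" and \<tau> :: "real \<Rightarrow> 'w \<Rightarrow> real"
    and X :: "real \<Rightarrow> 'w \<Rightarrow> path" and r :: "real \<Rightarrow> real"
  assumes r_pos: "\<And>\<epsilon>. 0 < \<epsilon> \<Longrightarrow> 0 < r \<epsilon>" and r_lim: "filterlim r at_top (at_right 0)"
    and delta_pos: "\<And>\<epsilon>. 0 < \<epsilon> \<Longrightarrow> 0 < \<delta> \<epsilon>" and delta_lim: "(\<delta> \<longlongrightarrow> 0) (at_right 0)"
    and RS: "\<And>\<epsilon>. 0 < \<epsilon> \<Longrightarrow> random_solution e k M B \<beta> T \<epsilon> (\<delta> \<epsilon>) (U0 \<epsilon>) (U \<epsilon>) (\<tau> \<epsilon>)"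
    and X_def: "X = (\<lambda>\<epsilon> w. path_of (\<tau> \<epsilon> w) (U \<epsilon> w))"
begin

lemma X_measurable:
  assumes "0 < \<epsilon>" "Xst_open e k T \<U>" shows "{w \<in> space M. X \<epsilon> w \<in> \<U>} \<in> events"
  using random_solution.solution[OF RS[OF assms(1)]] assms(2) unfolding strong_solution_def X_def by blast

text \<open>The core of (i): after an event A of the past at time s, an independent spike within
  \<kappa> forces death or exit and hence membership in \<open>\<N>\<close>. The spike costs exp (-
  \<eta>/\<epsilon>) with \<eta> arbitrary, so it is free on the scale r.\<close>

lemma exit_liminf:
  assumes c: "0 < c" "\<And>\<epsilon>. 0 < \<epsilon> \<Longrightarrow> c \<le> \<epsilon> * r \<epsilon>"
    and s: "0 \<le> s" and \<kappa>: "0 < \<kappa>" and K: "0 < K" and N: "Xst_open e k T \<N>" and q: "\<And>\<epsilon>. 0 \<le> q \<epsilon>"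
    and A: "\<And>\<epsilon>. 0 < \<epsilon> \<Longrightarrow> \<exists>A\<in>sets (noise_filtration M B (U0 \<epsilon>) s). q \<epsilon> \<le> prob A \<and>
      (AE w in M. w \<in> A \<longrightarrow> min (exit_time e k T K (X \<epsilon> w)) (ereal (lifetime (X \<epsilon> w))) < ereal (s + \<kappa>) \<longrightarrow> X \<epsilon> w \<in> \<N>)"
  shows "Liminf (at_right 0) (\<lambda>\<epsilon>. ereal (inverse (r \<epsilon>)) * log_prob (q \<epsilon>)) \<le> Liminf (at_right 0) (scaled_log_prob M r X \<N>)"
  unfolding scaled_log_prob_def[abs_def]
proof (rule Liminf_log_prob_le[OF r_pos r_lim c])
  fix \<eta> :: real assume \<eta>: "0 < \<eta>"
  \<comment> \<open>The frequency depends on \<eta>, \<kappa> and K but not on \<epsilon>.\<close>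
  obtain z c where c: "0 < c" "freq z = axis 1 c" "1 / c\<^sup>2 < \<kappa>" "4 * (2 * K / c + K / c + 6 * K\<^sup>2 / c\<^sup>2)\<^sup>2 \<le> \<eta>"
    using wave_high_frequency[OF less_imp_le[OF K] \<kappa> \<eta>] by blast
  define L where "L = 2 * K / c + K / c + 6 * K\<^sup>2 / c\<^sup>2"
  have L: "0 \<le> L" using K c by (simp add: L_def)
  define t where "t = s + 1 / c\<^sup>2"
  have st: "s \<le> t" by (simp add: t_def)
  have Lt: "2 * K / c + c * K * (t - s) + 6 * K\<^sup>2 * (t - s) = L"
    using c(1) by (simp add: L_def t_def power2_eq_square)
  define \<gamma> where "\<gamma> = exp (- 1) / sqrt (2 * pi)"
  have \<gamma>: "0 < \<gamma>" by (simp add: \<gamma>_def)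
  have "eventually (\<lambda>\<epsilon>. 1 / 2 \<le> sqrtQ k \<beta> (\<delta> \<epsilon>) z) (at_right 0)"
    by (rule sqrtQ_eventually[OF delta_lim delta_pos])
  with eventually_pos have "eventually (\<lambda>\<epsilon>. q \<epsilon> * (exp (- (\<eta> / \<epsilon>)) * \<gamma>) \<le> prob {w \<in> space M. X \<epsilon> w \<in> \<N>}) (at_right 0)"
  proof eventually_elim
    case (elim \<epsilon>)
    interpret R: random_solution e k M B \<beta> T \<epsilon> "\<delta> \<epsilon>" "U0 \<epsilon>" "U \<epsilon>" "\<tau> \<epsilon>" by (rule RS[OF elim(1)])
    obtain A where A: "A \<in> sets (noise_filtration M B (U0 \<epsilon>) s)" "q \<epsilon> \<le> prob A"
      "AE w in M. w \<in> A \<longrightarrow> min (exit_time e k T K (X \<epsilon> w)) (ereal (lifetime (X \<epsilon> w))) < ereal (s + \<kappa>) \<longrightarrow> X \<epsilon> w \<in> \<N>"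
      using A[OF elim(1)] by blast
    define G where "G = {w \<in> space M. L < \<bar>R.NN (fw z) t w - R.NN (fw z) s w\<bar>}"
    have "4 * L\<^sup>2 / \<epsilon> \<le> \<eta> / \<epsilon>" using c(4) elim(1) by (intro divide_right_mono) (auto simp: L_def)
    then have "q \<epsilon> * (exp (- (\<eta> / \<epsilon>)) * \<gamma>) \<le> prob A * (exp (- 4 * L\<^sup>2 / \<epsilon>) * \<gamma>)"
      using \<gamma> A(2) by (intro mult_mono mult_right_mono) auto
    also have "\<dots> \<le> prob (A \<inter> G)"
      unfolding \<gamma>_def G_def t_def by (rule R.spike_probability[OF A(1) s c(2,1) L elim(2)])
    also have "\<dots> \<le> prob {w \<in> space M. X \<epsilon> w \<in> \<N>}"
    proof (rule finite_measure_mono_AE[OF _ X_measurable[OF elim(1) N]])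
      show "AE w in M. w \<in> A \<inter> G \<longrightarrow> w \<in> {w \<in> space M. X \<epsilon> w \<in> \<N>}"
        using A(3) R.AE_reg
      proof eventually_elim
        case (elim w)
        show ?case
        proof
          assume a: "w \<in> A \<inter> G"
          have "min (exit_time e k T K (X \<epsilon> w)) (ereal (\<tau> \<epsilon> w)) \<le> ereal t"
            unfolding X_def by (rule R.reg_exit[OF elim(2) s st c(2,1)]) (use a in \<open>simp add: Lt G_def\<close>)
          also have "ereal t < ereal (s + \<kappa>)" using c(3) by (simp add: t_def)
          finally have "min (exit_time e k T K (X \<epsilon> w)) (ereal (lifetime (X \<epsilon> w))) < ereal (s + \<kappa>)"
            by (simp add: X_def)
          then show "w \<in> {w \<in> space M. X \<epsilon> w \<in> \<N>}" using elim a by (simp add: G_def)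
        qed
      qed
    qed
    finally show ?case .
  qed
  then show "\<exists>\<gamma>>0. eventually (\<lambda>\<epsilon>. q \<epsilon> * (exp (- (\<eta> / \<epsilon>)) * \<gamma>) \<le> prob {w \<in> space M. X \<epsilon> w \<in> \<N>}) (at_right 0)"
    using \<gamma> by blast
qed (simp_all add: q)

text \<open>This is \<open>exit_liminf\<close> at time 0 with the sure event, whose log-probability
  is 0.\<close>

lemma Star_liminf:
  assumes c: "0 < c" "\<And>\<epsilon>. 0 < \<epsilon> \<Longrightarrow> c \<le> \<epsilon> * r \<epsilon>" and U: "Xst_open e k T \<U>" "Star \<in> \<U>"
  shows "0 \<le> Liminf (at_right 0) (scaled_log_prob M r X \<U>)"
proof -
  obtain \<kappa> K where K: "0 < \<kappa>" "0 < K"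
    "\<And>w. w \<in> Xst_loc e k T \<Longrightarrow> min (ereal (lifetime w)) (exit_time e k T K w) < ereal \<kappa> \<Longrightarrow> w \<in> \<U>"
    using Xst_open_contains_Star[OF U] by blast
  have "Liminf (at_right 0) (\<lambda>\<epsilon>. ereal (inverse (r \<epsilon>)) * log_prob 1) \<le> Liminf (at_right 0) (scaled_log_prob M r X \<U>)"
  proof (rule exit_liminf[OF c order_refl K(1,2) U(1)])
    fix \<epsilon> :: real assume "0 < \<epsilon>"
    then interpret R: random_solution e k M B \<beta> T \<epsilon> "\<delta> \<epsilon>" "U0 \<epsilon>" "U \<epsilon>" "\<tau> \<epsilon>" by (rule RS)
    show "\<exists>A\<in>sets (noise_filtration M B (U0 \<epsilon>) 0). 1 \<le> prob A \<and>
      (AE w in M. w \<in> A \<longrightarrow> min (exit_time e k T K (X \<epsilon> w)) (ereal (lifetime (X \<epsilon> w))) < ereal (0 + \<kappa>) \<longrightarrow> X \<epsilon> w \<in> \<U>)"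
    proof (rule bexI[of _ "space M"], intro conjI)
      show "space M \<in> sets (noise_filtration M B (U0 \<epsilon>) 0)" unfolding R.space_\<F>[of 0, symmetric] by (rule sets.top)
      show "AE w in M. w \<in> space M \<longrightarrow> min (exit_time e k T K (X \<epsilon> w)) (ereal (lifetime (X \<epsilon> w))) < ereal (0 + \<kappa>) \<longrightarrow> X \<epsilon> w \<in> \<U>"
        using R.AE_reg by eventually_elim (auto simp: R.reg_def X_def min.commute intro!: K(3))
    qed (simp add: prob_space)
  qed simp_all
  then show ?thesis by (simp add: log_prob_def Liminf_const zero_ereal_def)
qed

lemma liminf_nonpos: "Liminf (at_right 0) (scaled_log_prob M r X \<U>) \<le> 0"
proof -
  from eventually_pos have "eventually (\<lambda>\<epsilon>. scaled_log_prob M r X \<U> \<epsilon> \<le> 0) (at_right 0)"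
  proof eventually_elim
    case (elim \<epsilon>)
    define p where "p = prob {w \<in> space M. X \<epsilon> w \<in> \<U>}"
    have p: "0 \<le> p" "p \<le> 1" by (auto simp: p_def)
    show ?case
    proof (cases "p = 0")
      case True
      then show ?thesis using r_pos[OF elim] by (simp add: scaled_log_prob_def p_def[symmetric] log_prob_def)
    next
      case False
      then have "ln p \<le> 0" using p by simp
      then have "inverse (r \<epsilon>) * ln p \<le> 0" using r_pos[OF elim] by (intro mult_nonneg_nonpos) auto
      then show ?thesis using False by (simp add: scaled_log_prob_def p_def[symmetric] log_prob_def)
    qed
  qed
  then have "Liminf (at_right 0) (scaled_log_prob M r X \<U>) \<le> Liminf (at_right 0) (\<lambda>_::real. 0)" by (rule Liminf_mono)
  then show ?thesis by (simp add: Liminf_const)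
qed

text \<open>The random path follows u, which agrees with v, up to a time S before the end of v, and
  is then driven out by a spike. What u does after S does not matter, so a ball around u up to S
  serves as its neighbourhood.\<close>

lemma initial_segment_liminf:
  assumes c: "0 < c" "\<And>\<epsilon>. 0 < \<epsilon> \<Longrightarrow> c \<le> \<epsilon> * r \<epsilon>"
    and u: "u \<in> Xst_loc e k T" and v: "v \<in> Xst_loc e k T" "v \<preceq>\<^sub>s u" "v \<noteq> Star"
    and N: "Xst_open e k T \<N>" "v \<in> \<N>"
  shows "\<exists>\<U>. Xst_open e k T \<U> \<and> u \<in> \<U> \<and>
    Liminf (at_right 0) (scaled_log_prob M r X \<U>) \<le> Liminf (at_right 0) (scaled_log_prob M r X \<N>)"
proof -
  obtain S \<rho> \<kappa> K where S: "0 < S" "S < lifetime v" "0 < \<rho>" "0 < \<kappa>" "0 < K"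
    and N': "\<And>w. w \<in> Xst_loc e k T \<Longrightarrow> S < lifetime w \<Longrightarrow> close_to S \<rho> (path_at w) (path_at v) \<Longrightarrow>
       min (exit_time e k T K w) (ereal (lifetime w)) < ereal (lifetime v + \<kappa>) \<Longrightarrow> w \<in> \<N>"
    using Xst_open_contains[OF N v(3)] by blast
  have Su: "S < lifetime u" using v(2) S(2) by (simp add: initial_segment_def)
  then have uS: "u \<noteq> Star" using S by auto
  have vu: "path_at u s = path_at v s" if "s \<in> {0..S}" for s
    using v(2) that S(2) by (simp add: initial_segment_def)
  define \<U> where "\<U> = pball T (path_at u) S \<rho>"
  note ball = ball_around[OF u uS S(1) Su S(3), folded \<U>_def]
  have gu: "good S (path_at u)" by (rule path_good[OF u]) (use S Su in auto)
  have S0: "0 \<le> S" using S by simp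
  have "Liminf (at_right 0) (\<lambda>\<epsilon>. ereal (inverse (r \<epsilon>)) * log_prob (prob {w \<in> space M. X \<epsilon> w \<in> \<U>}))
     \<le> Liminf (at_right 0) (scaled_log_prob M r X \<N>)"
  proof (rule exit_liminf[OF c S0 S(4,5) N(1)])
    fix \<epsilon> :: real assume "0 < \<epsilon>"
    then interpret R: random_solution e k M B \<beta> T \<epsilon> "\<delta> \<epsilon>" "U0 \<epsilon>" "U \<epsilon>" "\<tau> \<epsilon>" by (rule RS)
    obtain A where A: "A \<in> sets (noise_filtration M B (U0 \<epsilon>) S)"
      "\<And>w. R.reg w \<Longrightarrow> w \<in> A \<longleftrightarrow> S < \<tau> \<epsilon> w \<and> close_to S \<rho> (path_at (X \<epsilon> w)) (path_at u)"
      using R.near_event_adapted[OF gu S(1), of \<rho>] unfolding X_def by blast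
    have Aev: "A \<in> events"
      by (rule filtration_indep_increment(1)[OF R.noise R.U0_measurable R.datum_indep S0, of "S + 1" UNIV A]) (use A in auto)
    show "\<exists>A\<in>sets (noise_filtration M B (U0 \<epsilon>) S). prob {w \<in> space M. X \<epsilon> w \<in> \<U>} \<le> prob A \<and>
      (AE w in M. w \<in> A \<longrightarrow> min (exit_time e k T K (X \<epsilon> w)) (ereal (lifetime (X \<epsilon> w))) < ereal (S + \<kappa>) \<longrightarrow> X \<epsilon> w \<in> \<N>)"
    proof (intro bexI[OF _ A(1)] conjI)
      show "prob {w \<in> space M. X \<epsilon> w \<in> \<U>} \<le> prob A"
      proof (rule finite_measure_mono_AE[OF _ Aev])
        show "AE w in M. w \<in> {w \<in> space M. X \<epsilon> w \<in> \<U>} \<longrightarrow> w \<in> A"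
          using R.AE_reg
        proof eventually_elim
          case (elim w)
          show ?case
          proof
            assume "w \<in> {w \<in> space M. X \<epsilon> w \<in> \<U>}"
            then obtain \<rho>' where w: "S < \<tau> \<epsilon> w" "\<rho>' < \<rho>" "close_to S \<rho>' (path_at (X \<epsilon> w)) (path_at u)"
              unfolding \<U>_def pball_def by (auto simp: X_def)
            have "close_to S \<rho> (path_at (X \<epsilon> w)) (path_at u)"
              by (rule close_to_mono[OF w(3) order_refl less_imp_le[OF w(2)] _ gu])
                (use R.reg_good[OF elim S0 w(1)] in \<open>simp add: X_def\<close>)
            then show "w \<in> A" using A(2)[OF elim] w(1) by simp
          qed
        qed
      qed
      show "AE w in M. w \<in> A \<longrightarrow> min (exit_time e k T K (X \<epsilon> w)) (ereal (lifetime (X \<epsilon> w))) < ereal (S + \<kappa>) \<longrightarrow> X \<epsilon> w \<in> \<N>"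
        using R.AE_reg
      proof eventually_elim
        case (elim w)
        have XL: "X \<epsilon> w \<in> Xst_loc e k T" "lifetime (X \<epsilon> w) = \<tau> \<epsilon> w" using elim by (auto simp: R.reg_def X_def)
        show ?case
        proof (intro impI)
          assume a: "w \<in> A" and m: "min (exit_time e k T K (X \<epsilon> w)) (ereal (lifetime (X \<epsilon> w))) < ereal (S + \<kappa>)"
          have cl: "close_to S \<rho> (path_at (X \<epsilon> w)) (path_at v)"
            using a A(2)[OF elim] close_to_cong[of S "path_at u" "path_at v" \<rho> "path_at (X \<epsilon> w)"] vu by blast
          have "ereal (S + \<kappa>) < ereal (lifetime v + \<kappa>)" using S by simp
          with m have "min (exit_time e k T K (X \<epsilon> w)) (ereal (lifetime (X \<epsilon> w))) < ereal (lifetime v + \<kappa>)"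
            by (rule order.strict_trans)
          then show "X \<epsilon> w \<in> \<N>" using N'[OF XL(1) _ cl] XL a A(2)[OF elim] by simp
        qed
      qed
    qed
  qed simp_all
  then show ?thesis using ball by (auto simp: scaled_log_prob_def[abs_def])
qed

text \<open>Deviation in one mode is a weakly closed condition that excludes the zero of the rate
  function, so the rate has a positive lower bound a there; passing to a/2 turns the limsup into an
  eventual bound.\<close>

lemma datum_deviation:
  assumes rate: "good_rate_function weak_topology I" and ldp: "LDP M weak_topology (\<lambda>\<epsilon>. 1 / \<epsilon>) U0 I"
    and zero: "u\<^sub>0 \<in> df_space" "\<And>u. u \<in> df_space \<Longrightarrow> I u = 0 \<longleftrightarrow> u = u\<^sub>0"
    and datum: "\<And>\<epsilon>. 0 < \<epsilon> \<Longrightarrow> L2_datum e k M (U0 \<epsilon>)" and \<Delta>: "0 < \<Delta>"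
  shows "\<exists>a>0. eventually (\<lambda>\<epsilon>. prob {w \<in> space M. \<Delta> \<le> \<bar>e z \<bullet> (U0 \<epsilon> w - u\<^sub>0)\<bar>} \<le> exp (- (a / \<epsilon>))) (at_right 0)"
proof -
  define F where "F = {h \<in> df_space. \<Delta> \<le> \<bar>e z \<bullet> (h - u\<^sub>0)\<bar>}"
  have "openin weak_topology {h \<in> df_space. h \<bullet> e z \<in> ball (u\<^sub>0 \<bullet> e z) \<Delta>}"
    by (rule openin_weak_halfspace[OF e_df open_ball])
  then have "closedin weak_topology (df_space - {h \<in> df_space. h \<bullet> e z \<in> ball (u\<^sub>0 \<bullet> e z) \<Delta>})"
    unfolding topspace_weak_topology[symmetric] by (rule closedin_diff[OF closedin_topspace])
  also have "df_space - {h \<in> df_space. h \<bullet> e z \<in> ball (u\<^sub>0 \<bullet> e z) \<Delta>} = F"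
    unfolding F_def by (auto simp: dist_real_def inner_diff_right inner_commute abs_minus_commute not_less)
  finally have F: "closedin weak_topology F" .
  have "I x \<noteq> 0" if "x \<in> F" for x using that zero(2)[of x] \<Delta> by (auto simp: F_def)
  then obtain a :: real where a: "0 < a" "\<And>x. x \<in> F \<Longrightarrow> ereal a \<le> I x"
    using rate_function_positive[OF rate F] by blast
  have "Limsup (at_right 0) (scaled_log_prob M (\<lambda>\<epsilon>. 1 / \<epsilon>) U0 F) \<le> - (INF x\<in>F. I x)"
    using ldp F unfolding LDP_def by blast
  also have "\<dots> \<le> - ereal a" unfolding ereal_minus_le_minus by (rule INF_greatest) (rule a(2))
  also have "\<dots> < ereal (- (a / 2))" using a(1) by simp
  finally have "eventually (\<lambda>\<epsilon>. scaled_log_prob M (\<lambda>\<epsilon>. 1 / \<epsilon>) U0 F \<epsilon> < ereal (- (a / 2))) (at_right 0)"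
    by (rule Limsup_lessD)
  moreover note eventually_pos
  ultimately have "eventually (\<lambda>\<epsilon>. prob {w \<in> space M. \<Delta> \<le> \<bar>e z \<bullet> (U0 \<epsilon> w - u\<^sub>0)\<bar>} \<le> exp (- (a / 2 / \<epsilon>))) (at_right 0)"
  proof eventually_elim
    case (elim \<epsilon>)
    define p where "p = prob {w \<in> space M. U0 \<epsilon> w \<in> F}"
    have U0m: "U0 \<epsilon> \<in> borel_measurable M" and df: "AE w in M. U0 \<epsilon> w \<in> HV"
      using datum[OF elim(2)] by (auto simp: L2_datum_def)
    have Fb: "F \<in> sets borel"
    proof -
      have "F = df_space \<inter> {h. \<Delta> \<le> \<bar>e z \<bullet> (h - u\<^sub>0)\<bar>}" by (auto simp: F_def)
      moreover have "closed (df_space \<inter> {h. \<Delta> \<le> \<bar>e z \<bullet> (h - u\<^sub>0)\<bar>})"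
        unfolding df_space_def by (intro closed_Int closed_closure closed_Collect_le continuous_intros)
      ultimately show ?thesis by auto
    qed
    have Fev: "{w \<in> space M. U0 \<epsilon> w \<in> F} \<in> events"
      using measurable_sets[OF U0m Fb] by (simp add: vimage_def Int_def conj_commute)
    \<comment> \<open>The datum is divergence-free almost surely, so a deviating datum lies in
      F.\<close>
    have "prob {w \<in> space M. \<Delta> \<le> \<bar>e z \<bullet> (U0 \<epsilon> w - u\<^sub>0)\<bar>} \<le> p"
      unfolding p_def
    proof (rule finite_measure_mono_AE[OF _ Fev])
      show "AE w in M. w \<in> {w \<in> space M. \<Delta> \<le> \<bar>e z \<bullet> (U0 \<epsilon> w - u\<^sub>0)\<bar>} \<longrightarrow> w \<in> {w \<in> space M. U0 \<epsilon> w \<in> F}"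
        using df by eventually_elim (auto simp: F_def HV_def)
    qed
    also have "p \<le> exp (- (a / 2 / \<epsilon>))"
    proof (cases "p = 0")
      case False
      then have p: "0 < p" using measure_nonneg[of M] by (simp add: p_def order.not_eq_order_implies_strict)
      have "ereal (\<epsilon> * ln p) < ereal (- (a / 2))"
        using elim(1) False by (simp add: scaled_log_prob_def log_prob_def p_def[symmetric])
      then have "\<epsilon> * ln p < - (a / 2)" by simp
      then have "ln p < - (a / 2 / \<epsilon>)" using elim(2) by (simp add: field_simps)
      then have "exp (ln p) \<le> exp (- (a / 2 / \<epsilon>))" by simp
      then show ?thesis using p by simp
    qed simp
    finally show ?case .
  qed
  then show ?thesis using a(1) by (intro exI[of _ "a / 2"]) auto
qed

text \<open>If all residuals of v matched the datum, v would solve Navier-Stokes by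
  \<open>NS_from_waves\<close> and be an initial segment of the maximal solution. So one residual is
  off at some time, and by continuity it is off throughout a ball.\<close>

lemma non_solution_ball:
  assumes zero: "u\<^sub>0 \<in> df_space"
    and ustar: "NS_maximal_solution e k T u\<^sub>0 ustar" and v: "v \<in> Xst_loc e k T" "\<not> v \<preceq>\<^sub>s ustar"
  shows "\<exists>S \<rho> t z \<Delta>. 0 < S \<and> S < lifetime v \<and> 0 < \<rho> \<and> 0 \<le> t \<and> t \<le> S \<and> 0 < \<Delta> \<and> v \<noteq> Star \<and>
    (\<forall>w. good S w \<longrightarrow> close_to S \<rho> w (path_at v) \<longrightarrow> 2 * \<Delta> \<le> \<bar>resid z t w - e z \<bullet> u\<^sub>0\<bar>)"
proof -
  have us: "NS_strong_solution e k T u\<^sub>0 ustar" "\<And>w. NS_strong_solution e k T u\<^sub>0 w \<Longrightarrow> w \<preceq>\<^sub>s ustar"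
    using ustar by (auto simp: NS_maximal_solution_def)
  have "0 \<le> lifetime ustar"
    using lifetime_pos[of ustar T] us(1) by (auto simp: NS_strong_solution_def less_imp_le)
  then have vS: "v \<noteq> Star" using v(2) by (auto simp: initial_segment_def)
  have "\<exists>t\<in>{0..<lifetime v}. \<exists>z. resid z t (path_at v) \<noteq> e z \<bullet> u\<^sub>0"
  proof (rule ccontr)
    assume "\<not> ?thesis"
    then have "\<And>t z. t \<in> {0..<lifetime v} \<Longrightarrow> resid z t (path_at v) = e z \<bullet> u\<^sub>0" by blast
    then have "NS_strong_solution e k T u\<^sub>0 v"
      unfolding NS_strong_solution_def using v(1) vS
      by (auto intro!: NS_from_waves path_good[OF v(1)] zero)
    then show False using us(2) v(2) by blast
  qed
  then obtain t z where t: "t \<in> {0..<lifetime v}" and ne: "resid z t (path_at v) \<noteq> e z \<bullet> u\<^sub>0" by blast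
  \<comment> \<open>Positive even for t = 0, and strictly before the end of v.\<close>
  define S where "S = (t + lifetime v) / 2"
  have S: "0 < S" "S < lifetime v" "0 \<le> t" "t \<le> S" using t by (auto simp: S_def)
  \<comment> \<open>One third is lost to the perturbation of the path;
    \<open>non_solution_limsup\<close> splits the other two between datum and noise.\<close>
  define \<Delta> where "\<Delta> = \<bar>resid z t (path_at v) - e z \<bullet> u\<^sub>0\<bar> / 3"
  have \<Delta>: "0 < \<Delta>" using ne by (simp add: \<Delta>_def)
  have gv: "good S (path_at v)" by (rule path_good[OF v(1)]) (use S in auto)
  have "t \<in> {0..S}" using S by simp
  then obtain \<rho> where \<rho>: "0 < \<rho>" "\<And>w. good S w \<Longrightarrow> close_to S \<rho> w (path_at v) \<Longrightarrow> \<bar>resid z t w - resid z t (path_at v)\<bar> \<le> \<Delta>"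
    using resid_continuous[OF gv _ \<Delta>, of t z] by blast
  have "2 * \<Delta> \<le> \<bar>resid z t w - e z \<bullet> u\<^sub>0\<bar>" if "good S w" "close_to S \<rho> w (path_at v)" for w
  proof -
    have "\<bar>resid z t (path_at v) - e z \<bullet> u\<^sub>0\<bar> \<le> \<bar>resid z t w - resid z t (path_at v)\<bar> + \<bar>resid z t w - e z \<bullet> u\<^sub>0\<bar>"
      by linarith
    then show ?thesis using \<rho>(2)[OF that] by (simp add: \<Delta>_def)
  qed
  then show ?thesis using S \<rho>(1) \<Delta> vS by blast
qed

text \<open>On the ball the residual, which is datum plus noise, is off by 2 \<Delta>, so the datum
  or the noise is off by \<Delta>; both events are eventually exponentially small in
  1/\<epsilon>.\<close>

lemma non_solution_limsup:
  assumes er: "((\<lambda>\<epsilon>. \<epsilon> * r \<epsilon>) \<longlongrightarrow> 0) (at_right 0)"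
    and rate: "good_rate_function weak_topology I" and ldp: "LDP M weak_topology (\<lambda>\<epsilon>. 1 / \<epsilon>) U0 I"
    and zero: "u\<^sub>0 \<in> df_space" "\<And>u. u \<in> df_space \<Longrightarrow> I u = 0 \<longleftrightarrow> u = u\<^sub>0"
    and datum: "\<And>\<epsilon>. 0 < \<epsilon> \<Longrightarrow> L2_datum e k M (U0 \<epsilon>)" and W: "white_noise M B"
    and ustar: "NS_maximal_solution e k T u\<^sub>0 ustar" and v: "v \<in> Xst_loc e k T" "\<not> v \<preceq>\<^sub>s ustar"
  shows "\<exists>\<U>. Xst_open e k T \<U> \<and> v \<in> \<U> \<and> Limsup (at_right 0) (scaled_log_prob M r X \<U>) = -\<infinity>"
proof -
  obtain S \<rho> t z \<Delta> where S: "0 < S" "S < lifetime v" "0 < \<rho>" "0 \<le> t" "t \<le> S" "0 < \<Delta>" "v \<noteq> Star"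
    and far: "\<And>w. good S w \<Longrightarrow> close_to S \<rho> w (path_at v) \<Longrightarrow> 2 * \<Delta> \<le> \<bar>resid z t w - e z \<bullet> u\<^sub>0\<bar>"
    using non_solution_ball[OF zero(1) ustar v] by blast
  define \<U> where "\<U> = pball T (path_at v) S \<rho>"
  note ball = ball_around[OF v(1) S(7,1,2,3), folded \<U>_def]
  have S0: "0 \<le> S" using S by simp
  have gv: "good S (path_at v)" by (rule path_good[OF v(1) S0 S(2)])
  obtain a where a: "0 < a" and eva: "eventually (\<lambda>\<epsilon>. prob {w \<in> space M. \<Delta> \<le> \<bar>e z \<bullet> (U0 \<epsilon> w - u\<^sub>0)\<bar>} \<le> exp (- (a / \<epsilon>))) (at_right 0)"
    using datum_deviation[OF rate ldp zero datum S(6), of z] by blast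
  obtain C c where C: "0 < C" "0 < c" and evc: "\<And>\<epsilon> \<delta>. 0 < \<epsilon> \<Longrightarrow> 0 < \<delta> \<Longrightarrow>
     prob {w \<in> space M. \<Delta> \<le> \<bar>sqrt \<epsilon> * noise_term e k \<beta> \<delta> B (ew z) t w\<bar>} \<le> C * exp (- c / \<epsilon>)"
    using noise_upper[OF prob_space_axioms W S(4,6), of \<beta> z] by blast
  define b where "b = min a c"
  have b: "0 < b" using a C by (simp add: b_def)
  have C1: "0 < 1 + C" using C by simp
  have "Limsup (at_right 0) (\<lambda>\<epsilon>. ereal (inverse (r \<epsilon>)) * log_prob (prob {w \<in> space M. X \<epsilon> w \<in> \<U>})) = -\<infinity>"
  proof (rule Limsup_log_prob_exp[OF r_pos r_lim er _ C1 b])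
    from eva eventually_pos show "eventually (\<lambda>\<epsilon>. prob {w \<in> space M. X \<epsilon> w \<in> \<U>} \<le> (1 + C) * exp (- (b / \<epsilon>))) (at_right 0)"
    proof eventually_elim
      case (elim \<epsilon>)
      interpret R: random_solution e k M B \<beta> T \<epsilon> "\<delta> \<epsilon>" "U0 \<epsilon>" "U \<epsilon>" "\<tau> \<epsilon>" by (rule RS[OF elim(2)])
      define P where "P = {w \<in> space M. \<Delta> \<le> \<bar>e z \<bullet> (U0 \<epsilon> w - u\<^sub>0)\<bar>}"
      define Q where "Q = {w \<in> space M. \<Delta> \<le> \<bar>R.NN (ew z) t w\<bar>}"
      have Pm: "P \<in> events"
      proof -
        have [measurable]: "(\<lambda>w. e z \<bullet> (U0 \<epsilon> w - u\<^sub>0)) \<in> borel_measurable M"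
          by (rule measurable_compose[OF R.U0_measurable borel_measurable_continuous_onI]) (intro continuous_intros)
        show ?thesis unfolding P_def by measurable
      qed
      have Qm: "Q \<in> events"
      proof (rule filtration_indep_increment(1)[OF R.noise R.U0_measurable R.datum_indep S(4), of "t + 1" UNIV Q])
        have [measurable]: "R.NN (ew z) t \<in> borel_measurable (noise_filtration M B (U0 \<epsilon>) t)" by (rule R.NN_\<F>[OF S(4) order_refl])
        show "Q \<in> sets (noise_filtration M B (U0 \<epsilon>) t)" unfolding Q_def R.space_\<F>[of t, symmetric] by measurable
      qed auto
      have "prob {w \<in> space M. X \<epsilon> w \<in> \<U>} \<le> prob (P \<union> Q)"
      proof (rule finite_measure_mono_AE[OF _ sets.Un[OF Pm Qm]])
        show "AE w in M. w \<in> {w \<in> space M. X \<epsilon> w \<in> \<U>} \<longrightarrow> w \<in> P \<union> Q"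
          using R.AE_reg
        proof eventually_elim
          case (elim w)
          show ?case
          proof
            assume x: "w \<in> {w \<in> space M. X \<epsilon> w \<in> \<U>}"
            then obtain \<rho>' where w: "S < \<tau> \<epsilon> w" "\<rho>' < \<rho>" "close_to S \<rho>' (path_at (X \<epsilon> w)) (path_at v)"
              unfolding \<U>_def pball_def by (auto simp: X_def)
            have g: "good S (path_at (X \<epsilon> w))" using R.reg_good[OF elim S0 w(1)] by (simp add: X_def)
            have "close_to S \<rho> (path_at (X \<epsilon> w)) (path_at v)"
              by (rule close_to_mono[OF w(3) order_refl less_imp_le[OF w(2)] g gv])
            from far[OF g this] have f: "2 * \<Delta> \<le> \<bar>resid z t (path_at (X \<epsilon> w)) - e z \<bullet> u\<^sub>0\<bar>" .
            have "solves S (path_at (X \<epsilon> w)) (U0 \<epsilon> w) (\<lambda>z t. R.NN (ew z) t w)"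
              using R.reg_solves[OF elim w(1) S0] by (simp add: X_def)
            then have "resid z t (path_at (X \<epsilon> w)) = e z \<bullet> U0 \<epsilon> w + R.NN (ew z) t w"
              by (rule solves_resid) (use S in simp)
            then have "2 * \<Delta> \<le> \<bar>e z \<bullet> (U0 \<epsilon> w - u\<^sub>0) + R.NN (ew z) t w\<bar>" using f by (simp add: inner_diff_right algebra_simps)
            then have "\<Delta> \<le> \<bar>e z \<bullet> (U0 \<epsilon> w - u\<^sub>0)\<bar> \<or> \<Delta> \<le> \<bar>R.NN (ew z) t w\<bar>" by linarith
            then show "w \<in> P \<union> Q" using x by (auto simp: P_def Q_def)
          qed
        qed
      qed
      also have "\<dots> \<le> prob P + prob Q" by (rule measure_Un_le[OF Pm Qm])
      also have "\<dots> \<le> exp (- (a / \<epsilon>)) + C * exp (- c / \<epsilon>)"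
        using elim(1) evc[OF elim(2) delta_pos[OF elim(2)]] unfolding P_def Q_def R.NN_def by (intro add_mono)
      also have "\<dots> \<le> exp (- (b / \<epsilon>)) + C * exp (- (b / \<epsilon>))"
        using elim(2) C unfolding b_def by (intro add_mono mult_left_mono) (auto simp: divide_right_mono)
      finally show ?case by (simp add: distrib_right)
    qed
  qed simp_all
  then show ?thesis using ball by (auto simp: scaled_log_prob_def[abs_def])
qed

end

theorem theorem2p9:
  fixes T \<beta> :: real
    and e :: "'z \<Rightarrow> vfield" and k :: "'z \<Rightarrow> int ^ 3"
    and M :: "'w measure" and B :: "'z \<Rightarrow> 3 \<Rightarrow> real \<Rightarrow> 'w \<Rightarrow> real"
    and \<delta> r :: "real \<Rightarrow> real"
    and U0 :: "real \<Rightarrow> 'w \<Rightarrow> vfield"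
    and U :: "real \<Rightarrow> 'w \<Rightarrow> real \<Rightarrow> vfield" and \<tau> :: "real \<Rightarrow> 'w \<Rightarrow> real"
    and I\<^sub>0 :: "vfield \<Rightarrow> ereal" and u\<^sub>0 :: vfield
    and X :: "real \<Rightarrow> 'w \<Rightarrow> path"
  assumes T: "0 < T" and beta: "5 / 4 < \<beta>"
    and basis: "plane_wave_basis e k"
    and prob: "prob_space M"
    and noise: "white_noise M B"
    and delta_pos: "\<And>\<epsilon>. 0 < \<epsilon> \<Longrightarrow> 0 < \<delta> \<epsilon>"
    and delta_lim: "(\<delta> \<longlongrightarrow> 0) (at_right 0)"
    and scaling: "((\<lambda>\<epsilon>. \<epsilon> * \<delta> \<epsilon> powr (- 5 / (4 * \<beta>))) \<longlongrightarrow> 0) (at_right 0)"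
    and datum: "\<And>\<epsilon>. 0 < \<epsilon> \<Longrightarrow> L2_datum e k M (U0 \<epsilon>)"
    and datum_indep: "\<And>\<epsilon>. 0 < \<epsilon> \<Longrightarrow> indep_of_noise M B (U0 \<epsilon>)"
    and rate: "good_rate_function weak_topology I\<^sub>0"
    and ldp: "LDP M weak_topology (\<lambda>\<epsilon>. 1 / \<epsilon>) U0 I\<^sub>0"
    and zero: "u\<^sub>0 \<in> df_space" "\<And>u. u \<in> df_space \<Longrightarrow> I\<^sub>0 u = 0 \<longleftrightarrow> u = u\<^sub>0"
    and solution: "\<And>\<epsilon>. 0 < \<epsilon> \<Longrightarrow>
      maximal_strong_solution e k \<beta> T M B \<epsilon> (\<delta> \<epsilon>) (U0 \<epsilon>) (U \<epsilon>) (\<tau> \<epsilon>)"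
    and r_pos: "\<And>\<epsilon>. 0 < \<epsilon> \<Longrightarrow> 0 < r \<epsilon>"
    and r_lim: "filterlim r at_top (at_right 0)"
  defines "X \<equiv> (\<lambda>\<epsilon> \<omega>. path_of (\<tau> \<epsilon> \<omega>) (U \<epsilon> \<omega>))"
  shows
    "(0 < (INF \<epsilon>\<in>{0<..}. \<epsilon> * r \<epsilon>) \<longrightarrow>
       (\<forall>u\<in>Xst_loc e k T. \<forall>v\<in>Xst_loc e k T. v \<preceq>\<^sub>s u \<longrightarrow>
          (INF \<U>\<in>{\<U>. Xst_open e k T \<U> \<and> v \<in> \<U>}.
             Liminf (at_right 0) (scaled_log_prob M r X \<U>)) \<ge>
          (INF \<U>\<in>{\<U>. Xst_open e k T \<U> \<and> u \<in> \<U>}.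
             Liminf (at_right 0) (scaled_log_prob M r X \<U>))) \<and>
       (INF \<U>\<in>{\<U>. Xst_open e k T \<U> \<and> Star \<in> \<U>}.
          Liminf (at_right 0) (scaled_log_prob M r X \<U>)) = 0) \<and>
     (u\<^sub>0 \<in> HV \<and> ((\<lambda>\<epsilon>. \<epsilon> * r \<epsilon>) \<longlongrightarrow> 0) (at_right 0) \<longrightarrow>
       (\<forall>ustar. NS_maximal_solution e k T u\<^sub>0 ustar \<longrightarrow>
          (\<forall>v\<in>Xst_loc e k T. \<not> v \<preceq>\<^sub>s ustar \<longrightarrow>
             (INF \<U>\<in>{\<U>. Xst_open e k T \<U> \<and> v \<in> \<U>}.
                Limsup (at_right 0) (scaled_log_prob M r X \<U>)) = -\<infinity>)))"
proof -
  interpret plane_waves e k by unfold_locales (rule basis)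
  have RS: "random_solution e k M B \<beta> T \<epsilon> (\<delta> \<epsilon>) (U0 \<epsilon>) (U \<epsilon>) (\<tau> \<epsilon>)" if "0 < \<epsilon>" for \<epsilon>
    using basis prob T noise that datum[OF that] datum_indep[OF that] solution[OF that]
    by (intro random_solution.intro plane_waves.intro random_solution_axioms.intro)
      (auto simp: L2_datum_def maximal_strong_solution_def)
  interpret random_family e k M B \<beta> T \<delta> U0 U \<tau> X r
    by (intro random_family.intro random_family_axioms.intro plane_waves.intro basis prob r_pos r_lim delta_pos delta_lim RS) (auto simp: X_def)
  show ?thesis
  proof (intro conjI impI ballI allI)
    assume inf: "0 < (INF \<epsilon>\<in>{0<..}. \<epsilon> * r \<epsilon>)"
    define c where "c = (INF \<epsilon>\<in>{0<..}. \<epsilon> * r \<epsilon>)"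
    have c: "0 < c" using inf by (simp add: c_def)
    \<comment> \<open>A real infimum is a lower bound only for a set that is bounded below.\<close>
    have bd: "bdd_below ((\<lambda>\<epsilon>. \<epsilon> * r \<epsilon>) ` {0<..})"
      by (rule bdd_belowI[of _ 0]) (auto intro!: mult_nonneg_nonneg less_imp_le[OF r_pos])
    have c_le: "c \<le> \<epsilon> * r \<epsilon>" if "0 < \<epsilon>" for \<epsilon>
      unfolding c_def by (rule cINF_lower[OF bd]) (use that in simp)
    have S0: "0 \<le> Liminf (at_right 0) (scaled_log_prob M r X \<U>)" if "Xst_open e k T \<U>" "Star \<in> \<U>" for \<U>
      by (rule Star_liminf[OF c c_le that])
    \<comment> \<open>The whole space is an open neighbourhood, so every infimum is at most 0. With
      \<open>S0\<close> this settles \<open>Star\<close>, both in the second claim and as an initial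
      segment.\<close>
    have top: "(INF \<U>\<in>{\<U>. Xst_open e k T \<U> \<and> u \<in> \<U>}. Liminf (at_right 0) (scaled_log_prob M r X \<U>)) \<le> 0"
      if "u \<in> Xst_loc e k T" for u
      by (rule INF_lower2[of "Xst_loc e k T"]) (use that Xst_open_Xst_loc liminf_nonpos in auto)
    show "(INF \<U>\<in>{\<U>. Xst_open e k T \<U> \<and> Star \<in> \<U>}. Liminf (at_right 0) (scaled_log_prob M r X \<U>)) = 0"
      by (rule antisym[OF top INF_greatest]) (use S0 in \<open>auto simp: Xst_loc_def\<close>)
    fix u v assume u: "u \<in> Xst_loc e k T" and v: "v \<in> Xst_loc e k T" "v \<preceq>\<^sub>s u"
    show "(INF \<U>\<in>{\<U>. Xst_open e k T \<U> \<and> u \<in> \<U>}. Liminf (at_right 0) (scaled_log_prob M r X \<U>))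
      \<le> (INF \<U>\<in>{\<U>. Xst_open e k T \<U> \<and> v \<in> \<U>}. Liminf (at_right 0) (scaled_log_prob M r X \<U>))"
    proof (rule INF_greatest)
      fix \<N> assume "\<N> \<in> {\<U>. Xst_open e k T \<U> \<and> v \<in> \<U>}"
      then have N: "Xst_open e k T \<N>" "v \<in> \<N>" by auto
      show "(INF \<U>\<in>{\<U>. Xst_open e k T \<U> \<and> u \<in> \<U>}. Liminf (at_right 0) (scaled_log_prob M r X \<U>))
        \<le> Liminf (at_right 0) (scaled_log_prob M r X \<N>)"
      proof (cases "v = Star")
        case True
        then show ?thesis using top[OF u] S0[of \<N>] N by (meson order.trans)
      next
        case False
        then obtain \<U> where "Xst_open e k T \<U>" "u \<in> \<U>"
          "Liminf (at_right 0) (scaled_log_prob M r X \<U>) \<le> Liminf (at_right 0) (scaled_log_prob M r X \<N>)"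
          using initial_segment_liminf[OF c c_le u v _ N] by blast
        then show ?thesis by (intro INF_lower2[of \<U>]) auto
      qed
    qed
  next
    fix ustar v
    assume h: "u\<^sub>0 \<in> HV \<and> ((\<lambda>\<epsilon>. \<epsilon> * r \<epsilon>) \<longlongrightarrow> 0) (at_right 0)"
      and ustar: "NS_maximal_solution e k T u\<^sub>0 ustar" and v: "v \<in> Xst_loc e k T" "\<not> v \<preceq>\<^sub>s ustar"
    obtain \<U> where "Xst_open e k T \<U>" "v \<in> \<U>" "Limsup (at_right 0) (scaled_log_prob M r X \<U>) = -\<infinity>"
      using non_solution_limsup[OF conjunct2[OF h] rate ldp zero datum noise ustar v] by blast
    then have "(INF \<U>\<in>{\<U>. Xst_open e k T \<U> \<and> v \<in> \<U>}. Limsup (at_right 0) (scaled_log_prob M r X \<U>)) \<le> -\<infinity>"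
      by (intro INF_lower2[of \<U>]) auto
    then show "(INF \<U>\<in>{\<U>. Xst_open e k T \<U> \<and> v \<in> \<U>}. Limsup (at_right 0) (scaled_log_prob M r X \<U>)) = -\<infinity>"
      by simp
  qed
qed

end
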